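(* Fix $\overline\lambda\ge8\pi$ and $\overline E\ge1$. Then: (a) For every $c\in(0,1]$ there exists $\widetilde\rho_1=\widetilde\rho_1(c,\overline E,\overline\lambda)>0$ such that for any $\rho\in(0,\widetilde\rho_1]$ and any simple domain $\Omega$ satisfying $\{\rho^2x^2+y^2\le\beta_-^2\}\subseteq\Omega\subseteq\{\rho^2x^2+y^2\le\beta_+^2\}$ with $c=\frac{\beta_-^2}{\beta_+^2}$, and for each $\lambda\le\overline\lambda$, there exists at most one solution $u_\lambda$ of $P(\lambda,\Omega)$ which satisfies $\mathcal{E}(\omega(u_\lambda))\le\overline E$. (b) There exists $\widetilde N=\widetilde N(\overline\lambda,\overline E)\ge4\pi$ such that for any open, bounded and convex (therefore simple) domain $\Omega$ satisfying $$N(\Omega):=\frac{L^2(\partial\Omega)}{A(\Omega)}\ge\widetilde N,$$ and for each $\lambda\le\overline\lambda$, there exists at most one solution $u_\lambda$ of $P(\lambda,\Omega)$ which satisfies $\mathcal{E}(\omega(u_\lambda))\le\overline E$.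
   Context: A bounded, open, simply connected set $\Omega\subset\mathbb{R}^2$ is called simple if $\partial\Omega$ is the support of a simple and rectifiable Jordan curve. A simple domain is called regular if: (i) $\partial\Omega$ is the support of a continuous, piecewise $C^2$ curve with bounded first derivative and at most finitely many corner-type points $p_1,\dots,p_m$, i.e. the inner angle $\theta_j$ formed by the limiting tangents at $p_j$ is well defined and $\theta_j\in(0,2\pi)\setminus\{\pi\}$; (ii) for each $p_j$ there is a conformal bijection from an open neighborhood $U$ of $p_j$ which maps $U\cap\partial\Omega$ onto a curve of class $C^2$. $A$ denotes area and $L$ length. $P(\lambda,\Omega)$: $-\Delta u=\lambda e^u/\int_\Omega e^u$ in $\Omega$, $u=0$ on $\partial\Omega$. Solutions are $H^1_0(\Omega)$ weak solutions if $\Omega$ is regular and classical $C^2(\Omega)\cap C^0(\overline\Omega)$ solutions if $\Omega$ is only simple. For a solution $u$, its density is $\omega(u)=e^u/\int_\Omega e^u$. The energy of a density $\omega\ge0$, $\int_\Omega\omega=1$, is $\mathcal{E}(\omega)=\frac12\int_\Omega\omega\,G[\omega]$, where $G[\omega](x)=\int_\Omega G_\Omega(x,y)\omega(y)\,dy$ and $G_\Omega$ is the Dirichlet Green function: $-\Delta G_\Omega(\cdot,y)=\delta_y$ in $\Omega$, $G_\Omega(\cdot,y)=0$ on $\partial\Omega$. *)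

theory Defs
  imports "HOL-Complex_Analysis.Complex_Analysis"
begin

text \<open>The plane \<open>\<real>\<^sup>2\<close> is rendered as \<^typ>\<open>complex\<close>, with coordinates \<^const>\<open>Re\<close> and \<^const>\<open>Im\<close>.\<close>

section \<open>Differential operators and function spaces\<close>

text \<open>\<open>C\<^sup>k\<close> maps; meant for open sets \<open>S\<close> (and, with one-sided derivatives, nondegenerate intervals),
  where the derivative within \<open>S\<close> is unique.\<close>

primrec Ck_on :: "nat \<Rightarrow> 'a::euclidean_space set \<Rightarrow> ('a \<Rightarrow> 'b::real_normed_vector) \<Rightarrow> bool" where
  "Ck_on 0 S f \<longleftrightarrow> continuous_on S f"
| "Ck_on (Suc k) S f \<longleftrightarrow> f differentiable_on S \<and>
     (\<forall>b\<in>Basis. Ck_on k S (\<lambda>x. frechet_derivative f (at x within S) b))"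

definition gradient :: "(complex \<Rightarrow> real) \<Rightarrow> complex \<Rightarrow> complex" where
  "gradient f x = (\<Sum>b\<in>Basis. frechet_derivative f (at x) b *\<^sub>R b)"

definition laplacian :: "(complex \<Rightarrow> real) \<Rightarrow> complex \<Rightarrow> real" where
  "laplacian f x =
     (\<Sum>b\<in>Basis. frechet_derivative (\<lambda>y. frechet_derivative f (at y) b) (at x) b)"

definition test_function :: "complex set \<Rightarrow> (complex \<Rightarrow> real) \<Rightarrow> bool" where
  "test_function \<Omega> \<phi> \<longleftrightarrow> (\<forall>k. Ck_on k UNIV \<phi>) \<and>
     compact (closure {x. \<phi> x \<noteq> 0}) \<and> closure {x. \<phi> x \<noteq> 0} \<subseteq> \<Omega>"

definition locally_integrable_on ::
  "complex set \<Rightarrow> (complex \<Rightarrow> 'b::{banach, second_countable_topology}) \<Rightarrow> bool" where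
  "locally_integrable_on \<Omega> f \<longleftrightarrow> (\<forall>K. compact K \<and> K \<subseteq> \<Omega> \<longrightarrow> set_integrable lebesgue K f)"

definition weak_gradient :: "complex set \<Rightarrow> (complex \<Rightarrow> real) \<Rightarrow> (complex \<Rightarrow> complex) \<Rightarrow> bool" where
  "weak_gradient \<Omega> u g \<longleftrightarrow> locally_integrable_on \<Omega> u \<and> locally_integrable_on \<Omega> g \<and>
     (\<forall>\<phi>. test_function \<Omega> \<phi> \<longrightarrow> (\<forall>b\<in>Basis.
        (LINT x:\<Omega>|lebesgue. u x * frechet_derivative \<phi> (at x) b) =
        - (LINT x:\<Omega>|lebesgue. (g x \<bullet> b) * \<phi> x)))"

definition square_integrable_on :: "complex set \<Rightarrow> (complex \<Rightarrow> 'b::euclidean_space) \<Rightarrow> bool" where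
  "square_integrable_on \<Omega> f \<longleftrightarrow>
     set_borel_measurable lebesgue \<Omega> f \<and> set_integrable lebesgue \<Omega> (\<lambda>x. (norm (f x))\<^sup>2)"

text \<open>\<open>H1 \<Omega> u g\<close>: \<open>u\<close> belongs to \<open>H\<^sup>1(\<Omega>)\<close> and has weak gradient \<open>g\<close>; similarly for \<open>H10\<close>, the
  closure of the test functions in \<open>H\<^sup>1(\<Omega>)\<close>. Both \<open>u\<close> and \<open>g\<close> are representatives, relevant only
  up to null sets and only on \<open>\<Omega>\<close>.\<close>

definition H1 :: "complex set \<Rightarrow> (complex \<Rightarrow> real) \<Rightarrow> (complex \<Rightarrow> complex) \<Rightarrow> bool" where
  "H1 \<Omega> u g \<longleftrightarrow> square_integrable_on \<Omega> u \<and> square_integrable_on \<Omega> g \<and> weak_gradient \<Omega> u g"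

definition H10 :: "complex set \<Rightarrow> (complex \<Rightarrow> real) \<Rightarrow> (complex \<Rightarrow> complex) \<Rightarrow> bool" where
  "H10 \<Omega> u g \<longleftrightarrow> H1 \<Omega> u g \<and>
     (\<exists>\<phi>::nat \<Rightarrow> complex \<Rightarrow> real. (\<forall>n. test_function \<Omega> (\<phi> n)) \<and>
        (\<lambda>n. LINT x:\<Omega>|lebesgue. (\<phi> n x - u x)\<^sup>2 + (norm (gradient (\<phi> n) x - g x))\<^sup>2)
          \<longlonglongrightarrow> 0)"


section \<open>Length of curves\<close>

definition polygonal_lengths :: "(real \<Rightarrow> complex) \<Rightarrow> real set" where
  "polygonal_lengths \<gamma> =
     {\<Sum>i<n. dist (\<gamma> (t i)) (\<gamma> (t (Suc i))) | n (t :: nat \<Rightarrow> real). mono t \<and> range t \<subseteq> {0..1}}"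

definition rectifiable_path :: "(real \<Rightarrow> complex) \<Rightarrow> bool" where
  "rectifiable_path \<gamma> \<longleftrightarrow> path \<gamma> \<and> bdd_above (polygonal_lengths \<gamma>)"

definition path_len :: "(real \<Rightarrow> complex) \<Rightarrow> real" where
  "path_len \<gamma> = Sup (polygonal_lengths \<gamma>)"

definition jordan_param :: "complex set \<Rightarrow> (real \<Rightarrow> complex) \<Rightarrow> bool" where
  "jordan_param C \<gamma> \<longleftrightarrow> simple_path \<gamma> \<and> pathfinish \<gamma> = pathstart \<gamma> \<and> path_image \<gamma> = C"

text \<open>All simple closed parametrisations of a Jordan curve have the same length, so the choice is
  immaterial.\<close>

definition jordan_length :: "complex set \<Rightarrow> real" where
  "jordan_length C = path_len (SOME \<gamma>. jordan_param C \<gamma>)"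

definition isoperimetric_ratio :: "complex set \<Rightarrow> real" where
  "isoperimetric_ratio \<Omega> = (jordan_length (frontier \<Omega>))\<^sup>2 / measure lebesgue \<Omega>"


section \<open>Simple and regular domains\<close>

definition simple_domain :: "complex set \<Rightarrow> bool" where
  "simple_domain \<Omega> \<longleftrightarrow> bounded \<Omega> \<and> open \<Omega> \<and> simply_connected \<Omega> \<and>
     (\<exists>\<gamma>. jordan_param (frontier \<Omega>) \<gamma> \<and> rectifiable_path \<gamma>)"

text \<open>For \<open>\<gamma>\<close> traversing the boundary with the domain on its left, the inner angle at \<open>\<gamma> t\<close> is
  swept counterclockwise from the outgoing tangent \<open>\<tau>p\<close> to the reversed incoming tangent \<open>-\<tau>m\<close>.
  \<^const>\<open>Arg2pi\<close> takes values in \<open>[0, 2\<pi>)\<close>; a cusp (inner angle \<open>0\<close> or \<open>2\<pi>\<close>) is sent to \<open>0\<close>.\<close>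

definition has_inner_angle :: "(real \<Rightarrow> complex) \<Rightarrow> real \<Rightarrow> real \<Rightarrow> bool" where
  "has_inner_angle \<gamma> t \<theta> \<longleftrightarrow> (\<exists>\<tau>m \<tau>p.
     ((\<lambda>s. sgn (vector_derivative \<gamma> (at s))) \<longlongrightarrow> \<tau>m) (at_left t) \<and>
     ((\<lambda>s. sgn (vector_derivative \<gamma> (at s))) \<longlongrightarrow> \<tau>p) (at_right t) \<and>
     \<theta> = Arg2pi (- \<tau>m / \<tau>p))"

definition C2_regular_on :: "real set \<Rightarrow> (real \<Rightarrow> complex) \<Rightarrow> bool" where
  "C2_regular_on S \<gamma> \<longleftrightarrow> Ck_on 2 S \<gamma> \<and> (\<forall>s\<in>S. vector_derivative \<gamma> (at s) \<noteq> 0)"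

text \<open>A map that is conformal on a full plane neighbourhood of a corner preserves the angle there and
  cannot produce a \<open>C\<^sup>2\<close> curve, so the neighbourhood of \<open>p\<close> is taken relative to \<open>closure \<Omega>\<close>: the map
  is holomorphic inside \<open>\<Omega>\<close> and a homeomorphism up to the boundary (for a straight corner of angle
  \<open>\<theta>\<close>, it is \<open>z \<mapsto> (z - p) powr (\<pi>/\<theta>)\<close>).\<close>

definition conformally_C2_at :: "complex set \<Rightarrow> complex \<Rightarrow> bool" where
  "conformally_C2_at \<Omega> p \<longleftrightarrow> (\<exists>U f f' \<delta>. open U \<and> p \<in> U \<and>
     f holomorphic_on (U \<inter> \<Omega>) \<and>
     homeomorphism (U \<inter> closure \<Omega>) (f ` (U \<inter> closure \<Omega>)) f f' \<and>
     C2_regular_on {0<..<1} \<delta> \<and> inj_on \<delta> {0<..<1} \<and>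
     \<delta> ` {0<..<1} = f ` (U \<inter> frontier \<Omega>))"

text \<open>The boundary curve is a 1-periodic map, so that its base point plays no special role. At the
  finitely many break points in \<open>T\<close> (modulo 1) the curve need not be \<open>C\<^sup>2\<close>; those with inner angle
  different from \<open>\<pi>\<close> are the corners.\<close>

definition regular_domain :: "complex set \<Rightarrow> bool" where
  "regular_domain \<Omega> \<longleftrightarrow> simple_domain \<Omega> \<and>
     (\<exists>\<gamma> T. (\<forall>t. \<gamma> (t + 1) = \<gamma> t) \<and> jordan_param (frontier \<Omega>) \<gamma> \<and>
        (\<forall>z\<in>\<Omega>. winding_number \<gamma> z = 1) \<and>
        finite T \<and> T \<subseteq> {0..<1} \<and>
        C2_regular_on {s. frac s \<notin> T} \<gamma> \<and>
        bounded ((\<lambda>s. vector_derivative \<gamma> (at s)) ` {s. frac s \<notin> T}) \<and>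
        (\<forall>t\<in>T. \<exists>\<theta>. has_inner_angle \<gamma> t \<theta> \<and> 0 < \<theta> \<and> \<theta> < 2 * pi \<and>
           (\<theta> \<noteq> pi \<longrightarrow> conformally_C2_at \<Omega> (\<gamma> t))))"


section \<open>Solutions, densities and energy\<close>

definition mf_density :: "complex set \<Rightarrow> (complex \<Rightarrow> real) \<Rightarrow> complex \<Rightarrow> real" where
  "mf_density \<Omega> u x = exp (u x) / (LINT y:\<Omega>|lebesgue. exp (u y))"

definition classical_solution :: "real \<Rightarrow> complex set \<Rightarrow> (complex \<Rightarrow> real) \<Rightarrow> bool" where
  "classical_solution l \<Omega> u \<longleftrightarrow> Ck_on 2 \<Omega> u \<and> continuous_on (closure \<Omega>) u \<and>
     (\<forall>x\<in>\<Omega>. - laplacian u x = l * mf_density \<Omega> u x) \<and> (\<forall>x\<in>frontier \<Omega>. u x = 0)"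

definition weak_solution :: "real \<Rightarrow> complex set \<Rightarrow> (complex \<Rightarrow> real) \<Rightarrow> bool" where
  "weak_solution l \<Omega> u \<longleftrightarrow> set_integrable lebesgue \<Omega> (\<lambda>x. exp (u x)) \<and>
     (\<exists>g. H10 \<Omega> u g \<and> (\<forall>v h. H10 \<Omega> v h \<longrightarrow>
        (LINT x:\<Omega>|lebesgue. g x \<bullet> h x) = l * (LINT x:\<Omega>|lebesgue. mf_density \<Omega> u x * v x)))"

definition mf_solution :: "real \<Rightarrow> complex set \<Rightarrow> (complex \<Rightarrow> real) \<Rightarrow> bool" where
  "mf_solution l \<Omega> u \<longleftrightarrow>
     (if regular_domain \<Omega> then weak_solution l \<Omega> u else classical_solution l \<Omega> u)"

text \<open>Equality of two solutions: in \<open>H\<^sup>1\<^sub>0(\<Omega>)\<close>, i.e. almost everywhere, for weak solutions; as functions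
  on the closed domain for classical ones.\<close>

definition same_solution :: "complex set \<Rightarrow> (complex \<Rightarrow> real) \<Rightarrow> (complex \<Rightarrow> real) \<Rightarrow> bool" where
  "same_solution \<Omega> u v \<longleftrightarrow>
     (if regular_domain \<Omega> then AE x in lebesgue. x \<in> \<Omega> \<longrightarrow> u x = v x
      else \<forall>x\<in>closure \<Omega>. u x = v x)"

text \<open>\<open>g\<close> is the Dirichlet Green function with pole \<open>y\<close>; \<open>-\<Delta>g = \<delta>\<^sub>y\<close> is meant in the sense of
  distributions. On a simple domain \<open>g\<close> exists and is determined on \<open>closure \<Omega> - {y}\<close>.\<close>

definition is_green :: "complex set \<Rightarrow> complex \<Rightarrow> (complex \<Rightarrow> real) \<Rightarrow> bool" where
  "is_green \<Omega> y g \<longleftrightarrow> locally_integrable_on \<Omega> g \<and> continuous_on (closure \<Omega> - {y}) g \<and>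
     (\<forall>\<phi>. test_function \<Omega> \<phi> \<longrightarrow> (LINT x:\<Omega>|lebesgue. g x * (- laplacian \<phi> x)) = \<phi> y) \<and>
     (\<forall>x\<in>frontier \<Omega>. g x = 0)"

definition green :: "complex set \<Rightarrow> complex \<Rightarrow> complex \<Rightarrow> real" where
  "green \<Omega> x y = (SOME g. is_green \<Omega> y g) x"

definition green_potential :: "complex set \<Rightarrow> (complex \<Rightarrow> real) \<Rightarrow> complex \<Rightarrow> real" where
  "green_potential \<Omega> w x = (LINT y:\<Omega>|lebesgue. green \<Omega> x y * w y)"

definition energy :: "complex set \<Rightarrow> (complex \<Rightarrow> real) \<Rightarrow> real" where
  "energy \<Omega> w = 1 / 2 * (LINT x:\<Omega>|lebesgue. w x * green_potential \<Omega> w x)"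

definition ellipse :: "real \<Rightarrow> real \<Rightarrow> complex set" where
  "ellipse \<rho> \<beta> = {z. \<rho>\<^sup>2 * (Re z)\<^sup>2 + (Im z)\<^sup>2 \<le> \<beta>\<^sup>2}"

end

theory Submission
  imports Defs
begin

text \<open>
  On a domain inside a strip of half-width \<open>h\<close> the Poincare inequality has constant \<open>4 h\<^sup>2\<close>. If \<open>u\<close>, \<open>v\<close>
  solve the problem with the same \<open>\<lambda> > 0\<close> and densities \<open>\<omega>\<^sub>u\<close>, \<open>\<omega>\<^sub>v\<close>, testing with \<open>w = u - v\<close> gives
  \<open>\<integral> |\<nabla>w|\<^sup>2 = \<lambda> \<integral> (\<omega>\<^sub>u - \<omega>\<^sub>v) w \<le> C \<lambda> \<integral> (\<omega>\<^sub>u + \<omega>\<^sub>v) w\<^sup>2\<close>, since both densities have mass one. By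
  Cauchy-Schwarz, Ladyzhenskaya and Poincare the right hand side is at most
  \<open>C \<lambda> h (\<parallel>\<omega>\<^sub>u\<parallel>\<^sub>2 + \<parallel>\<omega>\<^sub>v\<parallel>\<^sub>2) \<integral> |\<nabla>w|\<^sup>2\<close>, so \<open>w = 0\<close> as soon as \<open>\<parallel>\<omega>\<parallel>\<^sub>2\<^sup>2 \<le> K / |\<Omega>|\<close> and \<open>h\<^sup>2\<close> is small
  against \<open>|\<Omega>|\<close>; for \<open>\<lambda> \<le> 0\<close> monotonicity suffices.

  The energy bound provides such a \<open>K\<close>: positivity of the Green form, seen from a Riemann map, yields
  \<open>2 \<integral> \<omega> \<phi> - \<integral> |\<nabla>\<phi>|\<^sup>2 \<le> 2 \<E>(\<omega>)\<close>, and \<open>\<phi> = u / \<lambda>\<close> gives \<open>\<integral> \<omega> u \<le> 2 \<lambda> \<E>(\<omega>)\<close>. Hence \<open>\<omega>\<close> puts little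
  mass on \<open>{u > k}\<close> for large \<open>k\<close>, and testing the equation with truncations of \<open>exp u - 1\<close> bounds
  \<open>\<integral> exp (2 u)\<close> by \<open>2 exp (2 k) |\<Omega>|\<close>.

  The ellipses are thin in this sense for small \<open>\<rho>\<close>. For a convex domain of diameter \<open>d\<close> take the
  strip parallel to a diameter: then \<open>d h \<le> 4 |\<Omega>|\<close>, while the perimeter is at most \<open>4 d\<close>.
\<close>

subsection \<open>Calculus of maps of class \<open>C\<^sup>k\<close>\<close>

text \<open>No boundary regularity enters the analysis. All inequalities are proved for compactly
  supported functions and carried to their energy closure \<open>Hc N\<close>, where
  \<open>N\<close> prescribes the smoothness of the approximants; weak and classical solutions then
  satisfy one weak equation, \<open>wsol\<close>, and are told apart again only when equality almost
  everywhere is turned into the required equality. Two obstacles shape the proof. The energy refers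
  to a Green function picked by choice, so before an energy bound says anything about
  \<open>u\<close>, a Green function has to be exhibited, shown to be unique off its pole, and shown
  to be a positive kernel; simple connectivity enters only here. Secondly, only compositions
  \<open>F (u x)\<close> with \<open>F'\<close> bounded are admissible, so exponentials are reached
  through truncations, with bounds uniform in the truncation. The outcome has the form X \<le> X / 2
  + const for the integral X of exp (2 u), and it is worthless unless X is finite beforehand;
  finiteness comes from iterating the Gagliardo inequality over all powers. Both sides of the final
  smallness condition scale like an area, which is why only thinness remains to be checked.\<close>

abbreviation pd :: "'a::euclidean_space \<Rightarrow> ('a \<Rightarrow> 'b::real_normed_vector) \<Rightarrow> 'a \<Rightarrow> 'b" where
  "pd b f x \<equiv> frechet_derivative f (at x) b"

lemma pd_eqI: "(f has_derivative f') (at x) \<Longrightarrow> pd b f x = f' b"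
  using frechet_derivative_at by metis

lemma has_derivative_within_cong:
  assumes "\<And>x. x \<in> S \<Longrightarrow> f x = g x" "x \<in> S"
  shows "(f has_derivative D) (at x within S) \<longleftrightarrow> (g has_derivative D) (at x within S)"
  using has_derivative_transform[OF assms(2), of f g D] has_derivative_transform[OF assms(2), of g f D] assms(1)
  by metis

lemma Ck_on_cong:
  "(\<And>x. x \<in> S \<Longrightarrow> f x = g x) \<Longrightarrow> Ck_on k S f \<longleftrightarrow> Ck_on k S g"
proof (induction k arbitrary: f g)
  case 0
  then show ?case by (simp cong: continuous_on_cong)
next
  case (Suc k)
  have *: "frechet_derivative f (at x within S) = frechet_derivative g (at x within S)" if "x \<in> S" for x
    unfolding frechet_derivative_def using has_derivative_within_cong[of S f g x] Suc.prems that by simp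
  have "f differentiable_on S \<longleftrightarrow> g differentiable_on S"
    unfolding differentiable_on_def differentiable_def
    using has_derivative_within_cong[of S f g] Suc.prems by blast
  moreover have "Ck_on k S (\<lambda>x. frechet_derivative f (at x within S) b) \<longleftrightarrow>
      Ck_on k S (\<lambda>x. frechet_derivative g (at x within S) b)" for b
    by (rule Suc.IH) (simp add: *)
  ultimately show ?case by simp
qed

text \<open>On an open set the derivative within the set is the full derivative. The defining
  equation leaves the simp set below, so that all later arguments run through this form, free of
  \<open>at x within S\<close>.\<close>

lemma Ck_on_Suc_open:
  assumes "open S"
  shows "Ck_on (Suc k) S f \<longleftrightarrow> (\<forall>x\<in>S. f differentiable (at x)) \<and> (\<forall>b\<in>Basis. Ck_on k S (pd b f))"
proof -
  have "Ck_on k S (\<lambda>x. frechet_derivative f (at x within S) b) \<longleftrightarrow> Ck_on k S (pd b f)" for b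
    by (rule Ck_on_cong) (simp add: at_within_open[OF _ assms])
  then show ?thesis
    by (simp add: differentiable_on_def at_within_open[OF _ assms])
qed

declare Ck_on.simps(2)[simp del]

lemma Ck_on_SucD: "open S \<Longrightarrow> Ck_on (Suc k) S f \<Longrightarrow> Ck_on k S f"
proof (induction k arbitrary: f)
  case 0
  then show ?case
    by (auto simp: Ck_on_Suc_open intro!: differentiable_imp_continuous_on differentiable_at_imp_differentiable_on)
next
  case (Suc k)
  then show ?case by (metis Ck_on_Suc_open)
qed

lemma Ck_on_le: "open S \<Longrightarrow> Ck_on n S f \<Longrightarrow> k \<le> n \<Longrightarrow> Ck_on k S f"
  by (induction n) (auto simp: le_Suc_eq dest: Ck_on_SucD)

lemma Ck_on_const: "open S \<Longrightarrow> Ck_on k S (\<lambda>x. c)"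
proof (induction k arbitrary: c)
  case (Suc k)
  have "pd b (\<lambda>x. c) = (\<lambda>x. 0)" for b :: 'a by (auto intro!: pd_eqI)
  then show ?case using Suc by (simp add: Ck_on_Suc_open)
qed simp

lemma Ck_on_bounded_linear:
  assumes "open S" "bounded_linear f" shows "Ck_on k S f"
proof (cases k)
  case 0 then show ?thesis using assms by (simp add: linear_continuous_on)
next
  case (Suc n)
  have d: "(f has_derivative f) (at x)" for x using assms(2) bounded_linear_imp_has_derivative by blast
  then have "pd b f = (\<lambda>x. f b)" for b by (auto intro!: pd_eqI)
  moreover have "f differentiable (at x)" for x using d unfolding differentiable_def by blast
  ultimately show ?thesis using assms Ck_on_const Suc by (auto simp: Ck_on_Suc_open)
qed

lemma Ck_on_subset: "open S \<Longrightarrow> open T \<Longrightarrow> T \<subseteq> S \<Longrightarrow> Ck_on k S f \<Longrightarrow> Ck_on k T f"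
  by (induction k arbitrary: f) (auto simp: Ck_on_Suc_open intro: continuous_on_subset)

lemma Ck_on_Un: "open S \<Longrightarrow> open T \<Longrightarrow> Ck_on k S f \<Longrightarrow> Ck_on k T f \<Longrightarrow> Ck_on k (S \<union> T) f"
  by (induction k arbitrary: f) (auto simp: Ck_on_Suc_open open_Un intro: continuous_on_open_Un)

lemma pd_add: "f differentiable at x \<Longrightarrow> g differentiable at x \<Longrightarrow>
    pd b (\<lambda>x. f x + g x) x = pd b f x + pd b g x"
  by (rule pd_eqI) (auto intro!: derivative_eq_intros simp: frechet_derivative_works[symmetric])

lemma pd_mult: fixes f g :: "'a::euclidean_space \<Rightarrow> real"
  shows "f differentiable at x \<Longrightarrow> g differentiable at x \<Longrightarrow>
    pd b (\<lambda>x. f x * g x) x = pd b f x * g x + f x * pd b g x"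
  using pd_eqI[OF has_derivative_mult, of f "frechet_derivative f (at x)" x g "frechet_derivative g (at x)" b]
  by (simp add: frechet_derivative_works[symmetric] add.commute)

lemma pd_real: "(F has_real_derivative F') (at t) \<Longrightarrow> pd 1 F t = F'"
  using pd_eqI[of F "(*) F'" t 1] by (simp add: has_field_derivative_def)

lemma pd_compose_real:
  assumes "(F has_real_derivative F') (at (f x))" "f differentiable at x"
  shows "pd b (\<lambda>x. F (f x)) x = F' * pd b f x"
  by (rule pd_eqI[where f' = "\<lambda>h. F' * pd h f x"])
     (use assms in \<open>auto simp: has_field_derivative_def frechet_derivative_works intro: has_derivative_compose\<close>)

lemma pd_cong_open:
  assumes "open S" "x \<in> S" "\<And>y. y \<in> S \<Longrightarrow> f y = g y" "f differentiable at x"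
  shows "pd b f x = pd b g x"
  using frechet_derivative_transform_within_open[OF assms(4,1,2,3)] by simp

lemma Ck_on_add:
  "open S \<Longrightarrow> Ck_on k S f \<Longrightarrow> Ck_on k S g \<Longrightarrow> Ck_on k S (\<lambda>x. f x + g x)"
proof (induction k arbitrary: f g)
  case 0 then show ?case by (auto intro: continuous_intros)
next
  case (Suc k)
  have "Ck_on k S (pd b (\<lambda>x. f x + g x)) \<longleftrightarrow> Ck_on k S (\<lambda>x. pd b f x + pd b g x)" for b
    using Suc.prems by (intro Ck_on_cong pd_add) (auto simp: Ck_on_Suc_open)
  then show ?case using Suc by (auto simp: Ck_on_Suc_open)
qed

lemma Ck_on_mult:
  fixes f g :: "'a::euclidean_space \<Rightarrow> real"
  shows "open S \<Longrightarrow> Ck_on k S f \<Longrightarrow> Ck_on k S g \<Longrightarrow> Ck_on k S (\<lambda>x. f x * g x)"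
proof (induction k arbitrary: f g)
  case 0 then show ?case by (auto intro: continuous_intros)
next
  case (Suc k)
  have "Ck_on k S (pd b (\<lambda>x. f x * g x)) \<longleftrightarrow> Ck_on k S (\<lambda>x. pd b f x * g x + f x * pd b g x)" for b
    using Suc.prems by (intro Ck_on_cong pd_mult) (auto simp: Ck_on_Suc_open)
  moreover have "Ck_on k S f" "Ck_on k S g" using Suc.prems Ck_on_SucD by blast+
  ultimately show ?case using Suc by (auto simp: Ck_on_Suc_open intro!: Ck_on_add)
qed

text \<open>Only the outer function varies in the induction: each derivative is
  \<open>pd 1 F\<close> composed with the same \<open>f\<close>, times a derivative of
  \<open>f\<close>, and the product rule does the rest.\<close>

lemma Ck_on_compose:
  fixes F :: "real \<Rightarrow> real" and f :: "'a::euclidean_space \<Rightarrow> real"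
  shows "open S \<Longrightarrow> open T \<Longrightarrow> f ` S \<subseteq> T \<Longrightarrow> Ck_on k T F \<Longrightarrow> Ck_on k S f \<Longrightarrow> Ck_on k S (\<lambda>x. F (f x))"
proof (induction k arbitrary: F)
  case 0 then show ?case by (auto intro: continuous_on_compose2)
next
  case (Suc k)
  have dF: "F differentiable (at t)" if "t \<in> T" for t using Suc.prems that by (auto simp: Ck_on_Suc_open)
  have df: "f differentiable (at x)" if "x \<in> S" for x using Suc.prems that by (auto simp: Ck_on_Suc_open)
  have hF: "(F has_real_derivative pd 1 F t) (at t)" if "t \<in> T" for t
    using dF[OF that] by (metis differentiable_def has_field_derivative_def pd_real real_differentiable_def)
  have "Ck_on k S (pd b (\<lambda>x. F (f x))) \<longleftrightarrow> Ck_on k S (\<lambda>x. pd 1 F (f x) * pd b f x)" for b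
    using Suc.prems by (intro Ck_on_cong pd_compose_real hF df) auto
  moreover have k: "Ck_on k S f" using Ck_on_SucD[OF Suc.prems(1,5)] .
  moreover have "Ck_on k T (pd 1 F)" using Suc.prems(2,4) by (simp add: Ck_on_Suc_open)
  then have "Ck_on k S (\<lambda>x. pd 1 F (f x))" using Suc.IH Suc.prems(1-3) k by blast
  moreover have "(\<lambda>x. F (f x)) differentiable (at x)" if "x \<in> S" for x
    using differentiable_chain_at[OF df[OF that] dF] that Suc.prems(3) by (auto simp: o_def)
  ultimately show ?case using Suc.prems(1,5)
    by (simp add: Ck_on_Suc_open Ck_on_mult)
qed

lemma Ck_on_SucI_real:
  fixes F :: "real \<Rightarrow> real"
  assumes "open T" "\<And>t. t \<in> T \<Longrightarrow> (F has_real_derivative F' t) (at t)" "Ck_on k T F'"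
  shows "Ck_on (Suc k) T F"
proof -
  have "Ck_on k T (pd 1 F) \<longleftrightarrow> Ck_on k T F'" using assms by (intro Ck_on_cong pd_real) auto
  then show ?thesis using assms
    by (auto simp: Ck_on_Suc_open real_differentiable_def)
qed

lemma Ck_on_ident: "open S \<Longrightarrow> Ck_on k S (\<lambda>x::'a::euclidean_space. x)"
  by (rule Ck_on_bounded_linear) (auto intro: bounded_linear_ident)

lemma Ck_on_exp: "Ck_on k UNIV (exp :: real \<Rightarrow> real)"
  by (induction k) (auto intro!: continuous_intros Ck_on_SucI_real DERIV_exp)

lemma Ck_on_inverse: "Ck_on k (- {0}) (inverse :: real \<Rightarrow> real)"
proof (induction k)
  case 0 show ?case by (auto intro!: continuous_intros)
next
  case (Suc k)
  have "Ck_on k (- {0}) (\<lambda>x. (-1) * (inverse x * inverse (x::real)))"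
    using Suc by (intro Ck_on_mult Ck_on_const) auto
  then show ?case
    by (rule Ck_on_SucI_real[rotated 2]) (auto intro!: derivative_eq_intros simp: power2_eq_square)
qed

lemma Ck_on_ln: "Ck_on k {0<..} (ln :: real \<Rightarrow> real)"
proof (cases k)
  case 0 then show ?thesis by (auto intro!: continuous_intros)
next
  case (Suc n)
  have "Ck_on n {0<..} (inverse :: real \<Rightarrow> real)"
    by (rule Ck_on_subset[OF _ _ _ Ck_on_inverse]) auto
  then show ?thesis unfolding Suc
    by (rule Ck_on_SucI_real[rotated 2]) (auto intro!: derivative_eq_intros simp: divide_inverse)
qed

lemma Ck_on_divide:
  fixes f g :: "'a::euclidean_space \<Rightarrow> real"
  assumes "open S" "Ck_on k S f" "Ck_on k S g" "\<And>x. x \<in> S \<Longrightarrow> g x \<noteq> 0"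
  shows "Ck_on k S (\<lambda>x. f x / g x)"
proof -
  have "Ck_on k S (\<lambda>x. inverse (g x))"
    by (rule Ck_on_compose[of S "- {0}" g k inverse]) (use assms Ck_on_inverse in auto)
  then show ?thesis using Ck_on_mult[of S k f "\<lambda>x. inverse (g x)"] assms by (simp add: divide_inverse)
qed

lemma Ck_on_power:
  fixes f :: "'a::euclidean_space \<Rightarrow> real"
  shows "open S \<Longrightarrow> Ck_on k S f \<Longrightarrow> Ck_on k S (\<lambda>x. f x ^ n)"
  by (induction n) (auto intro: Ck_on_const Ck_on_mult)

lemma Ck_on_diff:
  fixes f g :: "'a::euclidean_space \<Rightarrow> real"
  assumes "open S" "Ck_on k S f" "Ck_on k S g"
  shows "Ck_on k S (\<lambda>x. f x - g x)"
  using Ck_on_add[OF assms(1,2) Ck_on_mult[OF assms(1) Ck_on_const[OF assms(1), of k "-1"] assms(3)]] by simp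

lemma Ck_on_cmult:
  fixes f :: "'a::euclidean_space \<Rightarrow> real"
  assumes "open S" "Ck_on k S f"
  shows "Ck_on k S (\<lambda>x. c * f x)"
  using Ck_on_mult[OF assms(1) Ck_on_const[OF assms(1)] assms(2)] by simp

lemma Ck_on_arctan: "Ck_on k UNIV (arctan :: real \<Rightarrow> real)"
proof (cases k)
  case 0 then show ?thesis by (auto intro!: continuous_intros)
next
  case (Suc n)
  have nz: "1 + x\<^sup>2 \<noteq> 0" for x :: real by (metis add_pos_nonneg less_numeral_extra(1,3) zero_le_power2)
  have "Ck_on n UNIV (\<lambda>x::real. 1 / (1 + x\<^sup>2))"
    by (intro Ck_on_divide Ck_on_add Ck_on_const Ck_on_power Ck_on_ident) (auto simp: nz)
  then show ?thesis unfolding Suc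
    by (rule Ck_on_SucI_real[rotated 2]) (auto intro!: derivative_eq_intros simp: divide_inverse)
qed

section \<open>The flat function exp (- 1 / t) and its derivatives\<close>

definition flat :: "nat \<Rightarrow> real \<Rightarrow> real" where
  "flat n t = (if t > 0 then exp (- 1 / t) / t ^ n else 0)"

lemma flat_eq: "0 < t \<Longrightarrow> flat n t = exp (- inverse t) * inverse t ^ n"
  by (simp add: flat_def divide_inverse power_inverse)

lemma flat_nonneg: "0 \<le> flat n t" and flat_pos: "0 < t \<Longrightarrow> 0 < flat n t" and flat_0: "t \<le> 0 \<Longrightarrow> flat n t = 0"
  by (auto simp: flat_def)

lemma power_le_fact_exp:
  assumes "0 \<le> (x::real)" shows "x ^ m \<le> fact m * exp x"
proof -
  have "(\<Sum>n\<in>{m}. inverse (fact n) * x ^ n) \<le> (\<Sum>n. inverse (fact n) * x ^ n)"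
    using assms by (intro sum_le_suminf summable_exp) auto
  then have "inverse (fact m) * x ^ m \<le> exp x" by (simp add: exp_def)
  then show ?thesis by (simp add: divide_simps mult.commute split: if_splits)
qed

text \<open>One term of the exponential series at 1 / t. The case m = 0 bounds \<open>flat n\<close>
  by n factorial, the case m = 2 gives differentiability at 0.\<close>

lemma flat_le:
  assumes "0 < t" shows "flat n t \<le> fact (n + m) * t ^ m"
proof -
  have "(1 / t) ^ (n + m) \<le> fact (n + m) * exp (1 / t)"
    using assms by (intro power_le_fact_exp) auto
  then show ?thesis using assms
    by (simp add: flat_def exp_minus power_add field_simps)
qed

lemma flat_bounded: "\<bar>flat n t\<bar> \<le> fact n"
  using flat_le[of t n 0] flat_nonneg[of n t] flat_0[of t n] by (cases "0 < t") auto

text \<open>The family indexed by \<open>n\<close> is closed under differentiation, which is the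
  reason for carrying the power \<open>t ^ n\<close> in its definition: smoothness of all members
  follows by one induction on the order.\<close>

lemma DERIV_flat:
  "(flat n has_real_derivative flat (n + 2) t - n * flat (n + 1) t) (at t)"
proof (cases "t = 0")
  case False
  have pos: "(flat n has_real_derivative flat (n + 2) t - n * flat (n + 1) t) (at t)" if "t > 0"
  proof -
    have "((\<lambda>t. exp (- inverse t) * inverse t ^ n) has_real_derivative
        exp (- inverse t) * (inverse t * inverse t) * inverse t ^ n +
        exp (- inverse t) * (n * inverse t ^ (n - 1) * (- (inverse t * inverse t)))) (at t)"
      using that by (auto intro!: derivative_eq_intros)
    moreover have "exp (- inverse t) * (inverse t * inverse t) * inverse t ^ n +
        exp (- inverse t) * (n * inverse t ^ (n - 1) * (- (inverse t * inverse t)))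
        = flat (n + 2) t - n * flat (n + 1) t"
      using that by (cases n) (simp_all add: flat_eq)
    ultimately have "((\<lambda>t. exp (- inverse t) * inverse t ^ n) has_real_derivative
        flat (n + 2) t - n * flat (n + 1) t) (at t)" by simp
    then show ?thesis
      by (rule has_field_derivative_transform_within_open[where S="{0<..}"]) (use that in \<open>auto simp: flat_eq\<close>)
  qed
  moreover have "(flat n has_real_derivative flat (n + 2) t - n * flat (n + 1) t) (at t)" if "t < 0"
  proof -
    have "((\<lambda>t. 0) has_real_derivative flat (n + 2) t - n * flat (n + 1) t) (at t)"
      using that by (auto simp: flat_def)
    then show ?thesis
      by (rule has_field_derivative_transform_within_open[where S="{..<0}"]) (use that in \<open>auto simp: flat_def\<close>)
  qed
  ultimately show ?thesis using False by argo
next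
  case True
  have "((\<lambda>h. flat n h / h) \<longlongrightarrow> 0) (at 0)"
  proof (rule Lim_null_comparison)
    show "\<forall>\<^sub>F h in at 0. norm (flat n h / h) \<le> fact (n + 2) * \<bar>h\<bar>"
    proof (rule always_eventually, rule allI)
      fix h :: real
      show "norm (flat n h / h) \<le> fact (n + 2) * \<bar>h\<bar>"
      proof (cases "0 < h")
        case True
        then have "flat n h / h \<le> fact (n + 2) * h\<^sup>2 / h"
          using flat_le[of h n 2] by (intro divide_right_mono) auto
        then show ?thesis using True flat_nonneg[of n h] by (simp add: power2_eq_square)
      next
        case False
        then have "flat n h = 0" by (simp add: flat_0)
        moreover have "0 \<le> fact (n + 2) * \<bar>h\<bar>" by (intro mult_nonneg_nonneg) auto
        ultimately show ?thesis by (simp only: div_0 norm_zero)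
      qed
    qed
    show "((\<lambda>h. fact (n + 2) * \<bar>h\<bar>) \<longlongrightarrow> (0::real)) (at 0)"
      by (auto intro!: tendsto_eq_intros)
  qed
  then show ?thesis using True by (simp add: DERIV_def flat_def)
qed

lemma Ck_on_flat: "Ck_on k UNIV (flat n)"
proof (induction k arbitrary: n)
  case 0
  show ?case using DERIV_flat DERIV_isCont by (fastforce intro!: continuous_at_imp_continuous_on)
next
  case (Suc k)
  show ?case
    by (rule Ck_on_SucI_real[OF _ DERIV_flat]) (auto intro!: Ck_on_diff Ck_on_cmult Suc)
qed

text \<open>Smoothness is local: the extension agrees with \<open>f\<close> on \<open>S\<close> and
  with 0 off \<open>K\<close>, and these two open sets cover the space.\<close>

lemma Ck_on_extend_zero:
  assumes "open S" "compact K" "K \<subseteq> S" "Ck_on k S f" "\<And>x. x \<in> S - K \<Longrightarrow> f x = 0"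
  shows "Ck_on k UNIV (\<lambda>x. if x \<in> S then f x else 0)"
proof -
  let ?g = "\<lambda>x. if x \<in> S then f x else 0"
  have "Ck_on k S ?g" using assms(4) Ck_on_cong[of S ?g f k] by simp
  moreover have "Ck_on k (- K) ?g"
    using Ck_on_cong[of "- K" ?g "\<lambda>x. 0" k] Ck_on_const[of "- K" k 0] assms compact_imp_closed by auto
  ultimately have "Ck_on k (S \<union> - K) ?g"
    using assms compact_imp_closed by (intro Ck_on_Un) auto
  moreover have "S \<union> - K = UNIV" using assms by auto
  ultimately show ?thesis by simp
qed

subsection \<open>Integration in the plane and the Gagliardo inequality\<close>

text \<open>The gateway to Fubini in the plane. Both measures give a box the product of its side
  lengths, since \<open>Basis\<close> consists of 1 and \<i>, and this determines the
  measure.\<close>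

lemma lborel_complex: "(lborel :: complex measure) = distr (lborel \<Otimes>\<^sub>M lborel) borel (\<lambda>(x, y). Complex x y)"
proof (rule lborel_eqI)
  have C[measurable]: "(\<lambda>(x, y). Complex x y) \<in> borel_measurable (lborel \<Otimes>\<^sub>M lborel)"
    unfolding complex_eq_iff case_prod_beta' Complex_eq by measurable
  fix l u :: complex assume le: "\<And>b. b \<in> Basis \<Longrightarrow> l \<bullet> b \<le> u \<bullet> b"
  have le': "Re l \<le> Re u" "Im l \<le> Im u" using le[of 1] le[of \<i>] by (auto simp: Basis_complex_def)
  have eq: "(\<lambda>(x, y). Complex x y) -` box l u \<inter> space (lborel \<Otimes>\<^sub>M lborel)
      = box (Re l) (Re u) \<times> box (Im l) (Im u)"
    by (auto simp: box_def Basis_complex_def space_pair_measure)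
  have "emeasure (distr (lborel \<Otimes>\<^sub>M lborel) borel (\<lambda>(x, y). Complex x y)) (box l u)
     = emeasure lborel (box (Re l) (Re u)) * emeasure lborel (box (Im l) (Im u))"
    by (subst emeasure_distr) (auto simp: eq lborel.emeasure_pair_measure_Times)
  also have "\<dots> = (\<Prod>b\<in>Basis. (u - l) \<bullet> b)"
    using le' by (simp add: Basis_complex_def ennreal_mult)
  finally show "emeasure (distr (lborel \<Otimes>\<^sub>M lborel) borel (\<lambda>(x, y). Complex x y)) (box l u)
     = (\<Prod>b\<in>Basis. (u - l) \<bullet> b)" .
qed simp

lemma measurable_Complex[measurable]: "(\<lambda>(x, y). Complex x y) \<in> borel_measurable (lborel \<Otimes>\<^sub>M lborel)"
    "(\<lambda>(x, y). Complex x y) \<in> borel_measurable (borel \<Otimes>\<^sub>M borel)"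
  unfolding complex_eq_iff case_prod_beta' Complex_eq by measurable

lemma
  fixes f :: "complex \<Rightarrow> ennreal"
  assumes [measurable]: "f \<in> borel_measurable borel"
  shows nn_integral_complex: "(\<integral>\<^sup>+z. f z \<partial>lborel) = (\<integral>\<^sup>+x. \<integral>\<^sup>+y. f (Complex x y) \<partial>lborel \<partial>lborel)"
    and nn_integral_complex': "(\<integral>\<^sup>+z. f z \<partial>lborel) = (\<integral>\<^sup>+y. \<integral>\<^sup>+x. f (Complex x y) \<partial>lborel \<partial>lborel)"
proof -
  have m[measurable]: "(\<lambda>(x, y). f (Complex x y)) \<in> borel_measurable (lborel \<Otimes>\<^sub>M lborel)"
    using measurable_compose[OF measurable_Complex(1) assms] by (simp add: case_prod_beta')
  have "(\<integral>\<^sup>+z. f z \<partial>lborel) = (\<integral>\<^sup>+p. (case p of (x, y) \<Rightarrow> f (Complex x y)) \<partial>(lborel \<Otimes>\<^sub>M lborel))"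
    by (subst lborel_complex, subst nn_integral_distr) (auto simp: case_prod_beta')
  then show "(\<integral>\<^sup>+z. f z \<partial>lborel) = (\<integral>\<^sup>+x. \<integral>\<^sup>+y. f (Complex x y) \<partial>lborel \<partial>lborel)"
    "(\<integral>\<^sup>+z. f z \<partial>lborel) = (\<integral>\<^sup>+y. \<integral>\<^sup>+x. f (Complex x y) \<partial>lborel \<partial>lborel)"
    using lborel.nn_integral_fst[OF m] lborel_pair.nn_integral_snd[OF m] by simp_all
qed

lemma
  fixes f :: "complex \<Rightarrow> real"
  assumes f: "integrable lborel f"
  shows integral_complex: "(\<integral>z. f z \<partial>lborel) = (\<integral>x. \<integral>y. f (Complex x y) \<partial>lborel \<partial>lborel)"
    and integral_complex': "(\<integral>z. f z \<partial>lborel) = (\<integral>y. \<integral>x. f (Complex x y) \<partial>lborel \<partial>lborel)"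
proof -
  have m: "f \<in> borel_measurable borel" using borel_measurable_integrable[OF f] by simp
  have i: "integrable (lborel \<Otimes>\<^sub>M lborel) (\<lambda>(x, y). f (Complex x y))"
    using f by (subst (asm) lborel_complex, subst (asm) integrable_distr_eq) (auto simp: case_prod_beta' m)
  have "(\<integral>z. f z \<partial>lborel) = (\<integral>p. (case p of (x, y) \<Rightarrow> f (Complex x y)) \<partial>(lborel \<Otimes>\<^sub>M lborel))"
    by (subst lborel_complex, subst integral_distr) (auto simp: case_prod_beta' m)
  then show "(\<integral>z. f z \<partial>lborel) = (\<integral>x. \<integral>y. f (Complex x y) \<partial>lborel \<partial>lborel)"
    "(\<integral>z. f z \<partial>lborel) = (\<integral>y. \<integral>x. f (Complex x y) \<partial>lborel \<partial>lborel)"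
    using lborel_pair.integral_fst'[OF i] lborel_pair.integral_snd[OF i] by simp_all
qed

lemma
  fixes g g' :: "real \<Rightarrow> real"
  assumes d: "\<And>t. (g has_real_derivative g' t) (at t)" and c: "continuous_on UNIV g'"
    and z: "\<And>t. R < \<bar>t\<bar> \<Longrightarrow> g t = 0"
  shows integral_deriv_compact_support: "(\<integral>t. g' t \<partial>lborel) = 0"
    and abs_le_nn_integral_deriv: "ennreal \<bar>g x\<bar> \<le> (\<integral>\<^sup>+t. ennreal \<bar>g' t\<bar> \<partial>lborel)"
proof -
  have z': "g' t = 0" if "R < \<bar>t\<bar>" for t
  proof -
    have "((\<lambda>x. 0) has_real_derivative g' t) (at t)"
      by (rule has_field_derivative_transform_within_open[OF d, of "{t. R < \<bar>t\<bar>}" t "\<lambda>x. 0"])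
        (use z that in \<open>auto intro!: open_Collect_less continuous_intros\<close>)
    then show ?thesis using DERIV_unique DERIV_const by blast
  qed
  have FTC: "(\<integral>t. g' t * indicator {a..b} t \<partial>lborel) = g b - g a" if "a \<le> b" for a b
    using c d that by (intro integral_FTC_Icc_real) (auto simp: continuous_on_eq_continuous_at)
  have "g' t = g' t * indicator {-\<bar>R\<bar>-1..\<bar>R\<bar>+1} t" for t
  proof (cases "R < \<bar>t\<bar>")
    case False
    then have "t \<in> {-\<bar>R\<bar>-1..\<bar>R\<bar>+1}" by auto
    then show ?thesis by simp
  qed (simp add: z')
  then have "(\<integral>t. g' t \<partial>lborel) = (\<integral>t. g' t * indicator {-\<bar>R\<bar>-1..\<bar>R\<bar>+1} t \<partial>lborel)" by presburger
  also have "\<dots> = 0" using FTC[of "-\<bar>R\<bar>-1" "\<bar>R\<bar>+1"] z[of "-\<bar>R\<bar>-1"] z[of "\<bar>R\<bar>+1"] by auto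
  finally show "(\<integral>t. g' t \<partial>lborel) = 0" .
  \<comment> \<open>A point to the left of both the support and \<open>x\<close>, so that
    \<open>g x\<close> is the integral of \<open>g'\<close> from there.\<close>
  define a where "a = - \<bar>R\<bar> - \<bar>x\<bar> - 1"
  have "g x = (\<integral>t. g' t * indicator {a..x} t \<partial>lborel)" using FTC[of a x] z[of a] by (auto simp: a_def)
  moreover have "integrable lborel (\<lambda>t. g' t * indicator {a..x} t)"
    using c by (intro borel_integrable_atLeastAtMost) (auto simp: continuous_on_eq_continuous_at)
  ultimately have "ennreal \<bar>g x\<bar> \<le> (\<integral>\<^sup>+t. ennreal \<bar>g' t * indicator {a..x} t\<bar> \<partial>lborel)"
    using integral_norm_bound_ennreal[of lborel "\<lambda>t. g' t * indicator {a..x} t"] by simp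
  also have "\<dots> \<le> (\<integral>\<^sup>+t. ennreal \<bar>g' t\<bar> \<partial>lborel)"
    by (intro nn_integral_mono ennreal_leI) (auto simp: indicator_def)
  finally show "ennreal \<bar>g x\<bar> \<le> (\<integral>\<^sup>+t. ennreal \<bar>g' t\<bar> \<partial>lborel)" .
qed

section \<open>Slicing compactly supported functions\<close>

definition C1c :: "(complex \<Rightarrow> real) \<Rightarrow> bool" where
  "C1c f \<longleftrightarrow> Ck_on 1 UNIV f \<and> (\<exists>R. \<forall>x. R < norm x \<longrightarrow> f x = 0)"

lemma C1cD:
  assumes "C1c f"
  shows "f differentiable (at x)" "continuous_on UNIV f" "b \<in> Basis \<Longrightarrow> continuous_on UNIV (pd b f)"
    "\<exists>R>0. \<forall>x. R < norm x \<longrightarrow> f x = 0 \<and> pd b f x = 0"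
proof -
  have 1: "Ck_on (Suc 0) UNIV f" using assms by (simp add: C1c_def)
  then show d: "f differentiable (at x)" for x by (simp add: Ck_on_Suc_open)
  show "b \<in> Basis \<Longrightarrow> continuous_on UNIV (pd b f)" using 1 by (simp add: Ck_on_Suc_open)
  show "continuous_on UNIV f" using Ck_on_SucD[OF _ 1] by simp
  obtain R where R: "\<forall>x. R < norm x \<longrightarrow> f x = 0" using assms by (auto simp: C1c_def)
  have "pd b f x = 0" if "R < norm x" for x
  proof -
    have "pd b f x = pd b (\<lambda>x. 0) x"
      using R that d by (intro pd_cong_open[of "{x. R < norm x}"]) (auto intro!: open_Collect_less continuous_intros)
    then show ?thesis by simp
  qed
  with R show "\<exists>R>0. \<forall>x. R < norm x \<longrightarrow> f x = 0 \<and> pd b f x = 0"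
    by (intro exI[of _ "\<bar>R\<bar> + 1"]) auto
qed

lemma has_vector_derivative_slice:
  fixes f :: "complex \<Rightarrow> real"
  assumes "\<And>z. f differentiable (at z)"
  shows "((\<lambda>s. f (Complex s y)) has_real_derivative pd 1 f (Complex s y)) (at s)"
    and "((\<lambda>t. f (Complex x t)) has_real_derivative pd \<i> f (Complex x t)) (at t)"
proof -
  have D: "(f has_derivative (\<lambda>h. pd h f z)) (at z)" for z using assms by (simp add: frechet_derivative_works)
  have lin: "linear (\<lambda>h. pd h f z)" for z using D has_derivative_linear by blast
  have 1: "((\<lambda>s. Complex s y) has_derivative (\<lambda>h. h *\<^sub>R 1)) (at s)"
    unfolding Complex_eq by (auto intro!: derivative_eq_intros simp: scaleR_conv_of_real)
  have 2: "((\<lambda>t. Complex x t) has_derivative (\<lambda>h. h *\<^sub>R \<i>)) (at t)"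
    unfolding Complex_eq by (auto intro!: derivative_eq_intros simp: scaleR_conv_of_real)
  show "((\<lambda>s. f (Complex s y)) has_real_derivative pd 1 f (Complex s y)) (at s)"
  proof -
    have "(\<lambda>h. pd (h *\<^sub>R 1) f (Complex s y)) = (\<lambda>h. pd 1 f (Complex s y) * h)"
      using linear_scale[OF lin] by (simp add: fun_eq_iff)
    then show ?thesis using has_derivative_compose[OF 1 D] by (simp add: has_field_derivative_def)
  qed
  show "((\<lambda>t. f (Complex x t)) has_real_derivative pd \<i> f (Complex x t)) (at t)"
  proof -
    have "(\<lambda>h. pd (h *\<^sub>R \<i>) f (Complex x t)) = (\<lambda>h. pd \<i> f (Complex x t) * h)"
      using linear_scale[OF lin] by (simp add: fun_eq_iff)
    then show ?thesis using has_derivative_compose[OF 2 D] by (simp add: has_field_derivative_def)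
  qed
qed

lemma norm_Complex_ge: "\<bar>x\<bar> \<le> norm (Complex x y)" "\<bar>y\<bar> \<le> norm (Complex x y)"
  using abs_Re_le_cmod[of "Complex x y"] abs_Im_le_cmod[of "Complex x y"] by auto

lemma integrable_continuous_compact_support:
  fixes f :: "complex \<Rightarrow> 'b::{banach, second_countable_topology}"
  assumes "continuous_on UNIV f" "\<And>x. R < norm x \<Longrightarrow> f x = 0"
  shows "integrable lborel f"
proof -
  have "integrable lborel (\<lambda>x. indicator (cball 0 R) x *\<^sub>R f x)"
    using assms by (intro borel_integrable_compact) (auto intro: continuous_on_subset)
  moreover have "(\<lambda>x. indicator (cball 0 R) x *\<^sub>R f x) = f"
    using assms(2) by (auto simp: indicator_def fun_eq_iff not_le)
  ultimately show ?thesis by simp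
qed

lemma C1c_slice:
  assumes "C1c f"
  obtains R where "\<And>x y. R < \<bar>x\<bar> \<Longrightarrow> f (Complex x y) = 0" "\<And>x y. R < \<bar>y\<bar> \<Longrightarrow> f (Complex x y) = 0"
  using C1cD(4)[OF assms] norm_Complex_ge by (metis order_less_le_trans)

lemma continuous_on_Complex:
  assumes "continuous_on UNIV f"
  shows "continuous_on UNIV (\<lambda>x. f (Complex x y))" "continuous_on UNIV (\<lambda>y. f (Complex x y))"
  unfolding Complex_eq
  by (rule continuous_on_compose2[OF assms], auto intro!: continuous_intros)+

lemma integral_pd:
  assumes f: "C1c f" and b: "b \<in> Basis"
  shows "integrable lborel (pd b f)" "(\<integral>z. pd b f z \<partial>lborel) = 0"
proof -
  obtain R where R: "\<forall>x. R < norm x \<longrightarrow> f x = 0 \<and> pd b f x = 0" using C1cD(4)[OF f] by blast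
  show i: "integrable lborel (pd b f)"
    using R C1cD(3)[OF f b] by (intro integrable_continuous_compact_support[of _ R]) auto
  note S = has_vector_derivative_slice[of f, OF C1cD(1)[OF f]]
  have c: "continuous_on UNIV (pd 1 f)" "continuous_on UNIV (pd \<i> f)"
    using C1cD(3)[OF f] by (auto simp: Basis_complex_def)
  obtain R' where R': "\<And>x y. R' < \<bar>x\<bar> \<Longrightarrow> f (Complex x y) = 0" "\<And>x y. R' < \<bar>y\<bar> \<Longrightarrow> f (Complex x y) = 0"
    using C1c_slice[OF f] by blast
  consider "b = 1" | "b = \<i>" using b by (auto simp: Basis_complex_def)
  then show "(\<integral>z. pd b f z \<partial>lborel) = 0"
  proof cases
    case 1
    show ?thesis unfolding integral_complex'[OF i]
      using integral_deriv_compact_support[OF S(1) continuous_on_Complex(1)[OF c(1)] R'(1)] by (simp add: 1)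
  next
    case 2
    show ?thesis unfolding integral_complex[OF i]
      using integral_deriv_compact_support[OF S(2) continuous_on_Complex(2)[OF c(2)] R'(2)] by (simp add: 2)
  qed
qed

text \<open>At a point (x, y), |f| is at most the integral of |pd 1 f| along the horizontal line and
  at most that of |pd \<i> f| along the vertical one. The first bound \<open>A y\<close> ignores x
  and the second bound \<open>B x\<close> ignores y, so their product integrates to a product of
  integrals.\<close>

lemma gagliardo:
  assumes f: "C1c f"
  shows "(\<integral>\<^sup>+z. ennreal ((f z)\<^sup>2) \<partial>lborel) \<le>
    (\<integral>\<^sup>+z. ennreal \<bar>pd 1 f z\<bar> \<partial>lborel) * (\<integral>\<^sup>+z. ennreal \<bar>pd \<i> f z\<bar> \<partial>lborel)"
proof -
  note S = has_vector_derivative_slice[of f, OF C1cD(1)[OF f]]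
  have c: "continuous_on UNIV (pd 1 f)" "continuous_on UNIV (pd \<i> f)"
    using C1cD(3)[OF f] by (auto simp: Basis_complex_def)
  have m[measurable]: "f \<in> borel_measurable borel" "pd 1 f \<in> borel_measurable borel" "pd \<i> f \<in> borel_measurable borel"
    using c C1cD(2)[OF f] by (auto intro: borel_measurable_continuous_onI)
  obtain R' where R': "\<And>x y. R' < \<bar>x\<bar> \<Longrightarrow> f (Complex x y) = 0" "\<And>x y. R' < \<bar>y\<bar> \<Longrightarrow> f (Complex x y) = 0"
    using C1c_slice[OF f] by blast
  define A where "A y = (\<integral>\<^sup>+s. ennreal \<bar>pd 1 f (Complex s y)\<bar> \<partial>lborel)" for y
  define B where "B x = (\<integral>\<^sup>+t. ennreal \<bar>pd \<i> f (Complex x t)\<bar> \<partial>lborel)" for x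
  have m2[measurable]: "(\<lambda>p. pd 1 f (Complex (snd p) (fst p))) \<in> borel_measurable (borel \<Otimes>\<^sub>M lborel)"
     "(\<lambda>p. pd \<i> f (Complex (fst p) (snd p))) \<in> borel_measurable (borel \<Otimes>\<^sub>M lborel)"
    unfolding Complex_eq by measurable
  have mA[measurable]: "A \<in> borel_measurable borel" unfolding A_def
    by (rule lborel.borel_measurable_nn_integral) (simp add: case_prod_beta', measurable)
  have mB[measurable]: "B \<in> borel_measurable borel" unfolding B_def
    by (rule lborel.borel_measurable_nn_integral) (simp add: case_prod_beta', measurable)
  have "ennreal ((f (Complex x y))\<^sup>2) \<le> A y * B x" for x y
  proof -
    have "ennreal \<bar>f (Complex x y)\<bar> \<le> A y"
      unfolding A_def by (rule abs_le_nn_integral_deriv[OF S(1) continuous_on_Complex(1)[OF c(1)] R'(1)])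
    moreover have "ennreal \<bar>f (Complex x y)\<bar> \<le> B x"
      unfolding B_def by (rule abs_le_nn_integral_deriv[OF S(2) continuous_on_Complex(2)[OF c(2)] R'(2)])
    ultimately have "ennreal \<bar>f (Complex x y)\<bar> * ennreal \<bar>f (Complex x y)\<bar> \<le> A y * B x" by (rule mult_mono) auto
    then show ?thesis by (simp add: ennreal_mult[symmetric] power2_eq_square abs_mult[symmetric])
  qed
  then have "(\<integral>\<^sup>+z. ennreal ((f z)\<^sup>2) \<partial>lborel) \<le> (\<integral>\<^sup>+x. \<integral>\<^sup>+y. A y * B x \<partial>lborel \<partial>lborel)"
    by (subst nn_integral_complex) (auto intro!: nn_integral_mono)
  also have "\<dots> = (\<integral>\<^sup>+y. A y \<partial>lborel) * (\<integral>\<^sup>+x. B x \<partial>lborel)"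
    by (simp add: nn_integral_multc nn_integral_cmult)
  also have "(\<integral>\<^sup>+y. A y \<partial>lborel) = (\<integral>\<^sup>+z. ennreal \<bar>pd 1 f z\<bar> \<partial>lborel)"
    unfolding A_def by (rule nn_integral_complex'[symmetric]) measurable
  also have "(\<integral>\<^sup>+x. B x \<partial>lborel) = (\<integral>\<^sup>+z. ennreal \<bar>pd \<i> f z\<bar> \<partial>lborel)"
    unfolding B_def by (rule nn_integral_complex[symmetric]) measurable
  finally show ?thesis .
qed

subsection \<open>Square integrable functions\<close>

definition sq_int :: "'a measure \<Rightarrow> ('a \<Rightarrow> 'b::euclidean_space) \<Rightarrow> bool" where
  "sq_int M f \<longleftrightarrow> f \<in> borel_measurable M \<and> integrable M (\<lambda>x. (norm (f x))\<^sup>2)"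

lemma sq_intD[measurable_dest]: "sq_int M f \<Longrightarrow> f \<in> borel_measurable M" by (simp add: sq_int_def)

lemma sq_int_inner:
  assumes "sq_int M f" "sq_int M g" shows "integrable M (\<lambda>x. f x \<bullet> g x)"
proof (rule Bochner_Integration.integrable_bound)
  show "integrable M (\<lambda>x. (norm (f x))\<^sup>2 + (norm (g x))\<^sup>2)" using assms by (auto simp: sq_int_def)
  show "(\<lambda>x. f x \<bullet> g x) \<in> borel_measurable M" using assms by (auto simp: sq_int_def)
  have "\<bar>f x \<bullet> g x\<bar> \<le> (norm (f x))\<^sup>2 + (norm (g x))\<^sup>2" for x
    using Cauchy_Schwarz_ineq2[of "f x" "g x"] sum_squares_bound[of "norm (f x)" "norm (g x)"]
      zero_le_power2[of "norm (f x)"] zero_le_power2[of "norm (g x)"] by linarith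
  then show "AE x in M. norm (f x \<bullet> g x) \<le> norm ((norm (f x))\<^sup>2 + (norm (g x))\<^sup>2)" by simp
qed

lemma sq_int_mult: "sq_int M (f :: 'a \<Rightarrow> real) \<Longrightarrow> sq_int M g \<Longrightarrow> integrable M (\<lambda>x. f x * g x)"
  using sq_int_inner[of M f g] by simp

lemma sq_int_scaleR:
  assumes "sq_int M f" shows "sq_int M (\<lambda>x. c *\<^sub>R f x)"
  using assms by (auto simp: sq_int_def power_mult_distrib)

lemma sq_int_add:
  assumes "sq_int M f" "sq_int M g" shows "sq_int M (\<lambda>x. f x + g x)"
proof -
  have "integrable M (\<lambda>x. (norm (f x))\<^sup>2 + 2 * (f x \<bullet> g x) + (norm (g x))\<^sup>2)"
    using assms sq_int_inner[OF assms] by (auto simp: sq_int_def)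
  then show ?thesis using assms by (auto simp: sq_int_def power2_norm_eq_inner inner_simps inner_commute algebra_simps)
qed

lemma sq_int_diff:
  assumes "sq_int M f" "sq_int M g" shows "sq_int M (\<lambda>x. f x - g x)"
  using sq_int_add[OF assms(1) sq_int_scaleR[OF assms(2), of "-1"]] by simp

lemma cauchy_schwarz_integral:
  assumes f: "sq_int M f" and g: "sq_int M g"
  shows "(\<integral>x. f x \<bullet> g x \<partial>M)\<^sup>2 \<le> (\<integral>x. (norm (f x))\<^sup>2 \<partial>M) * (\<integral>x. (norm (g x))\<^sup>2 \<partial>M)"
proof -
  define a b c where "a = (\<integral>x. (norm (f x))\<^sup>2 \<partial>M)" and "b = (\<integral>x. f x \<bullet> g x \<partial>M)" and "c = (\<integral>x. (norm (g x))\<^sup>2 \<partial>M)"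
  have q: "0 \<le> a + 2 * t * b + t\<^sup>2 * c" for t
  proof -
    have "0 \<le> (\<integral>x. (norm (f x + t *\<^sub>R g x))\<^sup>2 \<partial>M)" by simp
    also have "\<dots> = (\<integral>x. (norm (f x))\<^sup>2 + 2 * t * (f x \<bullet> g x) + t\<^sup>2 * (norm (g x))\<^sup>2 \<partial>M)"
      unfolding power2_norm_eq_inner
      by (intro Bochner_Integration.integral_cong refl) (simp add: inner_simps inner_commute power2_eq_square algebra_simps)
    also have "\<dots> = a + 2 * t * b + t\<^sup>2 * c"
      using f g sq_int_inner[OF f g] by (simp add: a_def b_def c_def sq_int_def)
    finally show ?thesis .
  qed
  have c: "0 \<le> c" by (simp add: c_def)
  have "b\<^sup>2 \<le> a * c"
  proof (cases "c = 0")
    case True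
    have "b = 0"
    proof (rule ccontr)
      assume "b \<noteq> 0"
      \<comment> \<open>For c = 0 the quadratic is affine in its parameter, and here it takes the
        value -1.\<close>
      then show False using q[of "- (a + 1) / (2 * b)"] True by (simp add: field_simps)
    qed
    then show ?thesis using True by simp
  next
    case False
    then have "0 < c" using c by simp
    then show ?thesis using q[of "- b / c"] by (simp add: power2_eq_square field_simps)
  qed
  then show ?thesis by (simp add: a_def b_def c_def)
qed

lemma cauchy_schwarz_integral_real:
  fixes f g :: "'a \<Rightarrow> real"
  assumes "sq_int M f" "sq_int M g"
  shows "\<bar>\<integral>x. f x * g x \<partial>M\<bar> \<le> sqrt (\<integral>x. (f x)\<^sup>2 \<partial>M) * sqrt (\<integral>x. (g x)\<^sup>2 \<partial>M)"
  using cauchy_schwarz_integral[OF assms] by (simp add: real_sqrt_mult[symmetric] real_le_rsqrt)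

text \<open>Square integrability is part of the notion because a Bochner integral defaults to 0 on
  non-integrable functions; the vanishing limit alone would then carry no information.\<close>

definition L2_lim :: "'a measure \<Rightarrow> (nat \<Rightarrow> 'a \<Rightarrow> 'b::euclidean_space) \<Rightarrow> ('a \<Rightarrow> 'b) \<Rightarrow> bool" where
  "L2_lim M F f \<longleftrightarrow> (\<forall>n. sq_int M (F n)) \<and> sq_int M f \<and> (\<lambda>n. \<integral>x. (norm (F n x - f x))\<^sup>2 \<partial>M) \<longlonglongrightarrow> 0"

lemma L2_limD: "L2_lim M F f \<Longrightarrow> sq_int M (F n)" "L2_lim M F f \<Longrightarrow> sq_int M f"
  "L2_lim M F f \<Longrightarrow> (\<lambda>n. \<integral>x. (norm (F n x - f x))\<^sup>2 \<partial>M) \<longlonglongrightarrow> 0"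
  by (auto simp: L2_lim_def)

lemma L2_lim_subseq: "L2_lim M F f \<Longrightarrow> strict_mono r \<Longrightarrow> L2_lim M (\<lambda>n. F (r n)) f"
  using LIMSEQ_subseq_LIMSEQ[of "\<lambda>n. \<integral>x. (norm (F n x - f x))\<^sup>2 \<partial>M" 0 r] by (auto simp: L2_lim_def o_def)

lemma L2_lim_bound:
  assumes "\<And>n. sq_int M (F n)" "sq_int M f"
    and "\<And>n. (\<integral>x. (norm (F n x - f x))\<^sup>2 \<partial>M) \<le> e n" "e \<longlonglongrightarrow> 0"
  shows "L2_lim M F f"
  unfolding L2_lim_def using assms
  by (auto intro!: tendsto_sandwich[OF _ _ tendsto_const assms(4)] always_eventually)

lemma norm_add_sq_le: "(norm (x + y :: 'a::real_inner))\<^sup>2 \<le> 2 * (norm x)\<^sup>2 + 2 * (norm y)\<^sup>2"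
  using zero_le_power2[of "norm (x - y)"]
  by (simp add: power2_norm_eq_inner inner_simps inner_commute algebra_simps)

lemma L2_lim_add:
  assumes F: "L2_lim M F f" and G: "L2_lim M G g"
  shows "L2_lim M (\<lambda>n x. F n x + G n x) (\<lambda>x. f x + g x)"
proof (rule L2_lim_bound)
  fix n
  show "sq_int M (\<lambda>x. F n x + G n x)" "sq_int M (\<lambda>x. f x + g x)"
    using F G by (auto intro!: sq_int_add simp: L2_lim_def)
  have iF: "integrable M (\<lambda>x. (norm (F n x - f x))\<^sup>2)" and iG: "integrable M (\<lambda>x. (norm (G n x - g x))\<^sup>2)"
    using sq_int_diff[OF L2_limD(1,2)[OF F]] sq_int_diff[OF L2_limD(1,2)[OF G]] by (auto simp: sq_int_def)
  have "(norm (F n x + G n x - (f x + g x)))\<^sup>2 \<le> 2 * (norm (F n x - f x))\<^sup>2 + 2 * (norm (G n x - g x))\<^sup>2" for x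
    using norm_add_sq_le[of "F n x - f x" "G n x - g x"] by (simp add: algebra_simps)
  then have "(\<integral>x. (norm (F n x + G n x - (f x + g x)))\<^sup>2 \<partial>M)
     \<le> (\<integral>x. 2 * (norm (F n x - f x))\<^sup>2 + 2 * (norm (G n x - g x))\<^sup>2 \<partial>M)"
    using iF iG by (intro integral_mono_AE') auto
  also have "\<dots> = 2 * (\<integral>x. (norm (F n x - f x))\<^sup>2 \<partial>M) + 2 * (\<integral>x. (norm (G n x - g x))\<^sup>2 \<partial>M)"
    using iF iG by simp
  finally show "(\<integral>x. (norm (F n x + G n x - (f x + g x)))\<^sup>2 \<partial>M)
     \<le> 2 * (\<integral>x. (norm (F n x - f x))\<^sup>2 \<partial>M) + 2 * (\<integral>x. (norm (G n x - g x))\<^sup>2 \<partial>M)" .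
next
  show "(\<lambda>n. 2 * (\<integral>x. (norm (F n x - f x))\<^sup>2 \<partial>M) + 2 * (\<integral>x. (norm (G n x - g x))\<^sup>2 \<partial>M)) \<longlonglongrightarrow> 0"
    using L2_limD(3)[OF F] L2_limD(3)[OF G] by (auto intro!: tendsto_eq_intros)
qed

lemma L2_lim_scaleR:
  assumes F: "L2_lim M F f" shows "L2_lim M (\<lambda>n x. c *\<^sub>R F n x) (\<lambda>x. c *\<^sub>R f x)"
proof -
  have "(norm (c *\<^sub>R F n x - c *\<^sub>R f x))\<^sup>2 = c\<^sup>2 * (norm (F n x - f x))\<^sup>2" for n x
    by (simp flip: scaleR_right_diff_distrib add: power_mult_distrib)
  then show ?thesis using F by (auto simp: L2_lim_def intro!: sq_int_scaleR tendsto_mult_right_zero)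
qed

lemma L2_lim_diff:
  assumes F: "L2_lim M F f" and G: "L2_lim M G g"
  shows "L2_lim M (\<lambda>n x. F n x - G n x) (\<lambda>x. f x - g x)"
  using L2_lim_add[OF F L2_lim_scaleR[OF G, of "-1"]] by simp

lemma L2_lim_inner_const:
  assumes F: "L2_lim M F f" and h: "sq_int M h"
  shows "(\<lambda>n. \<integral>x. F n x \<bullet> h x \<partial>M) \<longlonglongrightarrow> (\<integral>x. f x \<bullet> h x \<partial>M)"
proof -
  have "(\<lambda>n. (\<integral>x. F n x \<bullet> h x \<partial>M) - (\<integral>x. f x \<bullet> h x \<partial>M)) \<longlonglongrightarrow> 0"
  proof (rule Lim_null_comparison)
    have "norm ((\<integral>x. F n x \<bullet> h x \<partial>M) - (\<integral>x. f x \<bullet> h x \<partial>M)) \<le>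
      sqrt ((\<integral>x. (norm (F n x - f x))\<^sup>2 \<partial>M) * (\<integral>x. (norm (h x))\<^sup>2 \<partial>M))" for n
    proof -
      have "(\<integral>x. F n x \<bullet> h x \<partial>M) - (\<integral>x. f x \<bullet> h x \<partial>M) = (\<integral>x. (F n x - f x) \<bullet> h x \<partial>M)"
        using sq_int_inner[OF L2_limD(1)[OF F] h] sq_int_inner[OF L2_limD(2)[OF F] h] by (simp add: inner_diff_left)
      then show ?thesis
        using cauchy_schwarz_integral[OF sq_int_diff[OF L2_limD(1)[OF F, of n] L2_limD(2)[OF F]] h] by (simp add: real_le_rsqrt)
    qed
    then show "\<forall>\<^sub>F n in sequentially. norm ((\<integral>x. F n x \<bullet> h x \<partial>M) - (\<integral>x. f x \<bullet> h x \<partial>M)) \<le>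
      sqrt ((\<integral>x. (norm (F n x - f x))\<^sup>2 \<partial>M) * (\<integral>x. (norm (h x))\<^sup>2 \<partial>M))" by simp
    show "(\<lambda>n. sqrt ((\<integral>x. (norm (F n x - f x))\<^sup>2 \<partial>M) * (\<integral>x. (norm (h x))\<^sup>2 \<partial>M))) \<longlonglongrightarrow> 0"
      using tendsto_real_sqrt[OF tendsto_mult_left_zero[OF L2_limD(3)[OF F]]] by simp
  qed
  then show ?thesis by (simp add: LIM_zero_iff)
qed

lemma L2_lim_inner:
  assumes F: "L2_lim M F f" and G: "L2_lim M G g"
  shows "(\<lambda>n. \<integral>x. F n x \<bullet> G n x \<partial>M) \<longlonglongrightarrow> (\<integral>x. f x \<bullet> g x \<partial>M)"
proof -
  note f = L2_limD(2)[OF F] and g = L2_limD(2)[OF G] and Fn = L2_limD(1)[OF F] and Gn = L2_limD(1)[OF G]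
  have 1: "(\<lambda>n. \<integral>x. (F n x - f x) \<bullet> (G n x - g x) \<partial>M) \<longlonglongrightarrow> 0"
  proof (rule Lim_null_comparison)
    have "norm (\<integral>x. (F n x - f x) \<bullet> (G n x - g x) \<partial>M) \<le>
      sqrt ((\<integral>x. (norm (F n x - f x))\<^sup>2 \<partial>M) * (\<integral>x. (norm (G n x - g x))\<^sup>2 \<partial>M))" for n
      using cauchy_schwarz_integral[OF sq_int_diff[OF Fn f] sq_int_diff[OF Gn g]] by (simp add: real_le_rsqrt)
    then show "\<forall>\<^sub>F n in sequentially. norm (\<integral>x. (F n x - f x) \<bullet> (G n x - g x) \<partial>M) \<le>
      sqrt ((\<integral>x. (norm (F n x - f x))\<^sup>2 \<partial>M) * (\<integral>x. (norm (G n x - g x))\<^sup>2 \<partial>M))" by simp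
    show "(\<lambda>n. sqrt ((\<integral>x. (norm (F n x - f x))\<^sup>2 \<partial>M) * (\<integral>x. (norm (G n x - g x))\<^sup>2 \<partial>M))) \<longlonglongrightarrow> 0"
      using tendsto_real_sqrt[OF tendsto_mult_zero[OF L2_limD(3)[OF F] L2_limD(3)[OF G]]] by simp
  qed
  have "(\<integral>x. F n x \<bullet> G n x \<partial>M) = (\<integral>x. (F n x - f x) \<bullet> (G n x - g x) \<partial>M) + (\<integral>x. F n x \<bullet> g x \<partial>M)
      + (\<integral>x. G n x \<bullet> f x \<partial>M) - (\<integral>x. f x \<bullet> g x \<partial>M)" for n
    using sq_int_inner[OF Fn Gn] sq_int_inner[OF f g] sq_int_inner[OF Fn g] sq_int_inner[OF f Gn] sq_int_inner[OF Gn f]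
    by (simp add: inner_diff_left inner_diff_right inner_commute[of "f _" "G _ _"])
  moreover have "(\<lambda>n. (\<integral>x. (F n x - f x) \<bullet> (G n x - g x) \<partial>M) + (\<integral>x. F n x \<bullet> g x \<partial>M)
      + (\<integral>x. G n x \<bullet> f x \<partial>M) - (\<integral>x. f x \<bullet> g x \<partial>M)) \<longlonglongrightarrow> 0 + (\<integral>x. f x \<bullet> g x \<partial>M) + (\<integral>x. g x \<bullet> f x \<partial>M) - (\<integral>x. f x \<bullet> g x \<partial>M)"
    by (intro tendsto_intros 1 L2_lim_inner_const[OF F g] L2_lim_inner_const[OF G f])
  ultimately show ?thesis by (simp add: inner_commute)
qed

lemma L2_lim_norm:
  assumes F: "L2_lim M F f"
  shows "(\<lambda>n. \<integral>x. (norm (F n x))\<^sup>2 \<partial>M) \<longlonglongrightarrow> (\<integral>x. (norm (f x))\<^sup>2 \<partial>M)"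
  using L2_lim_inner[OF F F] by (simp add: power2_norm_eq_inner)

lemma L2_lim_AE_subseq:
  assumes F: "L2_lim M F f"
  obtains r where "strict_mono r" "AE x in M. (\<lambda>n. F (r n) x) \<longlonglongrightarrow> f x"
proof -
  have "integrable M (\<lambda>x. (norm (F n x - f x))\<^sup>2)" for n
    using sq_int_diff[OF L2_limD(1,2)[OF F]] by (auto simp: sq_int_def)
  then have "\<exists>r. strict_mono r \<and> (AE x in M. (\<lambda>n. (norm (F (r n) x - f x))\<^sup>2) \<longlonglongrightarrow> 0)"
    using L2_limD(3)[OF F] by (intro tendsto_L1_AE_subseq) auto
  then obtain r where r: "strict_mono r" "AE x in M. (\<lambda>n. (norm (F (r n) x - f x))\<^sup>2) \<longlonglongrightarrow> 0" by blast
  have "AE x in M. (\<lambda>n. F (r n) x) \<longlonglongrightarrow> f x"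
    using r(2)
  proof eventually_elim
    case (elim x)
    have "(\<lambda>n. sqrt ((norm (F (r n) x - f x))\<^sup>2)) \<longlonglongrightarrow> sqrt 0" by (intro tendsto_real_sqrt elim)
    then show ?case by (simp add: tendsto_norm_zero_iff LIM_zero_iff)
  qed
  with r(1) that show ?thesis by blast
qed

lemma L2_lim_dominated:
  fixes F :: "nat \<Rightarrow> 'a \<Rightarrow> 'b::euclidean_space"
  assumes [measurable]: "\<And>n. F n \<in> borel_measurable M" "f \<in> borel_measurable M"
    and w: "sq_int M (w :: 'a \<Rightarrow> real)" and b: "\<And>n. AE x in M. norm (F n x) \<le> w x"
    and l: "AE x in M. (\<lambda>n. F n x) \<longlonglongrightarrow> f x"
  shows "L2_lim M F f"
proof -
  have [measurable]: "w \<in> borel_measurable M" using w by (simp add: sq_int_def)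
  have w2: "integrable M (\<lambda>x. (w x)\<^sup>2)" using w by (simp add: sq_int_def)
  have bf: "AE x in M. norm (f x) \<le> w x"
  proof -
    have "AE x in M. \<forall>n. norm (F n x) \<le> w x" using b by (simp add: AE_all_countable)
    then show ?thesis using l
    proof eventually_elim
      case (elim x) then show ?case using tendsto_norm LIMSEQ_le_const2 by blast
    qed
  qed
  have s: "sq_int M h" if [measurable]: "h \<in> borel_measurable M" and "AE x in M. norm (h x) \<le> w x" for h :: "'a \<Rightarrow> 'b"
  proof -
    have "AE x in M. norm ((norm (h x))\<^sup>2) \<le> norm ((w x)\<^sup>2)" using that(2)
      by eventually_elim (simp add: power_mono)
    then have "integrable M (\<lambda>x. (norm (h x))\<^sup>2)"
      by (intro Bochner_Integration.integrable_bound[OF w2]) measurable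
    then show ?thesis by (simp add: sq_int_def)
  qed
  have "(\<lambda>n. \<integral>x. (norm (F n x - f x))\<^sup>2 \<partial>M) \<longlonglongrightarrow> (\<integral>x. 0 \<partial>M)"
  proof (rule integral_dominated_convergence)
    show "integrable M (\<lambda>x. 4 * (w x)\<^sup>2)" using w2 by simp
    show "AE x in M. (\<lambda>n. (norm (F n x - f x))\<^sup>2) \<longlonglongrightarrow> 0" using l
    proof eventually_elim
      case (elim x)
      then have "(\<lambda>n. norm (F n x - f x)) \<longlonglongrightarrow> 0" by (simp add: LIM_zero tendsto_norm_zero)
      then show ?case using tendsto_power[of _ 0 sequentially 2] by force
    qed
    show "AE x in M. norm ((norm (F n x - f x))\<^sup>2) \<le> 4 * (w x)\<^sup>2" for n
      using b[of n] bf
    proof eventually_elim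
      case (elim x)
      have "norm (F n x - f x) \<le> 2 * w x" using elim norm_triangle_ineq4[of "F n x" "f x"] by linarith
      then have "(norm (F n x - f x))\<^sup>2 \<le> (2 * w x)\<^sup>2" by (intro power_mono) auto
      then show ?case by (simp add: power_mult_distrib)
    qed
  qed measurable
  then show ?thesis
    unfolding L2_lim_def using s[OF assms(1) b] s[OF assms(2) bf] by simp
qed

lemma sq_int_bounded:
  fixes f :: "'a \<Rightarrow> 'b::euclidean_space"
  assumes "finite_measure M" "f \<in> borel_measurable M" "\<And>x. norm (f x) \<le> B"
  shows "sq_int M f"
proof -
  interpret finite_measure M by fact
  have "norm ((norm (f x))\<^sup>2) \<le> B\<^sup>2" for x using assms(3)[of x] by (simp add: power_mono)
  then show ?thesis unfolding sq_int_def using assms(2) by (auto intro!: integrable_const_bound[of _ "B\<^sup>2"])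
qed

subsection \<open>Compactly supported functions\<close>

lemma
  fixes h :: "complex \<Rightarrow> 'b::{banach, second_countable_topology}"
  assumes S: "S \<in> sets lebesgue" and h: "h \<in> borel_measurable borel" and z: "\<And>x. x \<notin> S \<Longrightarrow> h x = 0"
  shows integral_lebesgue_on_lborel: "integral\<^sup>L (lebesgue_on S) h = integral\<^sup>L lborel h"
    and integrable_lebesgue_on_lborel: "integrable (lebesgue_on S) h \<longleftrightarrow> integrable lborel h"
proof -
  have "(\<lambda>x. indicator S x *\<^sub>R h x) = h" using z by (auto simp: fun_eq_iff indicator_def)
  then show "integral\<^sup>L (lebesgue_on S) h = integral\<^sup>L lborel h" "integrable (lebesgue_on S) h \<longleftrightarrow> integrable lborel h"
    using S h by (simp_all add: integral_restrict_space integrable_restrict_space integral_completion integrable_completion)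
qed

lemma gradient_eq: "gradient f x = Complex (pd 1 f x) (pd \<i> f x)"
  by (simp add: gradient_def Basis_complex_def complex_eq_iff)

lemma inner_gradient: "gradient f x \<bullet> gradient g x = pd 1 f x * pd 1 g x + pd \<i> f x * pd \<i> g x"
  by (simp add: gradient_eq inner_complex_def)

lemma norm_gradient: "(norm (gradient f x))\<^sup>2 = (pd 1 f x)\<^sup>2 + (pd \<i> f x)\<^sup>2"
  by (simp add: gradient_eq cmod_power2)

lemma gradient_inner: "f differentiable (at x) \<Longrightarrow> gradient f x \<bullet> e = pd e f x"
proof -
  assume "f differentiable (at x)"
  then have l: "linear (frechet_derivative f (at x))" by (rule linear_frechet_derivative)
  have e: "e = Re e *\<^sub>R 1 + Im e *\<^sub>R \<i>" by (simp add: complex_eq_iff)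
  show ?thesis by (subst (2) e) (simp add: linear_add[OF l] linear_scale[OF l] gradient_eq inner_complex_def)
qed

lemma laplacian_eq: "laplacian f x = pd 1 (pd 1 f) x + pd \<i> (pd \<i> f) x"
  by (simp add: laplacian_def Basis_complex_def)

text \<open>\<open>N = UNIV\<close> gives the test functions; \<open>N = {2}\<close> gives the \<open>C\<^sup>2\<close> functions of compact support, the
  class in which truncations of a classical solution lie.\<close>

definition tfc :: "nat set \<Rightarrow> complex set \<Rightarrow> (complex \<Rightarrow> real) \<Rightarrow> bool" where
  "tfc N \<Omega> \<phi> \<longleftrightarrow> (\<forall>k\<in>N. Ck_on k UNIV \<phi>) \<and> compact (closure {x. \<phi> x \<noteq> 0}) \<and> closure {x. \<phi> x \<noteq> 0} \<subseteq> \<Omega>"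

lemma test_function_tfc: "test_function \<Omega> \<phi> \<longleftrightarrow> tfc UNIV \<Omega> \<phi>"
  by (simp add: test_function_def tfc_def)

lemma tfcI:
  assumes "\<And>k. k \<in> N \<Longrightarrow> Ck_on k UNIV \<phi>" "compact K" "K \<subseteq> \<Omega>" "\<And>x. x \<notin> K \<Longrightarrow> \<phi> x = 0"
  shows "tfc N \<Omega> \<phi>"
proof -
  have "closure {x. \<phi> x \<noteq> 0} \<subseteq> K"
    using assms compact_imp_closed[OF assms(2)] by (intro closure_minimal) auto
  moreover from this have "K \<inter> closure {x. \<phi> x \<noteq> 0} = closure {x. \<phi> x \<noteq> 0}" by blast
  then have "compact (closure {x. \<phi> x \<noteq> 0})"
    using compact_Int_closed[OF assms(2) closed_closure, of "{x. \<phi> x \<noteq> 0}"] by argo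
  ultimately show ?thesis using assms by (auto simp: tfc_def)
qed

lemma tfc_support:
  assumes "tfc N \<Omega> \<phi>" obtains K where "compact K" "K \<subseteq> \<Omega>" "\<And>x. x \<notin> K \<Longrightarrow> \<phi> x = 0"
proof (rule that)
  show "compact (closure {x. \<phi> x \<noteq> 0})" "closure {x. \<phi> x \<noteq> 0} \<subseteq> \<Omega>"
    using assms by (auto simp: tfc_def)
  show "\<phi> x = 0" if "x \<notin> closure {x. \<phi> x \<noteq> 0}" for x
    using that closure_subset[of "{x. \<phi> x \<noteq> 0}"] by auto
qed

lemma tfc_Ck: "tfc N \<Omega> \<phi> \<Longrightarrow> n \<in> N \<Longrightarrow> k \<le> n \<Longrightarrow> Ck_on k UNIV \<phi>"
  using Ck_on_le[of UNIV n \<phi> k] by (auto simp: tfc_def)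

lemma tfc_mono: "tfc N \<Omega> \<phi> \<Longrightarrow> N' \<subseteq> N \<Longrightarrow> tfc N' \<Omega> \<phi>"
  by (auto simp: tfc_def)

lemma tfc_compose:
  assumes "\<And>k. Ck_on k UNIV F" "F 0 = 0" "tfc N \<Omega> \<phi>"
  shows "tfc N \<Omega> (\<lambda>x. F (\<phi> x))"
proof -
  obtain K where "compact K" "K \<subseteq> \<Omega>" "\<And>x. x \<notin> K \<Longrightarrow> \<phi> x = 0" using tfc_support[OF assms(3)] by blast
  moreover have "Ck_on k UNIV (\<lambda>x. F (\<phi> x))" if "k \<in> N" for k
    by (rule Ck_on_compose[of _ UNIV]) (use assms that in \<open>auto simp: tfc_def\<close>)
  ultimately show ?thesis using assms(2) by (intro tfcI[of N _ K]) auto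
qed

lemma tfc_add_cmult:
  assumes "tfc N \<Omega> \<phi>" "tfc N \<Omega> \<psi>"
  shows "tfc N \<Omega> (\<lambda>x. \<phi> x + c * \<psi> x)"
proof -
  obtain K where K: "compact K" "K \<subseteq> \<Omega>" "\<And>x. x \<notin> K \<Longrightarrow> \<phi> x = 0" using tfc_support[OF assms(1)] by blast
  obtain L where L: "compact L" "L \<subseteq> \<Omega>" "\<And>x. x \<notin> L \<Longrightarrow> \<psi> x = 0" using tfc_support[OF assms(2)] by blast
  show ?thesis using assms K L
    by (intro tfcI[of N _ "K \<union> L"] Ck_on_add Ck_on_cmult) (auto simp: tfc_def)
qed

lemma tfc_diff: "tfc N \<Omega> \<phi> \<Longrightarrow> tfc N \<Omega> \<psi> \<Longrightarrow> tfc N \<Omega> (\<lambda>x. \<phi> x - \<psi> x)"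
  using tfc_add_cmult[of N \<Omega> \<phi> \<psi> "-1"] by simp

lemma compact_bounded_norm:
  assumes "compact (K::complex set)" shows "\<exists>R. \<forall>x. R < norm x \<longrightarrow> x \<notin> K"
proof -
  obtain R where "\<forall>x\<in>K. norm x \<le> R" using compact_imp_bounded[OF assms] by (auto simp: bounded_iff)
  then show ?thesis by (intro exI[of _ R]) auto
qed

lemma tfc_C1c:
  assumes "tfc N \<Omega> \<phi>" "n \<in> N" "1 \<le> n" shows "C1c \<phi>"
proof -
  obtain K where K: "compact K" "K \<subseteq> \<Omega>" "\<And>x. x \<notin> K \<Longrightarrow> \<phi> x = 0" using tfc_support[OF assms(1)] by blast
  obtain R where "\<forall>x. R < norm x \<longrightarrow> x \<notin> K" using compact_bounded_norm[OF K(1)] by blast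
  then show ?thesis unfolding C1c_def using tfc_Ck[OF assms] K(3) by blast
qed

lemma pd_zero_open:
  assumes "open S" "x \<in> S" "\<And>y. y \<in> S \<Longrightarrow> f y = 0"
  shows "pd b f x = 0"
  by (rule pd_eqI[where f'="\<lambda>h. 0"], rule has_derivative_transform_within_open[of "\<lambda>x. 0" _ _ _ S]) (use assms in auto)

lemma pd_zero_outside:
  assumes "compact K" "\<And>x. x \<notin> K \<Longrightarrow> \<phi> x = 0" "x \<notin> K" shows "pd b \<phi> x = 0"
  by (rule pd_zero_open[of "- K"]) (use assms compact_imp_closed in auto)

lemma tfc_pd:
  assumes "tfc N \<Omega> \<phi>" "Suc n \<in> N" "b \<in> Basis" shows "tfc {n} \<Omega> (pd b \<phi>)"
proof -
  obtain K where K: "compact K" "K \<subseteq> \<Omega>" "\<And>x. x \<notin> K \<Longrightarrow> \<phi> x = 0" using tfc_support[OF assms(1)] by blast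
  have "Ck_on (Suc n) UNIV \<phi>" using assms by (auto simp: tfc_def)
  then have "Ck_on n UNIV (pd b \<phi>)" using assms(3) by (simp add: Ck_on_Suc_open)
  then show ?thesis using K pd_zero_outside[OF K(1,3)] by (intro tfcI[of _ _ K]) auto
qed

lemma tfc_bounded:
  assumes "tfc {n} \<Omega> \<phi>" obtains B where "\<And>x. \<bar>\<phi> x\<bar> \<le> B" "0 \<le> B"
proof -
  obtain K where K: "compact K" "K \<subseteq> \<Omega>" "\<And>x. x \<notin> K \<Longrightarrow> \<phi> x = 0" using tfc_support[OF assms(1)] by blast
  have "Ck_on 0 UNIV \<phi>" using tfc_Ck[OF assms, of n 0] by simp
  then have "continuous_on K \<phi>" using continuous_on_subset by fastforce
  then have "bounded (\<phi> ` K)" using K(1) compact_continuous_image compact_imp_bounded by blast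
  then obtain B where B: "\<forall>x\<in>K. \<bar>\<phi> x\<bar> \<le> B" by (auto simp: bounded_iff)
  have "\<bar>\<phi> x\<bar> \<le> max B 0" for x using B K(3)[of x] by (cases "x \<in> K") (auto simp: max_def)
  then show ?thesis using that by (metis max.cobounded2)
qed

lemma finite_measure_lebesgue_on:
  assumes "open (\<Omega>::complex set)" "bounded \<Omega>" shows "finite_measure (lebesgue_on \<Omega>)"
  using assms emeasure_bounded_finite[OF assms(2)] by (intro finite_measureI)
    (auto simp: emeasure_restrict_space)

lemma borel_measurable_lebesgue_on: "f \<in> borel_measurable borel \<Longrightarrow> f \<in> borel_measurable (lebesgue_on S)"
  by (intro measurable_restrict_space1 measurable_completion) simp

lemma tfc_borel: "tfc {n} \<Omega> \<phi> \<Longrightarrow> \<phi> \<in> borel_measurable borel"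
  using tfc_Ck[of "{n}" \<Omega> \<phi> n 0] by (auto intro: borel_measurable_continuous_onI)

lemma tfc_sq_int:
  assumes "open \<Omega>" "bounded \<Omega>" "tfc {n} \<Omega> \<phi>" shows "sq_int (lebesgue_on \<Omega>) \<phi>"
proof -
  obtain B where "\<And>x. \<bar>\<phi> x\<bar> \<le> B" using tfc_bounded[OF assms(3)] by blast
  then show ?thesis using assms tfc_borel[OF assms(3)]
    by (intro sq_int_bounded[of _ _ B] finite_measure_lebesgue_on borel_measurable_lebesgue_on) auto
qed

lemma gradient_alt: "gradient \<phi> = (\<lambda>x. pd 1 \<phi> x *\<^sub>R 1 + pd \<i> \<phi> x *\<^sub>R \<i>)"
  by (simp add: fun_eq_iff gradient_eq complex_eq_iff)

lemma sq_int_scaleR_vec: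
  assumes "sq_int M (f :: 'a \<Rightarrow> real)" shows "sq_int M (\<lambda>x. f x *\<^sub>R (v::'b::euclidean_space))"
  using assms unfolding sq_int_def norm_scaleR power_mult_distrib real_norm_def power2_abs by auto

lemma tfc_gradient_sq_int:
  assumes "open \<Omega>" "bounded \<Omega>" "tfc N \<Omega> \<phi>" "Suc n \<in> N" shows "sq_int (lebesgue_on \<Omega>) (gradient \<phi>)"
  unfolding gradient_alt using assms(1,2) tfc_pd[OF assms(3,4)]
  by (intro sq_int_add sq_int_scaleR_vec tfc_sq_int[of _ n]) (auto simp: Basis_complex_def)

lemma integral_pd_on:
  fixes f :: "complex \<Rightarrow> real"
  assumes \<Omega>: "open \<Omega>" and f: "Ck_on 1 \<Omega> f" and K: "compact K" "K \<subseteq> \<Omega>" "\<And>x. x \<in> \<Omega> - K \<Longrightarrow> f x = 0"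
    and b: "b \<in> Basis"
  shows "integrable (lebesgue_on \<Omega>) (pd b f)" "(\<integral>x. pd b f x \<partial>lebesgue_on \<Omega>) = 0"
proof -
  let ?g = "\<lambda>x. if x \<in> \<Omega> then f x else 0"
  have g: "C1c ?g" unfolding C1c_def
    using Ck_on_extend_zero[OF \<Omega> K(1,2) f K(3)] compact_bounded_norm[OF K(1)] K(3) by auto
  have z: "pd b ?g x = 0" if "x \<notin> \<Omega>" for x
    by (rule pd_zero_outside[OF K(1)]) (use K that in auto)
  have m: "pd b ?g \<in> borel_measurable borel" using C1cD(3)[OF g b] by (rule borel_measurable_continuous_onI)
  have e: "pd b f x = pd b ?g x" if "x \<in> \<Omega>" for x
    using f that \<Omega> by (intro pd_cong_open[OF \<Omega> that]) (auto simp: Ck_on_Suc_open)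
  have S: "\<Omega> \<in> sets lebesgue" using \<Omega> by simp
  have "integrable (lebesgue_on \<Omega>) (pd b f) \<longleftrightarrow> integrable (lebesgue_on \<Omega>) (pd b ?g)"
    by (intro Bochner_Integration.integrable_cong) (auto simp: e)
  then show "integrable (lebesgue_on \<Omega>) (pd b f)"
    using integrable_lebesgue_on_lborel[OF S m z] integral_pd(1)[OF g b] by simp
  have "(\<integral>x. pd b f x \<partial>lebesgue_on \<Omega>) = (\<integral>x. pd b ?g x \<partial>lebesgue_on \<Omega>)"
    by (intro Bochner_Integration.integral_cong) (auto simp: e)
  then show "(\<integral>x. pd b f x \<partial>lebesgue_on \<Omega>) = 0"
    using integral_lebesgue_on_lborel[OF S m z] integral_pd(2)[OF g b] by simp
qed

text \<open>\<open>f\<close> is controlled only inside \<Omega> and may be wild at the boundary. Its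
  product with \<phi> has compact support in \<Omega>, hence extends by zero to the plane, where
  derivatives of compactly supported functions integrate to 0.\<close>

lemma integral_by_parts:
  assumes \<Omega>: "open \<Omega>" "bounded \<Omega>" and f: "Ck_on 1 \<Omega> f" and \<phi>: "tfc {1} \<Omega> \<phi>" and b: "b \<in> Basis"
  shows "(\<integral>x. f x * pd b \<phi> x \<partial>lebesgue_on \<Omega>) = - (\<integral>x. pd b f x * \<phi> x \<partial>lebesgue_on \<Omega>)"
    "integrable (lebesgue_on \<Omega>) (\<lambda>x. f x * pd b \<phi> x)" "integrable (lebesgue_on \<Omega>) (\<lambda>x. pd b f x * \<phi> x)"
proof -
  obtain K where K: "compact K" "K \<subseteq> \<Omega>" "\<And>x. x \<notin> K \<Longrightarrow> \<phi> x = 0" using tfc_support[OF \<phi>] by blast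
  have c\<phi>: "Ck_on 1 \<Omega> \<phi>" using \<phi> \<Omega> Ck_on_subset[of UNIV \<Omega> 1 \<phi>] by (auto simp: tfc_def)
  have i: "integrable (lebesgue_on \<Omega>) (pd b (\<lambda>x. f x * \<phi> x))" "(\<integral>x. pd b (\<lambda>x. f x * \<phi> x) x \<partial>lebesgue_on \<Omega>) = 0"
    using integral_pd_on[OF \<Omega>(1) Ck_on_mult[OF \<Omega>(1) f c\<phi>] K(1,2) _ b] K(3) by auto
  have cb: "integrable (lebesgue_on \<Omega>) g" if g: "continuous_on \<Omega> g" "\<And>x. x \<notin> K \<Longrightarrow> g x = 0" for g :: "complex \<Rightarrow> real"
  proof -
    have "integrable lborel (\<lambda>x. indicator K x *\<^sub>R g x)"
      using g K by (intro borel_integrable_compact) (auto intro: continuous_on_subset)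
    moreover have "(\<lambda>x. indicator K x *\<^sub>R g x) = g" using g(2) by (auto simp: fun_eq_iff indicator_def)
    ultimately have "integrable lborel g" by simp
    then show ?thesis using g(2) K(2) \<Omega>(1) borel_measurable_integrable
      by (subst integrable_lebesgue_on_lborel) auto
  qed
  have c: "continuous_on \<Omega> f" "continuous_on \<Omega> (pd b f)" "continuous_on \<Omega> \<phi>" "continuous_on \<Omega> (pd b \<phi>)"
    using f c\<phi> \<Omega> b Ck_on_SucD[of \<Omega> 0] by (auto simp: Ck_on_Suc_open)
  show 1: "integrable (lebesgue_on \<Omega>) (\<lambda>x. f x * pd b \<phi> x)" "integrable (lebesgue_on \<Omega>) (\<lambda>x. pd b f x * \<phi> x)"
    using c K(3) pd_zero_outside[OF K(1,3)] by (auto intro!: cb continuous_intros)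
  have "(\<integral>x. pd b (\<lambda>x. f x * \<phi> x) x \<partial>lebesgue_on \<Omega>) = (\<integral>x. pd b f x * \<phi> x + f x * pd b \<phi> x \<partial>lebesgue_on \<Omega>)"
    using f c\<phi> \<Omega> by (intro Bochner_Integration.integral_cong refl pd_mult) (auto simp: Ck_on_Suc_open)
  then show "(\<integral>x. f x * pd b \<phi> x \<partial>lebesgue_on \<Omega>) = - (\<integral>x. pd b f x * \<phi> x \<partial>lebesgue_on \<Omega>)"
    using i 1 by simp
qed

lemma integral_laplacian_by_parts:
  assumes \<Omega>: "open \<Omega>" "bounded \<Omega>" and f: "Ck_on 1 \<Omega> f" and \<phi>: "tfc {2} \<Omega> \<phi>"
  shows "(\<integral>x. f x * laplacian \<phi> x \<partial>lebesgue_on \<Omega>) = - (\<integral>x. gradient f x \<bullet> gradient \<phi> x \<partial>lebesgue_on \<Omega>)"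
    "integrable (lebesgue_on \<Omega>) (\<lambda>x. f x * laplacian \<phi> x)"
    "integrable (lebesgue_on \<Omega>) (\<lambda>x. gradient f x \<bullet> gradient \<phi> x)"
proof -
  have t: "tfc {1} \<Omega> (pd 1 \<phi>)" "tfc {1} \<Omega> (pd \<i> \<phi>)"
    using \<phi> by (auto intro!: tfc_pd[of "{2}"] simp: Basis_complex_def)
  have B: "1 \<in> (Basis::complex set)" "\<i> \<in> (Basis::complex set)" by (auto simp: Basis_complex_def)
  note p = integral_by_parts[OF \<Omega> f t(1) B(1)] integral_by_parts[OF \<Omega> f t(2) B(2)]
  show "integrable (lebesgue_on \<Omega>) (\<lambda>x. f x * laplacian \<phi> x)"
    "integrable (lebesgue_on \<Omega>) (\<lambda>x. gradient f x \<bullet> gradient \<phi> x)"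
    "(\<integral>x. f x * laplacian \<phi> x \<partial>lebesgue_on \<Omega>) = - (\<integral>x. gradient f x \<bullet> gradient \<phi> x \<partial>lebesgue_on \<Omega>)"
    unfolding laplacian_eq inner_gradient distrib_left
    using p by simp_all
qed

lemma C1c_power: "C1c \<phi> \<Longrightarrow> 1 \<le> k \<Longrightarrow> C1c (\<lambda>x. \<phi> x ^ k)"
  unfolding C1c_def by (auto intro: Ck_on_power)

lemma pd_power:
  fixes \<phi> :: "complex \<Rightarrow> real"
  assumes "\<phi> differentiable (at x)" shows "pd b (\<lambda>x. \<phi> x ^ k) x = k * \<phi> x ^ (k - 1) * pd b \<phi> x"
  by (rule pd_compose_real[of "\<lambda>t. t ^ k" _ \<phi>, OF _ assms]) (auto intro!: derivative_eq_intros)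

text \<open>Applied to \<open>\<phi>\<^sup>k\<close>, the Gagliardo inequality yields Ladyzhenskaya's inequality (\<open>k = 2\<close>) and,
  iterated, exponential integrability.\<close>

lemma gagliardo_power:
  assumes \<Omega>: "open \<Omega>" "bounded \<Omega>" and \<phi>: "tfc {1} \<Omega> \<phi>" and k: "1 \<le> k"
  shows "(\<integral>x. \<phi> x ^ (2 * k) \<partial>lebesgue_on \<Omega>) \<le>
    (real k)\<^sup>2 * (\<integral>x. \<phi> x ^ (2 * (k - 1)) \<partial>lebesgue_on \<Omega>) * (\<integral>x. (norm (gradient \<phi> x))\<^sup>2 \<partial>lebesgue_on \<Omega>)"
proof -
  define M where "M = lebesgue_on \<Omega>"
  define f where "f = (\<lambda>x. \<phi> x ^ k)"
  define D where "D = (\<integral>x. (norm (gradient \<phi> x))\<^sup>2 \<partial>M)"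
  define A where "A = (\<integral>x. \<phi> x ^ (2 * (k - 1)) \<partial>M)"
  have C\<phi>: "C1c \<phi>" using tfc_C1c[OF \<phi>] by simp
  then have C: "C1c f" unfolding f_def using k by (rule C1c_power)
  obtain K where K: "compact K" "K \<subseteq> \<Omega>" "\<And>x. x \<notin> K \<Longrightarrow> \<phi> x = 0" using tfc_support[OF \<phi>] by blast
  have z: "f x = 0" if "x \<notin> K" for x using K(3)[OF that] k by (simp add: f_def)
  have S: "\<Omega> \<in> sets lebesgue" using \<Omega> by simp
  have fin: "finite_measure M" unfolding M_def using \<Omega> by (rule finite_measure_lebesgue_on)
  have sq: "sq_int M (\<lambda>x. \<phi> x ^ (k - 1))"
  proof -
    obtain B where B: "\<And>x. \<bar>\<phi> x\<bar> \<le> B" using tfc_bounded[OF \<phi>] by blast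
    have "norm (\<phi> x ^ (k - 1)) \<le> B ^ (k - 1)" for x using B[of x] by (simp add: power_abs power_mono)
    then show ?thesis using fin tfc_borel[OF \<phi>] by (intro sq_int_bounded) (auto simp: M_def intro!: borel_measurable_lebesgue_on)
  qed
  have "sq_int M (gradient \<phi>)" unfolding M_def using \<Omega> \<phi> by (intro tfc_gradient_sq_int[of _ "{1}" _ 0]) auto
  then have iD: "integrable M (\<lambda>x. (norm (gradient \<phi> x))\<^sup>2)" by (simp add: sq_int_def)
  have A0: "0 \<le> A" by (simp add: A_def power_mult)
  \<comment> \<open>The derivative of the power is
    \<open>k * \<phi> x ^ (k - 1) * pd b \<phi> x\<close>, so Cauchy-Schwarz bounds its L1 norm by k
    sqrt (A D). Multiplying the bounds for the two directions yields the factor k^2 A D.\<close>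
  have P: "integrable lborel (\<lambda>x. \<bar>pd b f x\<bar>) \<and> (\<integral>x. \<bar>pd b f x\<bar> \<partial>lborel) \<le> k * sqrt (A * D)" if b: "b \<in> Basis" for b
  proof
    have m: "pd b f \<in> borel_measurable borel" using C1cD(3)[OF C b] by (rule borel_measurable_continuous_onI)
    show "integrable lborel (\<lambda>x. \<bar>pd b f x\<bar>)" using integral_pd(1)[OF C b] by simp
    have sb: "sq_int M (pd b \<phi>)"
      unfolding M_def using tfc_pd[OF \<phi> _ b, of 0] \<Omega> by (intro tfc_sq_int[of _ 0]) auto
    then have sb': "sq_int M (\<lambda>x. \<bar>pd b \<phi> x\<bar>)" and sq': "sq_int M (\<lambda>x. \<bar>\<phi> x ^ (k - 1)\<bar>)" using sq by (auto simp: sq_int_def)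
    have "(\<integral>x. (pd b \<phi> x)\<^sup>2 \<partial>M) \<le> D"
      unfolding D_def using b iD sb by (intro integral_mono) (auto simp: norm_gradient sq_int_def Basis_complex_def)
    then have "sqrt A * sqrt (\<integral>x. (pd b \<phi> x)\<^sup>2 \<partial>M) \<le> sqrt (A * D)"
      using A0 by (auto simp: real_sqrt_mult intro!: mult_left_mono)
    moreover have "(\<integral>x. \<bar>\<phi> x ^ (k - 1)\<bar> * \<bar>pd b \<phi> x\<bar> \<partial>M) \<le> sqrt A * sqrt (\<integral>x. (pd b \<phi> x)\<^sup>2 \<partial>M)"
      using cauchy_schwarz_integral_real[OF sq' sb'] by (simp add: A_def power_even_abs power_mult[symmetric] mult.commute)
    ultimately have 1: "(\<integral>x. \<bar>\<phi> x ^ (k - 1)\<bar> * \<bar>pd b \<phi> x\<bar> \<partial>M) \<le> sqrt (A * D)" by linarith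
    have pf: "pd b f x = k * \<phi> x ^ (k - 1) * pd b \<phi> x" for x
      unfolding f_def by (rule pd_power[OF C1cD(1)[OF C\<phi>]])
    have "(\<integral>x. \<bar>pd b f x\<bar> \<partial>lborel) = (\<integral>x. \<bar>pd b f x\<bar> \<partial>M)"
      unfolding M_def by (rule integral_lebesgue_on_lborel[OF S, symmetric])
        (use m pd_zero_outside[where \<phi>=f, OF K(1) z] K(2) in auto)
    also have "\<dots> = (\<integral>x. k * (\<bar>\<phi> x ^ (k - 1)\<bar> * \<bar>pd b \<phi> x\<bar>) \<partial>M)"
      by (simp add: pf abs_mult mult.assoc)
    also have "\<dots> = k * (\<integral>x. \<bar>\<phi> x ^ (k - 1)\<bar> * \<bar>pd b \<phi> x\<bar> \<partial>M)" by simp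
    also have "\<dots> \<le> k * sqrt (A * D)" using 1 by (intro mult_left_mono) auto
    finally show "(\<integral>x. \<bar>pd b f x\<bar> \<partial>lborel) \<le> k * sqrt (A * D)" .
  qed
  have P1: "integrable lborel (\<lambda>x. \<bar>pd 1 f x\<bar>)" "(\<integral>x. \<bar>pd 1 f x\<bar> \<partial>lborel) \<le> k * sqrt (A * D)"
    and P2: "integrable lborel (\<lambda>x. \<bar>pd \<i> f x\<bar>)" "(\<integral>x. \<bar>pd \<i> f x\<bar> \<partial>lborel) \<le> k * sqrt (A * D)"
    using P[of 1] P[of \<i>] by (auto simp: Basis_complex_def)
  have m: "f \<in> borel_measurable borel" using C1cD(2)[OF C] by (rule borel_measurable_continuous_onI)
  have i2: "integrable lborel (\<lambda>x. (f x)\<^sup>2)"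
  proof -
    obtain R where "\<And>x. R < norm x \<Longrightarrow> f x = 0" using C1cD(4)[OF C] by blast
    then show ?thesis using C1cD(2)[OF C] by (intro integrable_continuous_compact_support[of _ R]) (auto intro: continuous_intros)
  qed
  have "(\<integral>\<^sup>+z. ennreal ((f z)\<^sup>2) \<partial>lborel) = ennreal (\<integral>z. (f z)\<^sup>2 \<partial>lborel)"
    by (rule nn_integral_eq_integral[OF i2]) auto
  moreover have "(\<integral>\<^sup>+z. ennreal \<bar>pd 1 f z\<bar> \<partial>lborel) = ennreal (\<integral>x. \<bar>pd 1 f x\<bar> \<partial>lborel)"
      "(\<integral>\<^sup>+z. ennreal \<bar>pd \<i> f z\<bar> \<partial>lborel) = ennreal (\<integral>x. \<bar>pd \<i> f x\<bar> \<partial>lborel)"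
    using P1 P2 by (auto intro!: nn_integral_eq_integral)
  ultimately have "(\<integral>z. (f z)\<^sup>2 \<partial>lborel) \<le> (\<integral>x. \<bar>pd 1 f x\<bar> \<partial>lborel) * (\<integral>x. \<bar>pd \<i> f x\<bar> \<partial>lborel)"
    using gagliardo[OF C] by (simp add: ennreal_mult[symmetric])
  also have "\<dots> \<le> (k * sqrt (A * D)) * (k * sqrt (A * D))"
    using P1 P2 A0 by (intro mult_mono) (auto simp: D_def)
  also have "\<dots> = (real k)\<^sup>2 * A * D" using A0 by (simp add: power2_eq_square D_def)
  finally have "(\<integral>z. (f z)\<^sup>2 \<partial>lborel) \<le> (real k)\<^sup>2 * A * D" .
  moreover have "(\<integral>z. (f z)\<^sup>2 \<partial>lborel) = (\<integral>z. (f z)\<^sup>2 \<partial>M)" unfolding M_def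
    by (rule integral_lebesgue_on_lborel[OF S, symmetric]) (use m z K(2) in auto)
  ultimately show ?thesis by (simp add: f_def A_def D_def M_def power_mult[symmetric] mult.commute)
qed

text \<open>With s = x \<bullet> e - c, whose derivative along e is 1, the integral of the
  derivative of \<phi>^2 s along e vanishes. Thus the integral of \<phi>^2 equals minus twice that
  of \<phi> s times the derivative of \<phi>; by Cauchy-Schwarz and |s| \<le> h, the L2 norm of
  \<phi> is at most 2 h times that of its gradient.\<close>

lemma poincare_strip:
  assumes \<Omega>: "open \<Omega>" "bounded \<Omega>" and \<phi>: "tfc {1} \<Omega> \<phi>"
    and e: "norm e = 1" and h: "\<And>x. x \<in> \<Omega> \<Longrightarrow> \<bar>x \<bullet> e - c\<bar> \<le> h" "0 \<le> h"
  shows "(\<integral>x. (\<phi> x)\<^sup>2 \<partial>lebesgue_on \<Omega>) \<le> 4 * h\<^sup>2 * (\<integral>x. (norm (gradient \<phi> x))\<^sup>2 \<partial>lebesgue_on \<Omega>)"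
proof -
  define M where "M = lebesgue_on \<Omega>"
  define s where "s x = x \<bullet> e - c" for x :: complex
  define A D where "A = (\<integral>x. (\<phi> x)\<^sup>2 \<partial>M)" and "D = (\<integral>x. (norm (gradient \<phi> x))\<^sup>2 \<partial>M)"
  have C\<phi>: "C1c \<phi>" using tfc_C1c[OF \<phi>] by simp
  have cs: "Ck_on 1 UNIV s" unfolding s_def
    using Ck_on_add[OF _ Ck_on_bounded_linear[OF _ bounded_linear_inner_left] Ck_on_const[of UNIV 1 "-c"]] by simp
  obtain K where K: "compact K" "K \<subseteq> \<Omega>" "\<And>x. x \<notin> K \<Longrightarrow> \<phi> x = 0" using tfc_support[OF \<phi>] by blast
  let ?f = "\<lambda>x. (\<phi> x)\<^sup>2 * s x"
  have Cf: "Ck_on 1 UNIV ?f" using C\<phi> cs by (auto simp: C1c_def intro!: Ck_on_mult Ck_on_power)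
  have d: "\<phi> differentiable (at x)" "s differentiable (at x)" "?f differentiable (at x)" for x
    using C\<phi> cs Cf by (auto simp: Ck_on_Suc_open C1c_def)
  have i: "integrable M (pd b ?f)" "(\<integral>x. pd b ?f x \<partial>M) = 0" if "b \<in> Basis" for b
    unfolding M_def using integral_pd_on[OF \<Omega>(1) Ck_on_subset[OF _ \<Omega>(1) _ Cf] K(1,2) _ that] K(3) by auto
  have pde: "pd v g x = Re v * pd 1 g x + Im v * pd \<i> g x" if "g differentiable (at x)" for g :: "complex \<Rightarrow> real" and x v
    using gradient_inner[OF that, of v] by (simp add: gradient_eq inner_complex_def mult.commute)
  have ie: "integrable M (pd e ?f)" "(\<integral>x. pd e ?f x \<partial>M) = 0"
  proof -
    have "pd e ?f = (\<lambda>x. Re e * pd 1 ?f x + Im e * pd \<i> ?f x)" by (rule ext, rule pde[OF d(3)])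
    then show "integrable M (pd e ?f)" "(\<integral>x. pd e ?f x \<partial>M) = 0"
      using i[of 1] i[of \<i>] by (simp_all add: Basis_complex_def)
  qed
  have sD: "(s has_derivative (\<lambda>h. h \<bullet> e)) (at x)" for x unfolding s_def by (auto intro!: derivative_eq_intros)
  then have pds: "pd e s x = 1" for x using pd_eqI[OF sD, of x e] e by (simp add: dot_square_norm)
  have "pd e ?f x = pd e (\<lambda>x. (\<phi> x)\<^sup>2) x * s x + (\<phi> x)\<^sup>2 * pd e s x" for x
    by (rule pd_mult[of "\<lambda>x. (\<phi> x)\<^sup>2"]) (use C\<phi> d in \<open>auto intro: differentiable_power\<close>)
  then have eq: "pd e ?f x = 2 * (\<phi> x * s x) * pd e \<phi> x + (\<phi> x)\<^sup>2" for x
    using pd_power[where b=e and k=2 and x=x and \<phi>=\<phi>] d(1) pds by simp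
  have sq\<phi>: "sq_int M \<phi>" unfolding M_def using \<Omega> \<phi> by (rule tfc_sq_int)
  have sqg: "sq_int M (gradient \<phi>)" unfolding M_def using \<Omega> \<phi> by (intro tfc_gradient_sq_int[of _ "{1}" _ 0]) auto
  have mM: "s \<in> borel_measurable M" unfolding M_def s_def by (intro borel_measurable_lebesgue_on) measurable
  have ms[measurable]: "pd e \<phi> \<in> borel_measurable M" "\<phi> \<in> borel_measurable M"
    using sqg sq\<phi> by (auto simp: sq_int_def gradient_inner[OF d(1), symmetric])
  have le: "\<bar>pd e \<phi> x\<bar> \<le> norm (gradient \<phi> x)" for x
    using Cauchy_Schwarz_ineq2[of "gradient \<phi> x" e] e by (simp add: gradient_inner[OF d(1)])
  have sqe: "sq_int M (pd e \<phi>)" and De: "(\<integral>x. (pd e \<phi> x)\<^sup>2 \<partial>M) \<le> D"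
  proof -
    have l2: "(pd e \<phi> x)\<^sup>2 \<le> (norm (gradient \<phi> x))\<^sup>2" for x using le[of x] by (simp add: abs_le_square_iff[symmetric])
    show "sq_int M (pd e \<phi>)" unfolding sq_int_def
      using sqg l2 by (auto simp: sq_int_def intro: Bochner_Integration.integrable_bound)
    then show "(\<integral>x. (pd e \<phi> x)\<^sup>2 \<partial>M) \<le> D" unfolding D_def using l2 sqg by (intro integral_mono) (auto simp: sq_int_def)
  qed
  have sps: "sq_int M (\<lambda>x. \<phi> x * s x)" and Ds: "(\<integral>x. (\<phi> x * s x)\<^sup>2 \<partial>M) \<le> h\<^sup>2 * A"
  proof -
    have l2: "(\<phi> x * s x)\<^sup>2 \<le> h\<^sup>2 * (\<phi> x)\<^sup>2" if "x \<in> \<Omega>" for x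
    proof -
      have "\<bar>s x\<bar>\<^sup>2 \<le> h\<^sup>2" using h(1)[OF that] by (intro power_mono) (auto simp: s_def)
      then have "(\<phi> x)\<^sup>2 * (s x)\<^sup>2 \<le> (\<phi> x)\<^sup>2 * h\<^sup>2" by (intro mult_left_mono) auto
      then show ?thesis by (simp add: power_mult_distrib mult.commute)
    qed
    have i: "integrable M (\<lambda>x. h\<^sup>2 * (\<phi> x)\<^sup>2)" using sq\<phi> by (simp add: sq_int_def)
    have mf: "(\<lambda>x. (\<phi> x * s x)\<^sup>2) \<in> borel_measurable M" using mM ms(2) by simp
    have "integrable M (\<lambda>x. (\<phi> x * s x)\<^sup>2)"
      by (rule Bochner_Integration.integrable_bound[OF i]) (use l2 mf in \<open>auto simp: M_def intro!: AE_I2\<close>)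
    then show "sq_int M (\<lambda>x. \<phi> x * s x)" using mM by (simp add: sq_int_def)
    have "(\<integral>x. (\<phi> x * s x)\<^sup>2 \<partial>M) \<le> (\<integral>x. h\<^sup>2 * (\<phi> x)\<^sup>2 \<partial>M)"
      using \<open>integrable M (\<lambda>x. (\<phi> x * s x)\<^sup>2)\<close> i l2 by (intro integral_mono) (auto simp: M_def)
    then show "(\<integral>x. (\<phi> x * s x)\<^sup>2 \<partial>M) \<le> h\<^sup>2 * A" by (simp add: A_def)
  qed
  have iA: "integrable M (\<lambda>x. (\<phi> x)\<^sup>2)" using sq\<phi> by (simp add: sq_int_def)
  have "0 = 2 * (\<integral>x. (\<phi> x * s x) * pd e \<phi> x \<partial>M) + A"
    using ie iA sq_int_mult[OF sps sqe] by (simp add: eq A_def mult.assoc)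
  then have "A \<le> 2 * \<bar>\<integral>x. (\<phi> x * s x) * pd e \<phi> x \<partial>M\<bar>" by linarith
  also have "\<dots> \<le> 2 * (sqrt (h\<^sup>2 * A) * sqrt D)"
    using cauchy_schwarz_integral_real[OF sps sqe] Ds De
    by (intro mult_left_mono order_trans[OF cauchy_schwarz_integral_real[OF sps sqe]] mult_mono) (auto simp: A_def)
  finally have "A \<le> 2 * h * sqrt A * sqrt D" using h(2) by (simp add: real_sqrt_mult)
  then have "sqrt A * sqrt A \<le> (2 * h * sqrt D) * sqrt A" by (simp add: A_def mult_ac)
  then have "sqrt A \<le> 2 * h * sqrt D"
  proof (cases "0 < sqrt A")
    case True
    then show ?thesis using \<open>sqrt A * sqrt A \<le> _\<close> mult_right_le_imp_le by blast
  next
    case False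
    moreover have "0 \<le> 2 * h * sqrt D" using h(2) by (auto simp: D_def)
    ultimately show ?thesis by linarith
  qed
  then have "(sqrt A)\<^sup>2 \<le> (2 * h * sqrt D)\<^sup>2" by (intro power_mono) (auto simp: A_def)
  then show ?thesis by (simp add: power_mult_distrib A_def D_def M_def)
qed

subsection \<open>The energy closure of the compactly supported functions\<close>

text \<open>For limits not yet known to be integrable: integrability belongs to the conclusion. The
  bounds \<open>C n\<close> may vary with n, so that products of convergent norms can serve as
  bounds.\<close>

lemma fatou_integral:
  fixes f :: "'a \<Rightarrow> real"
  assumes F: "\<And>n. integrable M (F n)" "\<And>n x. 0 \<le> F n x" and f[measurable]: "f \<in> borel_measurable M"
    and l: "AE x in M. (\<lambda>n. F n x) \<longlonglongrightarrow> f x"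
    and b: "\<And>n. (\<integral>x. F n x \<partial>M) \<le> C n" "C \<longlonglongrightarrow> c"
  shows "integrable M f" "(\<integral>x. f x \<partial>M) \<le> c"
proof -
  have pos: "AE x in M. 0 \<le> f x" using l
  proof eventually_elim
    case (elim x) then show ?case by (rule LIMSEQ_le_const) (use F(2) in auto)
  qed
  have c0: "0 \<le> c"
  proof (rule LIMSEQ_le_const[OF b(2)])
    have "0 \<le> C n" for n using order_trans[OF Bochner_Integration.integral_nonneg b(1)] F(2) by blast
    then show "\<exists>N. \<forall>n\<ge>N. 0 \<le> C n" by blast
  qed
  have [measurable]: "F n \<in> borel_measurable M" for n using F(1) by auto
  have "(\<integral>\<^sup>+x. ennreal (f x) \<partial>M) = (\<integral>\<^sup>+x. liminf (\<lambda>n. ennreal (F n x)) \<partial>M)"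
  proof (rule nn_integral_cong_AE)
    show "AE x in M. ennreal (f x) = liminf (\<lambda>n. ennreal (F n x))" using l
    proof eventually_elim
      case (elim x)
      then have "(\<lambda>n. ennreal (F n x)) \<longlonglongrightarrow> ennreal (f x)" by (rule tendsto_ennrealI)
      then show ?case using lim_imp_Liminf by (metis sequentially_bot)
    qed
  qed
  also have "\<dots> \<le> liminf (\<lambda>n. \<integral>\<^sup>+x. ennreal (F n x) \<partial>M)" by (rule nn_integral_liminf) auto
  also have "\<dots> \<le> liminf (\<lambda>n. ennreal (C n))"
    using F b(1) by (intro Liminf_mono always_eventually allI) (simp add: nn_integral_eq_integral ennreal_leI)
  also have "\<dots> = ennreal c" using b(2) by (intro lim_imp_Liminf tendsto_ennrealI) auto
  finally have le: "(\<integral>\<^sup>+x. ennreal (f x) \<partial>M) \<le> ennreal c" .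
  then show i: "integrable M f"
    using pos by (intro integrableI_nonneg) (auto simp: less_top[symmetric] top_unique)
  then have "(\<integral>\<^sup>+x. ennreal (f x) \<partial>M) = ennreal (\<integral>x. f x \<partial>M)" using pos by (rule nn_integral_eq_integral)
  then show "(\<integral>x. f x \<partial>M) \<le> c" using le c0 by simp
qed

text \<open>The closure of the compactly supported functions of class \<open>N\<close> in the H1
  norm, with \<open>g\<close> the L2 limit of the gradients. Weak solutions lie in it for
  \<open>N = UNIV\<close>, classical solutions for \<open>N = {2}\<close>.\<close>

definition Hc :: "nat set \<Rightarrow> complex set \<Rightarrow> (complex \<Rightarrow> real) \<Rightarrow> (complex \<Rightarrow> complex) \<Rightarrow> bool" where
  "Hc N \<Omega> u g \<longleftrightarrow> (\<exists>\<phi>. (\<forall>n. tfc N \<Omega> (\<phi> n)) \<and>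
     L2_lim (lebesgue_on \<Omega>) \<phi> u \<and> L2_lim (lebesgue_on \<Omega>) (\<lambda>n. gradient (\<phi> n)) g)"

lemma Hc_sq_int: "Hc N \<Omega> u g \<Longrightarrow> sq_int (lebesgue_on \<Omega>) u" "Hc N \<Omega> u g \<Longrightarrow> sq_int (lebesgue_on \<Omega>) g"
  by (auto simp: Hc_def dest: L2_limD)

lemma Hc_AE_seq:
  assumes "Hc N \<Omega> u g"
  obtains \<phi> where "\<And>n. tfc N \<Omega> (\<phi> n)" "L2_lim (lebesgue_on \<Omega>) \<phi> u"
    "L2_lim (lebesgue_on \<Omega>) (\<lambda>n. gradient (\<phi> n)) g" "AE x in lebesgue_on \<Omega>. (\<lambda>n. \<phi> n x) \<longlonglongrightarrow> u x"
proof -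
  obtain \<phi> where \<phi>: "\<And>n. tfc N \<Omega> (\<phi> n)" "L2_lim (lebesgue_on \<Omega>) \<phi> u"
    "L2_lim (lebesgue_on \<Omega>) (\<lambda>n. gradient (\<phi> n)) g" using assms by (auto simp: Hc_def)
  obtain r where r: "strict_mono r" "AE x in lebesgue_on \<Omega>. (\<lambda>n. \<phi> (r n) x) \<longlonglongrightarrow> u x"
    using L2_lim_AE_subseq[OF \<phi>(2)] by blast
  show thesis
    by (rule that[of "\<lambda>n. \<phi> (r n)"]) (use \<phi> r L2_lim_subseq in auto)
qed

lemma gradient_diff:
  assumes "f differentiable (at x)" "g differentiable (at x)"
  shows "gradient (\<lambda>x. f x - g x) x = gradient f x - gradient g x"
proof -
  have "pd b (\<lambda>x. f x - g x) x = pd b f x - pd b g x" for b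
    using assms by (intro pd_eqI[of _ "\<lambda>b. pd b f x - pd b g x"] has_derivative_diff) (simp_all add: frechet_derivative_works)
  then show ?thesis by (simp add: gradient_eq complex_eq_iff)
qed

lemma gradient_compose_real:
  assumes "(F has_real_derivative F') (at (f x))" "f differentiable at x"
  shows "gradient (\<lambda>x. F (f x)) x = F' *\<^sub>R gradient f x"
  using pd_compose_real[OF assms] by (simp add: gradient_eq complex_eq_iff)

lemma tfc_differentiable: "tfc N \<Omega> \<phi> \<Longrightarrow> n \<in> N \<Longrightarrow> 1 \<le> n \<Longrightarrow> \<phi> differentiable (at x)"
  using tfc_C1c C1cD(1) by blast

lemma L2_lim_lipschitz:
  assumes G: "L2_lim M G g" and m: "\<And>n. F n \<in> borel_measurable M" and f: "sq_int M f"
    and b: "\<And>n x. norm (F n x - f x) \<le> c * norm (G n x - g x)"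
  shows "L2_lim M F f"
proof -
  have [measurable]: "f \<in> borel_measurable M" using f by (simp add: sq_int_def)
  note [measurable] = m
  have b2: "(norm (F n x - f x))\<^sup>2 \<le> c\<^sup>2 * (norm (G n x - g x))\<^sup>2" for n x
    using power_mono[OF b[of n x] norm_ge_zero, of 2] by (simp add: power_mult_distrib)
  have i: "integrable M (\<lambda>x. c\<^sup>2 * (norm (G n x - g x))\<^sup>2)" for n
    using sq_int_diff[OF L2_limD(1,2)[OF G]] by (auto simp: sq_int_def)
  have s: "sq_int M (\<lambda>x. F n x - f x)" for n
    unfolding sq_int_def using Bochner_Integration.integrable_bound[OF i, of "\<lambda>x. (norm (F n x - f x))\<^sup>2" n] b2[of n] by auto
  show ?thesis
  proof (rule L2_lim_bound)
    show "sq_int M (F n)" for n using sq_int_add[OF s[of n] f] by simp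
    show "(\<integral>x. (norm (F n x - f x))\<^sup>2 \<partial>M) \<le> c\<^sup>2 * (\<integral>x. (norm (G n x - g x))\<^sup>2 \<partial>M)" for n
      using integral_mono[OF _ i[of n], of "\<lambda>x. (norm (F n x - f x))\<^sup>2"] s[of n] b2[of n] by (simp add: sq_int_def)
    show "(\<lambda>n. c\<^sup>2 * (\<integral>x. (norm (G n x - g x))\<^sup>2 \<partial>M)) \<longlonglongrightarrow> 0"
      using L2_limD(3)[OF G] by (rule tendsto_mult_right_zero)
  qed fact
qed

lemma sq_int_dominated:
  assumes "sq_int M g" "f \<in> borel_measurable M" "\<And>x. norm (f x) \<le> c * norm (g x)"
  shows "sq_int M f"
proof -
  have "(norm (f x))\<^sup>2 \<le> c\<^sup>2 * (norm (g x))\<^sup>2" for x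
    using power_mono[OF assms(3)[of x] norm_ge_zero, of 2] by (simp add: power_mult_distrib)
  moreover have "integrable M (\<lambda>x. c\<^sup>2 * (norm (g x))\<^sup>2)" using assms(1) by (simp add: sq_int_def)
  ultimately show ?thesis unfolding sq_int_def using assms(2)
    by (auto intro: Bochner_Integration.integrable_bound[where f="\<lambda>x. c\<^sup>2 * (norm (g x))\<^sup>2"])
qed

section \<open>Chain rule and inequalities in the energy closure\<close>

context
  fixes \<Omega> :: "complex set" and N :: "nat set"
  assumes \<Omega>: "open \<Omega>" "bounded \<Omega>" and N: "2 \<in> N"
begin

lemma Hc_diff:
  assumes "Hc N \<Omega> u g" "Hc N \<Omega> v h" shows "Hc N \<Omega> (\<lambda>x. u x - v x) (\<lambda>x. g x - h x)"
proof -
  obtain \<phi> \<psi> where p: "\<And>n. tfc N \<Omega> (\<phi> n)" "L2_lim (lebesgue_on \<Omega>) \<phi> u"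
      "L2_lim (lebesgue_on \<Omega>) (\<lambda>n. gradient (\<phi> n)) g"
    "\<And>n. tfc N \<Omega> (\<psi> n)" "L2_lim (lebesgue_on \<Omega>) \<psi> v"
      "L2_lim (lebesgue_on \<Omega>) (\<lambda>n. gradient (\<psi> n)) h" using assms unfolding Hc_def by blast
  have "gradient (\<lambda>x. \<phi> n x - \<psi> n x) = (\<lambda>x. gradient (\<phi> n) x - gradient (\<psi> n) x)" for n
    using tfc_differentiable[OF p(1) N] tfc_differentiable[OF p(4) N] by (auto simp: gradient_diff)
  then show ?thesis unfolding Hc_def using p
    by (intro exI[of _ "\<lambda>n x. \<phi> n x - \<psi> n x"]) (auto intro!: L2_lim_diff tfc_diff)
qed

text \<open>Along approximants \<phi> n that converge almost everywhere, the gradient F'(\<phi> n)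
  \<nabla>\<phi> n is split as F'(\<phi> n) (\<nabla>\<phi> n - g) + F'(\<phi> n) g. The first part
  tends to 0 because F' is bounded, the second converges by dominated convergence because F' is
  continuous.\<close>

lemma Hc_compose:
  assumes F: "\<And>k. Ck_on k UNIV F" "F 0 = 0" "\<And>t. (F has_real_derivative F' t) (at t)" "\<And>t. \<bar>F' t\<bar> \<le> B"
    and u: "Hc N \<Omega> u g"
  shows "Hc N \<Omega> (\<lambda>x. F (u x)) (\<lambda>x. F' (u x) *\<^sub>R g x)"
proof -
  let ?M = "lebesgue_on \<Omega>"
  obtain \<phi> where \<phi>: "\<And>n. tfc N \<Omega> (\<phi> n)" "L2_lim ?M \<phi> u"
    "L2_lim ?M (\<lambda>n. gradient (\<phi> n)) g" "AE x in ?M. (\<lambda>n. \<phi> n x) \<longlonglongrightarrow> u x"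
    by (rule Hc_AE_seq[OF u]) blast
  have contF: "continuous_on UNIV F" using F(1)[of 0] by simp
  have eqF': "F' = pd 1 F" using pd_real[OF F(3)] by auto
  have contF': "continuous_on UNIV F'" unfolding eqF' using F(1)[of "Suc 0"] by (simp add: Ck_on_Suc_open)
  have mF: "F \<in> borel_measurable borel" "F' \<in> borel_measurable borel"
    using contF contF' by (auto intro: borel_measurable_continuous_onI)
  have mu: "u \<in> borel_measurable ?M" "g \<in> borel_measurable ?M" and sg: "sq_int ?M g"
    using Hc_sq_int[OF u] by (auto simp: sq_int_def)
  have m\<phi>: "\<phi> n \<in> borel_measurable ?M" "gradient (\<phi> n) \<in> borel_measurable ?M" for n
    using L2_limD(1)[OF \<phi>(2)] L2_limD(1)[OF \<phi>(3)] by (auto simp: sq_int_def)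
  note [measurable] = mF mu m\<phi> measurable_compose[OF mu(1) mF(1)] measurable_compose[OF mu(1) mF(2)]
     measurable_compose[OF m\<phi>(1) mF(1)] measurable_compose[OF m\<phi>(1) mF(2)]
  have lip: "\<bar>F s - F t\<bar> \<le> B * \<bar>s - t\<bar>" for s t
    using field_differentiable_bound[of UNIV F F' B s t] F(3,4) by (auto simp: field_differentiable_def)
  have B0: "0 \<le> B" using F(4)[of 0] by linarith
  have 1: "L2_lim ?M (\<lambda>n x. F (\<phi> n x)) (\<lambda>x. F (u x))"
  proof (rule L2_lim_lipschitz[OF \<phi>(2)])
    show "sq_int ?M (\<lambda>x. F (u x))"
      using lip[of _ 0] F(2) by (intro sq_int_dominated[OF Hc_sq_int(1)[OF u], of _ B]) auto
    show "norm (F (\<phi> n x) - F (u x)) \<le> B * norm (\<phi> n x - u x)" for n x using lip by simp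
  qed measurable
  have gr: "gradient (\<lambda>x. F (\<phi> n x)) = (\<lambda>x. F' (\<phi> n x) *\<^sub>R gradient (\<phi> n) x)" for n
    using gradient_compose_real[OF F(3) tfc_differentiable[OF \<phi>(1) N]] by auto
  have 2: "L2_lim ?M (\<lambda>n x. F' (\<phi> n x) *\<^sub>R (gradient (\<phi> n) x - g x)) (\<lambda>x. 0)"
    by (rule L2_lim_lipschitz[OF \<phi>(3), of _ _ B])
       (use F(4) in \<open>auto simp: sq_int_def intro!: mult_right_mono\<close>)
  have 3: "L2_lim ?M (\<lambda>n x. F' (\<phi> n x) *\<^sub>R g x) (\<lambda>x. F' (u x) *\<^sub>R g x)"
  proof (rule L2_lim_dominated)
    show "sq_int ?M (\<lambda>x. B * norm (g x))" using sg by (auto simp: sq_int_def power_mult_distrib)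
    show "AE x in ?M. norm (F' (\<phi> n x) *\<^sub>R g x) \<le> B * norm (g x)" for n
      using F(4) by (auto intro!: mult_right_mono)
    show "AE x in ?M. (\<lambda>n. F' (\<phi> n x) *\<^sub>R g x) \<longlonglongrightarrow> F' (u x) *\<^sub>R g x" using \<phi>(4)
    proof eventually_elim
      case (elim x)
      then have "(\<lambda>n. F' (\<phi> n x)) \<longlonglongrightarrow> F' (u x)"
        using contF' by (auto intro: isCont_tendsto_compose simp: continuous_on_eq_continuous_at)
      then show ?case by (intro tendsto_intros)
    qed
  qed measurable
  have "L2_lim ?M (\<lambda>n. gradient (\<lambda>x. F (\<phi> n x))) (\<lambda>x. F' (u x) *\<^sub>R g x)"
    unfolding gr using L2_lim_add[OF 2 3] by (simp add: scaleR_diff_right)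
  then show ?thesis unfolding Hc_def
    using 1 tfc_compose[OF F(1,2) \<phi>(1)] by (intro exI[of _ "\<lambda>n x. F (\<phi> n x)"]) auto
qed

lemma Hc_poincare:
  assumes u: "Hc N \<Omega> u g" and e: "norm e = 1" and h: "\<And>x. x \<in> \<Omega> \<Longrightarrow> \<bar>x \<bullet> e - c\<bar> \<le> h" "0 \<le> h"
  shows "(\<integral>x. (u x)\<^sup>2 \<partial>lebesgue_on \<Omega>) \<le> 4 * h\<^sup>2 * (\<integral>x. (norm (g x))\<^sup>2 \<partial>lebesgue_on \<Omega>)"
proof -
  obtain \<phi> where \<phi>: "\<And>n. tfc N \<Omega> (\<phi> n)" "L2_lim (lebesgue_on \<Omega>) \<phi> u"
    "L2_lim (lebesgue_on \<Omega>) (\<lambda>n. gradient (\<phi> n)) g" using u unfolding Hc_def by blast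
  have t: "tfc {1} \<Omega> (\<phi> n)" for n
    using \<phi>(1)[of n] tfc_Ck[OF \<phi>(1) N, of 1] by (auto simp: tfc_def)
  have "(\<integral>x. (\<phi> n x)\<^sup>2 \<partial>lebesgue_on \<Omega>) \<le> 4 * h\<^sup>2 * (\<integral>x. (norm (gradient (\<phi> n) x))\<^sup>2 \<partial>lebesgue_on \<Omega>)" for n
    by (rule poincare_strip[OF \<Omega> t e h])
  then show ?thesis
    using L2_lim_norm[OF \<phi>(2)] tendsto_mult_left[OF L2_lim_norm[OF \<phi>(3)], of "4 * h\<^sup>2"]
    by (intro LIMSEQ_le[of _ _ "\<lambda>n. 4 * h\<^sup>2 * (\<integral>x. (norm (gradient (\<phi> n) x))\<^sup>2 \<partial>lebesgue_on \<Omega>)"]) auto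
qed

text \<open>The case k = 2 of \<open>gagliardo_power\<close>, whence the constant 4. The fourth
  power is not continuous for the approximation at hand, so the inequality passes to the limit by
  Fatou, which also supplies integrability.\<close>

lemma Hc_ladyzhenskaya:
  assumes u: "Hc N \<Omega> u g"
  shows "integrable (lebesgue_on \<Omega>) (\<lambda>x. (u x) ^ 4)"
    "(\<integral>x. (u x) ^ 4 \<partial>lebesgue_on \<Omega>) \<le> 4 * (\<integral>x. (u x)\<^sup>2 \<partial>lebesgue_on \<Omega>) * (\<integral>x. (norm (g x))\<^sup>2 \<partial>lebesgue_on \<Omega>)"
proof -
  let ?M = "lebesgue_on \<Omega>"
  obtain \<phi> where \<phi>: "\<And>n. tfc N \<Omega> (\<phi> n)" "L2_lim ?M \<phi> u"
    "L2_lim ?M (\<lambda>n. gradient (\<phi> n)) g" "AE x in ?M. (\<lambda>n. \<phi> n x) \<longlonglongrightarrow> u x"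
    by (rule Hc_AE_seq[OF u]) blast
  have t: "tfc {1} \<Omega> (\<phi> n)" for n
    using \<phi>(1)[of n] tfc_Ck[OF \<phi>(1) N, of 1] by (auto simp: tfc_def)
  have i: "integrable ?M (\<lambda>x. (\<phi> n x) ^ 4)" for n
  proof -
    obtain B where B: "\<And>x. \<bar>\<phi> n x\<bar> \<le> B" using tfc_bounded[OF t] by blast
    have "norm ((\<phi> n x)\<^sup>2) \<le> B\<^sup>2" for x using B[of x] power_mono[of "\<bar>\<phi> n x\<bar>" B 2] by simp
    then have "sq_int ?M (\<lambda>x. (\<phi> n x)\<^sup>2)"
      using L2_limD(1)[OF \<phi>(2), of n] by (intro sq_int_bounded finite_measure_lebesgue_on \<Omega>) (auto simp: sq_int_def)
    then show ?thesis by (simp add: sq_int_def)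
  qed
  have b: "(\<integral>x. (\<phi> n x) ^ 4 \<partial>?M) \<le> 4 * (\<integral>x. (\<phi> n x)\<^sup>2 \<partial>?M) * (\<integral>x. (norm (gradient (\<phi> n) x))\<^sup>2 \<partial>?M)" for n
    using gagliardo_power[OF \<Omega> t, of 2 n] by simp
  have c: "(\<lambda>n. 4 * (\<integral>x. (\<phi> n x)\<^sup>2 \<partial>?M) * (\<integral>x. (norm (gradient (\<phi> n) x))\<^sup>2 \<partial>?M)) \<longlonglongrightarrow>
     4 * (\<integral>x. (u x)\<^sup>2 \<partial>?M) * (\<integral>x. (norm (g x))\<^sup>2 \<partial>?M)"
    using L2_lim_norm[OF \<phi>(2)] by (intro tendsto_intros L2_lim_norm[OF \<phi>(3)]) simp
  have "AE x in ?M. (\<lambda>n. (\<phi> n x) ^ 4) \<longlonglongrightarrow> (u x) ^ 4"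
    using \<phi>(4) by eventually_elim (intro tendsto_intros)
  from fatou_integral[OF i _ _ this b c] Hc_sq_int[OF u]
  show "integrable ?M (\<lambda>x. (u x) ^ 4)"
    "(\<integral>x. (u x) ^ 4 \<partial>?M) \<le> 4 * (\<integral>x. (u x)\<^sup>2 \<partial>?M) * (\<integral>x. (norm (g x))\<^sup>2 \<partial>?M)"
    by (auto simp: sq_int_def)
qed

text \<open>Iterating \<open>gagliardo_power\<close> bounds the integral of \<psi>^(2k) by (k!)^2
  D^k |\<Omega>|. As (k!)^2 \<le> (2k)!, the series of 2 cosh (p \<psi>), which dominates exp (p
  |\<psi>|), is dominated by a geometric one of ratio p^2 D \<le> 1/2; its sum 2, times the factor 2
  in front of cosh, makes the constant 4.\<close>

lemma tfc_exp_integral: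
  assumes t: "tfc N \<Omega> \<psi>" and D: "p\<^sup>2 * (\<integral>x. (norm (gradient \<psi> x))\<^sup>2 \<partial>lebesgue_on \<Omega>) \<le> 1 / 2"
  shows "integrable (lebesgue_on \<Omega>) (\<lambda>x. exp (p * \<bar>\<psi> x\<bar>))"
    "(\<integral>x. exp (p * \<bar>\<psi> x\<bar>) \<partial>lebesgue_on \<Omega>) \<le> 4 * measure lebesgue \<Omega>"
proof -
  let ?M = "lebesgue_on \<Omega>"
  interpret finite_measure ?M by (rule finite_measure_lebesgue_on[OF \<Omega>])
  have t1: "tfc {1} \<Omega> \<psi>" using t tfc_Ck[OF t N, of 1] by (auto simp: tfc_def)
  obtain B where B: "\<And>x. \<bar>\<psi> x\<bar> \<le> B" using tfc_bounded[OF t1] by blast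
  have m[measurable]: "\<psi> \<in> borel_measurable ?M" using tfc_borel[OF t1] by (rule borel_measurable_lebesgue_on)
  define D where "D = (\<integral>x. (norm (gradient \<psi> x))\<^sup>2 \<partial>?M)"
  have D0: "0 \<le> D" by (simp add: D_def)
  have mOm: "measure ?M \<Omega> = measure lebesgue \<Omega>" using \<Omega> by (simp add: measure_restrict_space)
  have i: "integrable ?M (\<lambda>x. \<psi> x ^ k)" for k
    using B power_mono[of "\<bar>\<psi> _\<bar>" B k] by (intro integrable_const_bound[of _ "B ^ k"]) (auto simp: power_abs)
  have a: "(\<integral>x. \<psi> x ^ (2 * k) \<partial>?M) \<le> (fact k)\<^sup>2 * D ^ k * measure lebesgue \<Omega>" for k
  proof (induction k)
    case 0 then show ?case by (simp add: mOm)
  next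
    case (Suc k)
    have "(\<integral>x. \<psi> x ^ (2 * Suc k) \<partial>?M) \<le> (real (Suc k))\<^sup>2 * (\<integral>x. \<psi> x ^ (2 * k) \<partial>?M) * D"
      using gagliardo_power[OF \<Omega> t1, of "Suc k"] by (simp add: D_def)
    also have "\<dots> \<le> (real (Suc k))\<^sup>2 * ((fact k)\<^sup>2 * D ^ k * measure lebesgue \<Omega>) * D"
      using Suc D0 by (intro mult_right_mono mult_left_mono) auto
    also have "\<dots> = (fact (Suc k))\<^sup>2 * D ^ Suc k * measure lebesgue \<Omega>"
      by (simp only: fact_Suc of_nat_mult power_mult_distrib power_Suc mult_ac)
    finally show ?case .
  qed
  define S where "S n x = (\<Sum>k<n. 2 * (p * \<psi> x) ^ (2 * k) / fact (2 * k))" for n x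
  have S_int: "integrable ?M (S n)" for n
    unfolding S_def power_mult_distrib using i by auto
  have trm: "(\<integral>x. 2 * (p * \<psi> x) ^ (2 * k) / fact (2 * k) \<partial>?M) \<le> 2 * measure lebesgue \<Omega> * (1 / 2) ^ k" for k
  proof -
    have f: "(fact k)\<^sup>2 \<le> (fact (2 * k) :: real)"
    proof -
      have "fact k * fact k dvd (fact (k + k) :: nat)" by (rule fact_fact_dvd_fact)
      then have "fact k * fact k \<le> (fact (k + k) :: nat)" by (rule dvd_imp_le) simp
      then have "real (fact k * fact k) \<le> real (fact (k + k))" by (rule of_nat_mono)
      then show ?thesis by (simp add: power2_eq_square mult_2)
    qed
    have "(\<integral>x. 2 * (p * \<psi> x) ^ (2 * k) / fact (2 * k) \<partial>?M) = 2 * p ^ (2 * k) / fact (2 * k) * (\<integral>x. \<psi> x ^ (2 * k) \<partial>?M)"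
      by (simp add: power_mult_distrib)
    also have "\<dots> \<le> 2 * p ^ (2 * k) / fact (2 * k) * ((fact k)\<^sup>2 * D ^ k * measure lebesgue \<Omega>)"
      by (intro mult_left_mono a) (auto simp: power_mult)
    also have "\<dots> = 2 * measure lebesgue \<Omega> * (p\<^sup>2 * D) ^ k * ((fact k)\<^sup>2 / fact (2 * k))"
      by (simp add: power_mult_distrib power_mult)
    also have "\<dots> \<le> 2 * measure lebesgue \<Omega> * (1 / 2) ^ k * 1"
      using assms(2) f D0 by (intro mult_mono power_mono) (auto simp: D_def)
    finally show ?thesis by simp
  qed
  have S_le: "(\<integral>x. S n x \<partial>?M) \<le> 4 * measure lebesgue \<Omega>" for n
  proof -
    have "(\<integral>x. S n x \<partial>?M) = (\<Sum>k<n. \<integral>x. 2 * (p * \<psi> x) ^ (2 * k) / fact (2 * k) \<partial>?M)"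
      unfolding S_def power_mult_distrib using i by (intro Bochner_Integration.integral_sum) auto
    also have "\<dots> \<le> (\<Sum>k<n. 2 * measure lebesgue \<Omega> * (1 / 2) ^ k)" by (intro sum_mono trm)
    also have "\<dots> = 2 * measure lebesgue \<Omega> * (\<Sum>k<n. (1 / 2) ^ k)" by (simp add: sum_distrib_left)
    also have "\<dots> \<le> 2 * measure lebesgue \<Omega> * 2"
      by (intro mult_left_mono) (auto simp: geometric_sum)
    finally show ?thesis by simp
  qed
  have S_lim: "(\<lambda>n. S n x) \<longlonglongrightarrow> 2 * cosh (p * \<psi> x)" for x
  proof -
    \<comment> \<open>The known series for cosh runs over all powers, with zero coefficients at odd
      ones, so \<open>S n\<close> corresponds to its partial sum below 2 n.\<close>
    let ?c = "\<lambda>n. if even n then (p * \<psi> x) ^ n /\<^sub>R fact n else 0"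
    have "(\<lambda>n. sum ?c {..<n}) \<longlonglongrightarrow> cosh (p * \<psi> x)" using cosh_converges[of "p * \<psi> x"] by (simp add: sums_def)
    then have "(\<lambda>n. sum ?c {..<2 * n}) \<longlonglongrightarrow> cosh (p * \<psi> x)"
      by (rule LIMSEQ_subseq_LIMSEQ[where f="\<lambda>n. 2 * n", unfolded o_def]) (simp add: strict_mono_def)
    moreover have "S n x = 2 * sum ?c {..<2 * n}" for n
      unfolding S_def by (induction n) (auto simp: divide_inverse)
    ultimately show ?thesis by (auto intro!: tendsto_mult_left)
  qed
  have S0: "0 \<le> S n x" for n x unfolding S_def by (intro sum_nonneg) (auto simp: power_mult)
  have mc: "(\<lambda>x. 2 * cosh (p * \<psi> x)) \<in> borel_measurable ?M" unfolding cosh_def by measurable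
  have "AE x in ?M. (\<lambda>n. S n x) \<longlonglongrightarrow> 2 * cosh (p * \<psi> x)" by (intro AE_I2 S_lim)
  note c = fatou_integral[OF S_int S0 mc this S_le tendsto_const]
  have le: "exp (p * \<bar>\<psi> x\<bar>) \<le> 2 * cosh (p * \<psi> x)" for x
    by (cases "0 \<le> \<psi> x") (auto simp: cosh_def)
  show e: "integrable ?M (\<lambda>x. exp (p * \<bar>\<psi> x\<bar>))"
    by (rule Bochner_Integration.integrable_bound[OF c(1)]) (use le in \<open>auto intro!: AE_I2 order_trans[OF le]\<close>)
  show "(\<integral>x. exp (p * \<bar>\<psi> x\<bar>) \<partial>?M) \<le> 4 * measure lebesgue \<Omega>"
    using integral_mono[OF e c(1) le] c(2) by linarith
qed

text \<open>No smallness of the gradient is assumed for \<open>u\<close>, but it holds for the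
  differences \<phi> (n + n0) - \<phi> n0 once n0 is large, because the gradients converge. So
  \<open>u\<close> is a bounded function plus one to which \<open>tfc_exp_integral\<close> applies
  in the limit.\<close>

lemma Hc_exp_integrable:
  assumes u: "Hc N \<Omega> u g"
  shows "integrable (lebesgue_on \<Omega>) (\<lambda>x. exp (p * u x))"
proof -
  let ?M = "lebesgue_on \<Omega>"
  obtain \<phi> where \<phi>: "\<And>n. tfc N \<Omega> (\<phi> n)" "L2_lim ?M \<phi> u"
    "L2_lim ?M (\<lambda>n. gradient (\<phi> n)) g" "AE x in ?M. (\<lambda>n. \<phi> n x) \<longlonglongrightarrow> u x"
    by (rule Hc_AE_seq[OF u]) blast
  define q where "q = \<bar>p\<bar> + 1"
  have q: "0 < q" by (simp add: q_def)
  note L = L2_limD(3)[OF \<phi>(3)]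
  \<comment> \<open>The difference of two gradients within \<delta> of \<open>g\<close> has squared
    norm at most 4 \<delta>, and q^2 times this is exactly 1/2.\<close>
  define \<delta> where "\<delta> = 1 / (8 * q\<^sup>2)"
  have \<delta>: "0 < \<delta>" using q by (simp add: \<delta>_def)
  obtain n0 where n0: "\<And>n. n \<ge> n0 \<Longrightarrow> (\<integral>x. (norm (gradient (\<phi> n) x - g x))\<^sup>2 \<partial>?M) < \<delta>"
    using order_tendstoD(2)[OF L \<delta>] by (auto simp: eventually_sequentially)
  have sg: "sq_int ?M (\<lambda>x. gradient (\<phi> n) x - g x)" for n
    using sq_int_diff[OF L2_limD(1,2)[OF \<phi>(3)]] .
  define \<psi> where "\<psi> n = (\<lambda>x. \<phi> (n + n0) x - \<phi> n0 x)" for n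
  have t: "tfc N \<Omega> (\<psi> n)" for n unfolding \<psi>_def by (intro tfc_diff \<phi>)
  have D: "q\<^sup>2 * (\<integral>x. (norm (gradient (\<psi> n) x))\<^sup>2 \<partial>?M) \<le> 1 / 2" for n
  proof -
    have "gradient (\<psi> n) x = (gradient (\<phi> (n + n0)) x - g x) + (- (gradient (\<phi> n0) x - g x))" for x
      unfolding \<psi>_def using tfc_differentiable[OF \<phi>(1) N] by (simp add: gradient_diff)
    then have "(norm (gradient (\<psi> n) x))\<^sup>2 \<le> 2 * (norm (gradient (\<phi> (n + n0)) x - g x))\<^sup>2 + 2 * (norm (gradient (\<phi> n0) x - g x))\<^sup>2" for x
      using norm_add_sq_le[of "gradient (\<phi> (n + n0)) x - g x" "- (gradient (\<phi> n0) x - g x)"] by (simp add: norm_minus_commute)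
    moreover have "sq_int ?M (gradient (\<psi> n))"
      using tfc_gradient_sq_int[OF \<Omega> t, of 1] N by (simp add: numeral_2_eq_2)
    ultimately have "(\<integral>x. (norm (gradient (\<psi> n) x))\<^sup>2 \<partial>?M) \<le>
      (\<integral>x. 2 * (norm (gradient (\<phi> (n + n0)) x - g x))\<^sup>2 + 2 * (norm (gradient (\<phi> n0) x - g x))\<^sup>2 \<partial>?M)"
      using sg by (intro integral_mono) (auto simp: sq_int_def)
    also have "\<dots> = 2 * (\<integral>x. (norm (gradient (\<phi> (n + n0)) x - g x))\<^sup>2 \<partial>?M) + 2 * (\<integral>x. (norm (gradient (\<phi> n0) x - g x))\<^sup>2 \<partial>?M)"
      using sg by (simp add: sq_int_def)
    also have "\<dots> \<le> 4 * \<delta>" using n0[of "n + n0"] n0[of n0] by simp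
    finally have "q\<^sup>2 * (\<integral>x. (norm (gradient (\<psi> n) x))\<^sup>2 \<partial>?M) \<le> q\<^sup>2 * (4 * \<delta>)" by (intro mult_left_mono) auto
    also have "\<dots> = 1 / 2" using q by (simp add: \<delta>_def)
    finally show ?thesis .
  qed
  have mu[measurable]: "u \<in> borel_measurable ?M" "\<phi> n \<in> borel_measurable ?M" for n
    using Hc_sq_int[OF u] L2_limD(1)[OF \<phi>(2)] by (auto simp: sq_int_def)
  have al: "AE x in ?M. (\<lambda>n. exp (q * \<bar>\<psi> n x\<bar>)) \<longlonglongrightarrow> exp (q * \<bar>u x - \<phi> n0 x\<bar>)"
    using \<phi>(4)
  proof eventually_elim
    case (elim x)
    then have "(\<lambda>n. \<phi> (n + n0) x) \<longlonglongrightarrow> u x" by (rule LIMSEQ_ignore_initial_segment)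
    then show ?case unfolding \<psi>_def by (intro tendsto_intros)
  qed
  have i: "integrable ?M (\<lambda>x. exp (q * \<bar>u x - \<phi> n0 x\<bar>))"
    by (rule fatou_integral(1)[OF tfc_exp_integral(1)[OF t D] _ _ al tfc_exp_integral(2)[OF t D] tendsto_const]) auto
  have t2: "tfc {2} \<Omega> (\<phi> n0)" using \<phi>(1)[of n0] N by (auto simp: tfc_def)
  obtain B where B: "\<And>x. \<bar>\<phi> n0 x\<bar> \<le> B" using tfc_bounded[OF t2] by blast
  have "exp (p * u x) \<le> exp (q * B) * exp (q * \<bar>u x - \<phi> n0 x\<bar>)" for x
  proof -
    have "p * u x \<le> q * \<bar>u x\<bar>" using abs_ge_self[of "p * u x"] q
      by (simp add: abs_mult q_def distrib_right)
    also have "\<dots> \<le> q * (B + \<bar>u x - \<phi> n0 x\<bar>)" using B[of x] q by (intro mult_left_mono) auto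
    finally show ?thesis by (simp add: exp_add[symmetric] distrib_left)
  qed
  then show ?thesis
    by (intro Bochner_Integration.integrable_bound[OF integrable_mult_right[OF i, of "exp (q * B)"]]) auto
qed

end

lemma set_lebesgue_integral_eq_on:
  fixes f :: "complex \<Rightarrow> 'b::{banach, second_countable_topology}"
  assumes "open \<Omega>"
  shows "set_lebesgue_integral lebesgue \<Omega> f = integral\<^sup>L (lebesgue_on \<Omega>) f"
    "set_integrable lebesgue \<Omega> f \<longleftrightarrow> integrable (lebesgue_on \<Omega>) f"
  using assms by (simp_all add: set_lebesgue_integral_def set_integrable_def integral_restrict_space integrable_restrict_space)

lemma exp_diff_mult_le: "(exp a - exp b) * (a - b) \<le> (exp a + exp b) * (a - b)\<^sup>2" for a b :: real
proof -
  have *: "(exp a - exp b) * (a - b) \<le> exp a * (a - b)\<^sup>2" if "b \<le> a" for a b :: real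
  proof -
    have "exp a - exp b = exp a * (1 - exp (- (a - b)))" by (simp add: right_diff_distrib exp_add[symmetric])
    also have "\<dots> \<le> exp a * (a - b)"
    proof (rule mult_left_mono)
      show "1 - exp (- (a - b)) \<le> a - b" using exp_ge_add_one_self[of "- (a - b)"] by linarith
    qed simp
    finally have "(exp a - exp b) * (a - b) \<le> exp a * (a - b) * (a - b)" using that by (intro mult_right_mono) auto
    then show ?thesis by (simp add: power2_eq_square mult.assoc)
  qed
  have p: "0 \<le> exp a * (a - b)\<^sup>2" "0 \<le> exp b * (a - b)\<^sup>2" by auto
  show ?thesis
  proof (cases "b \<le> a")
    case True
    then show ?thesis using *[of b a] p unfolding distrib_right by linarith
  next
    case False
    then have "a \<le> b" by simp
    have "(exp a - exp b) * (a - b) = (exp b - exp a) * (b - a)" by algebra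
    also have "\<dots> \<le> exp b * (b - a)\<^sup>2" by (rule *) fact
    also have "\<dots> = exp b * (a - b)\<^sup>2" by (simp add: power2_commute)
    finally show ?thesis unfolding distrib_right by (rule add_increasing[OF p(1)])
  qed
qed

lemma exp_diff_mult_nonneg: "0 \<le> (exp a - exp b) * (a - b)" for a b :: real
  by (cases "b \<le> a") (auto intro: mult_nonneg_nonneg mult_nonpos_nonpos)

definition wsol :: "nat set \<Rightarrow> complex set \<Rightarrow> real \<Rightarrow> (complex \<Rightarrow> real) \<Rightarrow> (complex \<Rightarrow> complex) \<Rightarrow> bool" where
  "wsol N \<Omega> l u g \<longleftrightarrow> Hc N \<Omega> u g \<and> (\<forall>\<phi>. tfc N \<Omega> \<phi> \<longrightarrow>
     (\<integral>x. g x \<bullet> gradient \<phi> x \<partial>lebesgue_on \<Omega>) = l * (\<integral>x. mf_density \<Omega> u x * \<phi> x \<partial>lebesgue_on \<Omega>))"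

subsection \<open>The truncated test functions\<close>

text \<open>A smooth stand-in for the minimum of s and m: it fixes 0, is bounded by 2 m, has slope
  in (0, 1], and tends to s as m grows.\<close>

definition trunc :: "real \<Rightarrow> real \<Rightarrow> real" where "trunc m s = m * arctan (s / m)"

lemma trunc_DERIV: "0 < m \<Longrightarrow> (trunc m has_real_derivative 1 / (1 + (s / m)\<^sup>2)) (at s)"
  unfolding trunc_def by (auto intro!: derivative_eq_intros simp: divide_inverse)

lemma trunc_Ck: "0 < m \<Longrightarrow> Ck_on k UNIV (trunc m)"
  using Ck_on_cmult[OF open_UNIV Ck_on_compose[of UNIV UNIV "\<lambda>s. (1 / m) * s" k arctan, OF _ _ _ Ck_on_arctan
      Ck_on_cmult[OF open_UNIV Ck_on_ident[OF open_UNIV]]], of m]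
  by (simp add: trunc_def[abs_def])

lemma trunc_0: "trunc m 0 = 0" by (simp add: trunc_def)

lemma trunc_bounds: assumes "0 < m" "0 \<le> s" shows "0 \<le> trunc m s" "trunc m s \<le> s"
proof -
  show "0 \<le> trunc m s" using assms by (simp add: trunc_def)
  have "arctan (s / m) \<le> s / m" using assms by (intro arctan_le_self) auto
  then show "trunc m s \<le> s" using assms by (simp add: trunc_def field_simps)
qed

lemma trunc_upper: "0 < m \<Longrightarrow> trunc m s \<le> 2 * m"
  using arctan_ubound[of "s / m"] pi_less_4 by (simp add: trunc_def)

lemma trunc_tendsto: "(\<lambda>n. trunc (real (Suc n)) s) \<longlonglongrightarrow> s"
proof -
  have "((\<lambda>h. (arctan (s * h) - arctan (s * 0)) / h) \<longlongrightarrow> s) (at 0)"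
  proof -
    have "((\<lambda>h. arctan (s * h)) has_real_derivative s) (at 0)"
      by (auto intro!: derivative_eq_intros)
    then show ?thesis by (simp add: DERIV_def)
  qed
  moreover have "filterlim (\<lambda>n. 1 / real (Suc n)) (at 0) sequentially"
    unfolding filterlim_at using LIMSEQ_inverse_real_of_nat by (auto simp: divide_inverse)
  ultimately have "(\<lambda>n. (arctan (s * (1 / real (Suc n))) - arctan (s * 0)) / (1 / real (Suc n))) \<longlonglongrightarrow> s"
    by (rule filterlim_compose)
  then show ?thesis by (simp add: trunc_def mult.commute)
qed

text \<open>exp (s / 2) with a smooth switch at height k. Its fourth power is comparable to exp (2
  s) above k, its square is at most exp s times s / (2 k), and its slope squared is at most exp s.
  The gain 1 / k in the second property is what later makes a constant small.\<close>

definition damp :: "real \<Rightarrow> real \<Rightarrow> real" where "damp k s = exp (s / 2) * (s\<^sup>2 / (s\<^sup>2 + k\<^sup>2))"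

lemma damp_Ck: assumes "0 < k" shows "Ck_on j UNIV (damp k)"
proof -
  have nz: "s\<^sup>2 + k\<^sup>2 \<noteq> 0" for s :: real using assms by (simp add: sum_power2_eq_zero_iff)
  have "Ck_on j UNIV (\<lambda>s::real. exp ((1/2) * s))"
    by (rule Ck_on_compose[of UNIV UNIV "\<lambda>s. (1/2) * s" j exp, OF _ _ _ Ck_on_exp
          Ck_on_cmult[OF open_UNIV Ck_on_ident[OF open_UNIV]]]) simp_all
  moreover have "Ck_on j UNIV (\<lambda>s::real. s\<^sup>2 / (s\<^sup>2 + k\<^sup>2))"
    using nz by (intro Ck_on_divide Ck_on_add Ck_on_power Ck_on_ident Ck_on_const) auto
  ultimately have "Ck_on j UNIV (\<lambda>s::real. exp ((1/2) * s) * (s\<^sup>2 / (s\<^sup>2 + k\<^sup>2)))" by (rule Ck_on_mult[OF open_UNIV])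
  moreover have "damp k = (\<lambda>s. exp ((1/2) * s) * (s\<^sup>2 / (s\<^sup>2 + k\<^sup>2)))" by (simp add: fun_eq_iff damp_def)
  ultimately show ?thesis by simp
qed

lemma damp_0: "damp k 0 = 0" by (simp add: damp_def)

lemma damp_DERIV:
  assumes "2 \<le> k"
  obtains d where "\<And>s. (damp k has_real_derivative d s) (at s)" "\<And>s. (d s)\<^sup>2 \<le> exp s"
proof
  have pos: "0 < s\<^sup>2 + k\<^sup>2" for s :: real using assms by (simp add: sum_power2_gt_zero_iff)
  let ?d = "\<lambda>s. exp (s / 2) * ((s\<^sup>2 / (s\<^sup>2 + k\<^sup>2)) / 2 + 2 * s * k\<^sup>2 / (s\<^sup>2 + k\<^sup>2)\<^sup>2)"
  show "(damp k has_real_derivative ?d s) (at s)" for s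
  proof -
    have "((\<lambda>s. s\<^sup>2 / (s\<^sup>2 + k\<^sup>2)) has_real_derivative (2 * s * (s\<^sup>2 + k\<^sup>2) - s\<^sup>2 * (2 * s)) / ((s\<^sup>2 + k\<^sup>2) * (s\<^sup>2 + k\<^sup>2))) (at s)"
      using pos[of s] by (auto intro!: derivative_eq_intros)
    moreover have "(2 * s * (s\<^sup>2 + k\<^sup>2) - s\<^sup>2 * (2 * s)) / ((s\<^sup>2 + k\<^sup>2) * (s\<^sup>2 + k\<^sup>2)) = 2 * s * k\<^sup>2 / (s\<^sup>2 + k\<^sup>2)\<^sup>2"
      by (simp add: power2_eq_square algebra_simps)
    ultimately have *: "((\<lambda>s. s\<^sup>2 / (s\<^sup>2 + k\<^sup>2)) has_real_derivative 2 * s * k\<^sup>2 / (s\<^sup>2 + k\<^sup>2)\<^sup>2) (at s)" by simp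
    have "((\<lambda>s. exp (s / 2)) has_real_derivative exp (s / 2) / 2) (at s)"
      by (auto intro!: derivative_eq_intros)
    from DERIV_mult[OF this *] show ?thesis unfolding damp_def by (simp add: algebra_simps)
  qed
  show "(?d s)\<^sup>2 \<le> exp s" for s
  proof -
    define q where "q = s\<^sup>2 + k\<^sup>2"
    have q: "0 < q" "k\<^sup>2 \<le> q" "s\<^sup>2 \<le> q" using pos[of s] by (auto simp: q_def)
    \<comment> \<open>The two summands of the slope, freed of exp (s / 2), are each at most 1/2. For
      the second one, 2 |s| k \<le> q and k^2 \<le> q bound it by 1 / k, and this is where k \<ge> 2
      is used.\<close>
    have "2 * \<bar>s\<bar> * k \<le> q" using sum_squares_bound[of "\<bar>s\<bar>" k] by (simp add: q_def)
    then have "2 * \<bar>s\<bar> * k * k * k\<^sup>2 \<le> q * k * q" using q assms by (intro mult_mono) auto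
    then have "(2 * \<bar>s\<bar> * k\<^sup>2) * k\<^sup>2 \<le> k * q\<^sup>2" by (simp add: power2_eq_square mult_ac)
    moreover have "(2 * \<bar>s\<bar> * k\<^sup>2) * 2 * k \<le> (2 * \<bar>s\<bar> * k\<^sup>2) * k\<^sup>2"
      using assms mult_left_mono[of "2 * k" "k\<^sup>2" "2 * \<bar>s\<bar> * k\<^sup>2"] by (simp add: power2_eq_square mult.assoc)
    ultimately have "k * (2 * (2 * \<bar>s\<bar> * k\<^sup>2)) \<le> k * q\<^sup>2" by (simp add: mult_ac)
    then have "2 * (2 * \<bar>s\<bar> * k\<^sup>2) \<le> q\<^sup>2" using assms mult_le_cancel_left_pos[of k] by simp
    then have 1: "\<bar>2 * s * k\<^sup>2 / q\<^sup>2\<bar> \<le> 1 / 2" using q by (simp add: abs_mult field_simps)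
    have 2: "\<bar>(s\<^sup>2 / q) / 2\<bar> \<le> 1 / 2" using q by simp
    have "\<bar>(s\<^sup>2 / q) / 2 + 2 * s * k\<^sup>2 / q\<^sup>2\<bar> \<le> 1 / 2 + 1 / 2"
      by (rule order_trans[OF abs_triangle_ineq add_mono[OF 2 1]])
    then have "\<bar>(s\<^sup>2 / q) / 2 + 2 * s * k\<^sup>2 / q\<^sup>2\<bar> \<le> 1" by (simp only: field_sum_of_halves)
    then have "((s\<^sup>2 / q) / 2 + 2 * s * k\<^sup>2 / q\<^sup>2)\<^sup>2 \<le> 1" by (simp add: abs_square_le_1)
    then have "(exp (s / 2))\<^sup>2 * ((s\<^sup>2 / q) / 2 + 2 * s * k\<^sup>2 / q\<^sup>2)\<^sup>2 \<le> (exp (s / 2))\<^sup>2 * 1"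
      by (intro mult_left_mono) auto
    moreover have "(exp (s / 2))\<^sup>2 = exp s" using exp_double[of "s / 2"] by simp
    ultimately show ?thesis by (simp only: power_mult_distrib q_def mult_1_right)
  qed
qed

lemma damp_sq_le:
  assumes "0 < k" "0 \<le> s" shows "(damp k s)\<^sup>2 \<le> exp s * s / (2 * k)"
proof -
  define q where "q = s\<^sup>2 + k\<^sup>2"
  have q: "0 < q" "s\<^sup>2 \<le> q" using assms by (auto simp: q_def intro: add_nonneg_pos)
  have "2 * s * k \<le> q" using sum_squares_bound[of s k] by (simp add: q_def)
  then have "s * (2 * s * k) \<le> s * q" using assms by (intro mult_left_mono) auto
  then have 1: "s\<^sup>2 / q \<le> s / (2 * k)" using q assms by (simp add: field_simps power2_eq_square)
  have "(s\<^sup>2 / q)\<^sup>2 \<le> 1 * (s\<^sup>2 / q)" unfolding power2_eq_square[of "s\<^sup>2 / q"] using q by (intro mult_right_mono) auto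
  then have "(s\<^sup>2 / q)\<^sup>2 \<le> s / (2 * k)" using 1 by simp
  then have "exp s * (s\<^sup>2 / q)\<^sup>2 \<le> exp s * (s / (2 * k))" by (intro mult_left_mono) auto
  moreover have "(exp (s / 2))\<^sup>2 = exp s" using exp_double[of "s / 2"] by simp
  then have "(damp k s)\<^sup>2 = exp s * (s\<^sup>2 / q)\<^sup>2" by (simp only: damp_def power_mult_distrib q_def)
  ultimately show ?thesis by simp
qed

text \<open>Above k the switch is at least 1/2, and 16 is the inverse of the fourth power of 1/2;
  below k the constant summand suffices.\<close>

lemma exp_le_damp:
  assumes "0 < k" "0 \<le> s" shows "exp (2 * s) \<le> 16 * (damp k s) ^ 4 + exp (2 * k)"
proof (cases "s \<le> k")
  case True
  then have "exp (2 * s) \<le> exp (2 * k)" by simp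
  moreover have "0 \<le> 16 * (damp k s) ^ 4" by simp
  ultimately show ?thesis by linarith
next
  case False
  then have "k\<^sup>2 \<le> s\<^sup>2" using assms by (intro power_mono) auto
  then have "1 / 2 \<le> s\<^sup>2 / (s\<^sup>2 + k\<^sup>2)" using assms False by (simp add: field_simps add_nonneg_pos)
  then have "exp (s / 2) * (1 / 2) \<le> damp k s" unfolding damp_def by (intro mult_left_mono) auto
  then have "(exp (s / 2) * (1 / 2)) ^ 4 \<le> (damp k s) ^ 4" by (intro power_mono) auto
  moreover have "(exp (s / 2)) ^ 4 = exp (2 * s)" by (simp add: exp_of_nat_mult[symmetric])
  ultimately have "exp (2 * s) * (1 / 2) ^ 4 \<le> (damp k s) ^ 4" by (simp only: power_mult_distrib)
  then have "exp (2 * s) \<le> 16 * (damp k s) ^ 4" by (simp add: power_divide)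
  then show ?thesis using exp_gt_zero[of "2 * k"] by linarith
qed

subsection \<open>A priori estimates and uniqueness\<close>

context
  fixes \<Omega> :: "complex set" and N :: "nat set"
  assumes \<Omega>: "open \<Omega>" "bounded \<Omega>" and N: "2 \<in> N" and pos: "0 < measure lebesgue \<Omega>"
begin

private abbreviation (input) M where "M \<equiv> lebesgue_on \<Omega>"
private abbreviation (input) Z where "Z u \<equiv> (\<integral>x. exp (u x) \<partial>lebesgue_on \<Omega>)"

interpretation finite_measure M by (rule finite_measure_lebesgue_on[OF \<Omega>])

lemma measure_M: "measure M \<Omega> = measure lebesgue \<Omega>" using \<Omega> by (simp add: measure_restrict_space)

lemma mf_density_eq: "mf_density \<Omega> u x = exp (u x) / Z u"
  by (simp add: mf_density_def set_lebesgue_integral_eq_on[OF \<Omega>(1)])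

lemma AE_M_not_False: "\<not> (AE x in M. False)"
proof
  assume "AE x in M. False"
  then have "emeasure M (space M) = 0"
    using AE_iff_measurable[of "space M" M "\<lambda>x. False"] by auto
  then have "measure M \<Omega> = 0" using \<Omega> by (simp add: measure_def)
  then show False using pos measure_M by simp
qed

context
  fixes u g assumes H: "Hc N \<Omega> u g"
begin

lemma u_measurable: "u \<in> borel_measurable M" "g \<in> borel_measurable M"
  using Hc_sq_int[OF H] by (auto simp: sq_int_def)

lemma exp_integrable: "integrable M (\<lambda>x. exp (p * u x))" "integrable M (\<lambda>x. exp (u x))"
  using Hc_exp_integrable[OF \<Omega> N H, of p] Hc_exp_integrable[OF \<Omega> N H, of 1] by auto

lemma Z_pos: "0 < Z u"
proof -
  have "Z u \<noteq> 0"
  proof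
    assume "Z u = 0"
    then have "AE x in M. exp (u x) = 0" using exp_integrable(2) by (subst (asm) integral_nonneg_eq_0_iff_AE) auto
    then show False using AE_M_not_False by simp
  qed
  moreover have "0 \<le> Z u" by simp
  ultimately show ?thesis by linarith
qed

lemma mf_density_nonneg: "0 \<le> mf_density \<Omega> u x"
  using Z_pos by (simp add: mf_density_eq)

lemma mf_density_exp: "mf_density \<Omega> u x = exp (u x - ln (Z u))"
  using Z_pos by (simp add: mf_density_eq exp_diff)

lemma mf_density_sq_int: "sq_int M (mf_density \<Omega> u)"
proof -
  have "(\<lambda>x. (mf_density \<Omega> u x)\<^sup>2) = (\<lambda>x. exp (2 * u x) / (Z u)\<^sup>2)"
    by (simp add: mf_density_eq power_divide exp_double[symmetric])
  then show ?thesis unfolding sq_int_def using exp_integrable(1)[of 2] u_measurable by (simp add: mf_density_eq[abs_def])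
qed

lemma mf_density_integral: "integrable M (mf_density \<Omega> u)" "(\<integral>x. mf_density \<Omega> u x \<partial>M) = 1"
  using Z_pos exp_integrable(2) by (simp_all add: mf_density_eq[abs_def])

end

text \<open>Both sides of the equation are continuous in the test function for the norm of
  \<open>Hc\<close>: the right side because the density is square integrable, a consequence of
  exponential integrability with exponent 2.\<close>

lemma wsolD:
  assumes w: "wsol N \<Omega> l u g"
  shows "Hc N \<Omega> u g"
    "Hc N \<Omega> v h \<Longrightarrow> (\<integral>x. g x \<bullet> h x \<partial>M) = l * (\<integral>x. mf_density \<Omega> u x * v x \<partial>M)"
proof -
  show H: "Hc N \<Omega> u g" using w by (simp add: wsol_def)
  assume "Hc N \<Omega> v h"
  then obtain \<phi> where \<phi>: "\<And>n. tfc N \<Omega> (\<phi> n)" "L2_lim M \<phi> v"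
    "L2_lim M (\<lambda>n. gradient (\<phi> n)) h" unfolding Hc_def by blast
  have "(\<lambda>n. \<integral>x. gradient (\<phi> n) x \<bullet> g x \<partial>M) \<longlonglongrightarrow> (\<integral>x. h x \<bullet> g x \<partial>M)"
    by (rule L2_lim_inner_const[OF \<phi>(3) Hc_sq_int(2)[OF H]])
  moreover have "(\<lambda>n. l * (\<integral>x. \<phi> n x \<bullet> mf_density \<Omega> u x \<partial>M)) \<longlonglongrightarrow> l * (\<integral>x. v x \<bullet> mf_density \<Omega> u x \<partial>M)"
    by (rule tendsto_mult_left[OF L2_lim_inner_const[OF \<phi>(2) mf_density_sq_int[OF H]]])
  moreover have "(\<integral>x. gradient (\<phi> n) x \<bullet> g x \<partial>M) = l * (\<integral>x. \<phi> n x \<bullet> mf_density \<Omega> u x \<partial>M)" for n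
    using w \<phi>(1)[of n] by (simp add: wsol_def inner_commute mult.commute[of "mf_density _ _ _"])
  ultimately have "(\<integral>x. h x \<bullet> g x \<partial>M) = l * (\<integral>x. v x \<bullet> mf_density \<Omega> u x \<partial>M)"
    using LIMSEQ_unique by simp
  then show "(\<integral>x. g x \<bullet> h x \<partial>M) = l * (\<integral>x. mf_density \<Omega> u x * v x \<partial>M)"
    by (simp add: inner_commute mult.commute)
qed

lemma wsol_test_compose:
  assumes w: "wsol N \<Omega> l u g"
    and F: "\<And>k. Ck_on k UNIV F" "F 0 = 0" "\<And>t. (F has_real_derivative F' t) (at t)" "\<And>t. \<bar>F' t\<bar> \<le> B"
  shows "(\<integral>x. F' (u x) * (norm (g x))\<^sup>2 \<partial>M) = l * (\<integral>x. mf_density \<Omega> u x * F (u x) \<partial>M)"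
    "integrable M (\<lambda>x. F' (u x) * (norm (g x))\<^sup>2)" "integrable M (\<lambda>x. mf_density \<Omega> u x * F (u x))"
proof -
  note H = wsolD(1)[OF w]
  note C = Hc_compose[OF \<Omega> N F H]
  show "(\<integral>x. F' (u x) * (norm (g x))\<^sup>2 \<partial>M) = l * (\<integral>x. mf_density \<Omega> u x * F (u x) \<partial>M)"
    using wsolD(2)[OF w C] by (simp add: power2_norm_eq_inner)
  show "integrable M (\<lambda>x. F' (u x) * (norm (g x))\<^sup>2)"
    using sq_int_inner[OF Hc_sq_int(2)[OF H] Hc_sq_int(2)[OF C]] by (simp add: power2_norm_eq_inner)
  show "integrable M (\<lambda>x. mf_density \<Omega> u x * F (u x))"
    using sq_int_mult[OF mf_density_sq_int[OF H] Hc_sq_int(1)[OF C]] .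
qed

text \<open>The test function - flat 0 (- u) is a smooth substitute for minus the negative part of
  u: it is increasing in u, so the left side of the equation is nonnegative, while the right side is
  nonpositive. Both vanish, hence so does the negative part.\<close>

lemma wsol_nonneg:
  assumes w: "wsol N \<Omega> l u g" and l: "0 < l"
  shows "AE x in M. 0 \<le> u x"
proof -
  note H = wsolD(1)[OF w]
  let ?F = "\<lambda>t. - flat 0 (- t)"
  have k: "Ck_on k UNIV ?F" for k
  proof -
    have "Ck_on k UNIV (\<lambda>t. flat 0 ((-1) * t))"
      by (rule Ck_on_compose[of UNIV UNIV "\<lambda>s. (-1) * s" k "flat 0", OF _ _ _ Ck_on_flat
          Ck_on_cmult[OF open_UNIV Ck_on_ident[OF open_UNIV]]]) simp_all
    from Ck_on_cmult[OF _ this, of "-1"] show ?thesis by simp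
  qed
  have d: "(?F has_real_derivative flat 2 (- t)) (at t)" for t
    using DERIV_flat[of 0 "- t"] by (auto intro!: derivative_eq_intros DERIV_chain2[of "flat 0"] simp: numeral_2_eq_2)
  note T = wsol_test_compose[OF w k _ d flat_bounded]
  have "0 \<le> l * (\<integral>x. mf_density \<Omega> u x * ?F (u x) \<partial>M)"
    by (subst T(1)[symmetric]) (auto simp: flat_0 flat_nonneg intro!: Bochner_Integration.integral_nonneg)
  then have "0 \<le> (\<integral>x. mf_density \<Omega> u x * ?F (u x) \<partial>M)" using l by (metis mult_le_cancel_left_pos mult_zero_right)
  moreover have n: "0 \<le> mf_density \<Omega> u x * flat 0 (- u x)" for x
    using mf_density_nonneg[OF H] flat_nonneg by simp
  moreover have i: "integrable M (\<lambda>x. mf_density \<Omega> u x * flat 0 (- u x))"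
    using T(3) by (simp add: flat_0)
  moreover have "0 \<le> (\<integral>x. mf_density \<Omega> u x * flat 0 (- u x) \<partial>M)" by (intro Bochner_Integration.integral_nonneg n)
  ultimately have "(\<integral>x. mf_density \<Omega> u x * flat 0 (- u x) \<partial>M) = 0"
    by simp
  then have "AE x in M. mf_density \<Omega> u x * flat 0 (- u x) = 0"
    using integral_nonneg_eq_0_iff_AE[OF i] n by simp
  then show ?thesis
  proof eventually_elim
    case (elim x)
    then have "flat 0 (- u x) = 0" using Z_pos[OF H] by (simp add: mf_density_eq)
    then show ?case using flat_pos[of "- u x" 0] by (cases "0 \<le> u x") auto
  qed
qed

text \<open>Let X be the integral of exp (2 u). Two compositions of one truncation are played
  against each other: \<open>V\<close>, like exp u - 1, is used as a test function and bounds the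
  gradient of \<open>F\<close>, like \<open>damp k\<close>, by l X / Z. As \<open>F\<close> squared
  has integral at most Z m / (2 k), Ladyzhenskaya bounds that of its fourth power by a small
  multiple of X, uniformly in n, and \<open>exp_le_damp\<close> returns from there to X.\<close>

lemma wsol_L2_bound:
  assumes w: "wsol N \<Omega> l u g" and l: "0 < l" "l \<le> lbar"
    and m: "(\<integral>x. mf_density \<Omega> u x * u x \<partial>M) \<le> m" and k: "2 \<le> k" "64 * lbar * m \<le> k"
  shows "(\<integral>x. (mf_density \<Omega> u x)\<^sup>2 \<partial>M) \<le> 2 * exp (2 * k) / measure lebesgue \<Omega>"
proof -
  note H = wsolD(1)[OF w] and u0 = wsol_nonneg[OF w l(1)]
  note [measurable] = u_measurable[OF H]
  define X where "X = (\<integral>x. exp (2 * u x) \<partial>M)"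
  have Zp: "0 < Z u" by (rule Z_pos[OF H])
  have iX: "integrable M (\<lambda>x. exp (2 * u x))" by (rule exp_integrable(1)[OF H])
  have X0: "0 \<le> X" by (simp add: X_def)
  have iuu: "integrable M (\<lambda>x. mf_density \<Omega> u x * u x)"
    by (rule sq_int_mult[OF mf_density_sq_int[OF H] Hc_sq_int(1)[OF H]])
  then have ieu: "integrable M (\<lambda>x. exp (u x) * u x)"
    using integrable_mult_right[OF iuu, of "Z u"] Zp by (simp add: mf_density_eq)
  have eu: "(\<integral>x. exp (u x) * u x \<partial>M) = Z u * (\<integral>x. mf_density \<Omega> u x * u x \<partial>M)"
    using Zp by (simp add: mf_density_eq)
  have m0: "0 \<le> m"
  proof -
    have "0 \<le> (\<integral>x. mf_density \<Omega> u x * u x \<partial>M)"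
      by (rule integral_nonneg_AE, use u0 in eventually_elim) (use mf_density_nonneg[OF H] in simp)
    then show ?thesis using m by simp
  qed
  obtain d where d: "\<And>s. (damp k has_real_derivative d s) (at s)" "\<And>s. (d s)\<^sup>2 \<le> exp s"
    using damp_DERIV[OF k(1)] by blast
  have kp: "0 < k" using k by simp
  define T where "T n = trunc (real (Suc n))" for n
  define T' where "T' n s = 1 / (1 + (s / real (Suc n))\<^sup>2)" for n s
  have T: "(T n has_real_derivative T' n s) (at s)" for n s
    unfolding T_def T'_def by (rule trunc_DERIV) simp
  have T'01: "0 \<le> T' n s" "T' n s \<le> 1" for n s unfolding T'_def by (auto simp: divide_le_eq_1 add_pos_nonneg)
  have TCk: "Ck_on j UNIV (T n)" for j n unfolding T_def by (rule trunc_Ck) simp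
  define F where "F n s = damp k (T n s)" for n s
  define F' where "F' n s = d (T n s) * T' n s" for n s
  define V where "V n s = exp (T n s) - 1" for n s
  define V' where "V' n s = exp (T n s) * T' n s" for n s
  have FCk: "Ck_on j UNIV (F n)" for j n unfolding F_def
    by (rule Ck_on_compose[of UNIV UNIV "T n" j "damp k", OF _ _ _ damp_Ck[OF kp] TCk]) auto
  have VCk: "Ck_on j UNIV (V n)" for j n unfolding V_def
    by (intro Ck_on_diff Ck_on_const Ck_on_compose[of UNIV UNIV "T n" j exp, OF _ _ _ Ck_on_exp TCk]) auto
  have F0: "F n 0 = 0" "V n 0 = 0" for n by (auto simp: F_def V_def T_def trunc_0 damp_0)
  have FD: "(F n has_real_derivative F' n s) (at s)" for n s
    unfolding F_def F'_def by (rule DERIV_chain2[OF d(1) T])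
  have VD: "(V n has_real_derivative V' n s) (at s)" for n s
    unfolding V_def V'_def using DERIV_diff[OF DERIV_chain2[OF DERIV_exp T] DERIV_const] by simp
  have Vb: "\<bar>V' n s\<bar> \<le> exp (2 * real (Suc n))" for n s
  proof -
    have "exp (T n s) * T' n s \<le> exp (2 * real (Suc n)) * 1"
      using T'01 trunc_upper[of "real (Suc n)" s] by (intro mult_mono) (auto simp: T_def)
    then show ?thesis using T'01 by (simp add: V'_def abs_mult)
  qed
  \<comment> \<open>The pairing of \<open>F\<close> with \<open>V\<close> rests on this: the slope
    bound for \<open>damp\<close>, together with T' \<le> 1, which turns one factor T' of the square
    into 1.\<close>
  have FV: "(F' n s)\<^sup>2 \<le> V' n s" for n s
  proof -
    have "(F' n s)\<^sup>2 = (d (T n s))\<^sup>2 * (T' n s * T' n s)" by (simp add: F'_def power_mult_distrib power2_eq_square)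
    also have "\<dots> \<le> exp (T n s) * (1 * T' n s)" using d(2) T'01 by (intro mult_mono) auto
    finally show ?thesis by (simp add: V'_def)
  qed
  have Fb: "\<bar>F' n s\<bar> \<le> 1 + exp (2 * real (Suc n))" for n s
  proof -
    have "\<bar>F' n s\<bar> \<le> 1 + (F' n s)\<^sup>2" using sum_squares_bound[of 1 "\<bar>F' n s\<bar>"] zero_le_power2[of "F' n s"] by (simp)
    then show ?thesis using FV[of n s] Vb[of n s] by linarith
  qed
  note HF = Hc_compose[OF \<Omega> N FCk F0(1) FD Fb H]
  note TV = wsol_test_compose[OF w VCk F0(2) VD Vb]
  have grad: "(\<integral>x. (norm (F' n (u x) *\<^sub>R g x))\<^sup>2 \<partial>M) \<le> l * X / Z u" for n
  proof -
    have "(\<integral>x. (norm (F' n (u x) *\<^sub>R g x))\<^sup>2 \<partial>M) \<le> (\<integral>x. V' n (u x) * (norm (g x))\<^sup>2 \<partial>M)"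
      using Hc_sq_int(2)[OF HF] TV(2) FV
      by (intro integral_mono) (auto simp: sq_int_def power_mult_distrib intro!: mult_right_mono)
    also have "\<dots> = l * (\<integral>x. mf_density \<Omega> u x * V n (u x) \<partial>M)" by (rule TV(1))
    also have "(\<integral>x. mf_density \<Omega> u x * V n (u x) \<partial>M) \<le> (\<integral>x. exp (2 * u x) / Z u \<partial>M)"
    proof (rule integral_mono_AE[OF TV(3)])
      show "AE x in M. mf_density \<Omega> u x * V n (u x) \<le> exp (2 * u x) / Z u" using u0
      proof eventually_elim
        case (elim x)
        have "T n (u x) \<le> u x" using trunc_bounds(2)[OF _ elim] by (simp add: T_def)
        then have "exp (T n (u x)) \<le> exp (u x)" by simp
        then have "V n (u x) \<le> exp (u x)" unfolding V_def by linarith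
        then have "exp (u x) * V n (u x) \<le> exp (2 * u x)" by (simp add: exp_double power2_eq_square)
        then show ?case using Zp by (simp add: mf_density_eq divide_right_mono)
      qed
    qed (use iX in simp)
    also have "\<dots> = X / Z u" by (simp add: X_def)
    finally show ?thesis using l(1) by simp
  qed
  have sq: "(\<integral>x. (F n (u x))\<^sup>2 \<partial>M) \<le> Z u * m / (2 * k)" for n
  proof -
    have "(\<integral>x. (F n (u x))\<^sup>2 \<partial>M) \<le> (\<integral>x. exp (u x) * u x / (2 * k) \<partial>M)"
    proof (rule integral_mono_AE)
      show "AE x in M. (F n (u x))\<^sup>2 \<le> exp (u x) * u x / (2 * k)" using u0
      proof eventually_elim
        case (elim x)
        have t: "0 \<le> T n (u x)" "T n (u x) \<le> u x" using trunc_bounds[OF _ elim] by (auto simp: T_def)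
        have "(F n (u x))\<^sup>2 \<le> exp (T n (u x)) * T n (u x) / (2 * k)"
          unfolding F_def by (rule damp_sq_le[OF kp t(1)])
        also have "\<dots> \<le> exp (u x) * u x / (2 * k)"
          using t kp by (intro divide_right_mono mult_mono) auto
        finally show ?case .
      qed
    qed (use ieu Hc_sq_int(1)[OF HF] in \<open>auto simp: sq_int_def\<close>)
    also have "\<dots> = Z u * (\<integral>x. mf_density \<Omega> u x * u x \<partial>M) / (2 * k)" using eu by simp
    also have "\<dots> \<le> Z u * m / (2 * k)" using m Zp kp by (intro divide_right_mono mult_left_mono) auto
    finally show ?thesis .
  qed
  have quart: "(\<integral>x. (F n (u x)) ^ 4 \<partial>M) \<le> X / 32" for n
  proof -
    have "(\<integral>x. (F n (u x)) ^ 4 \<partial>M) \<le> 4 * (\<integral>x. (F n (u x))\<^sup>2 \<partial>M) * (\<integral>x. (norm (F' n (u x) *\<^sub>R g x))\<^sup>2 \<partial>M)"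
      by (rule Hc_ladyzhenskaya(2)[OF \<Omega> N HF])
    also have "\<dots> \<le> 4 * (Z u * m / (2 * k)) * (l * X / Z u)"
      using grad[of n] sq[of n] Zp m0 kp by (intro mult_mono) auto
    \<comment> \<open>The normalisation cancels, since it appears as Z in the bound for
      \<open>F\<close> and as 1 / Z in the bound for its gradient. The choice k \<ge> 64 lbar m then
      makes the factor at most 1/32.\<close>
    also have "\<dots> = (2 * l * m / k) * X" using Zp by simp
    also have "\<dots> \<le> (1 / 32) * X"
    proof (intro mult_right_mono X0)
      have "64 * (l * m) \<le> 64 * (lbar * m)" using l m0 by (intro mult_left_mono mult_right_mono) auto
      then have "64 * (l * m) \<le> k" using k(2) by linarith
      then show "2 * l * m / k \<le> 1 / 32" using kp by (simp add: field_simps)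
    qed
    finally show ?thesis by simp
  qed
  have lim: "AE x in M. (\<lambda>n. (F n (u x)) ^ 4) \<longlonglongrightarrow> (damp k (u x)) ^ 4"
  proof (rule AE_I2)
    fix x
    have "(\<lambda>n. damp k (T n (u x))) \<longlonglongrightarrow> damp k (u x)"
      unfolding T_def by (rule isCont_tendsto_compose[OF DERIV_isCont[OF d(1)] trunc_tendsto])
    then show "(\<lambda>n. (F n (u x)) ^ 4) \<longlonglongrightarrow> (damp k (u x)) ^ 4" unfolding F_def by (rule tendsto_power)
  qed
  have mdamp: "(\<lambda>x. (damp k (u x)) ^ 4) \<in> borel_measurable M" unfolding damp_def by measurable
  note Fa = fatou_integral[OF Hc_ladyzhenskaya(1)[OF \<Omega> N HF] _ mdamp lim quart tendsto_const]
  have "X \<le> (\<integral>x. 16 * (damp k (u x)) ^ 4 + exp (2 * k) \<partial>M)"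
    unfolding X_def
  proof (rule integral_mono_AE[OF iX])
    show "integrable M (\<lambda>x. 16 * (damp k (u x)) ^ 4 + exp (2 * k))" using Fa(1) by simp
    show "AE x in M. exp (2 * u x) \<le> 16 * (damp k (u x)) ^ 4 + exp (2 * k)"
      using u0 by eventually_elim (rule exp_le_damp[OF kp])
  qed
  also have "\<dots> = 16 * (\<integral>x. (damp k (u x)) ^ 4 \<partial>M) + exp (2 * k) * measure lebesgue \<Omega>"
    using Fa(1) by (simp add: measure_M)
  also have "\<dots> \<le> 16 * (X / 32) + exp (2 * k) * measure lebesgue \<Omega>" using Fa(2) by simp
  \<comment> \<open>The summand 16 (X / 32) = X / 2 is absorbed by the left side, which is sound
    because X is the integral of an integrable function by \<open>iX\<close>.\<close>
  finally have Xle: "X \<le> 2 * exp (2 * k) * measure lebesgue \<Omega>" by simp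
  have Zge: "measure lebesgue \<Omega> \<le> Z u"
  proof -
    have "(\<integral>x. 1 \<partial>M) \<le> Z u"
      by (rule integral_mono_AE[OF _ exp_integrable(2)[OF H]], simp, use u0 in eventually_elim) simp
    then show ?thesis by (simp add: measure_M)
  qed
  have "(\<integral>x. (mf_density \<Omega> u x)\<^sup>2 \<partial>M) = X / (Z u)\<^sup>2"
    by (simp add: mf_density_eq power_divide exp_double[symmetric] X_def)
  also have "\<dots> \<le> (2 * exp (2 * k) * measure lebesgue \<Omega>) / (measure lebesgue \<Omega>)\<^sup>2"
    using Xle Zge pos X0 by (intro frac_le power_mono) auto
  also have "\<dots> = 2 * exp (2 * k) / measure lebesgue \<Omega>" using pos by (simp add: power2_eq_square)
  finally show ?thesis .
qed

end

context
  fixes \<Omega> :: "complex set" and N :: "nat set"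
  assumes \<Omega>: "open \<Omega>" "bounded \<Omega>" and N: "2 \<in> N" and pos: "0 < measure lebesgue \<Omega>"
begin

interpretation finite_measure "lebesgue_on \<Omega>" by (rule finite_measure_lebesgue_on[OF \<Omega>])

text \<open>With \<kappa> the difference of the logarithms of the two normalisations, w1 = w2 exp (w
  - \<kappa>). As w1 - w2 has mass zero, w may be replaced by w - \<kappa> in the integral, where
  \<open>exp_diff_mult_le\<close> applies pointwise. It remains to bound \<kappa>^2, and \<kappa>
  lies between the means b and a of w under the two densities.\<close>

lemma density_difference_bound:
  assumes H1: "Hc N \<Omega> u1 g1" and H2: "Hc N \<Omega> u2 g2"
  defines "w1 \<equiv> mf_density \<Omega> u1" and "w2 \<equiv> mf_density \<Omega> u2"
  defines "w \<equiv> (\<lambda>x. u1 x - u2 x)"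
  shows "0 \<le> (\<integral>x. (w1 x - w2 x) * w x \<partial>lebesgue_on \<Omega>)"
    "(\<integral>x. (w1 x - w2 x) * w x \<partial>lebesgue_on \<Omega>) \<le> 6 * (\<integral>x. (w1 x + w2 x) * (w x)\<^sup>2 \<partial>lebesgue_on \<Omega>)"
    "integrable (lebesgue_on \<Omega>) (\<lambda>x. (w1 x + w2 x) * (w x)\<^sup>2)"
proof -
  define \<kappa> where "\<kappa> = ln (\<integral>x. exp (u1 x) \<partial>lebesgue_on \<Omega>) - ln (\<integral>x. exp (u2 x) \<partial>lebesgue_on \<Omega>)"
  note Hw = Hc_diff[OF \<Omega> N H1 H2, folded w_def]
  have sw: "sq_int (lebesgue_on \<Omega>) w" by (rule Hc_sq_int(1)[OF Hw])
  have s1: "sq_int (lebesgue_on \<Omega>) w1" and s2: "sq_int (lebesgue_on \<Omega>) w2"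
    unfolding w1_def w2_def using mf_density_sq_int[OF \<Omega> N pos] H1 H2 by auto
  have sw2: "sq_int (lebesgue_on \<Omega>) (\<lambda>x. (w x)\<^sup>2)" using Hc_ladyzhenskaya(1)[OF \<Omega> N Hw] sw by (auto simp: sq_int_def)
  have i1: "integrable (lebesgue_on \<Omega>) w1" "(\<integral>x. w1 x \<partial>lebesgue_on \<Omega>) = 1" and i2: "integrable (lebesgue_on \<Omega>) w2" "(\<integral>x. w2 x \<partial>lebesgue_on \<Omega>) = 1"
    unfolding w1_def w2_def using mf_density_integral[OF \<Omega> N pos] H1 H2 by auto
  have iw: "integrable (lebesgue_on \<Omega>) (\<lambda>x. w1 x * w x)" "integrable (lebesgue_on \<Omega>) (\<lambda>x. w2 x * w x)"
    "integrable (lebesgue_on \<Omega>) (\<lambda>x. w1 x * (w x)\<^sup>2)" "integrable (lebesgue_on \<Omega>) (\<lambda>x. w2 x * (w x)\<^sup>2)"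
    using sq_int_mult[OF s1 sw] sq_int_mult[OF s2 sw] sq_int_mult[OF s1 sw2] sq_int_mult[OF s2 sw2] by auto
  show S_int: "integrable (lebesgue_on \<Omega>) (\<lambda>x. (w1 x + w2 x) * (w x)\<^sup>2)" using iw by (simp add: distrib_right)
  have e1: "w1 x = exp (u1 x - ln (\<integral>x. exp (u1 x) \<partial>lebesgue_on \<Omega>))" and e2: "w2 x = exp (u2 x - ln (\<integral>x. exp (u2 x) \<partial>lebesgue_on \<Omega>))" for x
    unfolding w1_def w2_def using mf_density_exp[OF \<Omega> N pos] H1 H2 by auto
  have n: "0 \<le> w1 x" "0 \<le> w2 x" for x by (simp_all add: e1 e2)
  have d: "w x - \<kappa> = (u1 x - ln (\<integral>x. exp (u1 x) \<partial>lebesgue_on \<Omega>)) - (u2 x - ln (\<integral>x. exp (u2 x) \<partial>lebesgue_on \<Omega>))" for x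
    by (simp add: w_def \<kappa>_def)
  define a b where "a = (\<integral>x. w1 x * w x \<partial>lebesgue_on \<Omega>)" and "b = (\<integral>x. w2 x * w x \<partial>lebesgue_on \<Omega>)"
  define A B where "A = (\<integral>x. w1 x * (w x)\<^sup>2 \<partial>lebesgue_on \<Omega>)" and "B = (\<integral>x. w2 x * (w x)\<^sup>2 \<partial>lebesgue_on \<Omega>)"
  have S: "(\<integral>x. (w1 x + w2 x) * (w x)\<^sup>2 \<partial>lebesgue_on \<Omega>) = A + B" using iw by (simp add: distrib_right A_def B_def)
  have ab: "(\<integral>x. (w1 x - w2 x) * w x \<partial>lebesgue_on \<Omega>) = a - b" using iw by (simp add: left_diff_distrib a_def b_def)
  have k: "(\<integral>x. (w1 x - w2 x) * (w x - \<kappa>) \<partial>lebesgue_on \<Omega>) = a - b"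
  proof -
    have "(w1 x - w2 x) * (w x - \<kappa>) = w1 x * w x - w2 x * w x - \<kappa> * w1 x + \<kappa> * w2 x" for x by algebra
    then show ?thesis using iw i1 i2 by (simp add: a_def b_def)
  qed
  show "0 \<le> (\<integral>x. (w1 x - w2 x) * w x \<partial>lebesgue_on \<Omega>)"
    unfolding ab k[symmetric]
    by (rule Bochner_Integration.integral_nonneg) (simp only: e1 e2 d exp_diff_mult_nonneg)
  \<comment> \<open>Jensen's inequality for exp, in the form 1 + t \<le> exp t at t = w - \<kappa>
    with weight w2: the right side integrates to the mass of w1. The same with - t and weight w1
    gives \<kappa> \<le> a.\<close>
  have "b \<le> \<kappa>"
  proof -
    have "(\<integral>x. w2 x + w2 x * w x - \<kappa> * w2 x \<partial>lebesgue_on \<Omega>) \<le> (\<integral>x. w1 x \<partial>lebesgue_on \<Omega>)"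
    proof (rule integral_mono)
      show "w2 x + w2 x * w x - \<kappa> * w2 x \<le> w1 x" for x
      proof -
        have "w2 x * (1 + (w x - \<kappa>)) \<le> w2 x * exp (w x - \<kappa>)"
          by (intro mult_left_mono exp_ge_add_one_self n)
        also have "\<dots> = w1 x" unfolding d unfolding e1 e2 by (simp add: exp_add[symmetric])
        finally show ?thesis by (simp add: algebra_simps)
      qed
    qed (use i1 i2 iw in auto)
    then show ?thesis using i1 i2 iw by (simp add: b_def)
  qed
  moreover have "\<kappa> \<le> a"
  proof -
    have "(\<integral>x. w1 x - w1 x * w x + \<kappa> * w1 x \<partial>lebesgue_on \<Omega>) \<le> (\<integral>x. w2 x \<partial>lebesgue_on \<Omega>)"
    proof (rule integral_mono)
      show "w1 x - w1 x * w x + \<kappa> * w1 x \<le> w2 x" for x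
      proof -
        have "w1 x * (1 + (- (w x - \<kappa>))) \<le> w1 x * exp (- (w x - \<kappa>))"
          by (intro mult_left_mono exp_ge_add_one_self n)
        also have "\<dots> = w2 x" unfolding d unfolding e1 e2 by (simp add: exp_add[symmetric])
        finally show ?thesis by (simp add: algebra_simps)
      qed
    qed (use i1 i2 iw in auto)
    then show ?thesis using i1 i2 iw by (simp add: a_def)
  qed
  \<comment> \<open>The variance of w under the probability density w1 is nonnegative.\<close>
  moreover have "a\<^sup>2 \<le> A"
  proof -
    have "0 \<le> (\<integral>x. w1 x * (w x - a)\<^sup>2 \<partial>lebesgue_on \<Omega>)" using n by (intro Bochner_Integration.integral_nonneg) auto
    also have "\<dots> = (\<integral>x. w1 x * (w x)\<^sup>2 - 2 * a * (w1 x * w x) + a\<^sup>2 * w1 x \<partial>lebesgue_on \<Omega>)"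
      by (intro Bochner_Integration.integral_cong refl) (simp add: power2_eq_square algebra_simps)
    also have "\<dots> = A - a\<^sup>2" using iw i1 by (simp add: A_def a_def power2_eq_square)
    finally show ?thesis by simp
  qed
  moreover have "b\<^sup>2 \<le> B"
  proof -
    have "0 \<le> (\<integral>x. w2 x * (w x - b)\<^sup>2 \<partial>lebesgue_on \<Omega>)" using n by (intro Bochner_Integration.integral_nonneg) auto
    also have "\<dots> = (\<integral>x. w2 x * (w x)\<^sup>2 - 2 * b * (w2 x * w x) + b\<^sup>2 * w2 x \<partial>lebesgue_on \<Omega>)"
      by (intro Bochner_Integration.integral_cong refl) (simp add: power2_eq_square algebra_simps)
    also have "\<dots> = B - b\<^sup>2" using iw i2 by (simp add: B_def b_def power2_eq_square)
    finally show ?thesis by simp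
  qed
  ultimately have k2: "\<kappa>\<^sup>2 \<le> A + B"
  proof -
    assume *: "b \<le> \<kappa>" "\<kappa> \<le> a" "a\<^sup>2 \<le> A" "b\<^sup>2 \<le> B"
    have nn: "0 \<le> a\<^sup>2" "0 \<le> b\<^sup>2" by auto
    show ?thesis
    proof (cases "0 \<le> \<kappa>")
      case True
      then have "\<kappa>\<^sup>2 \<le> a\<^sup>2" using * by (intro power_mono) auto
      then show ?thesis using * nn by linarith
    next
      case False
      then have "(- \<kappa>)\<^sup>2 \<le> (- b)\<^sup>2" using * by (intro power_mono) auto
      then have "\<kappa>\<^sup>2 \<le> b\<^sup>2" by simp
      then show ?thesis using * nn by linarith
    qed
  qed
  have kw: "integrable (lebesgue_on \<Omega>) (\<lambda>x. (w1 x + w2 x) * (2 * (w x)\<^sup>2 + 2 * \<kappa>\<^sup>2))"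
  proof -
    have "(\<lambda>x. (w1 x + w2 x) * (2 * (w x)\<^sup>2 + 2 * \<kappa>\<^sup>2)) =
        (\<lambda>x. 2 * (w1 x * (w x)\<^sup>2) + 2 * (w2 x * (w x)\<^sup>2) + 2 * \<kappa>\<^sup>2 * w1 x + 2 * \<kappa>\<^sup>2 * w2 x)"
      by (rule ext) algebra
    then show ?thesis using iw i1 i2 by simp
  qed
  have "a - b \<le> (\<integral>x. (w1 x + w2 x) * (2 * (w x)\<^sup>2 + 2 * \<kappa>\<^sup>2) \<partial>lebesgue_on \<Omega>)"
    unfolding k[symmetric]
  proof (rule integral_mono[OF _ kw])
    have "(\<lambda>x. (w1 x - w2 x) * (w x - \<kappa>)) = (\<lambda>x. w1 x * w x - w2 x * w x - \<kappa> * w1 x + \<kappa> * w2 x)"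
      by (rule ext) algebra
    then show "integrable (lebesgue_on \<Omega>) (\<lambda>x. (w1 x - w2 x) * (w x - \<kappa>))" using iw i1 i2 by simp
    fix x
    have "(w1 x - w2 x) * (w x - \<kappa>) \<le> (w1 x + w2 x) * (w x - \<kappa>)\<^sup>2"
      by (simp only: e1 e2 d exp_diff_mult_le)
    also have "\<dots> \<le> (w1 x + w2 x) * (2 * (w x)\<^sup>2 + 2 * \<kappa>\<^sup>2)"
      using n[of x] norm_add_sq_le[of "w x" "- \<kappa>"] by (intro mult_left_mono) auto
    finally show "(w1 x - w2 x) * (w x - \<kappa>) \<le> (w1 x + w2 x) * (2 * (w x)\<^sup>2 + 2 * \<kappa>\<^sup>2)" .
  qed
  also have "\<dots> = (\<integral>x. 2 * (w1 x * (w x)\<^sup>2) + 2 * (w2 x * (w x)\<^sup>2) + 2 * \<kappa>\<^sup>2 * w1 x + 2 * \<kappa>\<^sup>2 * w2 x \<partial>lebesgue_on \<Omega>)"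
    by (intro Bochner_Integration.integral_cong refl) (simp add: algebra_simps)
  \<comment> \<open>The constant 2 \<kappa>^2 is integrated against w1 + w2, whose mass is 2; with
    \<kappa>^2 \<le> A + B the total is 2 + 4 = 6.\<close>
  also have "\<dots> = 2 * (A + B) + 4 * \<kappa>\<^sup>2" using iw i1 i2 by (simp add: A_def B_def)
  also have "\<dots> \<le> 6 * (A + B)" using k2 by simp
  finally show "(\<integral>x. (w1 x - w2 x) * w x \<partial>lebesgue_on \<Omega>) \<le> 6 * (\<integral>x. (w1 x + w2 x) * (w x)\<^sup>2 \<partial>lebesgue_on \<Omega>)"
    unfolding ab S .
qed

text \<open>For l > 0 the Dirichlet integral D of u1 - u2 satisfies D \<le> 48 l h sqrt (C /
  |\<Omega>|) D. Here 48 = 6 * 2 * 4: 6 from the comparison of densities, 2 for the number of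
  densities, and 4 as the root of 4 * 4, from Ladyzhenskaya followed by Poincare. The hypothesis
  \<open>big\<close> says that this factor is below 1 at \<open>lbar\<close>.\<close>

lemma wsol_unique:
  assumes w1: "wsol N \<Omega> l u1 g1" and w2: "wsol N \<Omega> l u2 g2"
    and e: "norm e = 1" and h: "\<And>x. x \<in> \<Omega> \<Longrightarrow> \<bar>x \<bullet> e - c\<bar> \<le> h" "0 \<le> h"
    and C: "0 \<le> C" and big: "(48 * lbar * h)\<^sup>2 * C < measure lebesgue \<Omega>" and l: "l \<le> lbar"
    and b1: "0 < l \<Longrightarrow> (\<integral>x. (mf_density \<Omega> u1 x)\<^sup>2 \<partial>lebesgue_on \<Omega>) \<le> C / measure lebesgue \<Omega>"
    and b2: "0 < l \<Longrightarrow> (\<integral>x. (mf_density \<Omega> u2 x)\<^sup>2 \<partial>lebesgue_on \<Omega>) \<le> C / measure lebesgue \<Omega>"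
  shows "AE x in lebesgue_on \<Omega>. u1 x = u2 x"
proof -
  define m where "m = measure lebesgue \<Omega>"
  note H1 = wsolD(1)[OF \<Omega> N pos w1] and H2 = wsolD(1)[OF \<Omega> N pos w2]
  note Hw = Hc_diff[OF \<Omega> N H1 H2]
  note dd = density_difference_bound[OF H1 H2]
  define D where "D = (\<integral>x. (norm (g1 x - g2 x))\<^sup>2 \<partial>lebesgue_on \<Omega>)"
  define w where "w = (\<lambda>x. u1 x - u2 x)"
  have D0: "0 \<le> D" by (simp add: D_def)
  have sw: "sq_int (lebesgue_on \<Omega>) w" unfolding w_def by (rule Hc_sq_int(1)[OF Hw])
  have s1: "sq_int (lebesgue_on \<Omega>) (mf_density \<Omega> u1)" and s2: "sq_int (lebesgue_on \<Omega>) (mf_density \<Omega> u2)"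
    using mf_density_sq_int[OF \<Omega> N pos] H1 H2 by auto
  note sg = Hc_sq_int(2)[OF H1] Hc_sq_int(2)[OF H2] Hc_sq_int(2)[OF Hw]
  have Deq: "D = l * (\<integral>x. (mf_density \<Omega> u1 x - mf_density \<Omega> u2 x) * w x \<partial>lebesgue_on \<Omega>)"
  proof -
    have "D = (\<integral>x. g1 x \<bullet> (g1 x - g2 x) \<partial>lebesgue_on \<Omega>) - (\<integral>x. g2 x \<bullet> (g1 x - g2 x) \<partial>lebesgue_on \<Omega>)"
      using sq_int_inner[OF sg(1,3)] sq_int_inner[OF sg(2,3)]
      by (simp add: D_def power2_norm_eq_inner inner_diff_left)
    also have "\<dots> = l * (\<integral>x. mf_density \<Omega> u1 x * w x \<partial>lebesgue_on \<Omega>) - l * (\<integral>x. mf_density \<Omega> u2 x * w x \<partial>lebesgue_on \<Omega>)"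
      using wsolD(2)[OF \<Omega> N pos w1 Hw] wsolD(2)[OF \<Omega> N pos w2 Hw] by (simp add: w_def)
    finally show ?thesis
      using sq_int_mult[OF s1 sw] sq_int_mult[OF s2 sw] by (simp add: left_diff_distrib right_diff_distrib)
  qed
  have "D = 0"
  proof (cases "0 < l")
    case False
    then have "D \<le> 0" unfolding Deq using dd(1) by (auto simp: w_def intro: mult_nonpos_nonneg)
    then show ?thesis using D0 by simp
  next
    case True
    have L: "integrable (lebesgue_on \<Omega>) (\<lambda>x. (w x) ^ 4)" "(\<integral>x. (w x) ^ 4 \<partial>lebesgue_on \<Omega>) \<le> 4 * (\<integral>x. (w x)\<^sup>2 \<partial>lebesgue_on \<Omega>) * D"
      using Hc_ladyzhenskaya[OF \<Omega> N Hw] by (auto simp: w_def D_def)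
    have P: "(\<integral>x. (w x)\<^sup>2 \<partial>lebesgue_on \<Omega>) \<le> 4 * h\<^sup>2 * D"
      using Hc_poincare[OF \<Omega> N Hw e h] by (simp add: w_def D_def)
    have "(\<integral>x. (w x) ^ 4 \<partial>lebesgue_on \<Omega>) \<le> 4 * (4 * h\<^sup>2 * D) * D"
      using L(2) P D0 by (meson mult_left_mono mult_right_mono order_trans zero_le_numeral)
    then have Q: "(\<integral>x. (w x) ^ 4 \<partial>lebesgue_on \<Omega>) \<le> (4 * h * D)\<^sup>2" by (simp add: power2_eq_square mult_ac)
    have sw2: "sq_int (lebesgue_on \<Omega>) (\<lambda>x. (w x)\<^sup>2)" using L sw by (auto simp: sq_int_def)
    have T: "(\<integral>x. f x * (w x)\<^sup>2 \<partial>lebesgue_on \<Omega>) \<le> sqrt (C / m) * (4 * h * D)"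
      if "sq_int (lebesgue_on \<Omega>) f" "(\<integral>x. (f x)\<^sup>2 \<partial>lebesgue_on \<Omega>) \<le> C / m" for f
    proof -
      have "(\<integral>x. f x * (w x)\<^sup>2 \<partial>lebesgue_on \<Omega>) \<le> sqrt (\<integral>x. (f x)\<^sup>2 \<partial>lebesgue_on \<Omega>) * sqrt (\<integral>x. (w x) ^ 4 \<partial>lebesgue_on \<Omega>)"
        using cauchy_schwarz_integral_real[OF that(1) sw2] by simp
      also have "\<dots> \<le> sqrt (C / m) * sqrt ((4 * h * D)\<^sup>2)"
        using that Q C pos by (intro mult_mono real_sqrt_le_mono) (auto simp: m_def)
      also have "\<dots> = sqrt (C / m) * (4 * h * D)" using h(2) D0 by simp
      finally show ?thesis .
    qed
    have "D \<le> l * (6 * (\<integral>x. (mf_density \<Omega> u1 x + mf_density \<Omega> u2 x) * (w x)\<^sup>2 \<partial>lebesgue_on \<Omega>))"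
      unfolding Deq using True dd(2) by (intro mult_left_mono) (auto simp: w_def)
    also have "(\<integral>x. (mf_density \<Omega> u1 x + mf_density \<Omega> u2 x) * (w x)\<^sup>2 \<partial>lebesgue_on \<Omega>) =
        (\<integral>x. mf_density \<Omega> u1 x * (w x)\<^sup>2 \<partial>lebesgue_on \<Omega>) + (\<integral>x. mf_density \<Omega> u2 x * (w x)\<^sup>2 \<partial>lebesgue_on \<Omega>)"
      using sq_int_mult[OF s1 sw2] sq_int_mult[OF s2 sw2] by (simp add: distrib_right)
    also have "l * (6 * \<dots>) \<le> l * (6 * (2 * (sqrt (C / m) * (4 * h * D))))"
      using T[OF s1] T[OF s2] b1[OF True] b2[OF True] True by (intro mult_left_mono) (auto simp: m_def)
    also have "\<dots> = (48 * l * h * sqrt (C / m)) * D" by simp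
    finally have DD: "D \<le> (48 * l * h * sqrt (C / m)) * D" .
    have "48 * l * h * sqrt (C / m) < 1"
    proof -
      have "48 * l * h * sqrt (C / m) \<le> 48 * lbar * h * sqrt (C / m)"
        using l h(2) C pos by (intro mult_right_mono) (auto simp: m_def)
      also have "\<dots> < 1"
      proof -
        have "(48 * lbar * h * sqrt (C / m))\<^sup>2 < 1\<^sup>2"
          using big pos C by (simp add: power_mult_distrib m_def)
        then show ?thesis by (rule power_less_imp_less_base) simp
      qed
      finally show ?thesis .
    qed
    then show ?thesis using DD D0 mult_right_mono
      by (metis antisym_conv2 leD mult_less_cancel_right2)
  qed
  then have "(\<integral>x. (w x)\<^sup>2 \<partial>lebesgue_on \<Omega>) \<le> 0"
    using Hc_poincare[OF \<Omega> N Hw e h] by (simp add: w_def D_def)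
  then have "(\<integral>x. (w x)\<^sup>2 \<partial>lebesgue_on \<Omega>) = 0" by (intro antisym Bochner_Integration.integral_nonneg) auto
  then have "AE x in lebesgue_on \<Omega>. (w x)\<^sup>2 = 0"
    using sw by (subst (asm) integral_nonneg_eq_0_iff_AE) (auto simp: sq_int_def)
  then show ?thesis by eventually_elim (simp add: w_def)
qed

end

subsection \<open>The logarithmic potential\<close>

text \<open>The value is \<open>2 \<pi>\<close>, which is never needed. The integrand is the Laplacian of
  \<open>ln (1 + |z|\<^sup>2) / 2\<close>, whose rescalings regularise \<open>ln |z|\<close>.\<close>

definition newton_const :: real where
  "newton_const = (\<integral>z. 2 / (1 + (norm z)\<^sup>2)\<^sup>2 \<partial>(lborel :: complex measure))"

lemma integrable_inverse_one_plus_square: "integrable lborel (\<lambda>x::real. 1 / (1 + x\<^sup>2))"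
proof (rule fatou_integral(1)[where F="\<lambda>n x. 1 / (1 + x\<^sup>2) * indicator {- real n..real n} x" and C="\<lambda>n. pi" and c=pi])
  have nz: "1 + x\<^sup>2 \<noteq> 0" for x :: real by (metis add_pos_nonneg less_numeral_extra(1,3) zero_le_power2)
  have ct: "isCont (\<lambda>x::real. 1 / (1 + x\<^sup>2)) x" for x by (intro continuous_intros) (simp add: nz)
  have d: "(arctan has_real_derivative 1 / (1 + x\<^sup>2)) (at x)" for x by (auto intro!: derivative_eq_intros simp: divide_inverse)
  show "integrable lborel (\<lambda>x. 1 / (1 + x\<^sup>2) * indicator {- real n..real n} x)" for n
    by (rule borel_integrable_atLeastAtMost) (rule ct)
  have "(\<integral>x. 1 / (1 + x\<^sup>2) * indicator {- real n..real n} x \<partial>lborel) = arctan (real n) - arctan (- real n)" for n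
    by (rule integral_FTC_Icc_real) (auto intro: d ct)
  then show "(\<integral>x. 1 / (1 + x\<^sup>2) * indicator {- real n..real n} x \<partial>lborel) \<le> pi" for n
    using arctan_ubound[of "real n"] by (simp add: arctan_minus)
  show "AE x in lborel. (\<lambda>n. 1 / (1 + x\<^sup>2) * indicator {- real n..real n} x) \<longlonglongrightarrow> 1 / (1 + x\<^sup>2)"
  proof (rule AE_I2)
    fix x :: real
    obtain n0 :: nat where n0: "\<bar>x\<bar> \<le> n0" using real_arch_simple by blast
    have "eventually (\<lambda>n. 1 / (1 + x\<^sup>2) = 1 / (1 + x\<^sup>2) * indicator {- real n..real n} x) sequentially"
      using eventually_ge_at_top[of n0] by eventually_elim (use n0 in \<open>auto simp: indicator_def abs_le_iff\<close>)
    then show "(\<lambda>n. 1 / (1 + x\<^sup>2) * indicator {- real n..real n} x) \<longlonglongrightarrow> 1 / (1 + x\<^sup>2)"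
      by (rule Lim_transform_eventually[OF tendsto_const])
  qed
qed (auto simp: add_nonneg_nonneg)

text \<open>The square of 1 + x^2 + y^2 dominates (1 + x^2) (1 + y^2), which reduces the claim to
  two integrals of the derivative of arctan.\<close>

lemma newton_kernel_integrable: "integrable (lborel :: complex measure) (\<lambda>z. 2 / (1 + (norm z)\<^sup>2)\<^sup>2)"
proof (rule integrableI_nonneg)
  have le: "2 / (1 + (norm (Complex x y))\<^sup>2)\<^sup>2 \<le> 2 * (1 / (1 + x\<^sup>2)) * (1 / (1 + y\<^sup>2))" for x y
  proof -
    have "(1 + x\<^sup>2) * (1 + y\<^sup>2) \<le> (1 + (x\<^sup>2 + y\<^sup>2)) * (1 + (x\<^sup>2 + y\<^sup>2))" by (intro mult_mono) auto
    then have "(1 + x\<^sup>2) * (1 + y\<^sup>2) \<le> (1 + (norm (Complex x y))\<^sup>2)\<^sup>2" unfolding cmod_power2 power2_eq_square[of "1 + _"] by simp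
    moreover have "0 < (1 + x\<^sup>2) * (1 + y\<^sup>2)" by (intro mult_pos_pos) (auto intro: add_pos_nonneg)
    ultimately have "2 / (1 + (norm (Complex x y))\<^sup>2)\<^sup>2 \<le> 2 / ((1 + x\<^sup>2) * (1 + y\<^sup>2))" by (intro frac_le) auto
    then show ?thesis by simp
  qed
  define I where "I = (\<integral>\<^sup>+x. ennreal (1 / (1 + x\<^sup>2)) \<partial>(lborel :: real measure))"
  have I: "I < \<infinity>" unfolding I_def using integrable_inverse_one_plus_square
    by (subst nn_integral_eq_integral) (auto simp: add_nonneg_nonneg)
  have "(\<integral>\<^sup>+z. ennreal (2 / (1 + (norm z)\<^sup>2)\<^sup>2) \<partial>(lborel :: complex measure)) =
      (\<integral>\<^sup>+x. \<integral>\<^sup>+y. ennreal (2 / (1 + (norm (Complex x y))\<^sup>2)\<^sup>2) \<partial>lborel \<partial>lborel)"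
    by (rule nn_integral_complex) measurable
  also have "\<dots> \<le> (\<integral>\<^sup>+x. \<integral>\<^sup>+y. ennreal 2 * ennreal (1 / (1 + x\<^sup>2)) * ennreal (1 / (1 + y\<^sup>2)) \<partial>lborel \<partial>lborel)"
  proof (intro nn_integral_mono)
    fix x y :: real
    have nn: "0 \<le> 1 / (1 + t\<^sup>2)" for t :: real by (simp add: add_nonneg_nonneg)
    have "ennreal 2 * ennreal (1 / (1 + x\<^sup>2)) * ennreal (1 / (1 + y\<^sup>2)) = ennreal (2 * (1 / (1 + x\<^sup>2)) * (1 / (1 + y\<^sup>2)))"
      by (simp only: ennreal_mult mult_nonneg_nonneg zero_le_numeral nn)
    then show "ennreal (2 / (1 + (norm (Complex x y))\<^sup>2)\<^sup>2) \<le> ennreal 2 * ennreal (1 / (1 + x\<^sup>2)) * ennreal (1 / (1 + y\<^sup>2))"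
      using ennreal_leI[OF le[of x y]] by simp
  qed
  also have "\<dots> = ennreal 2 * I * I"
    by (simp add: nn_integral_cmult nn_integral_multc I_def)
  also have "\<dots> < \<infinity>" using I by (simp add: ennreal_mult_less_top)
  finally show "(\<integral>\<^sup>+z. ennreal (2 / (1 + (norm z)\<^sup>2)\<^sup>2) \<partial>(lborel :: complex measure)) < \<infinity>" .
qed (auto intro!: borel_measurable_divide)

lemma newton_const_pos: "0 < newton_const"
proof -
  have "newton_const \<noteq> 0"
  proof
    assume "newton_const = 0"
    then have "AE z in (lborel :: complex measure). 2 / (1 + (norm z)\<^sup>2)\<^sup>2 = 0"
      unfolding newton_const_def using newton_kernel_integrable by (subst (asm) integral_nonneg_eq_0_iff_AE) auto
    then have "AE z in (lborel :: complex measure). False"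
    proof eventually_elim
      case (elim z)
      have "0 < 1 + (norm z)\<^sup>2" by (intro add_pos_nonneg) auto
      then show ?case using elim by simp
    qed
    then have "emeasure lborel (space (lborel :: complex measure)) = 0"
      using AE_iff_measurable[of "space lborel" "lborel :: complex measure" "\<lambda>x. False"] by auto
    then show False by simp
  qed
  moreover have "0 \<le> newton_const" unfolding newton_const_def by (intro Bochner_Integration.integral_nonneg) auto
  ultimately show ?thesis by simp
qed

lemma integral_complex_affine:
  fixes f :: "complex \<Rightarrow> real"
  assumes [measurable]: "f \<in> borel_measurable borel" and c: "c > 0"
  shows "(\<integral>x. f x \<partial>lborel) = c\<^sup>2 * (\<integral>z. f (t + c *\<^sub>R z) \<partial>lborel)"
proof -
  have "(\<integral>x. f x \<partial>lborel) = (\<integral>x. f x \<partial>(density (distr lborel borel (\<lambda>x. t + c *\<^sub>R x)) (\<lambda>_. ennreal (\<bar>c\<bar> ^ DIM(complex)))))"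
    using lborel_affine[of c t] c by simp
  also have "\<dots> = (\<integral>z. (\<bar>c\<bar> ^ DIM(complex)) *\<^sub>R f (t + c *\<^sub>R z) \<partial>lborel)"
    by (subst integral_density) (auto simp: integral_distr)
  finally show ?thesis using c by simp
qed

section \<open>Square integrability of the logarithmic kernel\<close>

lemma nn_integral_inverse_sqrt_abs:
  assumes "0 < d"
  shows "(\<integral>\<^sup>+a. ennreal (1 / sqrt \<bar>a - t\<bar>) * indicator {t - d..t + d} a \<partial>lborel) = ennreal (4 * sqrt d)"
proof -
  let ?F = "\<lambda>a. 2 * sgn (a - t) * sqrt \<bar>a - t\<bar>"
  have "((\<lambda>a. 1 / sqrt \<bar>a - t\<bar>) has_integral (?F (t + d) - ?F (t - d))) {t - d..t + d}"
  proof (rule fundamental_theorem_of_calculus_interior_strong[of "{t}"])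
    show "continuous_on {t - d..t + d} ?F"
    proof -
      have eq: "?F = (\<lambda>a. 2 * sqrt (max 0 (a - t)) - 2 * sqrt (max 0 (t - a)))"
        by (auto simp: fun_eq_iff sgn_if max_def)
      show ?thesis unfolding eq by (intro continuous_intros)
    qed
    fix a assume a: "a \<in> {t - d<..<t + d} - {t}"
    show "(?F has_vector_derivative 1 / sqrt \<bar>a - t\<bar>) (at a)"
    proof (cases "t < a")
      case True
      have "((\<lambda>a. 2 * sqrt (a - t)) has_real_derivative 2 * (inverse (sqrt (a - t)) / 2 * 1)) (at a)"
        using True by (intro DERIV_cmult DERIV_chain2[OF DERIV_real_sqrt]) (auto intro!: derivative_eq_intros)
      moreover have "2 * (inverse (sqrt (a - t)) / 2 * 1) = 1 / sqrt \<bar>a - t\<bar>" using True by (simp add: inverse_eq_divide)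
      ultimately have "((\<lambda>a. 2 * sqrt (a - t)) has_real_derivative 1 / sqrt \<bar>a - t\<bar>) (at a)"
        by (rule DERIV_cong)
      then have "(?F has_real_derivative 1 / sqrt \<bar>a - t\<bar>) (at a)"
        by (rule has_field_derivative_transform_within_open[of _ _ _ "{t<..}"]) (use True in auto)
      then show ?thesis by (simp add: has_real_derivative_iff_has_vector_derivative)
    next
      case False
      then have at: "a < t" using a by auto
      have "((\<lambda>a. - 2 * sqrt (t - a)) has_real_derivative - 2 * (inverse (sqrt (t - a)) / 2 * (- 1))) (at a)"
        using at by (intro DERIV_cmult DERIV_chain2[OF DERIV_real_sqrt]) (auto intro!: derivative_eq_intros)
      moreover have "- 2 * (inverse (sqrt (t - a)) / 2 * (- 1)) = 1 / sqrt \<bar>a - t\<bar>" using at by (simp add: inverse_eq_divide)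
      ultimately have "((\<lambda>a. - 2 * sqrt (t - a)) has_real_derivative 1 / sqrt \<bar>a - t\<bar>) (at a)"
        by (rule DERIV_cong)
      then have "(?F has_real_derivative 1 / sqrt \<bar>a - t\<bar>) (at a)"
        by (rule has_field_derivative_transform_within_open[of _ _ _ "{..<t}"]) (use at in auto)
      then show ?thesis by (simp add: has_real_derivative_iff_has_vector_derivative)
    qed
  qed (use assms in auto)
  moreover have "?F (t + d) - ?F (t - d) = 4 * sqrt d" using assms by simp
  ultimately have h: "((\<lambda>a. 1 / sqrt \<bar>a - t\<bar>) has_integral (4 * sqrt d)) {t - d..t + d}" by simp
  have "(\<integral>\<^sup>+a. indicator {t - d..t + d} a * ennreal (1 / sqrt \<bar>a - t\<bar>) \<partial>lborel) = ennreal (4 * sqrt d)"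
    using nn_integral_has_integral_lebesgue[OF _ h] by (simp add: indicator_mult_ennreal)
  then show ?thesis by (simp add: mult.commute)
qed

text \<open>The inequality ln t < t at the fourth root of d / r gives (ln (d / r))^2 \<le> 16 sqrt
  (d / r). Replacing the distance r by the smaller distance a in one coordinate leaves a bound that
  depends on that coordinate alone.\<close>

lemma ln_sq_le:
  assumes "0 < a" "a \<le> r" "r \<le> d"
  shows "(ln (d / r))\<^sup>2 \<le> 16 * sqrt d * (1 / sqrt a)"
proof -
  have r: "0 < r" using assms by simp
  then have d: "0 < d" using assms by simp
  have 0: "0 \<le> ln (d / r)" using assms r by simp
  have "ln (d / r) = 4 * ln (sqrt (sqrt (d / r)))"
    using r d by (simp add: ln_sqrt)
  also have "\<dots> \<le> 4 * sqrt (sqrt (d / r))" using r d ln_less_self[of "sqrt (sqrt (d / r))"] by (simp add: less_imp_le)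
  finally have "(ln (d / r))\<^sup>2 \<le> (4 * sqrt (sqrt (d / r)))\<^sup>2" using 0 by (intro power_mono) auto
  also have "\<dots> = 16 * sqrt (d / r)" using r d by (simp add: power_mult_distrib)
  also have "\<dots> \<le> 16 * sqrt (d / a)" using assms d by (simp add: divide_left_mono)
  finally show ?thesis by (simp add: real_sqrt_divide)
qed

text \<open>The bound of \<open>ln_sq_le\<close> is integrated over the square of half-side d around
  y: 16 sqrt d times 4 sqrt d in the first coordinate, times 2 d in the second, is 128 d^2. It does
  not depend on the pole.\<close>

lemma log_kernel_L2:
  fixes \<Omega> :: "complex set"
  assumes \<Omega>: "open \<Omega>" "bounded \<Omega>" and d: "0 < d" "\<And>x y. x \<in> \<Omega> \<Longrightarrow> y \<in> \<Omega> \<Longrightarrow> norm (x - y) \<le> d" and y: "y \<in> \<Omega>"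
  shows "sq_int (lebesgue_on \<Omega>) (\<lambda>x. ln (d / norm (x - y)))"
    "(\<integral>x. (ln (d / norm (x - y)))\<^sup>2 \<partial>lebesgue_on \<Omega>) \<le> 128 * d\<^sup>2"
proof -
  let ?M = "lebesgue_on \<Omega>"
  define k where "k z = ennreal (16 * sqrt d) * (ennreal (1 / sqrt \<bar>Re z - Re y\<bar>) * indicator {Re y - d..Re y + d} (Re z)) * indicator {Im y - d..Im y + d} (Im z)" for z
  have "(\<integral>\<^sup>+x. ennreal ((ln (d / norm (x - y)))\<^sup>2) \<partial>?M) = (\<integral>\<^sup>+x. ennreal ((ln (d / norm (x - y)))\<^sup>2) * indicator \<Omega> x \<partial>lborel)"
    using \<Omega> by (simp add: nn_integral_restrict_space nn_integral_completion)
  also have "\<dots> = (\<integral>\<^sup>+t. \<integral>\<^sup>+s. ennreal ((ln (d / norm (Complex s t - y)))\<^sup>2) * indicator \<Omega> (Complex s t) \<partial>lborel \<partial>lborel)"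
    using \<Omega>(1) by (intro nn_integral_complex') measurable
  also have "\<dots> \<le> (\<integral>\<^sup>+t. \<integral>\<^sup>+s. k (Complex s t) \<partial>lborel \<partial>lborel)"
  proof (rule nn_integral_mono, rule nn_integral_mono_AE)
    fix t
    show "AE s in lborel. ennreal ((ln (d / norm (Complex s t - y)))\<^sup>2) * indicator \<Omega> (Complex s t) \<le> k (Complex s t)"
      using AE_lborel_singleton[of "Re y"]
    proof eventually_elim
      case (elim s)
      let ?z = "Complex s t"
      show ?case
      proof (cases "?z \<in> \<Omega>")
        case True
        have n: "\<bar>s - Re y\<bar> \<le> norm (?z - y)" "\<bar>t - Im y\<bar> \<le> norm (?z - y)" "norm (?z - y) \<le> d"
          using abs_Re_le_cmod[of "?z - y"] abs_Im_le_cmod[of "?z - y"] d(2)[OF True y] by auto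
        then have ind: "s \<in> {Re y - d..Re y + d}" "t \<in> {Im y - d..Im y + d}" by auto
        have "(ln (d / norm (?z - y)))\<^sup>2 \<le> 16 * sqrt d * (1 / sqrt \<bar>s - Re y\<bar>)"
          using elim n by (intro ln_sq_le) auto
        then have "ennreal ((ln (d / norm (?z - y)))\<^sup>2) \<le> ennreal (16 * sqrt d) * ennreal (1 / sqrt \<bar>s - Re y\<bar>)"
          using d(1) by (subst ennreal_mult[symmetric]) (auto intro: ennreal_leI)
        then show ?thesis using True ind by (simp add: k_def)
      qed simp
    qed
  qed
  also have "\<dots> = (\<integral>\<^sup>+t. ennreal (16 * sqrt d) * ennreal (4 * sqrt d) * indicator {Im y - d..Im y + d} t \<partial>lborel)"
    unfolding k_def by (simp add: nn_integral_multc nn_integral_cmult nn_integral_inverse_sqrt_abs[OF d(1)])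
  also have "\<dots> = ennreal (16 * sqrt d) * ennreal (4 * sqrt d) * ennreal (2 * d)"
    using d(1) by (subst nn_integral_cmult_indicator) auto
  also have "\<dots> = ennreal (128 * d\<^sup>2)"
    using d(1) by (simp add: ennreal_mult[symmetric] power2_eq_square)
  finally have le: "(\<integral>\<^sup>+x. ennreal ((ln (d / norm (x - y)))\<^sup>2) \<partial>?M) \<le> ennreal (128 * d\<^sup>2)" .
  have m: "(\<lambda>x. ln (d / norm (x - y))) \<in> borel_measurable ?M"
    by (intro borel_measurable_lebesgue_on) measurable
  have i: "integrable ?M (\<lambda>x. (ln (d / norm (x - y)))\<^sup>2)"
    using le m by (intro integrableI_nonneg) (auto simp: less_top[symmetric] top_unique)
  then show "sq_int ?M (\<lambda>x. ln (d / norm (x - y)))" using m by (simp add: sq_int_def)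
  have "(\<integral>\<^sup>+x. ennreal ((ln (d / norm (x - y)))\<^sup>2) \<partial>?M) = ennreal (\<integral>x. (ln (d / norm (x - y)))\<^sup>2 \<partial>?M)"
    by (rule nn_integral_eq_integral[OF i]) simp
  then show "(\<integral>x. (ln (d / norm (x - y)))\<^sup>2 \<partial>?M) \<le> 128 * d\<^sup>2" using le by simp
qed

lemma sq_int_integrable:
  assumes "finite_measure M" "sq_int M (f :: 'a \<Rightarrow> real)" shows "integrable M f"
  using sq_int_mult[OF assms(2) sq_int_bounded[OF assms(1), of "\<lambda>x. 1 :: real" 1]] by simp

lemma tfc_laplacian:
  assumes "tfc {2} \<Omega> \<phi>" shows "tfc {0} \<Omega> (laplacian \<phi>)"
proof -
  have "tfc {1} \<Omega> (pd b \<phi>)" if "b \<in> Basis" for b using tfc_pd[OF assms _ that, of 1] by simp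
  then have "tfc {0} \<Omega> (pd b (pd b \<phi>))" if "b \<in> Basis" for b using tfc_pd[of "{1}" \<Omega> "pd b \<phi>" 0 b] that by simp
  then have "tfc {0} \<Omega> (\<lambda>x. pd 1 (pd 1 \<phi>) x + 1 * pd \<i> (pd \<i> \<phi>) x)"
    by (intro tfc_add_cmult) (auto simp: Basis_complex_def)
  then show ?thesis by (simp add: laplacian_eq[abs_def])
qed

text \<open>The regularisation ln (|x - y|^2 + e^2) / 2 has the Laplacian 2 e^2 / (|x - y|^2 +
  e^2)^2. Two integrations by parts move the Laplacian onto it, and the substitution x = y + e z
  turns the result into the fixed kernel of \<open>newton_const\<close>.\<close>

lemma regularised_log_identity:
  assumes \<Omega>: "open \<Omega>" "bounded \<Omega>" and \<phi>: "tfc {2} \<Omega> \<phi>" and e: "0 < e"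
  shows "(\<integral>x. (ln ((norm (x - y))\<^sup>2 + e\<^sup>2) / 2) * laplacian \<phi> x \<partial>lebesgue_on \<Omega>) =
    (\<integral>z. 2 / (1 + (norm z)\<^sup>2)\<^sup>2 * \<phi> (y + e *\<^sub>R z) \<partial>lborel)"
proof -
  let ?M = "lebesgue_on \<Omega>"
  define q where "q x = (norm (x - y))\<^sup>2 + e\<^sup>2" for x
  define s where "s b x = (x - y) \<bullet> b" for b x :: complex
  have q: "0 < q x" for x using e by (simp add: q_def add_nonneg_pos)
  have sD: "(s b has_derivative (\<lambda>h. h \<bullet> b)) (at x)" for b x unfolding s_def by (auto intro!: derivative_eq_intros)
  have qD: "(q has_derivative (\<lambda>h. 2 * ((x - y) \<bullet> h))) (at x)" for x
    unfolding q_def power2_norm_eq_inner by (auto intro!: derivative_eq_intros simp: inner_commute)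
  have B: "1 \<in> (Basis::complex set)" "\<i> \<in> (Basis::complex set)" by (auto simp: Basis_complex_def)
  have sC: "Ck_on k UNIV (s b)" for k b
  proof -
    have "s b = (\<lambda>x. x \<bullet> b + (- (y \<bullet> b)))" by (simp add: s_def fun_eq_iff inner_diff_left)
    then show ?thesis using Ck_on_add[OF open_UNIV Ck_on_bounded_linear[OF open_UNIV bounded_linear_inner_left] Ck_on_const[OF open_UNIV]] by metis
  qed
  have qeq: "q = (\<lambda>x. ((s 1 x)\<^sup>2 + (s \<i> x)\<^sup>2) + e\<^sup>2)"
    by (simp add: q_def s_def fun_eq_iff cmod_power2 inner_complex_def)
  have qC: "Ck_on k UNIV q" for k unfolding qeq
    by (intro Ck_on_add[OF open_UNIV] Ck_on_power[OF open_UNIV] sC Ck_on_const[OF open_UNIV])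
  have fC: "Ck_on k UNIV (\<lambda>x. ln (q x) / 2)" for k
  proof -
    have "Ck_on k UNIV (\<lambda>x. ln (q x))"
      by (rule Ck_on_compose[of UNIV "{0<..}" q k ln, OF _ _ _ Ck_on_ln qC]) (use q in auto)
    from Ck_on_cmult[OF open_UNIV this, of "1/2"] show ?thesis by simp
  qed
  have gC: "Ck_on k UNIV (\<lambda>x. s b x / q x)" for k b
    by (rule Ck_on_divide[OF open_UNIV sC qC]) (use q in \<open>auto simp: less_le\<close>)
  have pf: "pd b (\<lambda>x. ln (q x) / 2) x = s b x / q x" for b x
  proof -
    have "((\<lambda>x. ln (q x) * (1 / 2)) has_derivative (\<lambda>h. (2 * ((x - y) \<bullet> h)) * inverse (q x) * (1 / 2))) (at x)"
      by (intro has_derivative_mult_left has_derivative_ln q qD)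
    then have "pd b (\<lambda>x. ln (q x) * (1 / 2)) x = (2 * ((x - y) \<bullet> b)) * inverse (q x) * (1 / 2)" by (rule pd_eqI)
    then show ?thesis by (simp add: s_def inverse_eq_divide)
  qed
  have pg: "pd b (\<lambda>x. s b x / q x) x = 1 / q x - 2 * (s b x)\<^sup>2 / (q x)\<^sup>2" if b: "b \<in> Basis" for b x
  proof -
    have "((\<lambda>x. s b x / q x) has_derivative (\<lambda>h. ((h \<bullet> b) * q x - s b x * (2 * ((x - y) \<bullet> h))) / (q x * q x))) (at x)"
      using q[of x] by (intro has_derivative_divide' sD qD) auto
    then have "pd b (\<lambda>x. s b x / q x) x = ((b \<bullet> b) * q x - s b x * (2 * ((x - y) \<bullet> b))) / (q x * q x)" by (rule pd_eqI)
    then show ?thesis using b q[of x] by (simp add: s_def inner_Basis diff_divide_distrib power2_eq_square)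
  qed
  have sub: "Ck_on k \<Omega> f" if "Ck_on k UNIV f" for k f using Ck_on_subset[OF open_UNIV \<Omega>(1) _ that] by simp
  have \<phi>1: "tfc {1} \<Omega> \<phi>" using \<phi> tfc_Ck[OF \<phi>, of 2 1] by (auto simp: tfc_def)
  have P: "(\<integral>x. (s b x / q x) * pd b \<phi> x \<partial>?M) = - (\<integral>x. (1 / q x - 2 * (s b x)\<^sup>2 / (q x)\<^sup>2) * \<phi> x \<partial>?M)"
    "integrable ?M (\<lambda>x. (s b x / q x) * pd b \<phi> x)"
    "integrable ?M (\<lambda>x. (1 / q x - 2 * (s b x)\<^sup>2 / (q x)\<^sup>2) * \<phi> x)" if b: "b \<in> Basis" for b
    using integral_by_parts[OF \<Omega> sub[OF gC] \<phi>1 b, of b] by (simp_all add: pg[OF b])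
  have "(\<integral>x. (ln (q x) / 2) * laplacian \<phi> x \<partial>?M) = - (\<integral>x. (s 1 x / q x) * pd 1 \<phi> x + (s \<i> x / q x) * pd \<i> \<phi> x \<partial>?M)"
    using integral_laplacian_by_parts(1)[OF \<Omega> sub[OF fC] \<phi>] by (simp add: inner_gradient pf)
  also have "\<dots> = (\<integral>x. (1 / q x - 2 * (s 1 x)\<^sup>2 / (q x)\<^sup>2) * \<phi> x + (1 / q x - 2 * (s \<i> x)\<^sup>2 / (q x)\<^sup>2) * \<phi> x \<partial>?M)"
    using P[OF B(1)] P[OF B(2)] by simp
  also have "\<dots> = (\<integral>x. 2 * e\<^sup>2 / (q x)\<^sup>2 * \<phi> x \<partial>?M)"
  proof (rule Bochner_Integration.integral_cong[OF refl])
    fix x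
    have "2 * q x - 2 * (s 1 x)\<^sup>2 - 2 * (s \<i> x)\<^sup>2 = 2 * e\<^sup>2" by (simp add: qeq)
    moreover have "1 / q x = q x / (q x)\<^sup>2" using q[of x] by (simp add: power2_eq_square)
    ultimately have "(1 / q x - 2 * (s 1 x)\<^sup>2 / (q x)\<^sup>2) + (1 / q x - 2 * (s \<i> x)\<^sup>2 / (q x)\<^sup>2) = 2 * e\<^sup>2 / (q x)\<^sup>2"
      by (simp add: diff_divide_distrib[symmetric] add_divide_distrib[symmetric])
    then show "(1 / q x - 2 * (s 1 x)\<^sup>2 / (q x)\<^sup>2) * \<phi> x + (1 / q x - 2 * (s \<i> x)\<^sup>2 / (q x)\<^sup>2) * \<phi> x = 2 * e\<^sup>2 / (q x)\<^sup>2 * \<phi> x"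
      by (simp only: distrib_right[symmetric])
  qed
  also have "\<dots> = (\<integral>x. 2 * e\<^sup>2 / (q x)\<^sup>2 * \<phi> x \<partial>lborel)"
  proof (rule integral_lebesgue_on_lborel)
    obtain K where "compact K" "K \<subseteq> \<Omega>" "\<And>x. x \<notin> K \<Longrightarrow> \<phi> x = 0" by (rule tfc_support[OF \<phi>]) blast
    then show "2 * e\<^sup>2 / (q x)\<^sup>2 * \<phi> x = 0" if "x \<notin> \<Omega>" for x using that by auto
    show "(\<lambda>x. 2 * e\<^sup>2 / (q x)\<^sup>2 * \<phi> x) \<in> borel_measurable borel"
      using tfc_borel[OF \<phi>] unfolding q_def by measurable
  qed (use \<Omega> in simp)
  also have "\<dots> = e\<^sup>2 * (\<integral>z. 2 * e\<^sup>2 / (q (y + e *\<^sub>R z))\<^sup>2 * \<phi> (y + e *\<^sub>R z) \<partial>lborel)"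
    by (rule integral_complex_affine[OF _ e]) (use tfc_borel[OF \<phi>] in \<open>unfold q_def, measurable\<close>)
  also have "\<dots> = (\<integral>z. e\<^sup>2 * (2 * e\<^sup>2 / (q (y + e *\<^sub>R z))\<^sup>2 * \<phi> (y + e *\<^sub>R z)) \<partial>lborel)"
    by (rule integral_mult_right_zero[symmetric])
  also have "\<dots> = (\<integral>z. 2 / (1 + (norm z)\<^sup>2)\<^sup>2 * \<phi> (y + e *\<^sub>R z) \<partial>lborel)"
  proof (rule Bochner_Integration.integral_cong[OF refl])
    fix z
    have "q (y + e *\<^sub>R z) = e\<^sup>2 * (1 + (norm z)\<^sup>2)" by (simp add: q_def power_mult_distrib algebra_simps)
    then show "e\<^sup>2 * (2 * e\<^sup>2 / (q (y + e *\<^sub>R z))\<^sup>2 * \<phi> (y + e *\<^sub>R z)) = 2 / (1 + (norm z)\<^sup>2)\<^sup>2 * \<phi> (y + e *\<^sub>R z)"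
      using e by (simp add: power_mult_distrib power2_eq_square)
  qed
  finally show ?thesis by (simp add: q_def)
qed

text \<open>The limit e \<longrightarrow> 0 of the regularised identity. For e \<le> 1 the
  regularised logarithm lies between ln |x - y| and d^2, which dominates the left side; on the right
  \<phi> is bounded and the kernel integrable.\<close>

lemma log_potential_identity:
  assumes \<Omega>: "open \<Omega>" "bounded \<Omega>" and \<phi>: "tfc {2} \<Omega> \<phi>" and y: "y \<in> \<Omega>"
  shows "(\<integral>x. ln (norm (x - y)) * laplacian \<phi> x \<partial>lebesgue_on \<Omega>) = newton_const * \<phi> y"
    "sq_int (lebesgue_on \<Omega>) (\<lambda>x. ln (norm (x - y)))"
proof -
  let ?M = "lebesgue_on \<Omega>"
  interpret finite_measure ?M by (rule finite_measure_lebesgue_on[OF \<Omega>])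
  obtain R where R: "\<And>x. x \<in> \<Omega> \<Longrightarrow> norm x \<le> R" using \<Omega>(2) by (auto simp: bounded_iff)
  define d where "d = 2 * \<bar>R\<bar> + 1"
  have d: "0 < d" "norm (x - z) \<le> d" if "x \<in> \<Omega>" "z \<in> \<Omega>" for x z
    using R[OF that(1)] R[OF that(2)] norm_triangle_ineq4[of x z] by (auto simp: d_def)
  have d0: "0 < d" by (simp add: d_def)
  note L = log_kernel_L2(1)[OF \<Omega> d0 d(2) y]
  have cst: "sq_int ?M (\<lambda>x. c)" for c :: real by (rule sq_int_bounded[of _ _ "\<bar>c\<bar>"]) (auto intro: finite_measure_axioms)
  have mln: "(\<lambda>x. ln (norm (x - y))) \<in> borel_measurable borel" by measurable
  have s: "sq_int ?M (\<lambda>x. \<bar>ln d\<bar> + \<bar>ln (d / norm (x - y))\<bar>)"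
    using L by (intro sq_int_add cst) (auto simp: sq_int_def)
  show sl: "sq_int ?M (\<lambda>x. ln (norm (x - y)))"
  proof (rule sq_int_dominated[OF s, of _ 1])
    show "norm (ln (norm (x - y))) \<le> 1 * norm (\<bar>ln d\<bar> + \<bar>ln (d / norm (x - y))\<bar>)" for x
      using d0 by (cases "x = y") (auto simp: ln_div)
  qed (use mln borel_measurable_lebesgue_on in blast)
  have tl: "tfc {0} \<Omega> (laplacian \<phi>)" by (rule tfc_laplacian[OF \<phi>])
  obtain B where B: "\<And>x. \<bar>laplacian \<phi> x\<bar> \<le> B" using tfc_bounded[OF tl] by blast
  have t2: "tfc {2} \<Omega> \<phi>" by fact
  obtain C where C: "\<And>x. \<bar>\<phi> x\<bar> \<le> C" using tfc_bounded[OF t2] by blast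
  define e where "e n = 1 / real (Suc n)" for n
  have e: "0 < e n" "e n \<le> 1" for n by (auto simp: e_def)
  have e0: "e \<longlonglongrightarrow> 0" unfolding e_def using LIMSEQ_inverse_real_of_nat by (simp add: divide_inverse)
  have e2: "(\<lambda>n. (norm (x - y))\<^sup>2 + (e n)\<^sup>2) \<longlonglongrightarrow> (norm (x - y))\<^sup>2" for x
    using tendsto_add[OF tendsto_const[of "(norm (x - y))\<^sup>2"] tendsto_power[OF e0, of 2]] by simp
  have "(\<lambda>n. \<integral>x. (ln ((norm (x - y))\<^sup>2 + (e n)\<^sup>2) / 2) * laplacian \<phi> x \<partial>?M) \<longlonglongrightarrow> (\<integral>x. ln (norm (x - y)) * laplacian \<phi> x \<partial>?M)"
  proof (rule integral_dominated_convergence)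
    have iln: "integrable ?M (\<lambda>x. \<bar>ln (norm (x - y))\<bar>)" using sq_int_integrable[OF finite_measure_axioms sl] by simp
    have "integrable ?M (\<lambda>x. \<bar>ln (norm (x - y))\<bar> + d\<^sup>2)" using iln by simp
    then show "integrable ?M (\<lambda>x. (\<bar>ln (norm (x - y))\<bar> + d\<^sup>2) * B)" by simp
    have ne: "AE x in ?M. x \<noteq> y \<and> x \<in> \<Omega>"
    proof -
      have "AE x in lborel. x \<noteq> y" by (rule AE_lborel_singleton)
      then have "AE x in lebesgue. x \<noteq> y" by (rule AE_completion)
      then have "AE x in lebesgue. x \<in> \<Omega> \<longrightarrow> x \<noteq> y \<and> x \<in> \<Omega>" by eventually_elim simp
      then show ?thesis using \<Omega> by (subst AE_restrict_space_iff) auto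
    qed
    show "AE x in ?M. (\<lambda>n. (ln ((norm (x - y))\<^sup>2 + (e n)\<^sup>2) / 2) * laplacian \<phi> x) \<longlonglongrightarrow> ln (norm (x - y)) * laplacian \<phi> x"
      using ne
    proof eventually_elim
      case (elim x)
      then have "(\<lambda>n. ln ((norm (x - y))\<^sup>2 + (e n)\<^sup>2)) \<longlonglongrightarrow> ln ((norm (x - y))\<^sup>2)"
        using e2[of x] by (intro tendsto_ln) auto
      then have "(\<lambda>n. (ln ((norm (x - y))\<^sup>2 + (e n)\<^sup>2) / 2) * laplacian \<phi> x) \<longlonglongrightarrow> ln ((norm (x - y))\<^sup>2) / 2 * laplacian \<phi> x"
        by (intro tendsto_mult_right tendsto_divide tendsto_const) auto
      then show ?case using elim by (simp add: ln_realpow)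
    qed
    show "AE x in ?M. norm ((ln ((norm (x - y))\<^sup>2 + (e n)\<^sup>2) / 2) * laplacian \<phi> x) \<le> (\<bar>ln (norm (x - y))\<bar> + d\<^sup>2) * B" for n
      using ne
    proof eventually_elim
      case (elim x)
      have r: "0 < norm (x - y)" "norm (x - y) \<le> d" using elim d(2)[of x y] y by auto
      have "ln ((norm (x - y))\<^sup>2) \<le> ln ((norm (x - y))\<^sup>2 + (e n)\<^sup>2)" using r by (subst ln_le_cancel_iff) (auto intro: add_pos_nonneg)
      then have lo: "ln (norm (x - y)) \<le> ln ((norm (x - y))\<^sup>2 + (e n)\<^sup>2) / 2" using r by (simp add: ln_realpow)
      have "ln ((norm (x - y))\<^sup>2 + (e n)\<^sup>2) \<le> (norm (x - y))\<^sup>2 + (e n)\<^sup>2 - 1" using r by (intro ln_le_minus_one) (auto intro: add_pos_nonneg)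
      also have "\<dots> \<le> (norm (x - y))\<^sup>2" using e[of n] by (simp add: power_le_one)
      also have "\<dots> \<le> d\<^sup>2" using r by (intro power_mono) auto
      finally have up: "ln ((norm (x - y))\<^sup>2 + (e n)\<^sup>2) / 2 \<le> d\<^sup>2" using zero_le_power2[of d] by linarith
      have "\<bar>ln ((norm (x - y))\<^sup>2 + (e n)\<^sup>2) / 2\<bar> \<le> \<bar>ln (norm (x - y))\<bar> + d\<^sup>2"
        using lo up zero_le_power2[of d] by linarith
      then have "\<bar>ln ((norm (x - y))\<^sup>2 + (e n)\<^sup>2) / 2\<bar> * \<bar>laplacian \<phi> x\<bar> \<le> (\<bar>ln (norm (x - y))\<bar> + d\<^sup>2) * B"
        using B[of x] by (intro mult_mono) auto
      then show ?case unfolding real_norm_def abs_mult[of _ "laplacian \<phi> x"] .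
    qed
  qed (use tfc_borel[OF tl] in \<open>auto intro!: borel_measurable_lebesgue_on borel_measurable_times\<close>)
  moreover have "(\<lambda>n. \<integral>z. 2 / (1 + (norm z)\<^sup>2)\<^sup>2 * \<phi> (y + e n *\<^sub>R z) \<partial>lborel) \<longlonglongrightarrow> (\<integral>z. 2 / (1 + (norm z)\<^sup>2)\<^sup>2 * \<phi> y \<partial>(lborel::complex measure))"
  proof (rule integral_dominated_convergence)
    show "integrable (lborel::complex measure) (\<lambda>z. 2 / (1 + (norm z)\<^sup>2)\<^sup>2 * C)" by (intro integrable_mult_left newton_kernel_integrable)
    show "AE z in lborel. (\<lambda>n. 2 / (1 + (norm z)\<^sup>2)\<^sup>2 * \<phi> (y + e n *\<^sub>R z)) \<longlonglongrightarrow> 2 / (1 + (norm z)\<^sup>2)\<^sup>2 * \<phi> y"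
    proof (rule AE_I2)
      fix z :: complex
      have "(\<lambda>n. y + e n *\<^sub>R z) \<longlonglongrightarrow> y + 0 *\<^sub>R z" by (intro tendsto_intros e0)
      moreover have "isCont \<phi> y" using tfc_Ck[OF \<phi>, of 2 0] by (simp add: continuous_on_eq_continuous_at)
      ultimately have "(\<lambda>n. \<phi> (y + e n *\<^sub>R z)) \<longlonglongrightarrow> \<phi> y" by (intro isCont_tendsto_compose[of y \<phi>]) auto
      then show "(\<lambda>n. 2 / (1 + (norm z)\<^sup>2)\<^sup>2 * \<phi> (y + e n *\<^sub>R z)) \<longlonglongrightarrow> 2 / (1 + (norm z)\<^sup>2)\<^sup>2 * \<phi> y" by (rule tendsto_mult_left)
    qed
    show "AE z in lborel. norm (2 / (1 + (norm z)\<^sup>2)\<^sup>2 * \<phi> (y + e n *\<^sub>R z)) \<le> 2 / (1 + (norm z)\<^sup>2)\<^sup>2 * C" for n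
      using C by (auto simp: abs_mult intro!: divide_right_mono)
  qed (use tfc_borel[OF \<phi>] in \<open>measurable\<close>)
  ultimately have "(\<integral>x. ln (norm (x - y)) * laplacian \<phi> x \<partial>?M) =
      (\<integral>z. 2 / (1 + (norm z)\<^sup>2)\<^sup>2 * \<phi> y \<partial>(lborel::complex measure))"
    unfolding regularised_log_identity[OF \<Omega> \<phi> e(1), of y] by (rule LIMSEQ_unique)
  then show "(\<integral>x. ln (norm (x - y)) * laplacian \<phi> x \<partial>?M) = newton_const * \<phi> y"
    unfolding newton_const_def by (simp only: integral_mult_left_zero)
qed

subsection \<open>The Green function of the disc, transported by a Riemann map\<close>

text \<open>\<open>f\<close> is a Riemann map and \<open>g\<close> its inverse. No boundary
  behaviour of either is assumed; the boundary is reached only through the compactness of the sets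
  where |f| \<le> r < 1.\<close>

locale conformal_disc =
  fixes \<Omega> :: "complex set" and f g :: "complex \<Rightarrow> complex"
  assumes \<Omega>: "open \<Omega>" "bounded \<Omega>" and sc: "simply_connected \<Omega>"
    and f: "f holomorphic_on \<Omega>" and g: "g holomorphic_on ball 0 1"
    and f_in: "\<And>z. z \<in> \<Omega> \<Longrightarrow> norm (f z) < 1" and g_in: "\<And>z. norm z < 1 \<Longrightarrow> g z \<in> \<Omega>"
    and gf: "\<And>z. z \<in> \<Omega> \<Longrightarrow> g (f z) = z" and fg: "\<And>z. norm z < 1 \<Longrightarrow> f (g z) = z"
begin

definition mob :: "complex \<Rightarrow> complex \<Rightarrow> complex" where
  "mob y x = Moebius_function 0 (f y) (f x)"

text \<open>On the diagonal ln 0 = 0 makes \<open>G\<close> vanish instead of being infinite. This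
  affects a null set only and keeps \<open>G\<close> real valued and nonnegative.\<close>

definition G :: "complex \<Rightarrow> complex \<Rightarrow> real" where
  "G x y = - ln (norm (mob y x)) / newton_const"

lemma den_nz: assumes "x \<in> \<Omega>" "y \<in> \<Omega>" shows "1 - cnj (f y) * f x \<noteq> 0"
proof
  assume "1 - cnj (f y) * f x = 0"
  then have "norm (cnj (f y) * f x) = 1" by (metis eq_iff_diff_eq_0 norm_one)
  moreover have "norm (cnj (f y) * f x) < 1 * 1"
    unfolding norm_mult using f_in assms by (intro mult_strict_mono') auto
  ultimately show False by simp
qed

lemma mob_eq: "mob y x = (f x - f y) / (1 - cnj (f y) * f x)"
  by (simp add: mob_def Moebius_function_simple)

lemma mob_lt_1: "x \<in> \<Omega> \<Longrightarrow> y \<in> \<Omega> \<Longrightarrow> norm (mob y x) < 1"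
  unfolding mob_def using f_in by (intro Moebius_function_norm_lt_1) auto

lemma f_inj: "inj_on f \<Omega>" using gf by (rule inj_on_inverseI)

lemma mob_nz: "x \<in> \<Omega> \<Longrightarrow> y \<in> \<Omega> \<Longrightarrow> x \<noteq> y \<Longrightarrow> mob y x \<noteq> 0"
  using f_inj den_nz[of x y] by (auto simp: mob_eq inj_on_def)

lemma norm_mob_commute: "norm (mob y x) = norm (mob x y)"
proof -
  have "norm (1 - cnj (f y) * f x) = norm (cnj (1 - cnj (f y) * f x))" by (simp only: complex_mod_cnj)
  also have "cnj (1 - cnj (f y) * f x) = 1 - cnj (f x) * f y" by (simp add: mult.commute)
  finally show ?thesis by (simp add: mob_eq norm_divide norm_minus_commute)
qed

lemma G_commute: "G x y = G y x" by (simp add: G_def norm_mob_commute[of y x])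

lemma G_nonneg: assumes "x \<in> \<Omega>" "y \<in> \<Omega>" shows "0 \<le> G x y"
proof (cases "mob y x = 0")
  case False
  then have "ln (norm (mob y x)) \<le> 0" using mob_lt_1[OF assms] by (simp add: ln_le_zero_iff)
  then show ?thesis using newton_const_pos by (simp add: G_def divide_nonpos_pos)
qed (simp add: G_def)

text \<open>Used twice: the factor 1 - |f x|^2 gives the decay of \<open>G\<close> at the boundary,
  and the right side is the positive kernel in whose powers \<open>G\<close> is expanded.\<close>

lemma one_minus_mob_sq:
  assumes "x \<in> \<Omega>" "y \<in> \<Omega>"
  shows "1 - (norm (mob y x))\<^sup>2 = (1 - (norm (f y))\<^sup>2) * (1 - (norm (f x))\<^sup>2) / (norm (1 - cnj (f y) * f x))\<^sup>2"
proof -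
  have nz: "(norm (1 - cnj (f y) * f x))\<^sup>2 \<noteq> 0" using den_nz[OF assms] by simp
  have "(norm (1 - cnj (f y) * f x))\<^sup>2 - (norm (f x - f y))\<^sup>2 = (1 - (norm (f y))\<^sup>2) * (1 - (norm (f x))\<^sup>2)"
    by (simp only: cmod_power2) (simp add: power2_eq_square algebra_simps)
  then show ?thesis using nz by (simp add: mob_eq norm_divide power_divide diff_divide_eq_iff divide_simps)
qed

text \<open>Schwarz's lemma for \<zeta> \<mapsto> (g (mob^-1 \<zeta>) - y) / d, where mob^-1 is the
  Moebius map with parameter - f y. It maps the disc into itself because all distances in \<Omega>
  are below d, and it fixes 0.\<close>

lemma mob_ge:
  assumes d: "\<And>x y. x \<in> \<Omega> \<Longrightarrow> y \<in> \<Omega> \<Longrightarrow> norm (x - y) < d" and xy: "x \<in> \<Omega>" "y \<in> \<Omega>"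
  shows "norm (x - y) \<le> d * norm (mob y x)"
proof -
  have d0: "0 < d" using d[OF xy(1) xy(1)] by simp
  have fy: "norm (f y) < 1" "norm (- f y) < 1" using f_in[OF xy(2)] by auto
  define F where "F \<zeta> = (g (Moebius_function 0 (- f y) \<zeta>) - y) / of_real d" for \<zeta>
  have mb: "norm (Moebius_function 0 (- f y) \<zeta>) < 1" if "norm \<zeta> < 1" for \<zeta>
    using that fy by (intro Moebius_function_norm_lt_1) auto
  have im: "Moebius_function 0 (- f y) ` ball 0 1 \<subseteq> ball 0 1" using mb by auto
  have "(\<lambda>\<zeta>. g (Moebius_function 0 (- f y) \<zeta>)) holomorphic_on ball 0 1"
    using holomorphic_on_compose_gen[OF Moebius_function_holomorphic[OF fy(2), of 0] g im] by (simp add: o_def)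
  then have holF: "F holomorphic_on ball 0 1"
    unfolding F_def using d0 by (intro holomorphic_intros) auto
  have F0: "F 0 = 0" using gf[OF xy(2)] by (simp add: F_def Moebius_function_of_zero)
  have F1: "norm (F \<zeta>) < 1" if "norm \<zeta> < 1" for \<zeta>
    using d[OF g_in[OF mb[OF that]] xy(2)] d0 by (simp add: F_def norm_divide)
  have "norm (F (mob y x)) \<le> norm (mob y x)"
    by (rule Schwarz_Lemma(1)[OF holF F0 F1 mob_lt_1[OF xy]])
  moreover have "F (mob y x) = (x - y) / of_real d"
  proof -
    have "Moebius_function 0 (- f y) (mob y x) = f x"
      unfolding mob_def using fy f_in[OF xy(1)] by (intro Moebius_function_compose) auto
    then show ?thesis using gf[OF xy(1)] by (simp add: F_def)
  qed
  ultimately show ?thesis using d0 by (simp add: norm_divide field_simps)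
qed

lemma G_le:
  assumes d: "\<And>x y. x \<in> \<Omega> \<Longrightarrow> y \<in> \<Omega> \<Longrightarrow> norm (x - y) < d" and xy: "x \<in> \<Omega>" "y \<in> \<Omega>"
  shows "G x y \<le> ln (d / norm (x - y)) / newton_const"
proof (cases "x = y")
  case True then show ?thesis by (simp add: G_def mob_eq)
next
  case False
  have d0: "0 < d" using d[OF xy(1) xy(1)] by simp
  have p: "0 < norm (x - y)" "0 < norm (mob y x)" using False mob_nz[OF xy] by auto
  have "norm (x - y) / d \<le> norm (mob y x)" using mob_ge[OF d xy] d0 by (simp add: field_simps)
  then have "ln (norm (x - y) / d) \<le> ln (norm (mob y x))" using p d0 by simp
  then have "- ln (norm (mob y x)) \<le> ln (d / norm (x - y))" using p d0 by (simp add: ln_div)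
  then have "- ln (norm (mob y x)) / newton_const \<le> ln (d / norm (x - y)) / newton_const"
    using newton_const_pos by (intro divide_right_mono) auto
  then show ?thesis by (simp only: G_def)
qed

lemma f_cont: "continuous_on \<Omega> f" using f by (rule holomorphic_on_imp_continuous_on)

lemma G_continuous: assumes y: "y \<in> \<Omega>" shows "continuous_on (\<Omega> - {y}) (\<lambda>x. G x y)"
proof -
  have "continuous_on (\<Omega> - {y}) (mob y)"
    unfolding mob_eq[abs_def] using den_nz[OF _ y] f_cont by (intro continuous_intros) (auto intro: continuous_on_subset)
  then show ?thesis unfolding G_def using mob_nz[OF _ y] newton_const_pos by (intro continuous_intros) auto
qed

lemma compact_sublevel:
  assumes "r < 1" shows "compact {x \<in> \<Omega>. norm (f x) \<le> r}"
proof -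
  have "{x \<in> \<Omega>. norm (f x) \<le> r} = g ` cball 0 r"
    using assms gf g_in fg by (force simp: image_iff)
  moreover have "compact (g ` cball 0 r)"
    using assms by (intro compact_continuous_image continuous_on_subset[OF holomorphic_on_imp_continuous_on[OF g]]) auto
  ultimately show ?thesis by simp
qed

lemma G_boundary:
  assumes y: "y \<in> \<Omega>" and e: "0 < e"
  obtains K where "compact K" "K \<subseteq> \<Omega>" "\<And>x. x \<in> \<Omega> - K \<Longrightarrow> G x y \<le> e"
proof -
  \<comment> \<open>q is the value of |mob| at which \<open>G\<close> equals e. With a = |f y| the
    denominator in \<open>one_minus_mob_sq\<close> is at least (1 - a)^2, so 1 - |f x|^2 < s forces
    1 - |mob|^2 \<le> 1 - q^2; the set K is where |f| \<le> r = sqrt (1 - s).\<close>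
  define q where "q = exp (- (e * newton_const))"
  have q: "0 < q" "q < 1" using e newton_const_pos by (auto simp: q_def)
  define a where "a = norm (f y)"
  have a: "0 \<le> a" "a < 1" using f_in[OF y] by (auto simp: a_def)
  define s where "s = (1 - q\<^sup>2) * (1 - a)\<^sup>2"
  have s: "0 < s" "s < 1"
  proof -
    have "q\<^sup>2 < 1" using q abs_square_less_1[of q] by simp
    moreover have "0 < q\<^sup>2" using q by simp
    ultimately have q2: "0 < 1 - q\<^sup>2" "1 - q\<^sup>2 < 1" by linarith+
    show "0 < s" using a q2(1) by (simp add: s_def)
    have "(1 - a)\<^sup>2 \<le> 1" using a by (simp add: power_le_one)
    then have "s \<le> (1 - q\<^sup>2) * 1" unfolding s_def using q2 by (intro mult_left_mono) auto
    then have "s \<le> 1 - q\<^sup>2" by (simp only: mult_1_right)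
    then show "s < 1" using q2(2) by (rule le_less_trans)
  qed
  define r where "r = sqrt (1 - s)"
  have r: "r < 1" "r\<^sup>2 = 1 - s" "0 \<le> r" using s by (auto simp: r_def)
  show thesis
  proof (rule that[OF compact_sublevel[OF r(1)]])
    fix x assume "x \<in> \<Omega> - {x \<in> \<Omega>. norm (f x) \<le> r}"
    then have x: "x \<in> \<Omega>" "r < norm (f x)" by auto
    have "r\<^sup>2 < (norm (f x))\<^sup>2" using x r by (intro power_strict_mono) auto
    then have 1: "1 - (norm (f x))\<^sup>2 < s" using r by simp
    have f1: "0 \<le> 1 - (norm (f x))\<^sup>2" using f_in[OF x(1)] by (simp add: power_le_one)
    have "1 - a \<le> norm (1 - cnj (f y) * f x)"
    proof -
      have "norm (cnj (f y) * f x) \<le> a * 1" unfolding norm_mult using f_in[OF x(1)] a by (intro mult_mono) (auto simp: a_def)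
      then show ?thesis using norm_triangle_ineq2[of 1 "cnj (f y) * f x"] by simp
    qed
    then have 2: "(1 - a)\<^sup>2 \<le> (norm (1 - cnj (f y) * f x))\<^sup>2" using a by (intro power_mono) auto
    have "1 - (norm (mob y x))\<^sup>2 \<le> (1 * s) / (1 - a)\<^sup>2"
      unfolding one_minus_mob_sq[OF x(1) y] using 1 2 f1 a s
      by (intro frac_le mult_mono) (auto simp: a_def power_le_one)
    also have "\<dots> = 1 - q\<^sup>2" using a by (simp add: s_def)
    finally have "q\<^sup>2 \<le> (norm (mob y x))\<^sup>2" by simp
    then have qm: "q \<le> norm (mob y x)" by (rule power2_le_imp_le) simp
    have "ln q \<le> ln (norm (mob y x))" using qm q by (subst ln_le_cancel_iff) auto
    then have "- ln (norm (mob y x)) \<le> e * newton_const" by (simp add: q_def)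
    then show "G x y \<le> e" using newton_const_pos by (simp add: G_def field_simps)
  qed auto
qed

abbreviation (input) "M \<equiv> lebesgue_on \<Omega>"

lemma AE_neq: "AE x in M. x \<noteq> y \<and> x \<in> \<Omega>"
proof -
  have "AE x in lebesgue. x \<noteq> y" by (intro AE_completion AE_lborel_singleton)
  then have "AE x in lebesgue. x \<in> \<Omega> \<longrightarrow> x \<noteq> y \<and> x \<in> \<Omega>" by eventually_elim simp
  then show ?thesis using \<Omega> by (subst AE_restrict_space_iff) auto
qed

lemma pd_Re_holomorphic:
  assumes "L holomorphic_on \<Omega>" "x \<in> \<Omega>"
  shows "((\<lambda>x. Re (L x)) has_derivative (\<lambda>h. Re (deriv L x * h))) (at x)"
    "pd b (\<lambda>x. Re (L x)) x = Re (deriv L x * b)"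
proof -
  have "(L has_field_derivative deriv L x) (at x)" by (rule holomorphic_derivI[OF assms(1) \<Omega>(1) assms(2)])
  then show "((\<lambda>x. Re (L x)) has_derivative (\<lambda>h. Re (deriv L x * h))) (at x)"
    unfolding has_field_derivative_def by (rule has_derivative_Re)
  then show "pd b (\<lambda>x. Re (L x)) x = Re (deriv L x * b)" by (rule pd_eqI)
qed

lemma Ck_Re_holomorphic:
  assumes "L holomorphic_on \<Omega>" shows "Ck_on 1 \<Omega> (\<lambda>x. Re (L x))"
proof -
  have "deriv L holomorphic_on \<Omega>" using assms \<Omega>(1) by (rule holomorphic_deriv)
  then have "continuous_on \<Omega> (\<lambda>x. Re (deriv L x * b))" for b
    by (intro continuous_intros holomorphic_on_imp_continuous_on)
  moreover have "continuous_on \<Omega> (pd b (\<lambda>x. Re (L x))) = continuous_on \<Omega> (\<lambda>x. Re (deriv L x * b))" for b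
    by (intro continuous_on_cong refl pd_Re_holomorphic(2) assms)
  moreover have "(\<lambda>x. Re (L x)) differentiable (at x)" if "x \<in> \<Omega>" for x
    using pd_Re_holomorphic(1)[OF assms that] unfolding differentiable_def by blast
  ultimately show ?thesis using \<Omega>(1) by (simp add: Ck_on_Suc_open)
qed

text \<open>After two integrations by parts the terms for the two coordinates cancel: the partial
  derivatives of Re L are Re L' and Re (L' \<i>), and differentiating the second in direction \<i>
  yields - Re L'', the opposite of what the first gives in direction 1.\<close>

lemma integral_harmonic_laplacian:
  assumes L: "L holomorphic_on \<Omega>" and \<phi>: "tfc {2} \<Omega> \<phi>"
  shows "(\<integral>x. Re (L x) * laplacian \<phi> x \<partial>M) = 0"
    "integrable M (\<lambda>x. Re (L x) * laplacian \<phi> x)"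
proof -
  have L': "deriv L holomorphic_on \<Omega>" using L \<Omega>(1) by (rule holomorphic_deriv)
  have iL': "(\<lambda>x. deriv L x * \<i>) holomorphic_on \<Omega>" by (rule holomorphic_on_mult[OF L' holomorphic_on_const])
  have \<phi>1: "tfc {1} \<Omega> \<phi>" using \<phi> tfc_Ck[OF \<phi>, of 2 1] by (auto simp: tfc_def)
  have B: "1 \<in> (Basis::complex set)" "\<i> \<in> (Basis::complex set)" by (auto simp: Basis_complex_def)
  note P1 = integral_by_parts[OF \<Omega> Ck_Re_holomorphic[OF L'] \<phi>1 B(1)]
  note P2 = integral_by_parts[OF \<Omega> Ck_Re_holomorphic[OF iL'] \<phi>1 B(2)]
  show "integrable M (\<lambda>x. Re (L x) * laplacian \<phi> x)"
    by (rule integral_laplacian_by_parts(2)[OF \<Omega> Ck_Re_holomorphic[OF L] \<phi>])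
  have d: "deriv (\<lambda>x. deriv L x * \<i>) x = deriv (deriv L) x * \<i>" if "x \<in> \<Omega>" for x
    using holomorphic_derivI[OF L' \<Omega>(1) that] by (intro DERIV_imp_deriv DERIV_cmult_right)
  have "(\<integral>x. Re (L x) * laplacian \<phi> x \<partial>M) = - (\<integral>x. gradient (\<lambda>x. Re (L x)) x \<bullet> gradient \<phi> x \<partial>M)"
    by (rule integral_laplacian_by_parts(1)[OF \<Omega> Ck_Re_holomorphic[OF L] \<phi>])
  also have "(\<integral>x. gradient (\<lambda>x. Re (L x)) x \<bullet> gradient \<phi> x \<partial>M) =
      (\<integral>x. Re (deriv L x) * pd 1 \<phi> x + Re (deriv L x * \<i>) * pd \<i> \<phi> x \<partial>M)"
    by (intro Bochner_Integration.integral_cong refl) (auto simp: inner_gradient pd_Re_holomorphic(2)[OF L])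
  also have "\<dots> = - (\<integral>x. pd 1 (\<lambda>x. Re (deriv L x)) x * \<phi> x \<partial>M) - (\<integral>x. pd \<i> (\<lambda>x. Re (deriv L x * \<i>)) x * \<phi> x \<partial>M)"
    using P1 P2 by simp
  also have "(\<integral>x. pd \<i> (\<lambda>x. Re (deriv L x * \<i>)) x * \<phi> x \<partial>M) = (\<integral>x. - (pd 1 (\<lambda>x. Re (deriv L x)) x * \<phi> x) \<partial>M)"
  proof (rule Bochner_Integration.integral_cong[OF refl])
    fix x assume "x \<in> space M"
    then have x: "x \<in> \<Omega>" by simp
    have "pd \<i> (\<lambda>x. Re (deriv L x * \<i>)) x = - pd 1 (\<lambda>x. Re (deriv L x)) x"
      unfolding pd_Re_holomorphic(2)[OF iL' x] pd_Re_holomorphic(2)[OF L' x] d[OF x] by simp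
    then show "pd \<i> (\<lambda>x. Re (deriv L x * \<i>)) x * \<phi> x = - (pd 1 (\<lambda>x. Re (deriv L x)) x * \<phi> x)" by simp
  qed
  finally show "(\<integral>x. Re (L x) * laplacian \<phi> x \<partial>M) = 0" by simp
qed

text \<open>The quotient of mob by x - y extends over y as a removable singularity and has no zeros
  because f is injective with nonvanishing derivative. Simple connectivity provides its holomorphic
  logarithm L, so ln |mob| is the logarithmic potential plus a harmonic function.\<close>

lemma mob_factor:
  assumes y: "y \<in> \<Omega>"
  obtains L where "L holomorphic_on \<Omega>" "\<And>x. x \<in> \<Omega> \<Longrightarrow> x \<noteq> y \<Longrightarrow> ln (norm (mob y x)) = ln (norm (x - y)) + Re (L x)"
proof -
  define q where "q x = (if x = y then deriv f y else (f x - f y) / (x - y))" for x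
  have hol: "(\<lambda>x. f x - f y) holomorphic_on \<Omega>" using f by (intro holomorphic_intros)
  have df: "deriv (\<lambda>x. f x - f y) y = deriv f y"
  proof -
    have "((\<lambda>x. f x - f y) has_field_derivative deriv f y - 0) (at y)"
      by (intro derivative_intros holomorphic_derivI[OF f \<Omega>(1) y])
    then show ?thesis by (simp add: DERIV_imp_deriv)
  qed
  have qh: "q holomorphic_on \<Omega>"
    by (rule pole_theorem_open_0[OF hol \<Omega>(1), of y]) (auto simp: q_def df)
  define F where "F x = q x / (1 - cnj (f y) * f x)" for x
  have Fh: "F holomorphic_on \<Omega>" unfolding F_def using qh f den_nz[OF _ y] by (intro holomorphic_intros) auto
  have Fnz: "F x \<noteq> 0" if "x \<in> \<Omega>" for x
    using den_nz[OF that y] holomorphic_injective_imp_regular[OF f \<Omega>(1) f_inj y] f_inj that y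
    by (auto simp: F_def q_def inj_on_def)
  obtain L where L: "L holomorphic_on \<Omega>" "\<And>x. x \<in> \<Omega> \<Longrightarrow> F x = exp (L x)"
    using sc Fh Fnz unfolding simply_connected_eq_holomorphic_log[OF \<Omega>(1)] by blast
  show thesis
  proof (rule that[OF L(1)])
    fix x assume x: "x \<in> \<Omega>" "x \<noteq> y"
    have "mob y x = (x - y) * F x" using x by (simp add: mob_eq F_def q_def)
    then have "norm (mob y x) = norm (x - y) * exp (Re (L x))" using L(2)[OF x(1)] by (simp add: norm_mult)
    then show "ln (norm (mob y x)) = ln (norm (x - y)) + Re (L x)" using x by (simp add: ln_mult)
  qed
qed

lemma G_representation:
  assumes y: "y \<in> \<Omega>" and \<phi>: "tfc {2} \<Omega> \<phi>"
  shows "(\<integral>x. G x y * laplacian \<phi> x \<partial>M) = - \<phi> y"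
proof -
  obtain L where L: "L holomorphic_on \<Omega>" "\<And>x. x \<in> \<Omega> \<Longrightarrow> x \<noteq> y \<Longrightarrow> ln (norm (mob y x)) = ln (norm (x - y)) + Re (L x)"
    using mob_factor[OF y] by blast
  note H = integral_harmonic_laplacian[OF L(1) \<phi>]
  note P = log_potential_identity[OF \<Omega> \<phi> y]
  have i: "integrable M (\<lambda>x. ln (norm (x - y)) * laplacian \<phi> x)"
    by (intro sq_int_mult P(2) tfc_sq_int[OF \<Omega> tfc_laplacian[OF \<phi>]])
  have mf: "f \<in> borel_measurable M" using f_cont \<Omega>(1) by (intro continuous_imp_measurable_on_sets_lebesgue) auto
  have mL: "(\<lambda>x. Re (L x)) \<in> borel_measurable M"
    using holomorphic_on_imp_continuous_on[OF L(1)] \<Omega>(1)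
    by (intro continuous_imp_measurable_on_sets_lebesgue continuous_intros) auto
  have ml: "(\<lambda>x. ln (norm (x - y))) \<in> borel_measurable M" using P(2) by (simp add: sq_int_def)
  have mlap: "laplacian \<phi> \<in> borel_measurable M"
    by (intro borel_measurable_lebesgue_on tfc_borel[OF tfc_laplacian[OF \<phi>]])
  have mG: "(\<lambda>x. G x y) \<in> borel_measurable M"
    unfolding G_def mob_eq using mf by measurable
  have "(\<integral>x. G x y * laplacian \<phi> x \<partial>M) = (\<integral>x. - (1 / newton_const) * (ln (norm (x - y)) * laplacian \<phi> x + Re (L x) * laplacian \<phi> x) \<partial>M)"
  proof (rule integral_cong_AE)
    show "AE x in M. G x y * laplacian \<phi> x = - (1 / newton_const) * (ln (norm (x - y)) * laplacian \<phi> x + Re (L x) * laplacian \<phi> x)"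
      using AE_neq[of y] by eventually_elim (use newton_const_pos in \<open>simp add: G_def L(2) field_simps\<close>)
  qed (use mG mlap mL ml in measurable)
  also have "\<dots> = - (1 / newton_const) * (newton_const * \<phi> y)"
    using i H P(1) by simp
  finally show ?thesis using newton_const_pos by simp
qed

lemma f_measurable[measurable]: "f \<in> borel_measurable M"
  using f_cont \<Omega>(1) by (intro continuous_imp_measurable_on_sets_lebesgue) auto

lemma cnj_measurable[measurable]: "cnj \<in> borel_measurable borel"
  by (intro borel_measurable_continuous_onI continuous_intros)

lemma G_measurable[measurable]: "(\<lambda>(x, y). G x y) \<in> borel_measurable (M \<Otimes>\<^sub>M M)"
  unfolding G_def mob_eq by measurable

lemma G_measurable1[measurable]: "(\<lambda>x. G x y) \<in> borel_measurable M"
  unfolding G_def mob_eq by measurable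

text \<open>Comparison with the logarithmic kernel via \<open>G_le\<close>. Uniformity of the bound
  in the pole is the point: it makes the double integral of \<open>G\<close> against square
  integrable functions converge absolutely.\<close>

lemma G_L2:
  obtains B where "0 \<le> B" "\<And>y. y \<in> \<Omega> \<Longrightarrow> sq_int M (\<lambda>x. G x y) \<and> (\<integral>x. (G x y)\<^sup>2 \<partial>M) \<le> B"
proof -
  obtain R where R: "\<And>x. x \<in> \<Omega> \<Longrightarrow> norm x \<le> R" using \<Omega>(2) by (auto simp: bounded_iff)
  define d where "d = 2 * \<bar>R\<bar> + 1"
  have d: "norm (x - z) < d" if "x \<in> \<Omega>" "z \<in> \<Omega>" for x z
    using R[OF that(1)] R[OF that(2)] norm_triangle_ineq4[of x z] by (auto simp: d_def)
  have d0: "0 < d" by (simp add: d_def)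
  show thesis
  proof (rule that[of "128 * d\<^sup>2 / newton_const\<^sup>2"])
    fix y assume y: "y \<in> \<Omega>"
    note L = log_kernel_L2[OF \<Omega> d0 less_imp_le[OF d] y]
    have le: "(G x y)\<^sup>2 \<le> (ln (d / norm (x - y)))\<^sup>2 / newton_const\<^sup>2" if "x \<in> \<Omega>" for x
      using power_mono[OF G_le[OF d that y] G_nonneg[OF that y], of 2] by (simp add: power_divide)
    have iL: "integrable M (\<lambda>x. (ln (d / norm (x - y)))\<^sup>2 / newton_const\<^sup>2)" using L(1) by (simp add: sq_int_def)
    have iG: "integrable M (\<lambda>x. (G x y)\<^sup>2)"
      by (rule Bochner_Integration.integrable_bound[OF iL]) (use le in \<open>auto intro!: AE_I2\<close>)
    have "(\<integral>x. (G x y)\<^sup>2 \<partial>M) \<le> (\<integral>x. (ln (d / norm (x - y)))\<^sup>2 / newton_const\<^sup>2 \<partial>M)"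
      using iG iL le by (intro integral_mono) auto
    also have "\<dots> \<le> 128 * d\<^sup>2 / newton_const\<^sup>2" using L(2) by (simp add: divide_right_mono)
    finally show "sq_int M (\<lambda>x. G x y) \<and> (\<integral>x. (G x y)\<^sup>2 \<partial>M) \<le> 128 * d\<^sup>2 / newton_const\<^sup>2"
      using iG by (simp add: sq_int_def)
  qed simp
qed

text \<open>The extension by zero is continuous at every boundary point, regular or not: by
  \<open>G_boundary\<close>, values above e / 2 occur only in a compact subset of \<Omega>, which a
  neighbourhood of the boundary point avoids.\<close>

lemma G_is_green:
  assumes y: "y \<in> \<Omega>" shows "is_green \<Omega> y (\<lambda>x. if x \<in> \<Omega> then G x y else 0)" (is "is_green \<Omega> y ?g")
  unfolding is_green_def
proof (intro conjI allI impI ballI)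
  obtain B where B: "\<And>y. y \<in> \<Omega> \<Longrightarrow> sq_int M (\<lambda>x. G x y) \<and> (\<integral>x. (G x y)\<^sup>2 \<partial>M) \<le> B" using G_L2 by blast
  have "integrable M (\<lambda>x. G x y)"
    using sq_int_integrable[OF finite_measure_lebesgue_on[OF \<Omega>]] B[OF y] by blast
  then have "integrable M ?g" by (rule Bochner_Integration.integrable_cong[THEN iffD1, rotated 2]) auto
  then have si: "set_integrable lebesgue \<Omega> ?g" by (simp add: set_lebesgue_integral_eq_on[OF \<Omega>(1)])
  show "locally_integrable_on \<Omega> ?g"
    unfolding locally_integrable_on_def
  proof (intro allI impI)
    fix K assume "compact K \<and> K \<subseteq> \<Omega>"
    then show "set_integrable lebesgue K ?g"
      by (intro set_integrable_subset[OF si]) (auto dest: lmeasurable_compact)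
  qed
  show "(LINT x:\<Omega>|lebesgue. ?g x * - laplacian \<phi> x) = \<phi> y" if "test_function \<Omega> \<phi>" for \<phi>
  proof -
    have t: "tfc {2} \<Omega> \<phi>" using that by (auto simp: test_function_tfc tfc_def)
    have "(LINT x:\<Omega>|lebesgue. ?g x * - laplacian \<phi> x) = (\<integral>x. - (G x y * laplacian \<phi> x) \<partial>M)"
      unfolding set_lebesgue_integral_eq_on[OF \<Omega>(1)] by (intro Bochner_Integration.integral_cong) auto
    then show ?thesis using G_representation[OF y t] by simp
  qed
  show "?g x = 0" if "x \<in> frontier \<Omega>" for x
    using that \<Omega>(1) by (simp add: frontier_def interior_open)
  show "continuous_on (closure \<Omega> - {y}) ?g"
    unfolding continuous_on_eq_continuous_within
  proof
    fix p assume p: "p \<in> closure \<Omega> - {y}"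
    show "continuous (at p within closure \<Omega> - {y}) ?g"
    proof (cases "p \<in> \<Omega>")
      case True
      have o: "open (\<Omega> - {y})" using \<Omega>(1) by auto
      have "continuous_on (\<Omega> - {y}) ?g" using G_continuous[OF y] by (rule continuous_on_eq) auto
      then have "isCont ?g p" using True p o by (simp add: continuous_on_eq_continuous_at)
      then show ?thesis by (rule continuous_at_imp_continuous_at_within)
    next
      case False
      show ?thesis unfolding continuous_within tendsto_iff
      proof (intro allI impI)
        fix e :: real assume e: "0 < e"
        obtain K where K: "compact K" "K \<subseteq> \<Omega>" "\<And>x. x \<in> \<Omega> - K \<Longrightarrow> G x y \<le> e / 2"
          using G_boundary[OF y, of "e / 2"] e by (metis half_gt_zero)
        have "open (- K)" "p \<in> - K" using K False compact_imp_closed by auto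
        then have "eventually (\<lambda>x. x \<in> - K) (at p within closure \<Omega> - {y})"
          unfolding eventually_at_topological by blast
        then show "eventually (\<lambda>x. dist (?g x) (?g p) < e) (at p within closure \<Omega> - {y})"
        proof eventually_elim
          case (elim x)
          show ?case
          proof (cases "x \<in> \<Omega>")
            case True
            then have "G x y \<le> e / 2" "0 \<le> G x y" using K(3)[of x] elim G_nonneg[OF True y] by auto
            then show ?thesis using True False e by (simp add: dist_real_def)
          qed (use False e in simp)
        qed
      qed
    qed
  qed
qed

end

section \<open>Positive semidefinite kernels and the energy form\<close>

lemma integrable_pair_product:
  fixes a b :: "'a \<Rightarrow> 'b::{real_normed_field, banach, second_countable_topology}"
  assumes "finite_measure M" and a: "integrable M a" and b: "integrable M b"
  shows "integrable (M \<Otimes>\<^sub>M M) (\<lambda>p. a (fst p) * b (snd p))"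
proof -
  interpret finite_measure M by fact
  interpret pair_sigma_finite M M ..
  have [measurable]: "a \<in> borel_measurable M" "b \<in> borel_measurable M" using a b by auto
  show ?thesis
  proof (rule Fubini_integrable)
    show "integrable M (\<lambda>x. \<integral>y. norm (a (fst (x, y)) * b (snd (x, y))) \<partial>M)"
      using a b by (simp add: norm_mult)
    show "AE x in M. integrable M (\<lambda>y. a (fst (x, y)) * b (snd (x, y)))"
      using b by simp
  qed measurable
qed

context conformal_disc
begin

interpretation finite_measure M by (rule finite_measure_lebesgue_on[OF \<Omega>])
interpretation pair_sigma_finite M M ..

text \<open>Test functions are all \<open>k\<close> dominated by a multiple of |h|, a class stable
  under bounded multipliers; this stability is what lets kernels be multiplied. They are complex
  because the building blocks 1 / (1 - z cnj w) are Hermitian rather than real.\<close>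

definition psd :: "(complex \<Rightarrow> real) \<Rightarrow> (complex \<Rightarrow> complex \<Rightarrow> complex) \<Rightarrow> bool" where
  "psd h A \<longleftrightarrow> (\<lambda>p. A (fst p) (snd p)) \<in> borel_measurable (M \<Otimes>\<^sub>M M) \<and> (\<exists>C. \<forall>x y. norm (A x y) \<le> C) \<and>
    (\<forall>k C. k \<in> borel_measurable M \<and> (\<forall>x. norm (k x) \<le> C * \<bar>h x\<bar>) \<longrightarrow>
      0 \<le> Re (\<integral>p. A (fst p) (snd p) * (k (fst p) * cnj (k (snd p))) \<partial>(M \<Otimes>\<^sub>M M)))"

lemma psd_integrable:
  fixes A :: "complex \<Rightarrow> complex \<Rightarrow> complex"
  assumes h: "integrable M h" and A: "(\<lambda>p. A (fst p) (snd p)) \<in> borel_measurable (M \<Otimes>\<^sub>M M)" "\<And>x y. norm (A x y) \<le> C"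
    and k: "k \<in> borel_measurable M" "\<And>x. norm (k x) \<le> D * \<bar>h x\<bar>"
  shows "integrable (M \<Otimes>\<^sub>M M) (\<lambda>p. A (fst p) (snd p) * (k (fst p) * cnj (k (snd p))))"
    "integrable (M \<Otimes>\<^sub>M M) (\<lambda>p. C * norm (k (fst p) * cnj (k (snd p))))"
proof -
  have "integrable M (\<lambda>x. D * \<bar>h x\<bar>)" using h by simp
  then have ik: "integrable M k" using k
    by (elim Bochner_Integration.integrable_bound) (auto intro!: AE_I2 order_trans[OF k(2)])
  have "integrable (M \<Otimes>\<^sub>M M) (\<lambda>p. k (fst p) * cnj (k (snd p)))"
    using ik by (intro integrable_pair_product finite_measure_axioms) auto
  then show i: "integrable (M \<Otimes>\<^sub>M M) (\<lambda>p. C * norm (k (fst p) * cnj (k (snd p))))"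
    by (intro integrable_mult_right integrable_norm)
  note [measurable] = A(1) k(1)
  have C0: "0 \<le> C" using A(2)[of undefined undefined] norm_ge_zero order_trans by blast
  show "integrable (M \<Otimes>\<^sub>M M) (\<lambda>p. A (fst p) (snd p) * (k (fst p) * cnj (k (snd p))))"
  proof (rule Bochner_Integration.integrable_bound[OF i])
    have le: "norm (A x y * z) \<le> norm (C * norm z)" for x y z
    proof -
      have "norm (A x y) * norm z \<le> C * norm z" by (intro mult_right_mono A(2) norm_ge_zero)
      also have "\<dots> = norm (C * norm z)" using C0 by simp
      finally show ?thesis by (simp only: norm_mult)
    qed
    show "AE p in M \<Otimes>\<^sub>M M. norm (A (fst p) (snd p) * (k (fst p) * cnj (k (snd p)))) \<le> norm (C * norm (k (fst p) * cnj (k (snd p))))"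
      by (intro AE_I2 le)
  qed measurable
qed

lemma psd_one:
  assumes h: "integrable M h" shows "psd h (\<lambda>x y. 1)"
  unfolding psd_def
proof (intro conjI allI impI)
  fix k :: "complex \<Rightarrow> complex" and C :: real assume k: "k \<in> borel_measurable M \<and> (\<forall>x. norm (k x) \<le> C * \<bar>h x\<bar>)"
  have "integrable M (\<lambda>x. C * \<bar>h x\<bar>)" using h by simp
  then have ik: "integrable M k" using k
    by (elim Bochner_Integration.integrable_bound) (auto intro!: AE_I2 intro: order_trans)
  have i: "integrable (M \<Otimes>\<^sub>M M) (\<lambda>p. k (fst p) * cnj (k (snd p)))"
    using ik by (intro integrable_pair_product finite_measure_axioms) auto
  have "(\<integral>p. k (fst p) * cnj (k (snd p)) \<partial>(M \<Otimes>\<^sub>M M)) = (\<integral>x. \<integral>y. k x * cnj (k y) \<partial>M \<partial>M)"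
    using integral_fst'[OF i] by simp
  also have "\<dots> = (\<integral>x. k x \<partial>M) * cnj (\<integral>x. k x \<partial>M)" using ik by simp
  also have "Re \<dots> = (norm (\<integral>x. k x \<partial>M))\<^sup>2" by (simp add: complex_mult_cnj cmod_power2)
  finally show "0 \<le> Re (\<integral>p. 1 * (k (fst p) * cnj (k (snd p))) \<partial>(M \<Otimes>\<^sub>M M))" by simp
qed auto

text \<open>The new factor is absorbed into the test function, since \<open>e x * k x\<close> is
  again dominated by a multiple of |h|.\<close>

lemma psd_mult:
  assumes A: "psd h A" and e[measurable]: "e \<in> borel_measurable M" and B: "\<And>x. norm (e x) \<le> B"
  shows "psd h (\<lambda>x y. A x y * (e x * cnj (e y)))"
  unfolding psd_def
proof (intro conjI allI impI)
  have [measurable]: "(\<lambda>p. A (fst p) (snd p)) \<in> borel_measurable (M \<Otimes>\<^sub>M M)" using A by (simp add: psd_def)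
  show "(\<lambda>p. A (fst p) (snd p) * (e (fst p) * cnj (e (snd p)))) \<in> borel_measurable (M \<Otimes>\<^sub>M M)" by measurable
  have B0: "0 \<le> B" using B[of undefined] norm_ge_zero order_trans by blast
  obtain C where C: "\<And>x y. norm (A x y) \<le> C" using A by (auto simp: psd_def)
  have C0: "0 \<le> C" using C[of undefined undefined] norm_ge_zero order_trans by blast
  have "norm (A x y * (e x * cnj (e y))) \<le> C * (B * B)" for x y
    unfolding norm_mult complex_mod_cnj using C B B0 C0 by (intro mult_mono) auto
  then show "\<exists>C. \<forall>x y. norm (A x y * (e x * cnj (e y))) \<le> C" by blast
  fix k :: "complex \<Rightarrow> complex" and D :: real assume k: "k \<in> borel_measurable M \<and> (\<forall>x. norm (k x) \<le> D * \<bar>h x\<bar>)"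
  then have [measurable]: "k \<in> borel_measurable M" by simp
  have "(\<lambda>x. e x * k x) \<in> borel_measurable M" by measurable
  moreover have "norm (e x * k x) \<le> (B * D) * \<bar>h x\<bar>" for x
    unfolding norm_mult mult.assoc using k B B0 by (intro mult_mono) auto
  ultimately have "0 \<le> Re (\<integral>p. A (fst p) (snd p) * ((e (fst p) * k (fst p)) * cnj (e (snd p) * k (snd p))) \<partial>(M \<Otimes>\<^sub>M M))"
    using A unfolding psd_def by blast
  then show "0 \<le> Re (\<integral>p. A (fst p) (snd p) * (e (fst p) * cnj (e (snd p))) * (k (fst p) * cnj (k (snd p))) \<partial>(M \<Otimes>\<^sub>M M))"
    by (simp add: mult_ac)
qed

lemma psd_add:
  assumes h: "integrable M h" and A: "psd h A" and B: "psd h B" shows "psd h (\<lambda>x y. A x y + B x y)"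
  unfolding psd_def
proof (intro conjI allI impI)
  have mA[measurable]: "(\<lambda>p. A (fst p) (snd p)) \<in> borel_measurable (M \<Otimes>\<^sub>M M)"
    and mB[measurable]: "(\<lambda>p. B (fst p) (snd p)) \<in> borel_measurable (M \<Otimes>\<^sub>M M)" using A B by (auto simp: psd_def)
  show "(\<lambda>p. A (fst p) (snd p) + B (fst p) (snd p)) \<in> borel_measurable (M \<Otimes>\<^sub>M M)" by measurable
  obtain C D where C: "\<And>x y. norm (A x y) \<le> C" and D: "\<And>x y. norm (B x y) \<le> D" using A B by (auto simp: psd_def)
  show "\<exists>C. \<forall>x y. norm (A x y + B x y) \<le> C"
    using norm_triangle_mono[OF C D] by blast
  fix k :: "complex \<Rightarrow> complex" and E :: real assume k: "k \<in> borel_measurable M \<and> (\<forall>x. norm (k x) \<le> E * \<bar>h x\<bar>)"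
  have iA: "integrable (M \<Otimes>\<^sub>M M) (\<lambda>p. A (fst p) (snd p) * (k (fst p) * cnj (k (snd p))))"
    using k by (intro psd_integrable(1)[OF h mA C, of k E]) auto
  have iB: "integrable (M \<Otimes>\<^sub>M M) (\<lambda>p. B (fst p) (snd p) * (k (fst p) * cnj (k (snd p))))"
    using k by (intro psd_integrable(1)[OF h mB D, of k E]) auto
  have "0 \<le> Re (\<integral>p. A (fst p) (snd p) * (k (fst p) * cnj (k (snd p))) \<partial>(M \<Otimes>\<^sub>M M))"
    "0 \<le> Re (\<integral>p. B (fst p) (snd p) * (k (fst p) * cnj (k (snd p))) \<partial>(M \<Otimes>\<^sub>M M))"
    using A B k unfolding psd_def by blast+
  then show "0 \<le> Re (\<integral>p. (A (fst p) (snd p) + B (fst p) (snd p)) * (k (fst p) * cnj (k (snd p))) \<partial>(M \<Otimes>\<^sub>M M))"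
    unfolding distrib_right using iA iB by simp
qed

lemma psd_zero: "psd h (\<lambda>x y. 0)"
  unfolding psd_def by auto

lemma psd_limit:
  assumes h: "integrable M h" and A: "\<And>n. psd h (A n)" and C: "\<And>n x y. norm (A n x y) \<le> C"
    and l: "\<And>x y. (\<lambda>n. A n x y) \<longlonglongrightarrow> B x y"
  shows "psd h B"
  unfolding psd_def
proof (intro conjI allI impI)
  have mA[measurable]: "(\<lambda>p. A n (fst p) (snd p)) \<in> borel_measurable (M \<Otimes>\<^sub>M M)" for n using A by (simp add: psd_def)
  show mB[measurable]: "(\<lambda>p. B (fst p) (snd p)) \<in> borel_measurable (M \<Otimes>\<^sub>M M)"
    by (rule borel_measurable_LIMSEQ_metric[OF mA]) (rule l)
  have CB: "norm (B x y) \<le> C" for x y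
    using C by (intro LIMSEQ_le_const2[OF tendsto_norm[OF l]]) auto
  then show "\<exists>C. \<forall>x y. norm (B x y) \<le> C" by blast
  fix k :: "complex \<Rightarrow> complex" and E :: real assume k: "k \<in> borel_measurable M \<and> (\<forall>x. norm (k x) \<le> E * \<bar>h x\<bar>)"
  then have km[measurable]: "k \<in> borel_measurable M" by simp
  have "(\<lambda>n. \<integral>p. A n (fst p) (snd p) * (k (fst p) * cnj (k (snd p))) \<partial>(M \<Otimes>\<^sub>M M)) \<longlonglongrightarrow>
     (\<integral>p. B (fst p) (snd p) * (k (fst p) * cnj (k (snd p))) \<partial>(M \<Otimes>\<^sub>M M))"
  proof (rule integral_dominated_convergence)
    show "integrable (M \<Otimes>\<^sub>M M) (\<lambda>p. C * norm (k (fst p) * cnj (k (snd p))))"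
      using k by (intro psd_integrable(2)[OF h mB CB, of k E]) auto
    show "AE p in M \<Otimes>\<^sub>M M. (\<lambda>n. A n (fst p) (snd p) * (k (fst p) * cnj (k (snd p)))) \<longlonglongrightarrow> B (fst p) (snd p) * (k (fst p) * cnj (k (snd p)))"
      by (intro AE_I2 tendsto_mult_right l)
    show "AE p in M \<Otimes>\<^sub>M M. norm (A n (fst p) (snd p) * (k (fst p) * cnj (k (snd p)))) \<le> C * norm (k (fst p) * cnj (k (snd p)))" for n
      using C by (intro AE_I2) (simp only: norm_mult[of "A _ _ _"] mult_right_mono norm_ge_zero)
  qed measurable
  then have "(\<lambda>n. Re (\<integral>p. A n (fst p) (snd p) * (k (fst p) * cnj (k (snd p))) \<partial>(M \<Otimes>\<^sub>M M))) \<longlonglongrightarrow>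
     Re (\<integral>p. B (fst p) (snd p) * (k (fst p) * cnj (k (snd p))) \<partial>(M \<Otimes>\<^sub>M M))" by (rule tendsto_Re)
  then show "0 \<le> Re (\<integral>p. B (fst p) (snd p) * (k (fst p) * cnj (k (snd p))) \<partial>(M \<Otimes>\<^sub>M M))"
    by (rule LIMSEQ_le_const) (use A k in \<open>unfold psd_def, blast\<close>)
qed

text \<open>The quotient is the geometric series of the kernels
  \<open>A x y * (e x * cnj (e y)) ^ j\<close>, each semidefinite by \<open>psd_mult\<close>. The
  bound q < 1 on |e| makes the partial sums uniformly bounded, so that \<open>psd_limit\<close>
  applies.\<close>

lemma psd_geometric:
  assumes h: "integrable M h" and A: "psd h A" and e[measurable]: "e \<in> borel_measurable M"
    and q: "\<And>x. norm (e x) \<le> q" "q < 1"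
  shows "psd h (\<lambda>x y. A x y / (1 - e x * cnj (e y)))"
proof -
  obtain C where C: "\<And>x y. norm (A x y) \<le> C" using A by (auto simp: psd_def)
  have C0: "0 \<le> C" using C[of undefined undefined] norm_ge_zero order_trans by blast
  have q0: "0 \<le> q" using q(1)[of undefined] norm_ge_zero order_trans by blast
  define t where "t x y = e x * cnj (e y)" for x y
  have t: "norm (t x y) \<le> q" "norm (t x y) < 1" for x y
  proof -
    have "norm (e y) \<le> 1" using q(1)[of y] q(2) by linarith
    then have "norm (t x y) \<le> q * 1"
      unfolding t_def norm_mult complex_mod_cnj using q(1)[of x] q0 by (intro mult_mono) auto
    then show "norm (t x y) \<le> q" "norm (t x y) < 1" using q(2) by auto
  qed
  define S where "S n x y = (\<Sum>j<n. A x y * t x y ^ j)" for n x y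
  have S: "psd h (S n)" for n
  proof (induction n)
    case 0 then show ?case unfolding S_def by (simp add: psd_zero)
  next
    case (Suc n)
    have "norm (e x ^ n) \<le> 1" for x
      using q(1)[of x] q(2) by (simp add: norm_power power_le_one)
    then have "psd h (\<lambda>x y. A x y * (e x ^ n * cnj (e y ^ n)))" by (intro psd_mult A) auto
    from psd_add[OF h Suc this] show ?case unfolding S_def t_def by (simp add: power_mult_distrib)
  qed
  have Seq: "S n x y = A x y * ((1 - t x y ^ n) / (1 - t x y))" for n x y
  proof -
    have "t x y \<noteq> 1" using t(2)[of x y] by auto
    then show ?thesis unfolding S_def sum_distrib_left[symmetric] by (simp add: sum_gp_strict)
  qed
  show ?thesis
  proof (rule psd_limit[OF h S])
    show "norm (S n x y) \<le> C * (2 / (1 - q))" for n x y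
    proof -
      have "norm (1 - t x y ^ n) \<le> 1 + 1"
        using norm_triangle_ineq4[of 1 "t x y ^ n"] t(2)[of x y] by (simp add: norm_power power_le_one add_mono order_trans)
      moreover have "1 - q \<le> norm (1 - t x y)" using norm_triangle_ineq2[of 1 "t x y"] t(1)[of x y] by simp
      ultimately show ?thesis unfolding Seq norm_mult norm_divide
        using C C0 q(2) by (intro mult_mono frac_le) auto
    qed
    show "(\<lambda>n. S n x y) \<longlonglongrightarrow> A x y / (1 - e x * cnj (e y))" for x y
    proof -
      have "(\<lambda>n. \<Sum>j<n. t x y ^ j) \<longlonglongrightarrow> 1 / (1 - t x y)" using geometric_sums[OF t(2)] by (simp add: sums_def)
      from tendsto_mult_left[OF this, of "A x y"] show ?thesis unfolding S_def sum_distrib_left t_def by simp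
    qed
  qed
qed

text \<open>By \<open>one_minus_mob_sq\<close> the kernel is w x * w y over |1 - f x cnj (f y)|^2,
  and this squared modulus is the product of a geometric denominator for f and one for its
  conjugate. So one multiplication by w and two uses of \<open>psd_geometric\<close> raise the power
  by one.\<close>

lemma psd_kernel_power:
  assumes h: "integrable M h" and q: "0 \<le> q" "q < 1" and z: "\<And>x. x \<in> \<Omega> \<Longrightarrow> q < norm (f x) \<Longrightarrow> h x = 0"
  shows "0 \<le> (\<integral>p. (1 - (norm (mob (snd p) (fst p)))\<^sup>2) ^ m * (h (fst p) * h (snd p)) \<partial>(M \<Otimes>\<^sub>M M))"
proof -
  \<comment> \<open>Cutting f off where |f| > q provides the uniform bound that the geometric series
    needs; the kernel changes only where h vanishes.\<close>
  define F where "F x = (if norm (f x) \<le> q then f x else 0)" for x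
  have F[measurable]: "F \<in> borel_measurable M" unfolding F_def by measurable
  have Fq: "norm (F x) \<le> q" for x using q by (simp add: F_def)
  define w where "w x = complex_of_real (1 - (norm (F x))\<^sup>2)" for x
  have w[measurable]: "w \<in> borel_measurable M" unfolding w_def by measurable
  have w1: "norm (w x) \<le> 1" for x
  proof -
    have "(norm (F x))\<^sup>2 \<le> 1" using Fq[of x] q by (intro power_le_one) auto
    then show ?thesis unfolding w_def norm_of_real by (simp add: abs_le_iff)
  qed
  define \<kappa> where "\<kappa> x y = w x * cnj (w y) / (1 - F x * cnj (F y)) / (1 - cnj (F x) * cnj (cnj (F y)))" for x y
  have step: "psd h (\<lambda>x y. A x y * \<kappa> x y)" if A: "psd h A" for A
  proof -
    have "psd h (\<lambda>x y. A x y * (w x * cnj (w y)))" by (rule psd_mult[OF A w w1])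
    then have "psd h (\<lambda>x y. A x y * (w x * cnj (w y)) / (1 - F x * cnj (F y)))" by (rule psd_geometric[OF h _ F Fq q(2)])
    then have "psd h (\<lambda>x y. A x y * (w x * cnj (w y)) / (1 - F x * cnj (F y)) / (1 - cnj (F x) * cnj (cnj (F y))))"
      by (rule psd_geometric[OF h _ _ _ q(2)]) (use Fq in auto)
    then show ?thesis by (simp add: \<kappa>_def)
  qed
  have P: "psd h (\<lambda>x y. \<kappa> x y ^ m)"
  proof (induction m)
    case (Suc m) then show ?case using step[OF Suc] by (simp add: mult.commute)
  qed (simp add: psd_one[OF h])
  have hm: "(\<lambda>x. complex_of_real (h x)) \<in> borel_measurable M" using h by auto
  have "0 \<le> Re (\<integral>p. \<kappa> (fst p) (snd p) ^ m * (complex_of_real (h (fst p)) * cnj (complex_of_real (h (snd p)))) \<partial>(M \<Otimes>\<^sub>M M))"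
    by (rule P[unfolded psd_def, THEN conjunct2, THEN conjunct2, rule_format, of "\<lambda>x. complex_of_real (h x)" 1])
       (use hm in auto)
  also have "(\<integral>p. \<kappa> (fst p) (snd p) ^ m * (complex_of_real (h (fst p)) * cnj (complex_of_real (h (snd p)))) \<partial>(M \<Otimes>\<^sub>M M)) =
    (\<integral>p. complex_of_real ((1 - (norm (mob (snd p) (fst p)))\<^sup>2) ^ m * (h (fst p) * h (snd p))) \<partial>(M \<Otimes>\<^sub>M M))"
  proof (rule Bochner_Integration.integral_cong[OF refl])
    fix p assume "p \<in> space (M \<Otimes>\<^sub>M M)"
    then obtain x y where p: "p = (x, y)" "x \<in> \<Omega>" "y \<in> \<Omega>" by (auto simp: space_pair_measure)
    have "\<kappa> x y = complex_of_real (1 - (norm (mob y x))\<^sup>2)" if hx: "h x \<noteq> 0" "h y \<noteq> 0"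
    proof -
      have n: "norm (f x) \<le> q" "norm (f y) \<le> q" using z p hx not_le by blast+
      then have Fx: "F x = f x" "F y = f y" by (auto simp: F_def)
      have e: "(1 - f x * cnj (f y)) * (1 - cnj (f x) * f y) = complex_of_real ((norm (1 - cnj (f y) * f x))\<^sup>2)"
      proof -
        have "(1 - f x * cnj (f y)) * (1 - cnj (f x) * f y) = (1 - cnj (f y) * f x) * cnj (1 - cnj (f y) * f x)"
          by (simp add: mult.commute)
        then show ?thesis by (simp only: complex_norm_square)
      qed
      have "\<kappa> x y = w x * w y / ((1 - f x * cnj (f y)) * (1 - cnj (f x) * f y))"
        by (simp add: \<kappa>_def Fx w_def)
      also have "\<dots> = complex_of_real ((1 - (norm (f x))\<^sup>2) * (1 - (norm (f y))\<^sup>2) / (norm (1 - cnj (f y) * f x))\<^sup>2)"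
        unfolding e by (simp add: w_def Fx)
      finally show ?thesis unfolding one_minus_mob_sq[OF p(2,3)] by (simp only: mult.commute)
    qed
    then show "\<kappa> (fst p) (snd p) ^ m * (complex_of_real (h (fst p)) * cnj (complex_of_real (h (snd p)))) =
      complex_of_real ((1 - (norm (mob (snd p) (fst p)))\<^sup>2) ^ m * (h (fst p) * h (snd p)))"
      unfolding p by (cases "h x = 0 \<or> h y = 0") auto
  qed
  finally show ?thesis by (simp only: integral_complex_of_real Re_complex_of_real)
qed

lemma G_form_integrable:
  assumes h: "sq_int M h" and k: "sq_int M k"
  shows "integrable (M \<Otimes>\<^sub>M M) (\<lambda>p. G (fst p) (snd p) * (h (fst p) * k (snd p)))"
proof (rule Fubini_integrable)
  have [measurable]: "h \<in> borel_measurable M" "k \<in> borel_measurable M" using h k by (auto simp: sq_int_def)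
  have mG[measurable]: "(\<lambda>p. G (fst p) (snd p)) \<in> borel_measurable (M \<Otimes>\<^sub>M M)" using G_measurable by (simp add: case_prod_beta')
  show m: "(\<lambda>p. G (fst p) (snd p) * (h (fst p) * k (snd p))) \<in> borel_measurable (M \<Otimes>\<^sub>M M)" by measurable
  obtain B where B: "0 \<le> B" "\<And>y. y \<in> \<Omega> \<Longrightarrow> sq_int M (\<lambda>x. G x y) \<and> (\<integral>x. (G x y)\<^sup>2 \<partial>M) \<le> B" using G_L2 by blast
  have k': "sq_int M (\<lambda>x. \<bar>k x\<bar>)" using k by (auto simp: sq_int_def)
  have Gx: "sq_int M (\<lambda>y. G x y)" "(\<integral>y. (G x y)\<^sup>2 \<partial>M) \<le> B" if "x \<in> \<Omega>" for x
    using B(2)[OF that] by (simp_all add: G_commute[of x])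
  have ii: "integrable M (\<lambda>y. G x y * k y)" if "x \<in> \<Omega>" for x by (intro sq_int_mult Gx k that)
  show "AE x in M. integrable M (\<lambda>y. G (fst (x, y)) (snd (x, y)) * (h (fst (x, y)) * k (snd (x, y))))"
  proof (rule AE_I2)
    fix x assume "x \<in> space M"
    then have "integrable M (\<lambda>y. h x * (G x y * k y))" using ii[of x] by simp
    then show "integrable M (\<lambda>y. G (fst (x, y)) (snd (x, y)) * (h (fst (x, y)) * k (snd (x, y))))" by (simp add: mult_ac)
  qed
  define J where "J = sqrt B * sqrt (\<integral>x. (k x)\<^sup>2 \<partial>M)"
  have bd: "(\<integral>y. norm (G x y * (h x * k y)) \<partial>M) \<le> \<bar>h x\<bar> * J" if x: "x \<in> \<Omega>" for x
  proof -
    have "(\<integral>y. norm (G x y * (h x * k y)) \<partial>M) = (\<integral>y. \<bar>h x\<bar> * (G x y * \<bar>k y\<bar>) \<partial>M)"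
      using G_nonneg[OF x] by (intro Bochner_Integration.integral_cong refl) (simp add: abs_mult)
    also have "\<dots> = \<bar>h x\<bar> * (\<integral>y. G x y * \<bar>k y\<bar> \<partial>M)" by simp
    also have "\<dots> \<le> \<bar>h x\<bar> * J"
    proof (rule mult_left_mono)
      have "(\<integral>y. G x y * \<bar>k y\<bar> \<partial>M) \<le> sqrt (\<integral>y. (G x y)\<^sup>2 \<partial>M) * sqrt (\<integral>x. (k x)\<^sup>2 \<partial>M)"
        using cauchy_schwarz_integral_real[OF Gx(1)[OF x] k'] by simp
      also have "\<dots> \<le> J" unfolding J_def using Gx(2)[OF x] by (intro mult_right_mono) auto
      finally show "(\<integral>y. G x y * \<bar>k y\<bar> \<partial>M) \<le> J" .
    qed simp
    finally show ?thesis .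
  qed
  have "integrable M (\<lambda>x. \<bar>h x\<bar> * J)" using sq_int_integrable[OF finite_measure_axioms h] by simp
  then show "integrable M (\<lambda>x. \<integral>y. norm (G (fst (x, y)) (snd (x, y)) * (h (fst (x, y)) * k (snd (x, y)))) \<partial>M)"
  proof (rule Bochner_Integration.integrable_bound)
    show "(\<lambda>x. \<integral>y. norm (G (fst (x, y)) (snd (x, y)) * (h (fst (x, y)) * k (snd (x, y)))) \<partial>M) \<in> borel_measurable M"
      by measurable
    show "AE x in M. norm (\<integral>y. norm (G (fst (x, y)) (snd (x, y)) * (h (fst (x, y)) * k (snd (x, y)))) \<partial>M) \<le> norm (\<bar>h x\<bar> * J)"
    proof (rule AE_I2)
      fix x assume "x \<in> space M"
      then have "(\<integral>y. norm (G x y * (h x * k y)) \<partial>M) \<le> \<bar>h x\<bar> * J" by (intro bd) simp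
      then show "norm (\<integral>y. norm (G (fst (x, y)) (snd (x, y)) * (h (fst (x, y)) * k (snd (x, y)))) \<partial>M) \<le> norm (\<bar>h x\<bar> * J)" by simp
    qed
  qed
qed

lemma AE_pair_neq: "AE p in M \<Otimes>\<^sub>M M. fst p \<noteq> snd p"
proof (rule AE_pair_measure)
  have m[measurable]: "(\<lambda>x. x) \<in> borel_measurable M" by (intro borel_measurable_lebesgue_on) simp
  have "(\<lambda>p. fst p - snd p) \<in> borel_measurable (M \<Otimes>\<^sub>M M)"
    using measurable_compose[OF measurable_fst m] measurable_compose[OF measurable_snd m] by (rule borel_measurable_diff)
  then have "{p \<in> space (M \<Otimes>\<^sub>M M). fst p - snd p \<noteq> 0} \<in> sets (M \<Otimes>\<^sub>M M)" by measurable
  then show "{p \<in> space (M \<Otimes>\<^sub>M M). fst p \<noteq> snd p} \<in> sets (M \<Otimes>\<^sub>M M)" by simp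
  show "AE x in M. AE y in M. fst (x, y) \<noteq> snd (x, y)"
  proof (rule AE_I2)
    fix x show "AE y in M. fst (x, y) \<noteq> snd (x, y)" using AE_neq[of x] by eventually_elim auto
  qed
qed

text \<open>Positivity of the energy follows from \<open>2 c G = - ln (1 - K) = (\<Sum>m. K\<^sup>m / m)\<close>, where
  \<open>K = (1 - |z|\<^sup>2) (1 - |w|\<^sup>2) / |1 - z w'|\<^sup>2\<close> is a positive semidefinite kernel on the disc.\<close>

lemma G_form_nonneg:
  assumes h: "sq_int M h"
  shows "0 \<le> (\<integral>p. G (fst p) (snd p) * (h (fst p) * h (snd p)) \<partial>(M \<Otimes>\<^sub>M M))"
proof -
  define c where "c = 2 * newton_const"
  have c: "0 < c" using newton_const_pos by (simp add: c_def)
  \<comment> \<open>The levels q n increase to 1. Restricting h to |f| \<le> q n puts it in the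
    reach of \<open>psd_kernel_power\<close>; the restriction is removed in the limit together with
    the truncation of the series.\<close>
  define q where "q n = 1 - 1 / real (Suc n)" for n
  have q: "0 \<le> q n" "q n < 1" for n by (auto simp: q_def divide_le_eq_1)
  define I where "I n x = (if norm (f x) \<le> q n then 1 else 0 :: real)" for n x
  define K where "K p = 1 - (norm (mob (snd p) (fst p)))\<^sup>2" for p
  \<comment> \<open>The term m = 0 vanishes because division by 0 gives 0, so the sum is a partial
    sum of the logarithmic series although it is indexed from 0.\<close>
  define A where "A n p = (\<Sum>m<n. K p ^ m / real m) * ((I n (fst p) * h (fst p)) * (I n (snd p) * h (snd p)))" for n p
  have hm[measurable]: "h \<in> borel_measurable M" using h by (simp add: sq_int_def)
  have ih: "integrable M h" by (rule sq_int_integrable[OF finite_measure_axioms h])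
  have Im[measurable]: "I n \<in> borel_measurable M" for n unfolding I_def by measurable
  have Km[measurable]: "K \<in> borel_measurable (M \<Otimes>\<^sub>M M)" unfolding K_def mob_eq by measurable
  have iIh: "integrable M (\<lambda>x. I n x * h x)" for n
    by (rule Bochner_Integration.integrable_bound[OF ih]) (auto simp: I_def)
  have K01: "0 \<le> K p" "K p \<le> 1" if "p \<in> space (M \<Otimes>\<^sub>M M)" for p
  proof -
    have "norm (mob (snd p) (fst p)) < 1" using that by (intro mob_lt_1) (auto simp: space_pair_measure)
    then show "0 \<le> K p" "K p \<le> 1" by (auto simp: K_def power_le_one)
  qed
  have Kser: "(\<lambda>m. K p ^ m / real m) sums (c * G (fst p) (snd p))" if "p \<in> space (M \<Otimes>\<^sub>M M)" "fst p \<noteq> snd p" for p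
  proof -
    have s: "fst p \<in> \<Omega>" "snd p \<in> \<Omega>" using that by (auto simp: space_pair_measure)
    have m: "0 < norm (mob (snd p) (fst p))" "norm (mob (snd p) (fst p)) < 1" using mob_nz[OF s that(2)] mob_lt_1[OF s] by auto
    then have "0 < (norm (mob (snd p) (fst p)))\<^sup>2" by simp
    then have "\<bar>- K p\<bar> < 1" using K01[OF that(1)] by (simp add: K_def)
    from ln_series'[OF this] have "(\<lambda>m. - (K p ^ m / real m)) sums ln (1 + - K p)" by simp
    then have "(\<lambda>m. K p ^ m / real m) sums (- ln ((norm (mob (snd p) (fst p)))\<^sup>2))"
      using sums_minus by (fastforce simp: K_def)
    moreover have "- ln ((norm (mob (snd p) (fst p)))\<^sup>2) = c * G (fst p) (snd p)"
      using m newton_const_pos by (simp add: c_def G_def ln_realpow)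
    ultimately show ?thesis by simp
  qed
  have pos: "0 \<le> (\<integral>p. A n p \<partial>(M \<Otimes>\<^sub>M M))" for n
  proof -
    have i: "integrable (M \<Otimes>\<^sub>M M) (\<lambda>p. K p ^ m / real m * ((I n (fst p) * h (fst p)) * (I n (snd p) * h (snd p))))" for m
    proof (rule Bochner_Integration.integrable_bound[OF integrable_pair_product[OF finite_measure_axioms iIh iIh]])
      show "AE p in M \<Otimes>\<^sub>M M. norm (K p ^ m / real m * ((I n (fst p) * h (fst p)) * (I n (snd p) * h (snd p))))
          \<le> norm (I n (fst p) * h (fst p) * (I n (snd p) * h (snd p)))"
      proof (rule AE_I2)
        fix p assume p: "p \<in> space (M \<Otimes>\<^sub>M M)"
        have "\<bar>K p ^ m / real m\<bar> \<le> 1"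
          using K01[OF p] by (cases m) (auto simp: divide_le_eq power_le_one intro: order_trans[OF power_le_one] simp del: power_Suc)
        then have "\<bar>K p ^ m / real m\<bar> * norm (I n (fst p) * h (fst p) * (I n (snd p) * h (snd p))) \<le> 1 * norm (I n (fst p) * h (fst p) * (I n (snd p) * h (snd p)))"
          by (intro mult_right_mono) auto
        then show "norm (K p ^ m / real m * ((I n (fst p) * h (fst p)) * (I n (snd p) * h (snd p))))
          \<le> norm (I n (fst p) * h (fst p) * (I n (snd p) * h (snd p)))" by (simp add: abs_mult)
      qed
    qed measurable
    have "(\<integral>p. A n p \<partial>(M \<Otimes>\<^sub>M M)) = (\<Sum>m<n. \<integral>p. K p ^ m / real m * ((I n (fst p) * h (fst p)) * (I n (snd p) * h (snd p))) \<partial>(M \<Otimes>\<^sub>M M))"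
      unfolding A_def sum_distrib_right by (rule Bochner_Integration.integral_sum) (rule i)
    also have "\<dots> = (\<Sum>m<n. (1 / real m) * (\<integral>p. K p ^ m * ((I n (fst p) * h (fst p)) * (I n (snd p) * h (snd p))) \<partial>(M \<Otimes>\<^sub>M M)))"
      by (intro sum.cong refl) (subst integral_mult_right_zero[symmetric], simp)
    also have "0 \<le> \<dots>"
      unfolding K_def
      by (intro sum_nonneg mult_nonneg_nonneg psd_kernel_power[OF iIh[of n] q[of n]]) (auto simp: I_def)
    finally show ?thesis .
  qed
  have "(\<lambda>n. \<integral>p. A n p \<partial>(M \<Otimes>\<^sub>M M)) \<longlonglongrightarrow> (\<integral>p. c * (G (fst p) (snd p) * (h (fst p) * h (snd p))) \<partial>(M \<Otimes>\<^sub>M M))"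
  proof (rule integral_dominated_convergence)
    show "integrable (M \<Otimes>\<^sub>M M) (\<lambda>p. c * \<bar>G (fst p) (snd p) * (h (fst p) * h (snd p))\<bar>)"
      by (intro integrable_mult_right integrable_abs G_form_integrable[OF h h])
    show "AE p in M \<Otimes>\<^sub>M M. (\<lambda>n. A n p) \<longlonglongrightarrow> c * (G (fst p) (snd p) * (h (fst p) * h (snd p)))"
      using AE_pair_neq AE_space
    proof eventually_elim
      case (elim p)
      have s: "fst p \<in> \<Omega>" "snd p \<in> \<Omega>" using elim by (auto simp: space_pair_measure)
      have Il: "(\<lambda>n. I n x) \<longlonglongrightarrow> 1" if "x \<in> \<Omega>" for x
      proof -
        have "q \<longlonglongrightarrow> 1 - 0" unfolding q_def using LIMSEQ_inverse_real_of_nat by (intro tendsto_diff) (auto simp: divide_inverse)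
        then have "eventually (\<lambda>n. norm (f x) < q n) sequentially" using f_in[OF that] by (intro order_tendstoD) auto
        then have "eventually (\<lambda>n. 1 = I n x) sequentially" by eventually_elim (simp add: I_def)
        then show ?thesis by (rule Lim_transform_eventually[OF tendsto_const])
      qed
      have "(\<lambda>n. A n p) \<longlonglongrightarrow> (c * G (fst p) (snd p)) * ((1 * h (fst p)) * (1 * h (snd p)))"
        unfolding A_def using Kser[OF elim(2,1)] s by (intro tendsto_mult Il tendsto_const) (auto simp: sums_def)
      then show ?case by (simp add: mult_ac)
    qed
    show "AE p in M \<Otimes>\<^sub>M M. norm (A n p) \<le> c * \<bar>G (fst p) (snd p) * (h (fst p) * h (snd p))\<bar>" for n
      using AE_pair_neq AE_space
    proof eventually_elim
      case (elim p)
      have s: "fst p \<in> \<Omega>" "snd p \<in> \<Omega>" using elim by (auto simp: space_pair_measure)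
      have nn: "0 \<le> K p ^ m / real m" for m using K01[OF elim(2)] by simp
      \<comment> \<open>All terms are nonnegative, so every partial sum stays below its limit c G.
        This makes c |G h h| an integrable majorant.\<close>
      have "(\<Sum>m<n. K p ^ m / real m) \<le> (\<Sum>m. K p ^ m / real m)"
        using sums_summable[OF Kser[OF elim(2,1)]] nn by (intro sum_le_suminf) auto
      then have le: "(\<Sum>m<n. K p ^ m / real m) \<le> c * G (fst p) (snd p)" using sums_unique[OF Kser[OF elim(2,1)]] by simp
      have b: "\<bar>(I n (fst p) * h (fst p)) * (I n (snd p) * h (snd p))\<bar> \<le> \<bar>h (fst p) * h (snd p)\<bar>"
        by (auto simp: I_def)
      have "\<bar>\<Sum>m<n. K p ^ m / real m\<bar> * \<bar>(I n (fst p) * h (fst p)) * (I n (snd p) * h (snd p))\<bar> \<le> (c * G (fst p) (snd p)) * \<bar>h (fst p) * h (snd p)\<bar>"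
        using le b nn by (intro mult_mono) (auto simp: abs_of_nonneg sum_nonneg intro: order_trans[OF sum_nonneg le])
      also have "\<dots> = c * \<bar>G (fst p) (snd p) * (h (fst p) * h (snd p))\<bar>" using G_nonneg[OF s] c by (simp add: abs_mult)
      finally show ?case unfolding A_def by (simp only: real_norm_def abs_mult[of "sum _ _"])
    qed
    have mG[measurable]: "(\<lambda>p. G (fst p) (snd p)) \<in> borel_measurable (M \<Otimes>\<^sub>M M)" using G_measurable by (simp add: case_prod_beta')
    show "(\<lambda>p. c * (G (fst p) (snd p) * (h (fst p) * h (snd p)))) \<in> borel_measurable (M \<Otimes>\<^sub>M M)" by measurable
    show "A n \<in> borel_measurable (M \<Otimes>\<^sub>M M)" for n unfolding A_def by measurable
  qed
  then have "0 \<le> (\<integral>p. c * (G (fst p) (snd p) * (h (fst p) * h (snd p))) \<partial>(M \<Otimes>\<^sub>M M))"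
    by (rule LIMSEQ_le_const) (use pos in auto)
  then show ?thesis using c by (simp add: zero_le_mult_iff)
qed

text \<open>Positivity of the form B at w + \<Delta>\<phi>. By the Green representation B h
  (\<Delta>\<phi>) is minus the integral of h \<phi>; hence the mixed terms give the linear part and
  B (\<Delta>\<phi>) (\<Delta>\<phi>) is the Dirichlet integral of \<phi>.\<close>

lemma energy_lower_bound:
  assumes w: "sq_int M w" and \<phi>: "tfc {2} \<Omega> \<phi>"
  shows "2 * (\<integral>x. w x * \<phi> x \<partial>M) - (\<integral>x. (norm (gradient \<phi> x))\<^sup>2 \<partial>M) \<le> (\<integral>x. w x * (\<integral>y. G x y * w y \<partial>M) \<partial>M)"
proof -
  define l where "l = laplacian \<phi>"
  have sl: "sq_int M l" unfolding l_def by (rule tfc_sq_int[OF \<Omega> tfc_laplacian[OF \<phi>]])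
  define B where "B h k = (\<integral>p. G (fst p) (snd p) * (h (fst p) * k (snd p)) \<partial>(M \<Otimes>\<^sub>M M))" for h k :: "complex \<Rightarrow> real"
  have Biter: "B h k = (\<integral>x. h x * (\<integral>y. G x y * k y \<partial>M) \<partial>M)" if "sq_int M h" "sq_int M k" for h k
  proof -
    have "B h k = (\<integral>x. \<integral>y. G x y * (h x * k y) \<partial>M \<partial>M)"
      unfolding B_def using integral_fst'[OF G_form_integrable[OF that]] by simp
    also have "\<dots> = (\<integral>x. \<integral>y. h x * (G x y * k y) \<partial>M \<partial>M)" by (simp add: mult_ac)
    finally show ?thesis by simp
  qed
  have Bsym: "B h k = B k h" if "sq_int M h" "sq_int M k" for h k
  proof -
    have "B h k = (\<integral>p. G (snd p) (fst p) * (h (snd p) * k (fst p)) \<partial>(M \<Otimes>\<^sub>M M))"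
      unfolding B_def using integral_product_swap[of "\<lambda>p. G (fst p) (snd p) * (h (fst p) * k (snd p))"]
        borel_measurable_integrable[OF G_form_integrable[OF that]] by (simp add: case_prod_beta')
    then show ?thesis unfolding B_def by (simp add: G_commute mult_ac)
  qed
  have Bl: "B h l = - (\<integral>x. h x * \<phi> x \<partial>M)" if "sq_int M h" for h
  proof -
    have "(\<integral>x. h x * (\<integral>y. G x y * l y \<partial>M) \<partial>M) = (\<integral>x. - (h x * \<phi> x) \<partial>M)"
    proof (rule Bochner_Integration.integral_cong[OF refl])
      fix x assume "x \<in> space M"
      then show "h x * (\<integral>y. G x y * l y \<partial>M) = - (h x * \<phi> x)"
        using G_representation[OF _ \<phi>, of x] by (simp add: l_def G_commute[of x])
    qed
    then show ?thesis using Biter[OF that sl] by simp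
  qed
  have "B (\<lambda>x. w x + l x) (\<lambda>x. w x + l x) = B w w + B w l + B l w + B l l"
  proof -
    note i = G_form_integrable[OF w w] G_form_integrable[OF w sl] G_form_integrable[OF sl w] G_form_integrable[OF sl sl]
    have "(\<lambda>p. G (fst p) (snd p) * ((w (fst p) + l (fst p)) * (w (snd p) + l (snd p)))) =
      (\<lambda>p. G (fst p) (snd p) * (w (fst p) * w (snd p)) + G (fst p) (snd p) * (w (fst p) * l (snd p)) +
        G (fst p) (snd p) * (l (fst p) * w (snd p)) + G (fst p) (snd p) * (l (fst p) * l (snd p)))"
      by (rule ext) (simp add: algebra_simps)
    then show ?thesis unfolding B_def using i by simp
  qed
  moreover have "0 \<le> B (\<lambda>x. w x + l x) (\<lambda>x. w x + l x)"
    unfolding B_def by (rule G_form_nonneg) (rule sq_int_add[OF w sl])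
  moreover have "B l w = - (\<integral>x. w x * \<phi> x \<partial>M)" "B w l = - (\<integral>x. w x * \<phi> x \<partial>M)" using Bsym[OF sl w] Bl[OF w] by auto
  moreover have "B l l = (\<integral>x. (norm (gradient \<phi> x))\<^sup>2 \<partial>M)"
  proof -
    have c1: "Ck_on 1 \<Omega> \<phi>" using tfc_Ck[OF \<phi>, of 2 1] Ck_on_subset[OF open_UNIV \<Omega>(1), of 1 \<phi>] by simp
    have "(\<integral>x. l x * \<phi> x \<partial>M) = - (\<integral>x. gradient \<phi> x \<bullet> gradient \<phi> x \<partial>M)"
      using integral_laplacian_by_parts(1)[OF \<Omega> c1 \<phi>] by (simp add: l_def mult.commute)
    then show ?thesis using Bl[OF sl] by (simp add: power2_norm_eq_inner)
  qed
  ultimately have "0 \<le> B w w - 2 * (\<integral>x. w x * \<phi> x \<partial>M) + (\<integral>x. (norm (gradient \<phi> x))\<^sup>2 \<partial>M)" by simp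
  then show ?thesis using Biter[OF w w] by simp
qed

end

subsection \<open>The mean value property\<close>

text \<open>A radial mollifier of radius 1 / sqrt s. The prefactor s keeps its mass independent of
  the scale, as it should in two dimensions.\<close>

definition bump :: "real \<Rightarrow> complex \<Rightarrow> complex \<Rightarrow> real" where
  "bump s x z = s * flat 2 (1 - s * (norm (z - x))\<^sup>2)"

definition bump_mass :: real where
  "bump_mass = (\<integral>t. flat 2 (1 - (norm t)\<^sup>2) \<partial>(lborel :: complex measure))"

lemma flat_continuous: "continuous_on S (flat n)"
  using Ck_on_flat[of 0 n] continuous_on_subset by fastforce

lemma flat_measurable[measurable]: "flat n \<in> borel_measurable borel"
  by (rule borel_measurable_continuous_onI[OF flat_continuous])

lemma bump_measurable[measurable]: "bump s x \<in> borel_measurable borel"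
  unfolding bump_def by measurable

lemma bump_nonneg: "0 \<le> s \<Longrightarrow> 0 \<le> bump s x z" by (simp add: bump_def flat_nonneg)

lemma bump_le: assumes "0 \<le> s" shows "bump s x z \<le> 2 * s"
proof -
  have "flat 2 (1 - s * (norm (z - x))\<^sup>2) \<le> 2"
    using flat_bounded[of 2 "1 - s * (norm (z - x))\<^sup>2"] by (simp add: fact_numeral)
  from mult_left_mono[OF this assms] show ?thesis by (simp add: bump_def mult.commute)
qed

lemma bump_outside:
  assumes "0 < R" "1 / R\<^sup>2 \<le> s" "z \<notin> cball x R"
  shows "1 - s * (norm (z - x))\<^sup>2 \<le> 0" "bump s x z = 0"
proof -
  have "R\<^sup>2 \<le> (norm (z - x))\<^sup>2" using assms by (intro power_mono) (auto simp: dist_norm norm_minus_commute)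
  then have "(1 / R\<^sup>2) * R\<^sup>2 \<le> s * (norm (z - x))\<^sup>2" using assms by (intro mult_mono) (auto intro: order_trans[OF _ assms(2)])
  then show "1 - s * (norm (z - x))\<^sup>2 \<le> 0" using assms(1) by simp
  then show "bump s x z = 0" by (simp add: bump_def flat_0)
qed

lemma bump_mass_pos: "0 < bump_mass"
  and bump_mass_integrable: "integrable (lborel :: complex measure) (\<lambda>t. flat 2 (1 - (norm t)\<^sup>2))"
proof -
  show i: "integrable (lborel :: complex measure) (\<lambda>t. flat 2 (1 - (norm t)\<^sup>2))"
  proof (rule integrable_continuous_compact_support[of _ 1])
    show "continuous_on UNIV (\<lambda>t::complex. flat 2 (1 - (norm t)\<^sup>2))"
      by (rule continuous_on_compose2[OF flat_continuous]) (auto intro!: continuous_intros)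
    show "flat 2 (1 - (norm t)\<^sup>2) = 0" if "1 < norm t" for t :: complex
      using that by (intro flat_0) (simp add: one_le_power)
  qed
  have "bump_mass \<noteq> 0"
  proof
    assume "bump_mass = 0"
    then have "AE t in (lborel :: complex measure). flat 2 (1 - (norm t)\<^sup>2) = 0"
      unfolding bump_mass_def using i flat_nonneg by (subst (asm) integral_nonneg_eq_0_iff_AE) auto
    then have "AE t in (lborel :: complex measure). t \<notin> ball 0 1"
    proof eventually_elim
      case (elim t)
      then show ?case using flat_pos[of "1 - (norm t)\<^sup>2" 2] by (auto simp: abs_square_less_1)
    qed
    then have "emeasure lborel (ball (0::complex) 1) = 0"
      using AE_iff_null_sets[of "ball (0::complex) 1" lborel] by auto
    then show False using content_ball_gt_0_iff[of "0::complex" 1] by (simp add: measure_def)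
  qed
  moreover have "0 \<le> bump_mass" unfolding bump_mass_def using flat_nonneg by (intro Bochner_Integration.integral_nonneg) auto
  ultimately show "0 < bump_mass" by simp
qed

lemma bump_integral:
  assumes s: "0 < s"
  shows "integrable lborel (bump s x)" "(\<integral>z. bump s x z \<partial>lborel) = bump_mass"
proof -
  define R where "R = 1 / sqrt s"
  have R: "0 < R" "1 / R\<^sup>2 \<le> s" "R\<^sup>2 = 1 / s" using s by (auto simp: R_def power_divide)
  show "integrable lborel (bump s x)"
  proof (rule integrable_continuous_compact_support[of _ "norm x + R"])
    have "continuous_on UNIV (\<lambda>z. flat 2 (1 - s * (norm (z - x))\<^sup>2))"
      by (rule continuous_on_compose2[OF flat_continuous]) (auto intro!: continuous_intros)
    then show "continuous_on UNIV (bump s x)" unfolding bump_def by (intro continuous_intros)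
    show "bump s x z = 0" if "norm x + R < norm z" for z
      using that norm_triangle_ineq2[of z x] by (intro bump_outside(2)[OF R(1,2)]) (auto simp: dist_norm norm_minus_commute)
  qed
  have "(\<integral>z. bump s x z \<partial>lborel) = R\<^sup>2 * (\<integral>t. bump s x (x + R *\<^sub>R t) \<partial>lborel)"
    by (rule integral_complex_affine[OF bump_measurable R(1)])
  also have "(\<lambda>t. bump s x (x + R *\<^sub>R t)) = (\<lambda>t. s * flat 2 (1 - (norm t)\<^sup>2))"
    using R s by (simp add: bump_def power_mult_distrib fun_eq_iff)
  also have "R\<^sup>2 * (\<integral>t. s * flat 2 (1 - (norm t)\<^sup>2) \<partial>(lborel :: complex measure)) = bump_mass"
    using s R(3) by (simp add: bump_mass_def)
  finally show "(\<integral>z. bump s x z \<partial>lborel) = bump_mass" .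
qed

definition bump' :: "complex \<Rightarrow> real \<Rightarrow> complex \<Rightarrow> real" where
  "bump' x s z = flat 2 (1 - s * (norm (z - x))\<^sup>2) - s * (norm (z - x))\<^sup>2 *
     (flat 4 (1 - s * (norm (z - x))\<^sup>2) - 2 * flat 3 (1 - s * (norm (z - x))\<^sup>2))"

lemma DERIV_flat2: "(flat 2 has_real_derivative flat 4 t - 2 * flat 3 t) (at t)"
  using DERIV_flat[of 2 t] by simp

lemma bump_DERIV: "((\<lambda>s. bump s x z) has_real_derivative bump' x s z) (at s)"
proof -
  have "((\<lambda>s. flat 2 (1 - s * (norm (z - x))\<^sup>2)) has_real_derivative
     (flat 4 (1 - s * (norm (z - x))\<^sup>2) - 2 * flat 3 (1 - s * (norm (z - x))\<^sup>2)) * (- ((norm (z - x))\<^sup>2))) (at s)"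
    by (rule DERIV_chain2[OF DERIV_flat2]) (auto intro!: derivative_eq_intros)
  from DERIV_mult[OF DERIV_ident this] show ?thesis
    unfolding bump_def bump'_def by (simp add: algebra_simps)
qed

text \<open>The scale derivative of the radial kernel is a Laplacian; this is the mean value property.\<close>

lemma bump_test_function:
  assumes R: "0 < R" "1 / R\<^sup>2 \<le> s" "cball x R \<subseteq> \<Omega>"
  defines "\<phi> \<equiv> \<lambda>z. - flat 0 (1 - s * (norm (z - x))\<^sup>2)"
  shows "test_function \<Omega> \<phi>" "laplacian \<phi> z = 4 * s * bump' x s z"
proof -
  define u where "u z = 1 - s * (norm (z - x))\<^sup>2" for z
  define r where "r b z = (z - x) \<bullet> b" for b z :: complex
  have rD: "(r b has_derivative (\<lambda>h. h \<bullet> b)) (at z)" for b z unfolding r_def by (auto intro!: derivative_eq_intros)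
  have uD: "(u has_derivative (\<lambda>h. - (s * (2 * ((z - x) \<bullet> h))))) (at z)" for z
    unfolding u_def power2_norm_eq_inner by (auto intro!: derivative_eq_intros simp: inner_commute)
  have rC: "Ck_on k UNIV (r b)" for k b
  proof -
    have "r b = (\<lambda>z. z \<bullet> b + (- (x \<bullet> b)))" by (simp add: r_def fun_eq_iff inner_diff_left)
    then show ?thesis using Ck_on_add[OF open_UNIV Ck_on_bounded_linear[OF open_UNIV bounded_linear_inner_left] Ck_on_const[OF open_UNIV]] by metis
  qed
  have ueq: "u = (\<lambda>z. 1 - s * ((r 1 z)\<^sup>2 + (r \<i> z)\<^sup>2))"
    by (simp add: u_def r_def fun_eq_iff cmod_power2 inner_complex_def)
  have uC: "Ck_on k UNIV u" for k unfolding ueq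
    by (intro Ck_on_diff[OF open_UNIV] Ck_on_cmult[OF open_UNIV] Ck_on_add[OF open_UNIV] Ck_on_power[OF open_UNIV] rC Ck_on_const[OF open_UNIV])
  have fC: "Ck_on k UNIV (\<lambda>z. flat n (u z))" for k n
    by (rule Ck_on_compose[of UNIV UNIV u k "flat n", OF _ _ _ Ck_on_flat uC]) auto
  have "tfc UNIV \<Omega> \<phi>"
  proof (rule tfcI[of _ _ "cball x R"])
    show "Ck_on k UNIV \<phi>" for k
      using Ck_on_cmult[OF open_UNIV fC, of k "-1" 0] by (simp add: \<phi>_def u_def)
    show "\<phi> z = 0" if "z \<notin> cball x R" for z using bump_outside(1)[OF R(1,2) that] by (simp add: \<phi>_def flat_0)
  qed (use R in auto)
  then show "test_function \<Omega> \<phi>" by (simp add: test_function_tfc)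
  have fD: "((\<lambda>z. flat n (u z)) has_derivative (\<lambda>h. (flat (n + 2) (u z) - n * flat (n + 1) (u z)) * (- (s * (2 * ((z - x) \<bullet> h)))))) (at z)" for n z
    using has_derivative_compose[OF uD DERIV_flat[unfolded has_field_derivative_def]] .
  have fD2: "((\<lambda>z. flat 2 (u z)) has_derivative (\<lambda>h. (flat 4 (u z) - 2 * flat 3 (u z)) * (- (s * (2 * ((z - x) \<bullet> h)))))) (at z)" for z
    using has_derivative_compose[OF uD DERIV_flat2[unfolded has_field_derivative_def]] .
  have p1: "pd b \<phi> z = 2 * s * (flat 2 (u z) * r b z)" for b z
  proof -
    have "(\<phi> has_derivative (\<lambda>h. - ((flat (0 + 2) (u z) - real 0 * flat (0 + 1) (u z)) * (- (s * (2 * ((z - x) \<bullet> h))))))) (at z)"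
      unfolding \<phi>_def u_def[symmetric] by (rule has_derivative_minus[OF fD])
    from pd_eqI[OF this, of b] show ?thesis by (simp add: r_def numeral_2_eq_2)
  qed
  have p2: "pd b (\<lambda>z. 2 * s * (flat 2 (u z) * r b z)) z =
      2 * s * (flat 2 (u z) - 2 * s * (r b z)\<^sup>2 * (flat 4 (u z) - 2 * flat 3 (u z)))" if b: "b \<in> Basis" for b z
  proof -
    have "((\<lambda>z. 2 * s * (flat 2 (u z) * r b z)) has_derivative
      (\<lambda>h. 2 * s * (flat 2 (u z) * (h \<bullet> b) + (flat 4 (u z) - 2 * flat 3 (u z)) * (- (s * (2 * ((z - x) \<bullet> h)))) * r b z))) (at z)"
      by (intro has_derivative_mult_right has_derivative_mult fD2 rD)
    from pd_eqI[OF this, of b] show ?thesis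
      using b by (simp add: r_def inner_Basis power2_eq_square algebra_simps)
  qed
  have "laplacian \<phi> z = pd 1 (\<lambda>z. 2 * s * (flat 2 (u z) * r 1 z)) z + pd \<i> (\<lambda>z. 2 * s * (flat 2 (u z) * r \<i> z)) z"
    unfolding laplacian_eq p1[abs_def] ..
  also have "\<dots> = 4 * s * (flat 2 (u z) - s * ((r 1 z)\<^sup>2 + (r \<i> z)\<^sup>2) * (flat 4 (u z) - 2 * flat 3 (u z)))"
  proof -
    have B: "1 \<in> (Basis::complex set)" "\<i> \<in> (Basis::complex set)" by (auto simp: Basis_complex_def)
    show ?thesis unfolding p2[OF B(1)] p2[OF B(2)] by (simp add: algebra_simps)
  qed
  also have "(r 1 z)\<^sup>2 + (r \<i> z)\<^sup>2 = (norm (z - x))\<^sup>2"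
    by (simp add: r_def cmod_power2 inner_complex_def)
  finally show "laplacian \<phi> z = 4 * s * bump' x s z" by (simp add: bump'_def u_def)
qed

context
  fixes \<Omega> :: "complex set" and D :: "complex \<Rightarrow> real"
  assumes D[measurable]: "D \<in> borel_measurable borel"
    and loc: "\<And>K. compact K \<Longrightarrow> K \<subseteq> \<Omega> \<Longrightarrow> integrable lborel (\<lambda>z. indicator K z * D z)"
    and harm: "\<And>\<phi>. test_function \<Omega> \<phi> \<Longrightarrow> (\<integral>z. D z * laplacian \<phi> z \<partial>lborel) = 0"
begin

lemma bump_D_integrable:
  assumes R: "0 < R" "1 / R\<^sup>2 \<le> s" "cball x R \<subseteq> \<Omega>"
  shows "integrable lborel (\<lambda>z. D z * bump s x z)"
proof -
  have s: "0 \<le> s" using R by (meson order_trans zero_le_divide_1_iff zero_le_power2)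
  have i: "integrable lborel (\<lambda>z. 2 * s * (indicator (cball x R) z * D z))" using loc[of "cball x R"] R by simp
  show ?thesis
  proof (rule Bochner_Integration.integrable_bound[OF i])
    show "AE z in lborel. norm (D z * bump s x z) \<le> norm (2 * s * (indicator (cball x R) z * D z))"
    proof (rule AE_I2)
      fix z
      show "norm (D z * bump s x z) \<le> norm (2 * s * (indicator (cball x R) z * D z))"
        using bump_nonneg[OF s, of x z] bump_le[OF s, of x z] bump_outside(2)[OF R(1,2), of z x] s
        by (cases "z \<in> cball x R") (auto simp: abs_mult mult.commute[of "\<bar>D z\<bar>"] intro!: mult_right_mono)
    qed
  qed measurable
qed

text \<open>The difference of the two kernels is the integral of \<open>bump'\<close> over the
  scales in [a, b]. After Fubini the inner integral, at fixed scale, is D against a multiple of the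
  Laplacian of a test function, hence 0.\<close>

lemma bump_D_const:
  assumes R: "0 < R" "1 / R\<^sup>2 \<le> a" "a \<le> b" "cball x R \<subseteq> \<Omega>"
  shows "(\<integral>z. D z * bump a x z \<partial>lborel) = (\<integral>z. D z * bump b x z \<partial>lborel)"
proof -
  define K where "K = cball x R"
  have a: "0 < a" using R by (meson less_le_trans zero_less_divide_1_iff zero_less_power)
  define f where "f z s = (indicator K z * D z) * (indicator {a..b} s * bump' x s z)" for z s
  have [measurable]: "K \<in> sets borel" by (simp add: K_def)
  have mf[measurable]: "(\<lambda>p. f (fst p) (snd p)) \<in> borel_measurable (lborel \<Otimes>\<^sub>M lborel)"
    unfolding f_def bump'_def by measurable
  define C where "C = 2 + b * R\<^sup>2 * 36"
  have C: "\<bar>bump' x s z\<bar> \<le> C" if "s \<in> {a..b}" "z \<in> K" for s z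
  proof -
    define u where "u = 1 - s * (norm (z - x))\<^sup>2"
    have f: "\<bar>flat 2 u\<bar> \<le> 2" "\<bar>flat 3 u\<bar> \<le> 6" "\<bar>flat 4 u\<bar> \<le> 24"
      using flat_bounded[of 2 u] flat_bounded[of 3 u] flat_bounded[of 4 u] by (auto simp: fact_numeral)
    have "\<bar>flat 4 u - 2 * flat 3 u\<bar> \<le> 36" using f by linarith
    moreover have "s * (norm (z - x))\<^sup>2 \<le> b * R\<^sup>2" "0 \<le> s * (norm (z - x))\<^sup>2"
      using that a R(1) by (auto simp: K_def dist_norm norm_minus_commute intro!: mult_mono power_mono)
    ultimately have "\<bar>s * (norm (z - x))\<^sup>2 * (flat 4 u - 2 * flat 3 u)\<bar> \<le> b * R\<^sup>2 * 36"
      unfolding abs_mult[of "s * _"] by (intro mult_mono) auto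
    then show ?thesis using f unfolding bump'_def u_def[symmetric] C_def by linarith
  qed
  have iK: "integrable lborel (\<lambda>z. indicator K z * D z)" using loc[of K] R by (simp add: K_def)
  have fb: "\<bar>f z s\<bar> \<le> \<bar>indicator K z * D z\<bar> * (C * indicator {a..b} s)" for z s
  proof (cases "s \<in> {a..b} \<and> z \<in> K")
    case True then show ?thesis using C[of s z] by (auto simp: f_def abs_mult intro!: mult_left_mono)
  next
    case False then show ?thesis by (auto simp: f_def)
  qed
  have i1: "integrable lborel (\<lambda>s. \<bar>indicator K z * D z\<bar> * (C * indicator {a..b} s))" for z
    by (intro integrable_mult_right integrable_real_indicator) (simp_all add: R(3))
  have iz: "integrable lborel (f z)" for z
  proof (rule Bochner_Integration.integrable_bound[OF i1])
    show "f z \<in> borel_measurable lborel" unfolding f_def bump'_def by measurable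
    show "AE s in lborel. norm (f z s) \<le> norm (\<bar>indicator K z * D z\<bar> * (C * indicator {a..b} s))"
      using fb by (intro AE_I2) (simp only: real_norm_def order_trans[OF fb abs_ge_self])
  qed
  have "integrable (lborel \<Otimes>\<^sub>M lborel) (\<lambda>p. f (fst p) (snd p))"
  proof (rule lborel_pair.Fubini_integrable)
    show "integrable lborel (\<lambda>z. \<integral>s. norm (f (fst (z, s)) (snd (z, s))) \<partial>lborel)"
    proof (rule Bochner_Integration.integrable_bound)
      show "integrable lborel (\<lambda>z. \<bar>indicator K z * D z\<bar> * (C * (b - a)))" using iK by simp
      show "(\<lambda>z. \<integral>s. norm (f (fst (z, s)) (snd (z, s))) \<partial>lborel) \<in> borel_measurable lborel" by measurable
      show "AE z in lborel. norm (\<integral>s. norm (f (fst (z, s)) (snd (z, s))) \<partial>lborel) \<le> norm (\<bar>indicator K z * D z\<bar> * (C * (b - a)))"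
      proof (rule AE_I2)
        fix z
        have "(\<integral>s. \<bar>f z s\<bar> \<partial>lborel) \<le> (\<integral>s. \<bar>indicator K z * D z\<bar> * (C * indicator {a..b} s) \<partial>lborel)"
          using fb iz by (intro integral_mono i1) auto
        also have "\<dots> = \<bar>indicator K z * D z\<bar> * (C * (b - a))" using R by simp
        finally have "(\<integral>s. \<bar>f z s\<bar> \<partial>lborel) \<le> \<bar>indicator K z * D z\<bar> * (C * (b - a))" .
        moreover have "0 \<le> (\<integral>s. \<bar>f z s\<bar> \<partial>lborel)" by simp
        ultimately show "norm (\<integral>s. norm (f (fst (z, s)) (snd (z, s))) \<partial>lborel) \<le> norm (\<bar>indicator K z * D z\<bar> * (C * (b - a)))"
          by simp
      qed
    qed
  qed (use iz in \<open>auto intro: mf\<close>)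
  then have ip: "integrable (lborel \<Otimes>\<^sub>M lborel) (case_prod f)" by (simp add: case_prod_beta')
  have "(\<integral>s. \<integral>z. f z s \<partial>lborel \<partial>lborel) = (\<integral>z. \<integral>s. f z s \<partial>lborel \<partial>lborel)"
    by (rule lborel_pair.Fubini_integral[OF ip])
  moreover have "(\<integral>z. f z s \<partial>lborel) = 0" for s
  proof (cases "s \<in> {a..b}")
    case True
    then have s: "0 < s" "1 / R\<^sup>2 \<le> s" using a R by auto
    have "f z s = (1 / (4 * s)) * (D z * (4 * s * bump' x s z))" for z
    proof (cases "z \<in> K")
      case False
      then have "1 - s * (norm (z - x))\<^sup>2 \<le> 0" using bump_outside(1)[OF R(1) s(2)] by (simp add: K_def)
      then show ?thesis using False by (simp add: f_def bump'_def flat_0)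
    qed (use True s in \<open>simp add: f_def\<close>)
    then have "(\<integral>z. f z s \<partial>lborel) = (1 / (4 * s)) * (\<integral>z. D z * (4 * s * bump' x s z) \<partial>lborel)"
      by (simp only: integral_mult_right_zero)
    also have "(\<integral>z. D z * (4 * s * bump' x s z) \<partial>lborel) = 0"
      using harm[OF bump_test_function(1)[OF R(1) s(2) R(4)]] bump_test_function(2)[OF R(1) s(2) R(4)] by simp
    finally show ?thesis by simp
  qed (simp add: f_def)
  moreover have "(\<integral>s. f z s \<partial>lborel) = D z * bump b x z - D z * bump a x z" for z
  proof (cases "z \<in> K")
    case True
    have ct: "isCont (\<lambda>s. bump' x s z) s" for s
      unfolding bump'_def by (intro continuous_intros isCont_o2[OF _ DERIV_isCont[OF DERIV_flat]])
    have "(\<integral>s. bump' x s z * indicator {a..b} s \<partial>lborel) = bump b x z - bump a x z"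
      by (rule integral_FTC_Icc_real[OF R(3)]) (use bump_DERIV ct in auto)
    moreover have "f z s = D z * (bump' x s z * indicator {a..b} s)" for s using True by (simp add: f_def)
    ultimately show ?thesis by (simp add: right_diff_distrib)
  next
    case False
    then show ?thesis using bump_outside(2)[of R a z x] bump_outside(2)[of R b z x] R by (simp add: f_def K_def)
  qed
  moreover have "1 / R\<^sup>2 \<le> b" using R by linarith
  ultimately show ?thesis
    using bump_D_integrable[OF R(1,2,4)] bump_D_integrable[of R b x] R by simp
qed

text \<open>By \<open>bump_D_const\<close> the integral is unchanged when the scale parameter grows,
  that is, when the kernel shrinks to x, and there continuity of D identifies its value.\<close>

lemma mean_value:
  assumes R: "0 < R" "1 / R\<^sup>2 \<le> a" "cball x R \<subseteq> \<Omega>" and c: "isCont D x"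
  shows "(\<integral>z. D z * bump a x z \<partial>lborel) = bump_mass * D x"
proof -
  define k where "k s = (\<integral>z. D z * bump s x z \<partial>lborel)" for s
  have "\<bar>k a - bump_mass * D x\<bar> \<le> e * bump_mass" if e: "0 < e" for e
  proof -
    obtain d where d: "0 < d" "\<And>z. dist z x < d \<Longrightarrow> dist (D z) (D x) < e"
      using c e unfolding continuous_at_eps_delta by (metis dist_commute)
    define r where "r = min R (d / 2)"
    have r: "0 < r" "r \<le> R" "r < d" using R d by (auto simp: r_def)
    define s where "s = max a (1 / r\<^sup>2)"
    have s: "a \<le> s" "1 / r\<^sup>2 \<le> s" by (auto simp: s_def)
    have s0: "0 < s" using r s(2) by (meson less_le_trans zero_less_divide_1_iff zero_less_power)
    have ka: "k a = k s" unfolding k_def by (rule bump_D_const[OF R(1,2) s(1) R(3)])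
    have Rs: "1 / R\<^sup>2 \<le> s" using R(2) s(1) by linarith
    have iD: "integrable lborel (\<lambda>z. D z * bump s x z)" by (rule bump_D_integrable[OF R(1) Rs R(3)])
    note iB = bump_integral[OF s0, of x]
    have "k s - bump_mass * D x = (\<integral>z. (D z - D x) * bump s x z \<partial>lborel)"
      unfolding k_def left_diff_distrib using iD iB by (simp add: mult.commute)
    also have "\<bar>\<dots>\<bar> \<le> (\<integral>z. e * bump s x z \<partial>lborel)"
      unfolding real_norm_def[symmetric]
    proof (rule order_trans[OF integral_norm_bound integral_mono[OF integrable_norm]])
      show "integrable lborel (\<lambda>z. (D z - D x) * bump s x z)" unfolding left_diff_distrib using iD iB by simp
      show "integrable lborel (\<lambda>z. e * bump s x z)" using iB by simp
      fix z
      show "norm ((D z - D x) * bump s x z) \<le> e * bump s x z"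
      proof (cases "z \<in> cball x r")
        case True
        then have "\<bar>D z - D x\<bar> \<le> e" using d(2)[of z] r by (auto simp: dist_real_def dist_commute)
        then show ?thesis using bump_nonneg[of s x z] s0 by (simp add: abs_mult mult_right_mono)
      next
        case False
        then show ?thesis using bump_outside(2)[OF r(1) s(2) False] by simp
      qed
    qed
    also have "\<dots> = e * bump_mass" using iB by simp
    finally show ?thesis using ka by simp
  qed
  then have "\<bar>k a - bump_mass * D x\<bar> \<le> 0 + e" if "0 < e" for e
  proof -
    have "0 < e / bump_mass" using that bump_mass_pos by simp
    then have "\<bar>k a - bump_mass * D x\<bar> \<le> e / bump_mass * bump_mass" using \<open>\<And>e. 0 < e \<Longrightarrow> _\<close> by blast
    then show ?thesis using bump_mass_pos by simp
  qed
  then have "\<bar>k a - bump_mass * D x\<bar> \<le> 0" by (rule field_le_epsilon)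
  then show ?thesis by (simp add: k_def)
qed

end

subsection \<open>Uniqueness of the Green function\<close>

lemma AE_lborel_open_empty:
  fixes U :: "complex set"
  assumes "open U" "AE z in lborel. z \<notin> U" shows "U = {}"
proof (rule ccontr)
  assume "U \<noteq> {}"
  have "AE z in lebesgue. z \<notin> U" by (rule AE_completion[OF assms(2)])
  then have "U \<in> null_sets lebesgue" using assms(1) by (subst AE_iff_null_sets) auto
  then show False using open_not_negligible[OF assms(1) \<open>U \<noteq> {}\<close>] by (simp add: negligible_iff_null_sets)
qed

text \<open>At y nothing is known about d beyond local integrability, and D has the arbitrary value
  0 there. The singularity is first removed: averages of D over kernels of a fixed scale depend
  continuously on the centre, so their value at y extends d continuously. The strong maximum
  principle is then run for this extension h.\<close>

lemma distributional_maximum_principle: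
  fixes d :: "complex \<Rightarrow> real"
  assumes \<Omega>: "open \<Omega>" "bounded \<Omega>" and y: "y \<in> \<Omega>"
    and c: "continuous_on (closure \<Omega> - {y}) d" and fr: "\<And>x. x \<in> frontier \<Omega> \<Longrightarrow> d x = 0"
  defines "D \<equiv> \<lambda>z. if z \<in> \<Omega> - {y} then d z else 0"
  assumes loc: "\<And>K. compact K \<Longrightarrow> K \<subseteq> \<Omega> \<Longrightarrow> integrable lborel (\<lambda>z. indicator K z * D z)"
    and harm: "\<And>\<phi>. test_function \<Omega> \<phi> \<Longrightarrow> (\<integral>z. D z * laplacian \<phi> z \<partial>lborel) = 0"
    and x: "x \<in> \<Omega> - {y}"
  shows "d x \<le> 0"
proof (rule ccontr)
  assume "\<not> d x \<le> 0"
  then have dx: "0 < d x" by simp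
  have o: "open (\<Omega> - {y})" using \<Omega>(1) by auto
  have cd: "continuous_on (\<Omega> - {y}) d" by (rule continuous_on_subset[OF c]) (use closure_subset in auto)
  have D[measurable]: "D \<in> borel_measurable borel"
  proof -
    have "(\<lambda>z. indicator (\<Omega> - {y}) z *\<^sub>R d z) \<in> borel_measurable borel"
      using o by (intro borel_measurable_continuous_on_indicator cd) auto
    moreover have "D = (\<lambda>z. indicator (\<Omega> - {y}) z *\<^sub>R d z)" by (auto simp: D_def fun_eq_iff indicator_def)
    ultimately show ?thesis by simp
  qed
  have cD: "isCont D z" if "z \<in> \<Omega> - {y}" for z
  proof -
    have "continuous_on (\<Omega> - {y}) D" using cd by (rule continuous_on_eq) (auto simp: D_def)
    then show ?thesis using that o by (simp add: continuous_on_eq_continuous_at)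
  qed
  have MV: "(\<integral>z. D z * bump a x z \<partial>lborel) = bump_mass * D x"
    if "0 < R" "1 / R\<^sup>2 \<le> a" "cball x R \<subseteq> \<Omega>" "isCont D x" for R a x
    by (rule mean_value[OF D loc harm that])
  have BC: "(\<integral>z. D z * bump a x z \<partial>lborel) = (\<integral>z. D z * bump b x z \<partial>lborel)"
    if "0 < R" "1 / R\<^sup>2 \<le> a" "a \<le> b" "cball x R \<subseteq> \<Omega>" for R a b x
    by (rule bump_D_const[OF D loc harm that])
  have BI: "integrable lborel (\<lambda>z. D z * bump s x z)"
    if "0 < R" "1 / R\<^sup>2 \<le> s" "cball x R \<subseteq> \<Omega>" for R s x
    by (rule bump_D_integrable[OF D loc harm that])
  obtain R1 where R1: "0 < R1" "cball y R1 \<subseteq> \<Omega>" using \<Omega>(1) y open_contains_cball by blast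
  \<comment> \<open>Half the radius, so that kernels of radius R centred anywhere in the ball of
    radius R around y are supported in \<Omega>.\<close>
  define R where "R = R1 / 2"
  define s where "s = 1 / R\<^sup>2"
  have R: "0 < R" "1 / R\<^sup>2 \<le> s" "0 < s" using R1 by (auto simp: R_def s_def)
  have sub: "cball z R \<subseteq> \<Omega>" if "z \<in> cball y R" for z
  proof -
    have "cball z R \<subseteq> cball y R1"
    proof
      fix p assume "p \<in> cball z R"
      then show "p \<in> cball y R1" using that dist_triangle[of y p z] by (simp add: R_def)
    qed
    then show ?thesis using R1 by blast
  qed
  \<comment> \<open>The mean value that d would have at y. Away from y, \<open>mean_value\<close>
    identifies the same average with d, and continuity in the centre shows that d tends to
    \<open>hy\<close>.\<close>
  define hy where "hy = (\<integral>z. D z * bump s y z \<partial>lborel) / bump_mass"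
  define h where "h z = (if z = y then hy else d z)" for z
  have hc: "continuous_on (closure \<Omega>) h"
    unfolding continuous_on_eq_continuous_within
  proof
    fix p assume p: "p \<in> closure \<Omega>"
    show "continuous (at p within closure \<Omega>) h"
    proof (cases "p = y")
      case False
      have "continuous (at p within closure \<Omega> - {y}) d" using c p False by (simp add: continuous_on_eq_continuous_within)
      moreover have "at p within closure \<Omega> - {y} = at p within closure \<Omega>"
        using False by (intro at_within_nhd[of p "- {y}"]) auto
      ultimately have "(d \<longlongrightarrow> d p) (at p within closure \<Omega>)" by (simp add: continuous_within)
      moreover have "eventually (\<lambda>z. z \<noteq> y) (at p within closure \<Omega>)"
        using False unfolding eventually_at_topological by (intro exI[of _ "- {y}"]) auto
      then have "eventually (\<lambda>z. d z = h z) (at p within closure \<Omega>)" by eventually_elim (simp add: h_def)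
      ultimately have "(h \<longlongrightarrow> d p) (at p within closure \<Omega>)" by (rule Lim_transform_eventually)
      then show ?thesis using False by (simp add: continuous_within h_def)
    next
      case True
      have "(h \<longlongrightarrow> hy) (at y within closure \<Omega>)"
        unfolding tendsto_at_iff_sequentially
      proof (intro allI impI)
        fix X assume X: "\<forall>i. X i \<in> closure \<Omega> - {y}" "X \<longlonglongrightarrow> y"
        have ev: "eventually (\<lambda>i. X i \<in> ball y R) sequentially"
          using X(2) R(1) by (intro topological_tendstoD) auto
        have "(\<lambda>i. \<integral>z. (indicator (cball y R1) z * D z) * bump s (X i) z \<partial>lborel) \<longlonglongrightarrow>
          (\<integral>z. (indicator (cball y R1) z * D z) * bump s y z \<partial>lborel)"
        proof (rule integral_dominated_convergence)
          show "integrable lborel (\<lambda>z. \<bar>indicator (cball y R1) z * D z\<bar> * (2 * s))"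
            using loc[of "cball y R1"] R1 by (intro integrable_mult_left integrable_abs) auto
          show "AE z in lborel. (\<lambda>i. (indicator (cball y R1) z * D z) * bump s (X i) z) \<longlonglongrightarrow> (indicator (cball y R1) z * D z) * bump s y z"
          proof (intro AE_I2 tendsto_mult_left)
            fix z
            have "isCont (\<lambda>w. bump s w z) y" unfolding bump_def
              by (intro continuous_intros isCont_o2[OF _ DERIV_isCont[OF DERIV_flat]])
            then show "(\<lambda>i. bump s (X i) z) \<longlonglongrightarrow> bump s y z" using X(2) by (rule isCont_tendsto_compose)
          qed
          show "AE z in lborel. norm ((indicator (cball y R1) z * D z) * bump s (X i) z) \<le> \<bar>indicator (cball y R1) z * D z\<bar> * (2 * s)" for i
          proof (rule AE_I2)
            fix z
            have "\<bar>indicator (cball y R1) z * D z\<bar> * \<bar>bump s (X i) z\<bar> \<le> \<bar>indicator (cball y R1) z * D z\<bar> * (2 * s)"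
              using bump_nonneg[of s "X i" z] bump_le[of s "X i" z] R(3) by (intro mult_left_mono) auto
            then show "norm ((indicator (cball y R1) z * D z) * bump s (X i) z) \<le> \<bar>indicator (cball y R1) z * D z\<bar> * (2 * s)"
              by (simp only: real_norm_def abs_mult[of "_ * _" "bump _ _ _"])
          qed
        qed (use D in \<open>auto intro!: borel_measurable_times borel_measurable_indicator\<close>)
        moreover have ib: "(indicator (cball y R1) z * D z) * bump s w z = D z * bump s w z" if w: "w \<in> cball y R" for w z
        proof (cases "z \<in> cball y R1")
          case False
          then have "z \<notin> cball w R" using w dist_triangle[of y z w] by (auto simp: R_def)
          then show ?thesis using bump_outside(2)[OF R(1,2)] by simp
        qed simp
        ultimately have "(\<lambda>i. \<integral>z. (indicator (cball y R1) z * D z) * bump s (X i) z \<partial>lborel) \<longlonglongrightarrow> bump_mass * hy"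
          using ib[of y] R(1) bump_mass_pos by (simp add: hy_def)
        moreover have "eventually (\<lambda>i. (\<integral>z. (indicator (cball y R1) z * D z) * bump s (X i) z \<partial>lborel) = bump_mass * h (X i)) sequentially"
          using ev
        proof eventually_elim
          case (elim i)
          then have Xi: "X i \<in> cball y R" "X i \<in> \<Omega> - {y}" using X(1) sub[of y] R(1) by auto
          have "(\<integral>z. D z * bump s (X i) z \<partial>lborel) = bump_mass * D (X i)"
            by (rule MV[OF R(1,2) sub[OF Xi(1)] cD[OF Xi(2)]])
          moreover have "h (X i) = D (X i)" using Xi(2) by (simp add: h_def D_def)
          ultimately show ?case by (simp only: ib[OF Xi(1)])
        qed
        ultimately have "(\<lambda>i. bump_mass * h (X i)) \<longlonglongrightarrow> bump_mass * hy" by (rule Lim_transform_eventually)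
        from tendsto_mult_left[OF this, of "1 / bump_mass"] show "(h \<circ> X) \<longlonglongrightarrow> hy"
          using bump_mass_pos by (simp add: o_def)
      qed
      then show ?thesis using True by (simp add: continuous_within h_def)
    qed
  qed
  have hmv: "(\<integral>z. D z * bump t p z \<partial>lborel) = bump_mass * h p"
    if p: "p \<in> \<Omega>" and r: "0 < r" "cball p r \<subseteq> \<Omega>" and t: "1 / r\<^sup>2 \<le> t" for p r t
  proof (cases "p = y")
    case False
    then show ?thesis using MV[OF r(1) t r(2) cD[of p]] p by (simp add: h_def D_def)
  next
    case True
    have sy: "cball y R \<subseteq> \<Omega>" using sub[of y] R by simp
    \<comment> \<open>An admissible scale t at y is compared with the scale s defining
      \<open>hy\<close> through the common larger parameter \<open>max s t\<close>.\<close>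
    have 1: "1 / r\<^sup>2 \<le> max s t" "1 / R\<^sup>2 \<le> max s t" using t R by auto
    have "(\<integral>z. D z * bump t y z \<partial>lborel) = (\<integral>z. D z * bump (max s t) y z \<partial>lborel)"
      using BC[OF r(1) t _ r(2), of "max s t"] True by simp
    also have "\<dots> = (\<integral>z. D z * bump s y z \<partial>lborel)"
      using BC[OF R(1,2) _ sy, of "max s t"] by simp
    finally show ?thesis using True bump_mass_pos by (simp add: h_def hy_def)
  qed
  have cpt: "compact (closure \<Omega>)" using \<Omega>(2) by (simp add: compact_closure)
  have ne: "closure \<Omega> \<noteq> {}" using y closure_subset by blast
  obtain p0 where p0: "p0 \<in> closure \<Omega>" "\<And>z. z \<in> closure \<Omega> \<Longrightarrow> h z \<le> h p0"
    using continuous_attains_sup[OF cpt ne hc] by blast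
  define A where "A = {z \<in> closure \<Omega>. h z = h p0}"
  have cA: "closed A" unfolding A_def using continuous_closed_preimage_constant[OF hc closed_closure] by simp
  have "closure \<Omega> \<inter> A = A" by (auto simp: A_def)
  then have kA: "compact A" using compact_Int_closed[OF cpt cA] by simp
  have nA: "A \<noteq> {}" using p0 by (auto simp: A_def)
  \<comment> \<open>Among the points where the maximum is attained a rightmost one is taken. The
    maximum spreads to a ball around it, which contains points further right; this replaces a
    connectedness argument.\<close>
  have "continuous_on A Re" by (intro continuous_intros)
  from continuous_attains_sup[OF kA nA this]
  obtain p where p: "p \<in> A" "\<And>z. z \<in> A \<Longrightarrow> Re z \<le> Re p" by blast
  define m where "m = h p"
  have hp: "h p = h p0" using p(1) by (simp add: A_def)
  have m: "h z \<le> m" if "z \<in> closure \<Omega>" for z using p0(2)[OF that] hp by (simp add: m_def)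
  have "x \<in> closure \<Omega>" using x closure_subset by blast
  then have "0 < m" using m[of x] x dx by (simp add: h_def)
  have pin: "p \<in> \<Omega>"
  proof (rule ccontr)
    assume "p \<notin> \<Omega>"
    then have "p \<in> frontier \<Omega>" using p \<Omega>(1) by (simp add: A_def frontier_def interior_open)
    then have "h p = 0" using fr y \<open>p \<notin> \<Omega>\<close> by (auto simp: h_def)
    then show False using \<open>0 < m\<close> by (simp add: m_def)
  qed
  obtain r where r: "0 < r" "cball p r \<subseteq> \<Omega>" using \<Omega>(1) pin open_contains_cball by blast
  define t where "t = 1 / r\<^sup>2"
  have t: "0 < t" "1 / r\<^sup>2 \<le> t" using r by (auto simp: t_def)
  have iB: "integrable lborel (bump t p)" "(\<integral>z. bump t p z \<partial>lborel) = bump_mass" using bump_integral[OF t(1)] by auto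
  have iD: "integrable lborel (\<lambda>z. D z * bump t p z)" using BI[OF r(1) t(2) r(2)] by simp
  have i0: "integrable lborel (\<lambda>z. (m - D z) * bump t p z)" unfolding left_diff_distrib using iB iD by simp
  have "(\<integral>z. (m - D z) * bump t p z \<partial>lborel) = 0"
    unfolding left_diff_distrib using iB iD hmv[OF pin r t(2)] by (simp add: m_def mult.commute)
  moreover have ae: "AE z in lborel. 0 \<le> (m - D z) * bump t p z"
    using AE_lborel_singleton[of y]
  proof eventually_elim
    case (elim z)
    show ?case
    proof (cases "z \<in> cball p r")
      case True
      then have "z \<in> \<Omega>" using r by auto
      moreover from this have "z \<in> closure \<Omega>" using closure_subset by blast
      ultimately have "D z \<le> m" using m[of z] elim by (simp add: D_def h_def)
      then show ?thesis using bump_nonneg[of t p z] t by simp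
    qed (use bump_outside(2)[OF r(1) t(2)] in simp)
  qed
  ultimately have z0: "AE z in lborel. (m - D z) * bump t p z = 0"
    using integral_nonneg_eq_0_iff_AE[OF i0 ae] by simp
  \<comment> \<open>The kernel is positive throughout the open ball, so a nonnegative integrand of
    integral 0 leaves no room for an open set where h is below its maximum.\<close>
  define U where "U = {z \<in> ball p r. h z < m}"
  have "open U"
  proof -
    have "continuous_on (ball p r) h" using continuous_on_subset[OF hc] r closure_subset by (meson ball_subset_cball order_trans)
    then have "open (ball p r \<inter> h -` {..<m})" by (intro continuous_open_preimage) auto
    moreover have "ball p r \<inter> h -` {..<m} = U" by (auto simp: U_def)
    ultimately show ?thesis by simp
  qed
  moreover have "AE z in lborel. z \<notin> U"
    using z0 AE_lborel_singleton[of y]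
  proof eventually_elim
    case (elim z)
    show ?case
    proof
      assume z: "z \<in> U"
      then have "z \<in> \<Omega>" using r by (auto simp: U_def)
      then have "D z < m" using z elim by (simp add: D_def U_def h_def)
      moreover have "0 < 1 - t * (norm (z - p))\<^sup>2"
      proof -
        have "(norm (z - p))\<^sup>2 < r\<^sup>2" using z by (intro power_strict_mono) (auto simp: U_def dist_norm norm_minus_commute)
        then show ?thesis using r(1) by (simp add: t_def)
      qed
      then have "0 < bump t p z" using t flat_pos by (simp add: bump_def)
      ultimately show False using elim by simp
    qed
  qed
  ultimately have "U = {}" by (rule AE_lborel_open_empty)
  moreover define z1 where "z1 = p + of_real (r / 2)"
  have "z1 \<in> U"
  proof -
    have b: "z1 \<in> ball p r" using r by (simp add: z1_def dist_norm norm_mult norm_divide)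
    then have cl: "z1 \<in> closure \<Omega>" using r closure_subset by (meson ball_subset_cball subsetD)
    have "z1 \<notin> A" using p(2)[of z1] r by (auto simp: z1_def)
    then have "h z1 \<noteq> m" using cl p by (auto simp: A_def m_def)
    then show ?thesis using b m[OF cl] by (simp add: U_def)
  qed
  ultimately show False by simp
qed

lemma locally_integrable_mult:
  assumes \<Omega>: "open \<Omega>" and g: "locally_integrable_on \<Omega> (g :: complex \<Rightarrow> real)" and l: "tfc {0} \<Omega> l"
  shows "integrable (lebesgue_on \<Omega>) (\<lambda>x. g x * l x)"
proof -
  obtain K where K: "compact K" "K \<subseteq> \<Omega>" "\<And>x. x \<notin> K \<Longrightarrow> l x = 0" by (rule tfc_support[OF l]) blast
  obtain B where B: "\<And>x. \<bar>l x\<bar> \<le> B" using tfc_bounded[OF l] by blast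
  have "integrable lebesgue (\<lambda>x. indicator K x *\<^sub>R g x)" using g K unfolding locally_integrable_on_def set_integrable_def by blast
  then have i: "integrable lebesgue (\<lambda>x. B * (indicator K x * g x))" by simp
  have lm: "l \<in> borel_measurable lebesgue" using tfc_borel[OF l] by (intro measurable_completion) simp
  have "integrable lebesgue (\<lambda>x. (indicator K x * g x) * l x)"
  proof (rule Bochner_Integration.integrable_bound[OF i])
    show "AE x in lebesgue. norm ((indicator K x * g x) * l x) \<le> norm (B * (indicator K x * g x))"
    proof (rule AE_I2)
      fix x
      have "\<bar>indicator K x * g x\<bar> * \<bar>l x\<bar> \<le> \<bar>indicator K x * g x\<bar> * \<bar>B\<bar>" using B[of x] by (intro mult_left_mono) auto
      then show "norm ((indicator K x * g x) * l x) \<le> norm (B * (indicator K x * g x))" by (simp add: abs_mult mult_ac)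
    qed
    have "(\<lambda>x. indicator K x *\<^sub>R g x) \<in> borel_measurable lebesgue"
      using g K by (auto simp: locally_integrable_on_def set_integrable_def)
    then show "(\<lambda>x. (indicator K x * g x) * l x) \<in> borel_measurable lebesgue" using lm by simp
  qed
  moreover have "(\<lambda>x. (indicator K x * g x) * l x) = (\<lambda>x. indicator \<Omega> x *\<^sub>R (g x * l x))"
    using K by (auto simp: fun_eq_iff indicator_def)
  ultimately show ?thesis using \<Omega> by (simp add: integrable_restrict_space)
qed

text \<open>In the difference the two point masses cancel, so it is harmonic in the sense of
  distributions on all of \<Omega>, pole included. The one-sided conclusion suffices, as the two
  functions can be exchanged.\<close>

lemma is_green_unique_le:
  assumes \<Omega>: "open \<Omega>" "bounded \<Omega>" and y: "y \<in> \<Omega>"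
    and g1: "is_green \<Omega> y g1" and g2: "is_green \<Omega> y g2" and x: "x \<in> \<Omega> - {y}"
  shows "g1 x - g2 x \<le> 0"
proof (rule distributional_maximum_principle[OF \<Omega> y _ _ _ _ x, where d="\<lambda>x. g1 x - g2 x"])
  show "continuous_on (closure \<Omega> - {y}) (\<lambda>x. g1 x - g2 x)" using g1 g2 by (auto simp: is_green_def intro!: continuous_intros)
  show "g1 x - g2 x = 0" if "x \<in> frontier \<Omega>" for x using g1 g2 that by (simp add: is_green_def)
  let ?D = "\<lambda>z. if z \<in> \<Omega> - {y} then g1 z - g2 z else 0"
  have o: "open (\<Omega> - {y})" using \<Omega>(1) by auto
  have D: "?D \<in> borel_measurable borel"
  proof -
    have "continuous_on (\<Omega> - {y}) (\<lambda>x. g1 x - g2 x)"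
      by (rule continuous_on_subset[of "closure \<Omega> - {y}"]) (use g1 g2 closure_subset in \<open>auto simp: is_green_def intro!: continuous_intros\<close>)
    then have "(\<lambda>z. indicator (\<Omega> - {y}) z *\<^sub>R (g1 z - g2 z)) \<in> borel_measurable borel"
      using o by (intro borel_measurable_continuous_on_indicator) auto
    moreover have "?D = (\<lambda>z. indicator (\<Omega> - {y}) z *\<^sub>R (g1 z - g2 z))" by (auto simp: fun_eq_iff indicator_def)
    ultimately show ?thesis by simp
  qed
  have ny: "AE z in lebesgue. z \<noteq> y" by (intro AE_completion AE_lborel_singleton)
  show "integrable lborel (\<lambda>z. indicator K z * ?D z)" if K: "compact K" "K \<subseteq> \<Omega>" for K
  proof -
    have "integrable lebesgue (\<lambda>x. indicator K x *\<^sub>R g1 x)" "integrable lebesgue (\<lambda>x. indicator K x *\<^sub>R g2 x)"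
      using g1 g2 K by (auto simp: is_green_def locally_integrable_on_def set_integrable_def)
    then have "integrable lebesgue (\<lambda>x. indicator K x * g1 x - indicator K x * g2 x)" by simp
    moreover have m: "(\<lambda>z. indicator K z * ?D z) \<in> borel_measurable borel"
      using D K(1) by (intro borel_measurable_times borel_measurable_indicator) (auto intro: borel_compact)
    moreover have "AE z in lebesgue. indicator K z * g1 z - indicator K z * g2 z = indicator K z * ?D z"
      using ny by eventually_elim (use K(2) in \<open>auto simp: indicator_def\<close>)
    ultimately have "integrable lebesgue (\<lambda>z. indicator K z * ?D z)"
      by (subst integrable_cong_AE[symmetric]) (auto intro: measurable_completion)
    then show ?thesis using m by (simp add: integrable_completion)
  qed
  show "(\<integral>z. ?D z * laplacian \<phi> z \<partial>lborel) = 0" if \<phi>: "test_function \<Omega> \<phi>" for \<phi>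
  proof -
    have "tfc {2} \<Omega> \<phi>" using \<phi> by (auto simp: test_function_tfc tfc_def)
    then have l: "tfc {0} \<Omega> (laplacian \<phi>)" by (rule tfc_laplacian)
    have lm: "laplacian \<phi> \<in> borel_measurable borel" by (rule tfc_borel[OF l])
    have i: "integrable (lebesgue_on \<Omega>) (\<lambda>x. g1 x * laplacian \<phi> x)" "integrable (lebesgue_on \<Omega>) (\<lambda>x. g2 x * laplacian \<phi> x)"
      using g1 g2 by (auto simp: is_green_def intro!: locally_integrable_mult[OF \<Omega>(1) _ l])
    have "(\<integral>x. g1 x * - laplacian \<phi> x \<partial>lebesgue_on \<Omega>) = \<phi> y" "(\<integral>x. g2 x * - laplacian \<phi> x \<partial>lebesgue_on \<Omega>) = \<phi> y"
      using g1 g2 \<phi> by (auto simp: is_green_def set_lebesgue_integral_eq_on[OF \<Omega>(1)])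
    then have e: "(\<integral>x. g1 x * laplacian \<phi> x - g2 x * laplacian \<phi> x \<partial>lebesgue_on \<Omega>) = 0" using i by simp
    have "(\<integral>z. ?D z * laplacian \<phi> z \<partial>lborel) = (\<integral>z. ?D z * laplacian \<phi> z \<partial>lebesgue_on \<Omega>)"
      by (rule integral_lebesgue_on_lborel[symmetric]) (use \<Omega>(1) D lm in auto)
    also have "\<dots> = (\<integral>x. g1 x * laplacian \<phi> x - g2 x * laplacian \<phi> x \<partial>lebesgue_on \<Omega>)"
    proof (rule integral_cong_AE)
      show "(\<lambda>z. ?D z * laplacian \<phi> z) \<in> borel_measurable (lebesgue_on \<Omega>)"
        using D lm by (intro borel_measurable_lebesgue_on borel_measurable_times)
      have "AE z in lebesgue. z \<in> \<Omega> \<longrightarrow> ?D z * laplacian \<phi> z = g1 z * laplacian \<phi> z - g2 z * laplacian \<phi> z"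
        using ny by eventually_elim (auto simp: left_diff_distrib)
      then show "AE z in lebesgue_on \<Omega>. ?D z * laplacian \<phi> z = g1 z * laplacian \<phi> z - g2 z * laplacian \<phi> z"
        using \<Omega>(1) by (subst AE_restrict_space_iff) auto
    qed (use i in auto)
    finally show ?thesis using e by simp
  qed
qed

text \<open>Whatever function the choice returns satisfies \<open>is_green\<close>, because
  \<open>G\<close> shows that one exists; uniqueness identifies the two away from the pole, where
  the value remains undetermined.\<close>

lemma (in conformal_disc) green_eq_G:
  assumes "x \<in> \<Omega>" "y \<in> \<Omega>" "x \<noteq> y" shows "green \<Omega> x y = G x y"
proof -
  have s: "is_green \<Omega> y (SOME g. is_green \<Omega> y g)" by (rule someI[of "is_green \<Omega> y", OF G_is_green[OF assms(2)]])
  have "green \<Omega> x y - G x y \<le> 0" "G x y - green \<Omega> x y \<le> 0"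
    using is_green_unique_le[OF \<Omega> assms(2) s G_is_green[OF assms(2)], of x]
      is_green_unique_le[OF \<Omega> assms(2) G_is_green[OF assms(2)] s, of x] assms
    by (auto simp: green_def)
  then show ?thesis by simp
qed

lemma (in conformal_disc) energy_eq:
  assumes w: "w \<in> borel_measurable M"
  shows "2 * energy \<Omega> w = (\<integral>x. w x * (\<integral>y. G x y * w y \<partial>M) \<partial>M)"
proof -
  have "green_potential \<Omega> w x = (\<integral>y. G x y * w y \<partial>M)" if x: "x \<in> \<Omega>" for x
  proof -
    have mG: "(\<lambda>y. G x y * w y) \<in> borel_measurable M"
      using w G_measurable1[of x] by (simp add: G_commute[of x])
    \<comment> \<open>The value of \<open>green\<close> at the pole is unspecified, so measurability
      is obtained by altering \<open>G\<close> at that single point.\<close>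
    have "{y \<in> space M. y = x} = {x}" using x by auto
    moreover have "{x} \<in> sets M" using x \<Omega>(1) by (simp add: sets_restrict_space_iff)
    ultimately have "(\<lambda>y. if y = x then green \<Omega> x x * w x else G x y * w y) \<in> borel_measurable M"
      using mG by (intro measurable_If) auto
    then have "(\<lambda>y. green \<Omega> x y * w y) \<in> borel_measurable M"
      by (rule measurable_cong[THEN iffD1, rotated]) (use green_eq_G[OF x] in auto)
    moreover have "AE y in M. green \<Omega> x y * w y = G x y * w y"
      using AE_neq[of x] by eventually_elim (use green_eq_G[OF x] in auto)
    ultimately show ?thesis
      unfolding green_potential_def set_lebesgue_integral_eq_on[OF \<Omega>(1)]
      using mG by (intro integral_cong_AE)
  qed
  then have "(\<integral>x. w x * green_potential \<Omega> w x \<partial>M) = (\<integral>x. w x * (\<integral>y. G x y * w y \<partial>M) \<partial>M)"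
    by (intro Bochner_Integration.integral_cong) auto
  then show ?thesis
    unfolding energy_def set_lebesgue_integral_eq_on[OF \<Omega>(1)] by simp
qed

subsection \<open>Weak solutions\<close>

lemma sq_int_integrable_vec:
  fixes f :: "'a \<Rightarrow> 'b::euclidean_space"
  assumes "finite_measure M" "sq_int M f" shows "integrable M f"
proof -
  interpret finite_measure M by fact
  have f: "f \<in> borel_measurable M" "integrable M (\<lambda>x. 1 + (norm (f x))\<^sup>2)" using assms(2) by (auto simp: sq_int_def)
  have "norm (f x) \<le> 1 + (norm (f x))\<^sup>2" for x using sum_squares_bound[of 1 "norm (f x)"] norm_ge_zero[of "f x"] by (simp del: norm_ge_zero)
  then show ?thesis using f by (intro Bochner_Integration.integrable_bound[OF f(2)]) (auto intro!: AE_I2 intro: order_trans)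
qed

lemma sq_int_locally_integrable:
  fixes f :: "complex \<Rightarrow> 'b::euclidean_space"
  assumes \<Omega>: "open \<Omega>" "bounded \<Omega>" and f: "sq_int (lebesgue_on \<Omega>) f"
  shows "locally_integrable_on \<Omega> f"
  unfolding locally_integrable_on_def
proof (intro allI impI)
  fix K assume K: "compact K \<and> K \<subseteq> \<Omega>"
  have "set_integrable lebesgue \<Omega> f"
    using sq_int_integrable_vec[OF finite_measure_lebesgue_on[OF \<Omega>] f] by (simp add: set_lebesgue_integral_eq_on[OF \<Omega>(1)])
  then show "set_integrable lebesgue K f" by (rule set_integrable_subset) (use K in \<open>auto dest: lmeasurable_compact\<close>)
qed

lemma square_integrable_on_sq_int:
  assumes "open \<Omega>" shows "square_integrable_on \<Omega> f \<longleftrightarrow> sq_int (lebesgue_on \<Omega>) f"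
proof -
  have "set_borel_measurable lebesgue \<Omega> f \<longleftrightarrow> f \<in> borel_measurable (lebesgue_on \<Omega>)"
    unfolding set_borel_measurable_def using assms by (subst borel_measurable_restrict_space_iff) auto
  then show ?thesis by (simp add: square_integrable_on_def sq_int_def set_lebesgue_integral_eq_on(2)[OF assms])
qed

lemma H10_imp_Hc:
  assumes \<Omega>: "open \<Omega>" "bounded \<Omega>" and H: "H10 \<Omega> u g" shows "Hc UNIV \<Omega> u g"
proof -
  let ?M = "lebesgue_on \<Omega>"
  have s: "sq_int ?M u" "sq_int ?M g" using H by (auto simp: H10_def H1_def square_integrable_on_sq_int[OF \<Omega>(1)])
  obtain \<phi> where \<phi>: "\<And>n. tfc UNIV \<Omega> (\<phi> n)"
    "(\<lambda>n. \<integral>x. (\<phi> n x - u x)\<^sup>2 + (norm (gradient (\<phi> n) x - g x))\<^sup>2 \<partial>?M) \<longlonglongrightarrow> 0"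
    using H by (auto simp: H10_def test_function_tfc set_lebesgue_integral_eq_on[OF \<Omega>(1)])
  have sp: "sq_int ?M (\<phi> n)" "sq_int ?M (gradient (\<phi> n))" for n
    using tfc_sq_int[OF \<Omega>, of 0 "\<phi> n"] tfc_mono[OF \<phi>(1), of "{0}" n] tfc_gradient_sq_int[OF \<Omega> \<phi>(1), of 0 n] by auto
  have i: "integrable ?M (\<lambda>x. (norm (\<phi> n x - u x))\<^sup>2)" "integrable ?M (\<lambda>x. (norm (gradient (\<phi> n) x - g x))\<^sup>2)" for n
    using sq_int_diff[OF sp(1)[of n] s(1)] sq_int_diff[OF sp(2)[of n] s(2)] by (auto simp: sq_int_def)
  have "L2_lim ?M \<phi> u"
  proof (rule L2_lim_bound[OF sp(1) s(1) _ \<phi>(2)])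
    show "(\<integral>x. (norm (\<phi> n x - u x))\<^sup>2 \<partial>?M) \<le> (\<integral>x. (\<phi> n x - u x)\<^sup>2 + (norm (gradient (\<phi> n) x - g x))\<^sup>2 \<partial>?M)" for n
      using i[of n] by (intro integral_mono) auto
  qed
  moreover have "L2_lim ?M (\<lambda>n. gradient (\<phi> n)) g"
  proof (rule L2_lim_bound[OF sp(2) s(2) _ \<phi>(2)])
    show "(\<integral>x. (norm (gradient (\<phi> n) x - g x))\<^sup>2 \<partial>?M) \<le> (\<integral>x. (\<phi> n x - u x)\<^sup>2 + (norm (gradient (\<phi> n) x - g x))\<^sup>2 \<partial>?M)" for n
      using i[of n] by (intro integral_mono) auto
  qed
  ultimately show ?thesis unfolding Hc_def using \<phi>(1) by blast
qed

lemma tfc_H10: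
  assumes \<Omega>: "open \<Omega>" "bounded \<Omega>" and \<phi>: "tfc UNIV \<Omega> \<phi>" shows "H10 \<Omega> \<phi> (gradient \<phi>)"
proof -
  have s: "sq_int (lebesgue_on \<Omega>) \<phi>" "sq_int (lebesgue_on \<Omega>) (gradient \<phi>)"
    using tfc_sq_int[OF \<Omega>, of 0 \<phi>] tfc_mono[OF \<phi>, of "{0}"] tfc_gradient_sq_int[OF \<Omega> \<phi>, of 0] by auto
  have "weak_gradient \<Omega> \<phi> (gradient \<phi>)"
    unfolding weak_gradient_def
  proof (intro conjI allI impI ballI)
    fix \<psi> b assume \<psi>: "test_function \<Omega> \<psi>" and b: "b \<in> (Basis :: complex set)"
    have p: "tfc {1} \<Omega> \<psi>" using \<psi> by (auto simp: test_function_tfc tfc_def)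
    have "Ck_on 1 \<Omega> \<phi>" using \<phi> Ck_on_subset[OF open_UNIV \<Omega>(1), of 1 \<phi>] by (auto simp: tfc_def)
    note P = integral_by_parts(1)[OF \<Omega> this p b]
    have "gradient \<phi> x \<bullet> b = pd b \<phi> x" for x
      by (rule gradient_inner) (rule tfc_differentiable[OF \<phi>, of 1], auto)
    then show "(LINT x:\<Omega>|lebesgue. \<phi> x * pd b \<psi> x) = - (LINT x:\<Omega>|lebesgue. (gradient \<phi> x \<bullet> b) * \<psi> x)"
      using P by (simp add: set_lebesgue_integral_eq_on[OF \<Omega>(1)])
  qed (use s sq_int_locally_integrable[OF \<Omega>] in auto)
  then show ?thesis unfolding H10_def H1_def square_integrable_on_sq_int[OF \<Omega>(1)] using s \<phi>
    by (auto intro!: exI[of _ "\<lambda>n. \<phi>"] simp: test_function_tfc set_lebesgue_integral_eq_on[OF \<Omega>(1)])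
qed

lemma weak_solution_imp_wsol:
  assumes \<Omega>: "open \<Omega>" "bounded \<Omega>" and w: "weak_solution l \<Omega> u"
  obtains g where "wsol UNIV \<Omega> l u g"
proof -
  obtain g where g: "H10 \<Omega> u g" "\<And>v h. H10 \<Omega> v h \<Longrightarrow>
        (LINT x:\<Omega>|lebesgue. g x \<bullet> h x) = l * (LINT x:\<Omega>|lebesgue. mf_density \<Omega> u x * v x)"
    using w by (auto simp: weak_solution_def)
  have "wsol UNIV \<Omega> l u g"
    unfolding wsol_def using H10_imp_Hc[OF \<Omega> g(1)] g(2)[OF tfc_H10[OF \<Omega>]]
    by (simp add: set_lebesgue_integral_eq_on[OF \<Omega>(1)])
  then show ?thesis using that by blast
qed

subsection \<open>Classical solutions\<close>

text \<open>Since \<open>cutoff e\<close> vanishes on \<open>[-e, e]\<close>, a continuous function that is zero on the boundary becomes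
  compactly supported when composed with it.\<close>

definition cutoff :: "real \<Rightarrow> real \<Rightarrow> real" where "cutoff e s = s * flat 0 (s\<^sup>2 / e\<^sup>2 - 1)"

text \<open>The derivative of \<open>cutoff e\<close> with the factor s^2 / e^2 = q + 1 absorbed
  through q flat 2 q = flat 1 q. In this form the bound 1 + 2 (1 + 2) = 7, uniform in e and s, is
  visible.\<close>

definition cutoff' :: "real \<Rightarrow> real \<Rightarrow> real" where
  "cutoff' e s = flat 0 (s\<^sup>2 / e\<^sup>2 - 1) + 2 * (flat 1 (s\<^sup>2 / e\<^sup>2 - 1) + flat 2 (s\<^sup>2 / e\<^sup>2 - 1))"

lemma cutoff_Ck: assumes "0 < e" shows "Ck_on k UNIV (cutoff e)"
proof -
  have "Ck_on k UNIV (\<lambda>s. (1 / e\<^sup>2) * s\<^sup>2 - 1)"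
    by (intro Ck_on_diff[OF open_UNIV] Ck_on_cmult[OF open_UNIV] Ck_on_power[OF open_UNIV] Ck_on_ident[OF open_UNIV] Ck_on_const[OF open_UNIV])
  then have "Ck_on k UNIV (\<lambda>s. flat 0 ((1 / e\<^sup>2) * s\<^sup>2 - 1))"
    by (rule Ck_on_compose[of UNIV UNIV "\<lambda>s. (1 / e\<^sup>2) * s\<^sup>2 - 1" k "flat 0", OF _ _ _ Ck_on_flat, rotated 3]) auto
  then have "Ck_on k UNIV (\<lambda>s. s * flat 0 ((1 / e\<^sup>2) * s\<^sup>2 - 1))"
    by (rule Ck_on_mult[OF open_UNIV Ck_on_ident[OF open_UNIV]])
  then show ?thesis by (simp add: cutoff_def[abs_def])
qed

lemma flat_shift: "q * flat (Suc n) q = flat n q" by (simp add: flat_def)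

lemma cutoff_DERIV: assumes "0 < e" shows "(cutoff e has_real_derivative cutoff' e s) (at s)"
proof -
  define q where "q = s\<^sup>2 / e\<^sup>2 - 1"
  have "((\<lambda>s. s\<^sup>2) has_real_derivative 2 * s) (at s)" by (auto intro!: derivative_eq_intros)
  from DERIV_diff[OF DERIV_cdivide[OF this, of "e\<^sup>2"] DERIV_const[of 1]]
  have "((\<lambda>s. s\<^sup>2 / e\<^sup>2 - 1) has_real_derivative 2 * s / e\<^sup>2) (at s)" by simp
  from DERIV_chain2[OF DERIV_flat[where n = 0] this]
  have "((\<lambda>s. flat 0 (s\<^sup>2 / e\<^sup>2 - 1)) has_real_derivative flat 2 q * (2 * s / e\<^sup>2)) (at s)"
    by (simp add: q_def numeral_2_eq_2)
  from DERIV_mult[OF DERIV_ident this]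
  have "(cutoff e has_real_derivative 1 * flat 0 q + flat 2 q * (2 * s / e\<^sup>2) * s) (at s)"
    unfolding cutoff_def[abs_def] q_def by simp
  moreover have "1 * flat 0 q + flat 2 q * (2 * s / e\<^sup>2) * s = cutoff' e s"
  proof -
    have "flat 2 q * (2 * s / e\<^sup>2) * s = 2 * (flat 2 q * (s\<^sup>2 / e\<^sup>2))" by (simp add: power2_eq_square)
    also have "\<dots> = 2 * (flat 2 q * (q + 1))" by (simp add: q_def)
    also have "flat 2 q * (q + 1) = flat 1 q + flat 2 q" using flat_shift[of q 1] by (simp add: algebra_simps numeral_2_eq_2)
    finally have "flat 2 q * (2 * s / e\<^sup>2) * s = 2 * (flat 1 q + flat 2 q)" by simp
    then show ?thesis by (simp add: cutoff'_def q_def)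
  qed
  ultimately show ?thesis by simp
qed

lemma cutoff'_bounds: "0 \<le> cutoff' e s" "cutoff' e s \<le> 7"
proof -
  show "0 \<le> cutoff' e s" unfolding cutoff'_def by (intro add_nonneg_nonneg mult_nonneg_nonneg flat_nonneg) auto
  define q where "q = s\<^sup>2 / e\<^sup>2 - 1"
  have h: "flat 0 q \<le> 1" "flat 1 q \<le> 1" "flat 2 q \<le> 2"
    using flat_bounded[of 0 q] flat_bounded[of 1 q] flat_bounded[of 2 q] by (auto simp: fact_numeral)
  have "flat 0 q + 2 * (flat 1 q + flat 2 q) \<le> 1 + 2 * (1 + 2)" by (intro add_mono mult_left_mono h) simp
  then show "cutoff' e s \<le> 7" unfolding cutoff'_def q_def[symmetric] by simp
qed

lemma cutoff_zero: assumes "0 < e" "\<bar>s\<bar> \<le> e" shows "cutoff e s = 0" "cutoff' e s = 0"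
proof -
  have "s\<^sup>2 \<le> e\<^sup>2" using assms by (simp add: abs_le_square_iff[symmetric])
  then have "s\<^sup>2 / e\<^sup>2 - 1 \<le> 0" using assms by simp
  then show "cutoff e s = 0" "cutoff' e s = 0" by (simp_all add: cutoff_def cutoff'_def flat_0)
qed

lemma abs_cutoff_le: "\<bar>cutoff e s\<bar> \<le> \<bar>s\<bar>"
  using flat_bounded[of 0 "s\<^sup>2 / e\<^sup>2 - 1"] by (simp add: cutoff_def abs_mult mult_left_le)

lemma flat_at_top: "(flat n \<longlongrightarrow> (if n = 0 then 1 else 0)) at_top"
proof -
  have i: "((\<lambda>t::real. inverse t) \<longlongrightarrow> 0) at_top" by (rule tendsto_inverse_0_at_top) (rule filterlim_ident)
  have "((\<lambda>t. exp (- inverse t) * inverse t ^ n) \<longlongrightarrow> exp (- 0) * 0 ^ n) (at_top :: real filter)"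
    by (intro tendsto_intros i)
  moreover have "eventually (\<lambda>t. exp (- inverse t) * inverse t ^ n = flat n t) at_top"
    using eventually_gt_at_top[of 0] by eventually_elim (simp add: flat_eq)
  ultimately have "(flat n \<longlongrightarrow> exp (- 0) * 0 ^ n) at_top" by (rule Lim_transform_eventually)
  then show ?thesis by (cases n) auto
qed

lemma cutoff_tendsto:
  assumes e: "e \<longlonglongrightarrow> 0" "\<And>n. 0 < e n"
  shows "(\<lambda>n. cutoff (e n) s) \<longlonglongrightarrow> s" "(\<lambda>n. cutoff' (e n) s) \<longlonglongrightarrow> (if s = 0 then 0 else 1)"
proof -
  have "(\<lambda>n. cutoff (e n) s) \<longlonglongrightarrow> s \<and> (\<lambda>n. cutoff' (e n) s) \<longlonglongrightarrow> (if s = 0 then 0 else 1)"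
  proof (cases "s = 0")
    case True
    then show ?thesis using cutoff_zero[OF e(2), of s] e(2) less_imp_le by (simp add: less_imp_le)
  next
    case False
    have "filterlim (\<lambda>n. s\<^sup>2 / (e n)\<^sup>2) at_top sequentially"
    proof (rule LIM_at_top_divide[of _ "s\<^sup>2"])
      show "(\<lambda>n. (e n)\<^sup>2) \<longlonglongrightarrow> 0" using tendsto_power[OF e(1), of 2] by simp
      show "eventually (\<lambda>n. 0 < (e n)\<^sup>2) sequentially" using e(2) by (simp add: less_imp_neq[symmetric] zero_less_power)
    qed (use False in auto)
    then have q: "filterlim (\<lambda>n. s\<^sup>2 / (e n)\<^sup>2 + (- 1)) at_top sequentially"
      using filterlim_tendsto_add_at_top[OF tendsto_const[of "- 1 :: real"]] by (simp add: add.commute)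
    note T = filterlim_compose[OF flat_at_top q]
    have "(\<lambda>n. s * flat 0 (s\<^sup>2 / (e n)\<^sup>2 + (- 1))) \<longlonglongrightarrow> s * 1"
      using T[of 0] by (intro tendsto_mult_left) simp
    moreover have "(\<lambda>n. flat 0 (s\<^sup>2 / (e n)\<^sup>2 + (- 1)) + 2 * (flat 1 (s\<^sup>2 / (e n)\<^sup>2 + (- 1)) + flat 2 (s\<^sup>2 / (e n)\<^sup>2 + (- 1)))) \<longlonglongrightarrow> 1 + 2 * (0 + 0)"
      using T[of 0] T[of 1] T[of 2] by (intro tendsto_add tendsto_mult_left) auto
    ultimately show ?thesis using False by (simp add: cutoff_def cutoff'_def)
  qed
  then show "(\<lambda>n. cutoff (e n) s) \<longlonglongrightarrow> s" "(\<lambda>n. cutoff' (e n) s) \<longlonglongrightarrow> (if s = 0 then 0 else 1)" by auto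
qed

text \<open>Nothing in the definition makes the gradient of a classical solution square integrable.
  Testing with \<open>cutoff (e n)\<close> of u bounds the integral of cutoff'(u) |\<nabla>u|^2 by
  |l| sup |u|, and Fatou transfers this to the limit; the same functions then serve as approximants
  in \<open>Hc {2}\<close>.\<close>

lemma classical_solution_imp_wsol:
  assumes \<Omega>: "open \<Omega>" "bounded \<Omega>" and cs: "classical_solution l \<Omega> u"
  obtains g where "wsol {2} \<Omega> l u g"
proof -
  let ?M = "lebesgue_on \<Omega>"
  interpret finite_measure ?M by (rule finite_measure_lebesgue_on[OF \<Omega>])
  have u2: "Ck_on 2 \<Omega> u" and uc: "continuous_on (closure \<Omega>) u" and ueq: "\<And>x. x \<in> \<Omega> \<Longrightarrow> - laplacian u x = l * mf_density \<Omega> u x"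
    and u0: "\<And>x. x \<in> frontier \<Omega> \<Longrightarrow> u x = 0" using cs by (auto simp: classical_solution_def)
  have u1: "Ck_on 1 \<Omega> u" by (rule Ck_on_le[OF \<Omega>(1) u2]) simp
  have ud: "u differentiable (at x)" if "x \<in> \<Omega>" for x using u1 that \<Omega>(1) by (simp add: Ck_on_Suc_open)
  have pu1: "Ck_on 1 \<Omega> (pd b u)" if "b \<in> Basis" for b
    using u2 that \<Omega>(1) Ck_on_Suc_open[OF \<Omega>(1), of 1 u] by (simp add: numeral_2_eq_2)
  have pu0: "continuous_on \<Omega> (pd b u)" if "b \<in> Basis" for b using Ck_on_le[OF \<Omega>(1) pu1[OF that], of 0] by simp
  have mM: "h \<in> borel_measurable ?M" if "continuous_on \<Omega> h" for h :: "complex \<Rightarrow> real"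
    using that \<Omega>(1) by (intro continuous_imp_measurable_on_sets_lebesgue) auto
  have ucO: "continuous_on \<Omega> u" by (rule continuous_on_subset[OF uc closure_subset])
  have mu[measurable]: "u \<in> borel_measurable ?M" by (rule mM[OF ucO])
  have mg[measurable]: "gradient u \<in> borel_measurable ?M"
  proof -
    have "(\<lambda>x. pd 1 u x *\<^sub>R 1 + pd \<i> u x *\<^sub>R \<i>) \<in> borel_measurable ?M"
      using mM[OF pu0[of 1]] mM[OF pu0[of \<i>]] by (auto simp: Basis_complex_def)
    then show ?thesis by (simp add: gradient_alt)
  qed
  have cpt: "compact (closure \<Omega>)" using \<Omega>(2) by (simp add: compact_closure)
  obtain B where B: "\<And>x. x \<in> closure \<Omega> \<Longrightarrow> \<bar>u x\<bar> \<le> B"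
    using compact_imp_bounded[OF compact_continuous_image[OF uc cpt]] by (auto simp: bounded_iff)
  have BO: "\<bar>u x\<bar> \<le> \<bar>B\<bar>" if "x \<in> \<Omega>" for x using B[of x] closure_subset that by fastforce
  have squ: "sq_int ?M u"
    unfolding sq_int_def
  proof (intro conjI)
    have "(u x)\<^sup>2 \<le> B\<^sup>2" if "x \<in> \<Omega>" for x using power_mono[OF BO[OF that] abs_ge_zero, of 2] by simp
    then show "integrable ?M (\<lambda>x. (norm (u x))\<^sup>2)"
      by (intro integrable_const_bound[of _ "B\<^sup>2"]) (auto intro!: AE_I2)
  qed (rule mu)
  define Z where "Z = (\<integral>x. exp (u x) \<partial>?M)"
  have dens: "mf_density \<Omega> u x = exp (u x) / Z" for x by (simp add: mf_density_def Z_def set_lebesgue_integral_eq_on[OF \<Omega>(1)])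
  have iexp: "integrable ?M (\<lambda>x. exp (u x))"
    by (rule integrable_const_bound[of _ "exp \<bar>B\<bar>"]) (use BO in \<open>auto intro!: AE_I2 order_trans[OF abs_ge_self BO]\<close>)
  have dn: "0 \<le> mf_density \<Omega> u x" for x by (simp add: dens Z_def)
  have di: "integrable ?M (mf_density \<Omega> u)" using iexp by (simp add: dens[abs_def])
  \<comment> \<open>An inequality, since for empty \<Omega> the normalisation is 0 and the density,
    by division by 0, is 0 as well.\<close>
  have d1: "(\<integral>x. mf_density \<Omega> u x \<partial>?M) \<le> 1" by (simp add: dens[abs_def] Z_def)
  have E1: "(\<integral>x. gradient u x \<bullet> gradient \<phi> x \<partial>?M) = l * (\<integral>x. mf_density \<Omega> u x * \<phi> x \<partial>?M)" if \<phi>: "tfc {2} \<Omega> \<phi>" for \<phi>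
  proof -
    have \<phi>1: "tfc {1} \<Omega> \<phi>" using \<phi> tfc_Ck[OF \<phi>, of 2 1] by (auto simp: tfc_def)
    have Bs: "1 \<in> (Basis::complex set)" "\<i> \<in> (Basis::complex set)" by (auto simp: Basis_complex_def)
    note P = integral_by_parts[OF \<Omega> pu1[OF Bs(1)] \<phi>1 Bs(1)] integral_by_parts[OF \<Omega> pu1[OF Bs(2)] \<phi>1 Bs(2)]
    have "(\<integral>x. gradient u x \<bullet> gradient \<phi> x \<partial>?M) = - (\<integral>x. laplacian u x * \<phi> x \<partial>?M)"
      unfolding inner_gradient laplacian_eq distrib_right using P by simp
    also have "\<dots> = (\<integral>x. l * (mf_density \<Omega> u x * \<phi> x) \<partial>?M)"
      unfolding Bochner_Integration.integral_minus[symmetric]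
    proof (rule Bochner_Integration.integral_cong[OF refl])
      fix x assume "x \<in> space ?M"
      then have "laplacian u x = - (l * mf_density \<Omega> u x)" using ueq[of x] by simp
      then show "- (laplacian u x * \<phi> x) = l * (mf_density \<Omega> u x * \<phi> x)" by simp
    qed
    finally show ?thesis by simp
  qed
  define e where "e n = 1 / real (Suc n)" for n
  have e: "0 < e n" for n by (simp add: e_def)
  have e0: "e \<longlonglongrightarrow> 0" unfolding e_def using LIMSEQ_inverse_real_of_nat by (simp add: divide_inverse)
  define \<phi> where "\<phi> n = (\<lambda>x. if x \<in> \<Omega> then cutoff (e n) (u x) else 0)" for n
  have \<phi>t: "tfc {2} \<Omega> (\<phi> n)" for n
  proof -
    define K where "K = {x \<in> closure \<Omega>. e n \<le> \<bar>u x\<bar>}"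
    have "closed K" unfolding K_def
      using continuous_closed_preimage[OF continuous_on_rabs[OF uc] closed_closure closed_atLeast[of "e n"]]
      by (simp add: vimage_def Int_def)
    moreover have "closure \<Omega> \<inter> K = K" by (auto simp: K_def)
    ultimately have K: "compact K" using compact_Int_closed[OF cpt, of K] by simp
    have KO: "K \<subseteq> \<Omega>"
    proof
      fix x assume x: "x \<in> K"
      show "x \<in> \<Omega>"
      proof (rule ccontr)
        assume "x \<notin> \<Omega>"
        then have "u x = 0" using x u0 \<Omega>(1) by (auto simp: K_def frontier_def interior_open)
        then show False using x e[of n] by (simp add: K_def)
      qed
    qed
    have z: "cutoff (e n) (u x) = 0" if "x \<in> \<Omega> - K" for x
      using that closure_subset by (intro cutoff_zero e) (force simp: K_def)
    have c: "Ck_on 2 \<Omega> (\<lambda>x. cutoff (e n) (u x))"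
      by (rule Ck_on_compose[of \<Omega> UNIV u 2 "cutoff (e n)", OF \<Omega>(1) _ _ cutoff_Ck[OF e] u2]) auto
    show ?thesis
    proof (rule tfcI[OF _ K KO])
      show "Ck_on k UNIV (\<phi> n)" if "k \<in> {2}" for k
        using Ck_on_extend_zero[OF \<Omega>(1) K KO c z] that by (simp add: \<phi>_def)
      show "\<phi> n x = 0" if "x \<notin> K" for x using z[of x] that by (simp add: \<phi>_def)
    qed
  qed
  have g\<phi>: "gradient (\<phi> n) x = cutoff' (e n) (u x) *\<^sub>R gradient u x" if x: "x \<in> \<Omega>" for n x
  proof -
    have "pd b (\<phi> n) x = cutoff' (e n) (u x) * pd b u x" for b
    proof -
      have "pd b (\<phi> n) x = pd b (\<lambda>x. cutoff (e n) (u x)) x"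
        by (rule pd_cong_open[OF \<Omega>(1) x _ tfc_differentiable[OF \<phi>t]]) (auto simp: \<phi>_def)
      then show ?thesis using pd_compose_real[OF cutoff_DERIV[OF e] ud[OF x]] by simp
    qed
    then show ?thesis by (simp add: gradient_eq complex_eq_iff)
  qed
  \<comment> \<open>cutoff' vanishes at 0 for every e, so this is the pointwise limit of the
    gradients of the approximants, whatever \<nabla>u is on the zero set of u.\<close>
  define g where "g x = (if u x = 0 then 0 else gradient u x)" for x
  have mgg: "g \<in> borel_measurable ?M" unfolding g_def by measurable
  have lim: "(\<lambda>n. cutoff' (e n) (u x)) \<longlonglongrightarrow> (if u x = 0 then 0 else 1)" for x by (rule cutoff_tendsto(2)[OF e0 e])
  have mc: "(\<lambda>x. cutoff' (e n) (u x)) \<in> borel_measurable ?M" for n unfolding cutoff'_def by measurable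
  have "integrable ?M (\<lambda>x. (norm (g x))\<^sup>2)"
  proof (rule fatou_integral(1)[where F="\<lambda>n x. cutoff' (e n) (u x) * (norm (gradient u x))\<^sup>2" and C="\<lambda>n. \<bar>l\<bar> * \<bar>B\<bar>" and c="\<bar>l\<bar> * \<bar>B\<bar>"])
    have eq: "cutoff' (e n) (u x) * (norm (gradient u x))\<^sup>2 = gradient u x \<bullet> gradient (\<phi> n) x" if "x \<in> \<Omega>" for n x
      using g\<phi>[OF that] by (simp add: power2_norm_eq_inner)
    show "integrable ?M (\<lambda>x. cutoff' (e n) (u x) * (norm (gradient u x))\<^sup>2)" for n
      using integral_laplacian_by_parts(3)[OF \<Omega> u1 \<phi>t[of n]]
      by (rule Bochner_Integration.integrable_cong[THEN iffD1, rotated 2]) (auto simp: eq)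
    show "0 \<le> cutoff' (e n) (u x) * (norm (gradient u x))\<^sup>2" for n x using cutoff'_bounds by simp
    show "(\<lambda>x. (norm (g x))\<^sup>2) \<in> borel_measurable ?M" using mgg by simp
    show "AE x in ?M. (\<lambda>n. cutoff' (e n) (u x) * (norm (gradient u x))\<^sup>2) \<longlonglongrightarrow> (norm (g x))\<^sup>2"
    proof (rule AE_I2)
      fix x
      have "(\<lambda>n. cutoff' (e n) (u x) * (norm (gradient u x))\<^sup>2) \<longlonglongrightarrow> (if u x = 0 then 0 else 1) * (norm (gradient u x))\<^sup>2"
        by (intro tendsto_mult_right lim)
      then show "(\<lambda>n. cutoff' (e n) (u x) * (norm (gradient u x))\<^sup>2) \<longlonglongrightarrow> (norm (g x))\<^sup>2" by (auto simp: g_def)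
    qed
    show "(\<integral>x. cutoff' (e n) (u x) * (norm (gradient u x))\<^sup>2 \<partial>?M) \<le> \<bar>l\<bar> * \<bar>B\<bar>" for n
    proof -
      have "(\<integral>x. cutoff' (e n) (u x) * (norm (gradient u x))\<^sup>2 \<partial>?M) = (\<integral>x. gradient u x \<bullet> gradient (\<phi> n) x \<partial>?M)"
        by (intro Bochner_Integration.integral_cong refl eq) simp
      also have "\<dots> = l * (\<integral>x. mf_density \<Omega> u x * \<phi> n x \<partial>?M)" by (rule E1[OF \<phi>t])
      also have "\<dots> \<le> \<bar>l\<bar> * \<bar>\<integral>x. mf_density \<Omega> u x * \<phi> n x \<partial>?M\<bar>" by (metis abs_ge_self abs_mult)
      also have "\<bar>\<integral>x. mf_density \<Omega> u x * \<phi> n x \<partial>?M\<bar> \<le> (\<integral>x. mf_density \<Omega> u x * \<bar>B\<bar> \<partial>?M)"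
      proof -
        have b: "\<bar>\<phi> n x\<bar> \<le> \<bar>B\<bar>" for x using order_trans[OF abs_cutoff_le BO] by (simp add: \<phi>_def)
        have m: "\<phi> n \<in> borel_measurable ?M"
          by (intro borel_measurable_lebesgue_on tfc_borel[OF \<phi>t])
        have iB: "integrable ?M (\<lambda>x. mf_density \<Omega> u x * \<bar>B\<bar>)" using di by simp
        have le: "norm (mf_density \<Omega> u x * \<phi> n x) \<le> mf_density \<Omega> u x * \<bar>B\<bar>" for x
          using b[of x] dn[of x] by (simp add: abs_mult mult_left_mono)
        have i: "integrable ?M (\<lambda>x. mf_density \<Omega> u x * \<phi> n x)"
          by (rule Bochner_Integration.integrable_bound[OF iB]) (use m di le in \<open>auto intro!: AE_I2 order_trans[OF _ abs_ge_self]\<close>)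
        have "norm (\<integral>x. mf_density \<Omega> u x * \<phi> n x \<partial>?M) \<le> (\<integral>x. norm (mf_density \<Omega> u x * \<phi> n x) \<partial>?M)" by (rule integral_norm_bound)
        also have "\<dots> \<le> (\<integral>x. mf_density \<Omega> u x * \<bar>B\<bar> \<partial>?M)" using i iB le by (intro integral_mono) auto
        finally show ?thesis by simp
      qed
      also have "(\<integral>x. mf_density \<Omega> u x * \<bar>B\<bar> \<partial>?M) = (\<integral>x. mf_density \<Omega> u x \<partial>?M) * \<bar>B\<bar>" by simp
      also have "\<dots> \<le> 1 * \<bar>B\<bar>" using d1 by (intro mult_right_mono) auto
      finally show ?thesis by (simp add: mult_left_mono)
    qed
  qed simp
  then have sg: "sq_int ?M g" using mgg by (simp add: sq_int_def)
  have L1: "L2_lim ?M \<phi> u"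
  proof (rule L2_lim_dominated)
    show "sq_int ?M (\<lambda>x. \<bar>u x\<bar>)" using squ by (auto simp: sq_int_def)
    show "AE x in ?M. norm (\<phi> n x) \<le> \<bar>u x\<bar>" for n using abs_cutoff_le by (auto simp: \<phi>_def)
    show "AE x in ?M. (\<lambda>n. \<phi> n x) \<longlonglongrightarrow> u x" using cutoff_tendsto(1)[OF e0 e] by (auto simp: \<phi>_def)
    show "\<phi> n \<in> borel_measurable ?M" for n by (intro borel_measurable_lebesgue_on tfc_borel[OF \<phi>t])
  qed (rule mu)
  have L2: "L2_lim ?M (\<lambda>n. gradient (\<phi> n)) g"
  proof (rule L2_lim_dominated)
    show "sq_int ?M (\<lambda>x. 7 * norm (g x))" using sg by (auto simp: sq_int_def power_mult_distrib)
    show "AE x in ?M. norm (gradient (\<phi> n) x) \<le> 7 * norm (g x)" for n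
    proof (rule AE_I2)
      fix x assume "x \<in> space ?M"
      then have x: "x \<in> \<Omega>" by simp
      show "norm (gradient (\<phi> n) x) \<le> 7 * norm (g x)"
      proof (cases "u x = 0")
        case True
        then show ?thesis using cutoff_zero(2)[OF e, of 0 n] e[of n] by (simp add: g\<phi>[OF x])
      next
        case False
        then show ?thesis using cutoff'_bounds[of "e n" "u x"] by (simp add: g\<phi>[OF x] g_def mult_right_mono)
      qed
    qed
    show "AE x in ?M. (\<lambda>n. gradient (\<phi> n) x) \<longlonglongrightarrow> g x"
    proof (rule AE_I2)
      fix x assume "x \<in> space ?M"
      then have x: "x \<in> \<Omega>" by simp
      have "(\<lambda>n. cutoff' (e n) (u x) *\<^sub>R gradient u x) \<longlonglongrightarrow> (if u x = 0 then 0 else 1) *\<^sub>R gradient u x"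
        by (intro tendsto_scaleR lim tendsto_const)
      then show "(\<lambda>n. gradient (\<phi> n) x) \<longlonglongrightarrow> g x" by (auto simp: g\<phi>[OF x] g_def split: if_splits)
    qed
    show "gradient (\<phi> n) \<in> borel_measurable ?M" for n
      using tfc_gradient_sq_int[OF \<Omega> \<phi>t, of 1 n] by (simp add: sq_int_def numeral_2_eq_2)
  qed (rule mgg)
  have "wsol {2} \<Omega> l u g"
    unfolding wsol_def
  proof (intro conjI allI impI)
    show "Hc {2} \<Omega> u g" unfolding Hc_def using L1 L2 \<phi>t by blast
    fix \<psi> assume \<psi>: "tfc {2} \<Omega> \<psi>"
    have s: "sq_int ?M (gradient \<psi>)" "sq_int ?M (laplacian \<psi>)"
      using tfc_gradient_sq_int[OF \<Omega> \<psi>, of 1] tfc_sq_int[OF \<Omega> tfc_laplacian[OF \<psi>]] by (auto simp: numeral_2_eq_2)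
    have c1: "Ck_on 1 \<Omega> (\<phi> n)" for n using tfc_Ck[OF \<phi>t, of 2 1 n] Ck_on_subset[OF open_UNIV \<Omega>(1), of 1 "\<phi> n"] by simp
    \<comment> \<open>Both derivatives are moved onto \<psi>, where L2 convergence of \<phi> n to u
      is enough, and then one is moved back onto u. So g and \<nabla>u have the same integral
      against \<nabla>\<psi> without any comparison on the zero set of u.\<close>
    have "(\<lambda>n. \<integral>x. gradient (\<phi> n) x \<bullet> gradient \<psi> x \<partial>?M) \<longlonglongrightarrow> (\<integral>x. g x \<bullet> gradient \<psi> x \<partial>?M)"
      by (rule L2_lim_inner_const[OF L2 s(1)])
    moreover have "(\<lambda>n. - (\<integral>x. \<phi> n x \<bullet> laplacian \<psi> x \<partial>?M)) \<longlonglongrightarrow> - (\<integral>x. u x \<bullet> laplacian \<psi> x \<partial>?M)"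
      by (intro tendsto_minus L2_lim_inner_const[OF L1 s(2)])
    moreover have "(\<integral>x. gradient (\<phi> n) x \<bullet> gradient \<psi> x \<partial>?M) = - (\<integral>x. \<phi> n x \<bullet> laplacian \<psi> x \<partial>?M)" for n
      using integral_laplacian_by_parts(1)[OF \<Omega> c1 \<psi>, of n] by simp
    ultimately have "(\<integral>x. g x \<bullet> gradient \<psi> x \<partial>?M) = - (\<integral>x. u x * laplacian \<psi> x \<partial>?M)"
      using LIMSEQ_unique by simp
    also have "\<dots> = (\<integral>x. gradient u x \<bullet> gradient \<psi> x \<partial>?M)"
      using integral_laplacian_by_parts(1)[OF \<Omega> u1 \<psi>] by simp
    finally show "(\<integral>x. g x \<bullet> gradient \<psi> x \<partial>?M) = l * (\<integral>x. mf_density \<Omega> u x * \<psi> x \<partial>?M)"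
      using E1[OF \<psi>] by simp
  qed
  then show thesis by (rule that)
qed

subsection \<open>Uniqueness on thin domains\<close>

text \<open>Testing the variational characterisation of the Green energy with \<open>u / l\<close>.\<close>

lemma wsol_energy_bound:
  assumes cd: "conformal_disc \<Omega> f g'" and N: "2 \<in> N" and pos: "0 < measure lebesgue \<Omega>"
    and w: "wsol N \<Omega> l u g" and l: "0 < l"
  shows "(\<integral>x. mf_density \<Omega> u x * u x \<partial>lebesgue_on \<Omega>) \<le> 2 * l * energy \<Omega> (mf_density \<Omega> u)"
proof -
  interpret conformal_disc \<Omega> f g' by (rule cd)
  let ?w = "mf_density \<Omega> u" and ?c = "1 / l"
  define I where "I = (\<integral>x. ?w x * u x \<partial>lebesgue_on \<Omega>)"
  note H = wsolD(1)[OF \<Omega> N pos w]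
  have sw: "sq_int (lebesgue_on \<Omega>) ?w" by (rule mf_density_sq_int[OF \<Omega> N pos H])
  have "Hc N \<Omega> (\<lambda>x. ?c * u x) (\<lambda>x. ?c *\<^sub>R g x)"
  proof (rule Hc_compose[OF \<Omega> N, where B = "\<bar>?c\<bar>" and F = "\<lambda>t. ?c * t", OF _ _ _ _ H])
    show "Ck_on k UNIV (\<lambda>t. ?c * t)" for k
      by (rule Ck_on_cmult[OF open_UNIV Ck_on_ident[OF open_UNIV]])
    show "((\<lambda>t. ?c * t) has_real_derivative ?c) (at t)" for t by (rule DERIV_cmult_Id)
  qed simp_all
  then obtain \<phi> where \<phi>: "\<And>n. tfc N \<Omega> (\<phi> n)" "L2_lim (lebesgue_on \<Omega>) \<phi> (\<lambda>x. ?c * u x)"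
    "L2_lim (lebesgue_on \<Omega>) (\<lambda>n. gradient (\<phi> n)) (\<lambda>x. ?c *\<^sub>R g x)" unfolding Hc_def by blast
  have "2 * (\<integral>x. ?w x * \<phi> n x \<partial>lebesgue_on \<Omega>) - (\<integral>x. (norm (gradient (\<phi> n) x))\<^sup>2 \<partial>lebesgue_on \<Omega>)
      \<le> 2 * energy \<Omega> ?w" for n
  proof -
    have "tfc {2} \<Omega> (\<phi> n)" using tfc_mono[OF \<phi>(1)] N by simp
    from energy_lower_bound[OF sw this] show ?thesis using energy_eq[of ?w] sw by (simp add: sq_int_def)
  qed
  moreover have "(\<lambda>n. 2 * (\<integral>x. ?w x * \<phi> n x \<partial>lebesgue_on \<Omega>) - (\<integral>x. (norm (gradient (\<phi> n) x))\<^sup>2 \<partial>lebesgue_on \<Omega>))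
      \<longlonglongrightarrow> 2 * (?c * I) - (\<integral>x. (norm (?c *\<^sub>R g x))\<^sup>2 \<partial>lebesgue_on \<Omega>)"
    using L2_lim_inner_const[OF \<phi>(2) sw]
    by (intro tendsto_diff tendsto_mult_left L2_lim_norm[OF \<phi>(3)]) (simp add: I_def mult_ac)
  ultimately have "2 * (?c * I) - (\<integral>x. (norm (?c *\<^sub>R g x))\<^sup>2 \<partial>lebesgue_on \<Omega>) \<le> 2 * energy \<Omega> ?w"
    by (intro LIMSEQ_le_const2) auto
  \<comment> \<open>The equation tested with u itself: after scaling by 1 / l the quadratic term
    equals I / l, half of the linear term 2 I / l.\<close>
  moreover have "(\<integral>x. (norm (g x))\<^sup>2 \<partial>lebesgue_on \<Omega>) = l * I"
    using wsolD(2)[OF \<Omega> N pos w H] by (simp add: I_def power2_norm_eq_inner)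
  then have "(\<integral>x. (norm (?c *\<^sub>R g x))\<^sup>2 \<partial>lebesgue_on \<Omega>) = ?c * I"
    using l by (simp add: power_mult_distrib power_divide power2_eq_square)
  ultimately have "?c * I \<le> 2 * energy \<Omega> ?w" by linarith
  then show ?thesis unfolding I_def[symmetric] using l by (simp add: field_simps)
qed

text \<open>The product of (48 lbar)^2 from \<open>wsol_unique\<close> and C = 2 exp (2 k) from
  \<open>wsol_L2_bound\<close>. There m = 2 lbar Ebar by the energy bound, so k = 2 + 128 lbar^2
  Ebar meets both k \<ge> 2 and k \<ge> 64 lbar m.\<close>

definition thin_const :: "real \<Rightarrow> real \<Rightarrow> real" where
  "thin_const lbar Ebar = (48 * lbar)\<^sup>2 * (2 * exp (2 * (2 + 128 * lbar\<^sup>2 * Ebar)))"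

lemma thin_const_pos: "0 < lbar \<Longrightarrow> 0 < thin_const lbar Ebar"
  by (simp add: thin_const_def)

lemma thin_uniqueness:
  assumes \<Omega>: "open \<Omega>" "bounded \<Omega>" and sc: "simply_connected \<Omega>" and ne: "\<Omega> \<noteq> {}"
    and e: "norm e = 1" and h: "\<And>x. x \<in> \<Omega> \<Longrightarrow> \<bar>x \<bullet> e - c\<bar> \<le> h" "0 \<le> h"
    and lbar: "0 < lbar" and Ebar: "0 \<le> Ebar" and thin: "thin_const lbar Ebar * h\<^sup>2 < measure lebesgue \<Omega>"
    and l: "l \<le> lbar" and u: "mf_solution l \<Omega> u" "energy \<Omega> (mf_density \<Omega> u) \<le> Ebar"
    and v: "mf_solution l \<Omega> v" "energy \<Omega> (mf_density \<Omega> v) \<le> Ebar"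
  shows "same_solution \<Omega> u v"
proof -
  have pos: "0 < measure lebesgue \<Omega>"
    using thin thin_const_pos[OF lbar, of Ebar] zero_le_power2[of h] by (smt (verit) mult_nonneg_nonneg)
  have "\<Omega> \<noteq> UNIV" using \<Omega>(2) not_bounded_UNIV by blast
  then obtain f g' where "f holomorphic_on \<Omega>" "g' holomorphic_on ball 0 1"
      "\<forall>z\<in>\<Omega>. f z \<in> ball 0 1 \<and> g' (f z) = z" "\<forall>z\<in>ball 0 1. g' z \<in> \<Omega> \<and> f (g' z) = z"
    using Riemann_mapping_theorem[of \<Omega>] \<Omega>(1) sc ne by blast
  then have cd: "conformal_disc \<Omega> f g'"
    using \<Omega> sc by unfold_locales auto
  define N :: "nat set" where "N = (if regular_domain \<Omega> then UNIV else {2})"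
  have N: "2 \<in> N" by (simp add: N_def)
  have ex: "\<exists>g. wsol N \<Omega> l w g" if "mf_solution l \<Omega> w" for w
    using that weak_solution_imp_wsol[OF \<Omega>, of l w] classical_solution_imp_wsol[OF \<Omega>, of l w]
    by (cases "regular_domain \<Omega>") (auto simp: mf_solution_def N_def)
  define m where "m = 2 * lbar * Ebar"
  define C where "C = 2 * exp (2 * (2 + 128 * lbar\<^sup>2 * Ebar))"
  have bound: "(\<integral>x. (mf_density \<Omega> w x)\<^sup>2 \<partial>lebesgue_on \<Omega>) \<le> C / measure lebesgue \<Omega>"
    if w: "wsol N \<Omega> l w g" and E: "energy \<Omega> (mf_density \<Omega> w) \<le> Ebar" and l0: "0 < l" for w g
    unfolding C_def
  proof (rule wsol_L2_bound[OF \<Omega> N pos w l0 l])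
    have "l * energy \<Omega> (mf_density \<Omega> w) \<le> lbar * Ebar"
      using l0 l E Ebar mult_left_mono[OF E, of l] mult_right_mono[OF l Ebar] by linarith
    then show "(\<integral>x. mf_density \<Omega> w x * w x \<partial>lebesgue_on \<Omega>) \<le> m"
      using wsol_energy_bound[OF cd N pos w l0] by (simp add: m_def)
    show "2 \<le> 2 + 128 * lbar\<^sup>2 * Ebar" "64 * lbar * m \<le> 2 + 128 * lbar\<^sup>2 * Ebar"
      using Ebar by (auto simp: m_def power2_eq_square)
  qed
  obtain g1 g2 where w: "wsol N \<Omega> l u g1" "wsol N \<Omega> l v g2" using ex[OF u(1)] ex[OF v(1)] by blast
  have big: "(48 * lbar * h)\<^sup>2 * C < measure lebesgue \<Omega>"
    using thin by (simp add: thin_const_def C_def power_mult_distrib mult_ac)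
  have C0: "0 \<le> C" by (simp add: C_def)
  have AE: "AE x in lebesgue_on \<Omega>. u x = v x"
    by (rule wsol_unique[OF \<Omega> N pos w e h C0 big l bound[OF w(1) u(2)] bound[OF w(2) v(2)]])
  then have AE': "AE x in lebesgue. x \<in> \<Omega> \<longrightarrow> u x = v x"
    using \<Omega>(1) by (simp add: AE_restrict_space_iff)
  show ?thesis
  proof (cases "regular_domain \<Omega>")
    case True
    then show ?thesis using AE' by (simp add: same_solution_def)
  next
    case False
    then have cl: "classical_solution l \<Omega> u" "classical_solution l \<Omega> v"
      using u(1) v(1) by (auto simp: mf_solution_def)
    then have c: "continuous_on (closure \<Omega>) u" "continuous_on (closure \<Omega>) v"
      and z: "\<And>x. x \<in> frontier \<Omega> \<Longrightarrow> u x = v x" by (auto simp: classical_solution_def)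
    \<comment> \<open>For classical solutions equality almost everywhere is upgraded: the set where
      they differ in \<Omega> is open by continuity and null, hence empty, and on the frontier both
      vanish.\<close>
    define D where "D = {x \<in> \<Omega>. u x - v x \<noteq> 0}"
    have "continuous_on \<Omega> (\<lambda>x. u x - v x)"
      by (intro continuous_on_diff continuous_on_subset[OF c(1)] continuous_on_subset[OF c(2)] closure_subset)
    from continuous_open_preimage[OF this \<Omega>(1), of "- {0}"]
    have "open D" by (simp add: D_def vimage_def Int_def open_Compl)
    moreover have "negligible D"
    proof -
      have "D = {x \<in> space lebesgue. \<not> (x \<in> \<Omega> \<longrightarrow> u x = v x)}" by (auto simp: D_def)
      moreover have "D \<in> sets lebesgue" using \<open>open D\<close> by simp
      ultimately have "emeasure lebesgue D = 0" using AE_iff_measurable[of D lebesgue "\<lambda>x. x \<in> \<Omega> \<longrightarrow> u x = v x"] AE' by auto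
      then show ?thesis using \<open>D \<in> sets lebesgue\<close> by (simp add: negligible_iff_emeasure0)
    qed
    ultimately have "D = {}" using open_not_negligible by blast
    then have "u x = v x" if "x \<in> \<Omega>" for x using that by (auto simp: D_def)
    then show ?thesis using False z by (auto simp: same_solution_def closure_Un_frontier)
  qed
qed

section \<open>Domains between two ellipses\<close>

lemma ellipse_measure_ge:
  assumes "0 < \<rho>" "0 < \<beta>" "ellipse \<rho> \<beta> \<subseteq> \<Omega>" "\<Omega> \<in> lmeasurable"
  shows "\<beta>\<^sup>2 / \<rho> \<le> measure lebesgue \<Omega>"
proof -
  \<comment> \<open>The inscribed rectangle with half the semi-axes in each direction: each term of
    the defining form is at most \<beta>^2 / 4 on it, and its area is \<beta> / \<rho> times
    \<beta>.\<close>
  define R where "R = cbox (Complex (- (\<beta> / (2 * \<rho>))) (- (\<beta> / 2))) (Complex (\<beta> / (2 * \<rho>)) (\<beta> / 2))"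
  have "R \<subseteq> ellipse \<rho> \<beta>"
  proof
    fix z assume z: "z \<in> R"
    have "\<bar>Re z\<bar> \<le> \<beta> / (2 * \<rho>)" "\<bar>Im z\<bar> \<le> \<beta> / 2" using z by (auto simp: R_def in_cbox_complex_iff)
    then have "\<bar>\<rho> * Re z\<bar> \<le> \<beta> / 2" "\<bar>Im z\<bar> \<le> \<beta> / 2" using assms(1) by (auto simp: abs_mult field_simps)
    from power_mono[OF this(1), of 2] power_mono[OF this(2), of 2]
    have "(\<rho> * Re z)\<^sup>2 \<le> \<beta>\<^sup>2 / 4" "(Im z)\<^sup>2 \<le> \<beta>\<^sup>2 / 4" by (auto simp: power_divide)
    then show "z \<in> ellipse \<rho> \<beta>" using zero_le_power2[of \<beta>] unfolding ellipse_def power_mult_distrib mem_Collect_eq by linarith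
  qed
  then have "measure lebesgue R \<le> measure lebesgue \<Omega>"
    using assms by (intro measure_mono_fmeasurable) (auto simp: R_def)
  moreover have "measure lebesgue R = \<beta>\<^sup>2 / \<rho>"
    using assms(1,2) by (simp add: R_def content_cbox_if box_ne_empty Basis_complex_def power2_eq_square)
  ultimately show ?thesis by simp
qed

text \<open>The outer ellipse lies in a horizontal strip of half-width \<beta>p, and the inner one
  gives area at least \<beta>m^2 / \<rho> = c \<beta>p^2 / \<rho>. Thinness thus reads K \<rho> < c
  for K the thinness constant, and the factor 2 in the bound on \<rho> makes it strict.\<close>

lemma ellipse_uniqueness:
  assumes lbar: "0 < lbar" and Ebar: "0 \<le> Ebar" and c: "0 < c"
    and \<rho>: "0 < \<rho>" "\<rho> \<le> c / (2 * thin_const lbar Ebar)"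
    and \<Omega>: "simple_domain \<Omega>" and \<beta>: "0 < \<beta>m" "0 < \<beta>p" and sub: "ellipse \<rho> \<beta>m \<subseteq> \<Omega>" "\<Omega> \<subseteq> ellipse \<rho> \<beta>p"
    and eq: "c = \<beta>m\<^sup>2 / \<beta>p\<^sup>2" and l: "l \<le> lbar"
    and u: "mf_solution l \<Omega> u" "energy \<Omega> (mf_density \<Omega> u) \<le> Ebar"
    and v: "mf_solution l \<Omega> v" "energy \<Omega> (mf_density \<Omega> v) \<le> Ebar"
  shows "same_solution \<Omega> u v"
proof -
  have o: "open \<Omega>" "bounded \<Omega>" "simply_connected \<Omega>" using \<Omega> by (auto simp: simple_domain_def)
  define K where "K = thin_const lbar Ebar"
  have K: "0 < K" by (simp add: K_def thin_const_pos lbar)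
  have "K * \<rho> \<le> c / 2" using \<rho>(2) K by (simp add: K_def[symmetric] field_simps)
  then have "K * \<rho> < c" using c by linarith
  then have "K < c / \<rho>" using \<rho>(1) by (simp add: field_simps)
  then have "K * \<beta>p\<^sup>2 < c / \<rho> * \<beta>p\<^sup>2" using \<beta>(2) by (intro mult_strict_right_mono) auto
  also have "\<dots> = \<beta>m\<^sup>2 / \<rho>" using \<beta>(2) by (simp add: eq)
  also have "\<dots> \<le> measure lebesgue \<Omega>"
    by (rule ellipse_measure_ge[OF \<rho>(1) \<beta>(1) sub(1)]) (use o in \<open>auto intro: lmeasurable_open\<close>)
  finally have thin: "thin_const lbar Ebar * \<beta>p\<^sup>2 < measure lebesgue \<Omega>" by (simp add: K_def)
  have ne: "\<Omega> \<noteq> {}" using subsetD[OF sub(1), of 0] by (auto simp: ellipse_def)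
  have h: "\<bar>x \<bullet> \<i> - 0\<bar> \<le> \<beta>p" if "x \<in> \<Omega>" for x
  proof -
    have "(Im x)\<^sup>2 \<le> \<beta>p\<^sup>2" using subsetD[OF sub(2) that] zero_le_power2[of "\<rho> * Re x"]
      unfolding ellipse_def power_mult_distrib mem_Collect_eq by linarith
    then have "\<bar>Im x\<bar> \<le> \<beta>p" using \<beta>(2) by (simp add: abs_le_square_iff[symmetric])
    then show ?thesis by (simp add: inner_complex_def)
  qed
  show ?thesis
    by (rule thin_uniqueness[OF o ne _ h _ lbar Ebar thin l u v]) (use \<beta> in auto)
qed

subsection \<open>Convex domains\<close>

text \<open>A shear maps \<open>A\<close> to a horizontal vector, and the horizontal slices then have length \<open>Re A / 2\<close>.\<close>

lemma parallelogram_measure_pos: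
  assumes S: "compact S" and A: "0 < Re A"
    and sub: "\<And>s t. 0 \<le> s \<Longrightarrow> s \<le> 1 / 2 \<Longrightarrow> 0 \<le> t \<Longrightarrow> t \<le> 1 / 2 \<Longrightarrow> p + s *\<^sub>R A + t *\<^sub>R B \<in> S"
  shows "\<bar>Re A * Im B - Im A * Re B\<bar> / 4 \<le> measure lebesgue S"
proof -
  have [measurable]: "S \<in> sets borel" using S by (simp add: compact_imp_closed)
  define m where "m = Im A / Re A"
  define \<eta> where "\<eta> = Im B - m * Re B"
  define F :: "complex \<Rightarrow> ennreal" where "F z = indicator S (Complex (Re z) (Im z + m * Re z))" for z
  have [measurable]: "(\<lambda>z. Complex (Re z) (Im z + m * Re z)) \<in> borel_measurable borel"
    unfolding Complex_eq by (intro borel_measurable_continuous_onI continuous_intros)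
  have [measurable]: "F \<in> borel_measurable borel" unfolding F_def by measurable
  define y0 where "y0 = Im p - m * Re p"
  define J where "J = closed_segment y0 (y0 + \<eta> / 2)"
  have J: "J \<in> sets borel" "emeasure lborel J = ennreal (\<bar>\<eta>\<bar> / 2)"
    by (auto simp: J_def closed_segment_eq_real_ivl)
  have "ennreal (\<bar>Re A * Im B - Im A * Re B\<bar> / 4) = ennreal (Re A / 2) * ennreal (\<bar>\<eta>\<bar> / 2)"
  proof -
    have "Re A * \<eta> = Re A * Im B - Im A * Re B" using A by (simp add: \<eta>_def m_def field_simps)
    then have "\<bar>Re A * Im B - Im A * Re B\<bar> = Re A * \<bar>\<eta>\<bar>" using A by (metis abs_mult abs_of_pos)
    then show ?thesis using A by (simp add: ennreal_mult[symmetric])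
  qed
  also have "\<dots> = (\<integral>\<^sup>+y. ennreal (Re A / 2) * indicator J y \<partial>lborel)"
    using J by (simp add: nn_integral_cmult_indicator)
  also have "\<dots> \<le> (\<integral>\<^sup>+y. \<integral>\<^sup>+x. F (Complex x y) \<partial>lborel \<partial>lborel)"
  proof (rule nn_integral_mono)
    fix y
    show "ennreal (Re A / 2) * indicator J y \<le> (\<integral>\<^sup>+x. F (Complex x y) \<partial>lborel)"
    proof (cases "y \<in> J")
      case True
      then obtain r where r: "0 \<le> r" "r \<le> 1" "y = (1 - r) * y0 + r * (y0 + \<eta> / 2)"
        by (auto simp: J_def in_segment)
      define t where "t = r / 2"
      have t: "0 \<le> t" "t \<le> 1 / 2" and y: "y = y0 + t * \<eta>" using r by (auto simp: t_def algebra_simps)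
      define x1 where "x1 = Re p + t * Re B"
      have "indicator {x1..x1 + Re A / 2} x \<le> F (Complex x y)" for x
      proof (cases "x \<in> {x1..x1 + Re A / 2}")
        case True
        define s where "s = (x - x1) / Re A"
        have s: "0 \<le> s" "s \<le> 1 / 2" "x = x1 + s * Re A" using A True by (auto simp: s_def field_simps)
        have "m * Re A = Im A" using A by (simp add: m_def)
        then have "y + m * x = Im p + s * Im A + t * Im B"
          by (simp add: y y0_def \<eta>_def s(3) x1_def algebra_simps)
        then have "Complex x (y + m * x) = p + s *\<^sub>R A + t *\<^sub>R B"
          by (simp add: complex_eq_iff s(3) x1_def)
        then have "F (Complex x y) = 1" using sub[OF s(1,2) t] by (simp add: F_def)
        then show ?thesis using True by simp
      qed simp
      then have "(\<integral>\<^sup>+x. indicator {x1..x1 + Re A / 2} x \<partial>lborel) \<le> (\<integral>\<^sup>+x. F (Complex x y) \<partial>lborel)"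
        by (intro nn_integral_mono)
      then show ?thesis using True A by simp
    qed simp
  qed
  also have "\<dots> = (\<integral>\<^sup>+x. \<integral>\<^sup>+y. F (Complex x y) \<partial>lborel \<partial>lborel)"
    using nn_integral_complex[of F] nn_integral_complex'[of F] by simp
  also have "\<dots> = (\<integral>\<^sup>+x. \<integral>\<^sup>+y. indicator S (Complex x y) \<partial>lborel \<partial>lborel)"
  proof (rule nn_integral_cong)
    fix x
    have "(\<lambda>y. indicator S (Complex x y) :: ennreal) \<in> borel_measurable borel" by measurable
    from nn_integral_real_affine[OF this, of 1 "m * x"]
    show "(\<integral>\<^sup>+y. F (Complex x y) \<partial>lborel) = (\<integral>\<^sup>+y. indicator S (Complex x y) \<partial>lborel)"
      by (simp add: F_def add.commute)
  qed
  also have "\<dots> = emeasure lborel S"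
    using nn_integral_complex[of "indicator S"] by simp
  also have "\<dots> = ennreal (measure lborel S)"
    using emeasure_bounded_finite[OF compact_imp_bounded[OF S]] by (intro emeasure_eq_ennreal_measure) auto
  finally show ?thesis by (simp add: measure_completion)
qed

text \<open>The shear needs Re A > 0. For Re A < 0 the parallelogram is swept from its opposite
  side, with - A; for Re A = 0 the roles of A and B are exchanged.\<close>

lemma parallelogram_measure:
  assumes S: "compact S"
    and sub: "\<And>s t. 0 \<le> s \<Longrightarrow> s \<le> 1 / 2 \<Longrightarrow> 0 \<le> t \<Longrightarrow> t \<le> 1 / 2 \<Longrightarrow> p + s *\<^sub>R A + t *\<^sub>R B \<in> S"
  shows "\<bar>Re A * Im B - Im A * Re B\<bar> / 4 \<le> measure lebesgue S"
proof -
  have *: "\<bar>Re A * Im B - Im A * Re B\<bar> / 4 \<le> measure lebesgue S" if nz: "Re A \<noteq> 0"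
    and sub: "\<And>s t. 0 \<le> s \<Longrightarrow> s \<le> 1 / 2 \<Longrightarrow> 0 \<le> t \<Longrightarrow> t \<le> 1 / 2 \<Longrightarrow> p + s *\<^sub>R A + t *\<^sub>R B \<in> S" for A B
  proof (cases "0 < Re A")
    case True
    then show ?thesis by (rule parallelogram_measure_pos[OF S _ sub])
  next
    case False
    have "\<bar>Re (- A) * Im B - Im (- A) * Re B\<bar> / 4 \<le> measure lebesgue S"
    proof (rule parallelogram_measure_pos[OF S, of _ "p + (1 / 2) *\<^sub>R A"])
      fix s t :: real assume "0 \<le> s" "s \<le> 1 / 2" "0 \<le> t" "t \<le> 1 / 2"
      then show "p + (1 / 2) *\<^sub>R A + s *\<^sub>R - A + t *\<^sub>R B \<in> S"
        using sub[of "1 / 2 - s" t] by (simp add: scaleR_left_diff_distrib add_diff_eq)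
    qed (use nz False in simp)
    then show ?thesis by (simp add: abs_minus_commute)
  qed
  show ?thesis
  proof (cases "Re A = 0")
    case A: True
    show ?thesis
    proof (cases "Re B = 0")
      case True
      then show ?thesis using A by simp
    next
      case False
      have "\<bar>Re B * Im A - Im B * Re A\<bar> / 4 \<le> measure lebesgue S"
      proof (rule *[OF False])
        fix s t :: real assume "0 \<le> s" "s \<le> 1 / 2" "0 \<le> t" "t \<le> 1 / 2"
        then show "p + s *\<^sub>R B + t *\<^sub>R A \<in> S" using sub[of t s] by (simp only: add_ac)
      qed
      then show ?thesis by (simp add: A abs_mult mult.commute)
    qed
  next
    case False
    then show ?thesis by (rule *[OF _ sub])
  qed
qed

text \<open>\<open>jordan_length\<close> picks a parametrisation by choice, so it is meaningful only
  once one exists; for a bounded convex domain the frontier is homeomorphic to a circle.\<close>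

lemma jordan_param_convex_frontier:
  assumes "open \<Omega>" "bounded \<Omega>" "convex \<Omega>" "\<Omega> \<noteq> {}"
  shows "\<exists>\<gamma>. jordan_param (frontier \<Omega>) \<gamma>"
proof -
  have "rel_frontier (ball (0::complex) 1) homeomorphic rel_frontier \<Omega>"
    using assms aff_dim_open[of \<Omega>] aff_dim_open[of "ball (0::complex) 1"]
    by (intro homeomorphic_rel_frontiers_convex_bounded_sets) auto
  then have "sphere (0::complex) 1 homeomorphic frontier \<Omega>"
    using assms by (simp add: rel_frontier_nonempty_interior interior_open frontier_ball)
  then obtain f g where h: "homeomorphism (sphere (0::complex) 1) (frontier \<Omega>) f g"
    by (auto simp: homeomorphic_def)
  let ?c = "circlepath 0 1"
  have im: "path_image ?c = sphere 0 1" by simp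
  have "simple_path (f \<circ> ?c)"
    by (rule simple_path_continuous_image)
      (use h im in \<open>auto simp: simple_path_circlepath homeomorphism_def intro: inj_on_inverseI\<close>)
  moreover have "path_image (f \<circ> ?c) = frontier \<Omega>"
    using h im by (simp add: path_image_compose homeomorphism_def)
  ultimately have "jordan_param (frontier \<Omega>) (f \<circ> ?c)"
    by (simp add: jordan_param_def pathfinish_compose pathstart_compose)
  then show ?thesis by blast
qed

text \<open>A line through an interior point meets the frontier at most once on each side of that point.\<close>

lemma convex_frontier_line_unique:
  assumes \<Omega>: "open \<Omega>" "convex \<Omega>" and b: "norm b = 1" and z: "z \<in> \<Omega>"
    and x: "x \<in> frontier \<Omega>" "x \<bullet> b = z \<bullet> b" and y: "y \<in> frontier \<Omega>" "y \<bullet> b = z \<bullet> b"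
    and side: "(0 < (x - z) \<bullet> (\<i> * b)) = (0 < (y - z) \<bullet> (\<i> * b))"
  shows "x = y"
proof -
  define v where "v = \<i> * b"
  have rep: "w = (w \<bullet> v) *\<^sub>R v" if "w \<bullet> b = 0" for w
  proof -
    have n: "Re b * Re b + Im b * Im b = 1" using b by (simp add: cmod_def power2_eq_square)
    have o: "Re w * Re b + Im w * Im b = 0" using that by (simp add: inner_complex_def)
    have "(Im w * Re b - Re w * Im b) * (- Im b) = Re w"
      using n o by algebra
    moreover have "(Im w * Re b - Re w * Im b) * Re b = Im w"
      using n o by algebra
    ultimately show ?thesis by (simp add: complex_eq_iff v_def inner_complex_def algebra_simps)
  qed
  define s where "s = (x - z) \<bullet> v"
  define t where "t = (y - z) \<bullet> v"
  have xs: "x - z = s *\<^sub>R v" and yt: "y - z = t *\<^sub>R v"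
  proof -
    have "(x - z) \<bullet> b = 0" "(y - z) \<bullet> b = 0" using x(2) y(2) by (auto simp: inner_diff_left)
    from rep[OF this(1)] rep[OF this(2)] show "x - z = s *\<^sub>R v" "y - z = t *\<^sub>R v" by (simp_all only: s_def t_def)
  qed
  have fr: "w \<notin> \<Omega>" "w \<in> closure \<Omega>" if "w \<in> frontier \<Omega>" for w
    using that \<Omega>(1) by (auto simp: frontier_def interior_open)
  \<comment> \<open>If two frontier points lay on one ray from z, the nearer one would lie strictly
    between the interior point z and a point of the closure, hence in the interior.\<close>
  have no: False if w: "w \<in> frontier \<Omega>" "w' \<in> frontier \<Omega>" and eq: "w - z = r *\<^sub>R v" "w' - z = r' *\<^sub>R v"
    and r: "0 < r / r'" "r / r' < 1" for w w' r r'
  proof -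
    have r': "r' \<noteq> 0" using r by auto
    have v0: "v \<noteq> 0" using b by (auto simp: v_def)
    have "w = (1 - r / r') *\<^sub>R z + (r / r') *\<^sub>R w'"
    proof -
      have "(r / r') *\<^sub>R (w' - z) = w - z" using eq r' by simp
      then show ?thesis by (simp add: algebra_simps)
    qed
    moreover have "z \<noteq> w'" using eq(2) r' v0 by auto
    ultimately have "w \<in> open_segment z w'" using r by (auto simp: in_segment)
    then have "w \<in> interior \<Omega>"
      using in_interior_closure_convex_segment[OF \<Omega>(2), of z w'] z fr(2)[OF w(2)] \<Omega>(1) by (auto simp: interior_open)
    then show False using fr(1)[OF w(1)] \<Omega>(1) by (simp add: interior_open)
  qed
  have nz: "s \<noteq> 0" "t \<noteq> 0" using xs yt z fr(1)[OF x(1)] fr(1)[OF y(1)] by auto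
  have sd: "(0 < s) = (0 < t)" using side by (simp add: s_def t_def v_def)
  then have st: "0 < s / t" "0 < t / s" using nz by (auto simp: zero_less_divide_iff)
  have "\<not> s / t < 1" "\<not> t / s < 1"
    using no[OF x(1) y(1) xs yt st(1)] no[OF y(1) x(1) yt xs st(2)] by auto
  then have "s = t" using sd nz st by (cases "0 < s") (auto simp: field_simps split: if_splits)
  then have "x - z = y - z" using xs yt by simp
  then show ?thesis by simp
qed

text \<open>Integrate over \<open>c\<close> the number of steps that cross the line \<open>z \<bullet> b = c\<close>.\<close>

lemma convex_frontier_variation:
  assumes \<Omega>: "open \<Omega>" "bounded \<Omega>" "convex \<Omega>" and b: "norm b = 1"
    and J: "jordan_param (frontier \<Omega>) \<gamma>" and t: "mono t" "range t \<subseteq> {0..1}"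
    and d: "\<And>x y. x \<in> closure \<Omega> \<Longrightarrow> y \<in> closure \<Omega> \<Longrightarrow> dist x y \<le> d"
  shows "(\<Sum>i<n. \<bar>\<gamma> (t (Suc i)) \<bullet> b - \<gamma> (t i) \<bullet> b\<bar>) \<le> 2 * d"
proof -
  define \<phi> where "\<phi> s = \<gamma> s \<bullet> b" for s
  have cg: "continuous_on {0..1} \<gamma>" and lf: "\<And>x y. x \<in> {0..1} \<Longrightarrow> y \<in> {0..1} \<Longrightarrow> \<gamma> x = \<gamma> y \<Longrightarrow>
      x = y \<or> x = 0 \<and> y = 1 \<or> x = 1 \<and> y = 0" and im: "\<gamma> ` {0..1} = frontier \<Omega>"
    using J by (auto simp: jordan_param_def simple_path_def path_def loop_free_def path_image_def)
  have gf: "\<gamma> s \<in> frontier \<Omega>" "\<gamma> s \<in> closure \<Omega>" if "s \<in> {0..1}" for s using im that by (auto simp: frontier_def)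
  have t01: "t i \<in> {0..1}" for i using t(2) by blast
  define U where "U i = {min (\<phi> (t i)) (\<phi> (t (Suc i)))<..<max (\<phi> (t i)) (\<phi> (t (Suc i)))}" for i
  have cl0: "closure \<Omega> \<noteq> {}" using gf[of 0] by auto
  have cpt: "compact (closure \<Omega>)" using \<Omega>(2) by (simp add: compact_closure)
  have cb: "continuous_on (closure \<Omega>) (\<lambda>x. x \<bullet> b)" by (intro continuous_intros)
  obtain p where p: "p \<in> closure \<Omega>" "\<And>x. x \<in> closure \<Omega> \<Longrightarrow> p \<bullet> b \<le> x \<bullet> b"
    using continuous_attains_inf[OF cpt cl0 cb] by blast
  obtain q where q: "q \<in> closure \<Omega>" "\<And>x. x \<in> closure \<Omega> \<Longrightarrow> x \<bullet> b \<le> q \<bullet> b"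
    using continuous_attains_sup[OF cpt cl0 cb] by blast
  have pq: "p \<bullet> b \<le> q \<bullet> b" "q \<bullet> b - p \<bullet> b \<le> d"
    using p(2)[OF q(1)] Cauchy_Schwarz_ineq2[of "q - p" b] d[OF q(1) p(1)] b
    by (auto simp: inner_diff_left dist_norm)
  \<comment> \<open>At most two steps cross the level c. Each crossing is a frontier point on the
    line through an interior point z, and the side of z on which it lies determines it; so the map
    from crossing steps to sides is injective.\<close>
  have count: "(\<Sum>i<n. indicator (U i) c) \<le> 2 * (indicator {p \<bullet> b..q \<bullet> b} c :: real)" for c
  proof -
    define I where "I = {i. i < n \<and> c \<in> U i}"
    have fI: "finite I" by (simp add: I_def)
    have "(\<Sum>i<n. indicator (U i) c) = (\<Sum>i\<in>I. 1::real)"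
      by (rule sum.mono_neutral_cong_right) (auto simp: I_def)
    then have sum: "(\<Sum>i<n. indicator (U i) c) = real (card I)" by simp
    show ?thesis
    proof (cases "I = {}")
      case False
      then obtain i0 where i0: "c \<in> U i0" by (auto simp: I_def)
      have "\<exists>\<tau>. t i < \<tau> \<and> \<tau> < t (Suc i) \<and> \<phi> \<tau> = c" if "i \<in> I" for i
      proof -
        have c: "c \<in> U i" using that by (simp add: I_def)
        have le: "t i \<le> t (Suc i)" using t(1) by (simp add: mono_def)
        have "continuous_on (closed_segment (t i) (t (Suc i))) \<phi>"
          unfolding \<phi>_def using t01[of i] t01[of "Suc i"] le
          by (intro continuous_intros continuous_on_subset[OF cg]) (auto simp: closed_segment_eq_real_ivl)
        moreover have "c \<in> closed_segment (\<phi> (t i)) (\<phi> (t (Suc i)))"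
          using c by (auto simp: U_def closed_segment_eq_real_ivl min_def max_def split: if_splits)
        ultimately obtain \<tau> where \<tau>: "\<tau> \<in> closed_segment (t i) (t (Suc i))" "\<phi> \<tau> = c"
          using IVT'_closed_segment_real by blast
        have "\<tau> \<noteq> t i" "\<tau> \<noteq> t (Suc i)" using c \<tau>(2) by (auto simp: U_def)
        then show ?thesis using \<tau> le by (intro exI[of _ \<tau>]) (auto simp: closed_segment_eq_real_ivl)
      qed
      then obtain \<tau> where \<tau>: "\<And>i. i \<in> I \<Longrightarrow> t i < \<tau> i \<and> \<tau> i < t (Suc i) \<and> \<phi> (\<tau> i) = c" by metis
      have ends: "\<phi> (t i0) < c \<or> \<phi> (t (Suc i0)) < c" "c < \<phi> (t i0) \<or> c < \<phi> (t (Suc i0))"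
        using i0 by (auto simp: U_def)
      have cpq: "c \<in> {p \<bullet> b..q \<bullet> b}"
        using ends p(2)[OF gf(2)[OF t01[of i0]]] p(2)[OF gf(2)[OF t01[of "Suc i0"]]]
          q(2)[OF gf(2)[OF t01[of i0]]] q(2)[OF gf(2)[OF t01[of "Suc i0"]]] unfolding \<phi>_def by auto
      \<comment> \<open>A step crosses c strictly, so the closure has points on both sides of the
        line. Were \<Omega> on one side, so would be its closure; hence \<Omega> meets both sides
        and, being connected, the line itself.\<close>
      have "\<exists>x\<in>\<Omega>. x \<bullet> b < c"
      proof (rule ccontr)
        assume "\<not> (\<exists>x\<in>\<Omega>. x \<bullet> b < c)"
        then have "\<Omega> \<subseteq> {x. b \<bullet> x \<ge> c}" by (auto simp: inner_commute not_less)
        then have "closure \<Omega> \<subseteq> {x. b \<bullet> x \<ge> c}" by (rule closure_minimal) (rule closed_halfspace_ge)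
        then have "c \<le> \<phi> (t i)" for i using gf(2)[OF t01[of i]] by (auto simp: \<phi>_def inner_commute[of _ b])
        then show False using ends(1) not_less by blast
      qed
      moreover have "\<exists>x\<in>\<Omega>. c < x \<bullet> b"
      proof (rule ccontr)
        assume "\<not> (\<exists>x\<in>\<Omega>. c < x \<bullet> b)"
        then have "\<Omega> \<subseteq> {x. b \<bullet> x \<le> c}" by (auto simp: inner_commute not_less)
        then have "closure \<Omega> \<subseteq> {x. b \<bullet> x \<le> c}" by (rule closure_minimal) (rule closed_halfspace_le)
        then have "\<phi> (t i) \<le> c" for i using gf(2)[OF t01[of i]] by (auto simp: \<phi>_def inner_commute[of _ b])
        then show False using ends(2) not_less by blast
      qed
      ultimately obtain z where z: "z \<in> \<Omega>" "z \<bullet> b = c"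
        using connected_ivt_hyperplane[OF convex_connected[OF \<Omega>(3)], of _ _ b c]
        by (metis inner_commute less_imp_le)
      have "inj_on (\<lambda>i. 0 < (\<gamma> (\<tau> i) - z) \<bullet> (\<i> * b)) I"
      proof (rule linorder_inj_onI)
        fix i j assume ij: "i < j" "i \<in> I" "j \<in> I"
        have "t (Suc i) \<le> t j" using t(1) ij(1) by (simp add: mono_def)
        then have lt: "\<tau> i < \<tau> j" using \<tau>[OF ij(2)] \<tau>[OF ij(3)] by linarith
        \<comment> \<open>Crossings are strictly inside their steps, hence strictly between 0 and 1,
          which rules out the one coincidence allowed on a closed curve, that of its end
          points.\<close>
        have 01: "\<tau> k \<in> {0..1}" "0 < \<tau> k" "\<tau> k < 1" if "k \<in> I" for k
          using \<tau>[OF that] t01[of k] t01[of "Suc k"] by auto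
        have "\<gamma> (\<tau> i) \<noteq> \<gamma> (\<tau> j)"
          using lf[OF 01(1)[OF ij(2)] 01(1)[OF ij(3)]] lt 01(2,3)[OF ij(2)] by auto
        moreover have "\<gamma> (\<tau> k) \<bullet> b = z \<bullet> b" if "k \<in> I" for k using \<tau>[OF that] z by (simp add: \<phi>_def)
        ultimately show "(0 < (\<gamma> (\<tau> i) - z) \<bullet> (\<i> * b)) \<noteq> (0 < (\<gamma> (\<tau> j) - z) \<bullet> (\<i> * b))"
          using convex_frontier_line_unique[OF \<Omega>(1,3) b z(1), of "\<gamma> (\<tau> i)" "\<gamma> (\<tau> j)"]
            gf(1)[OF 01(1)] ij by blast
      qed auto
      then have "card I \<le> card (UNIV :: bool set)" by (rule card_inj_on_le) auto
      then show ?thesis using sum cpq by simp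
    qed (simp add: sum)
  qed
  have iU: "integrable lborel (indicator (U i) :: real \<Rightarrow> real)" for i by (simp add: U_def)
  have iI: "integrable lborel (indicator {p \<bullet> b..q \<bullet> b} :: real \<Rightarrow> real)"
    using pq(1) by (intro integrable_real_indicator) auto
  have "(\<Sum>i<n. \<bar>\<phi> (t (Suc i)) - \<phi> (t i)\<bar>) = (\<Sum>i<n. \<integral>c. indicator (U i) c \<partial>lborel)"
    by (intro sum.cong) (auto simp: U_def min_def max_def)
  also have "\<dots> = (\<integral>c. (\<Sum>i<n. indicator (U i) c) \<partial>lborel)"
    using iU by (subst Bochner_Integration.integral_sum) auto
  also have "\<dots> \<le> (\<integral>c. 2 * indicator {p \<bullet> b..q \<bullet> b} c \<partial>lborel)"
    using iU iI count by (intro integral_mono) auto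
  also have "\<dots> = 2 * (q \<bullet> b - p \<bullet> b)" using pq(1) by simp
  also have "\<dots> \<le> 2 * d" using pq(2) by simp
  finally show ?thesis by (simp add: \<phi>_def)
qed

text \<open>Each chord is at most the sum of its two coordinate increments, and either coordinate
  varies by at most 2 d in total along the frontier.\<close>

lemma jordan_length_convex_le:
  assumes \<Omega>: "open \<Omega>" "bounded \<Omega>" "convex \<Omega>" "\<Omega> \<noteq> {}"
    and d: "\<And>x y. x \<in> closure \<Omega> \<Longrightarrow> y \<in> closure \<Omega> \<Longrightarrow> dist x y \<le> d"
  shows "0 \<le> jordan_length (frontier \<Omega>)" "jordan_length (frontier \<Omega>) \<le> 4 * d"
proof -
  define \<gamma> where "\<gamma> = (SOME \<gamma>. jordan_param (frontier \<Omega>) \<gamma>)"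
  have J: "jordan_param (frontier \<Omega>) \<gamma>"
    unfolding \<gamma>_def using jordan_param_convex_frontier[OF \<Omega>] by (rule someI_ex)
  have bound: "s \<le> 4 * d" if "s \<in> polygonal_lengths \<gamma>" for s
  proof -
    obtain n t where t: "mono t" "range t \<subseteq> {0..1}" and s: "s = (\<Sum>i<n. dist (\<gamma> (t i)) (\<gamma> (t (Suc i))))"
      using \<open>s \<in> _\<close> by (auto simp: polygonal_lengths_def)
    have "s \<le> (\<Sum>i<n. \<bar>\<gamma> (t (Suc i)) \<bullet> 1 - \<gamma> (t i) \<bullet> 1\<bar>) + (\<Sum>i<n. \<bar>\<gamma> (t (Suc i)) \<bullet> \<i> - \<gamma> (t i) \<bullet> \<i>\<bar>)"
      unfolding s sum.distrib[symmetric]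
    proof (rule sum_mono)
      fix i
      show "dist (\<gamma> (t i)) (\<gamma> (t (Suc i))) \<le> \<bar>\<gamma> (t (Suc i)) \<bullet> 1 - \<gamma> (t i) \<bullet> 1\<bar> + \<bar>\<gamma> (t (Suc i)) \<bullet> \<i> - \<gamma> (t i) \<bullet> \<i>\<bar>"
        using cmod_le[of "\<gamma> (t (Suc i)) - \<gamma> (t i)"] by (simp add: dist_norm norm_minus_commute inner_complex_def)
    qed
    then show ?thesis
      using convex_frontier_variation[OF \<Omega>(1-3) _ J t d, of 1 n] convex_frontier_variation[OF \<Omega>(1-3) _ J t d, of \<i> n]
      by simp
  qed
  have z: "0 \<in> polygonal_lengths \<gamma>"
    by (auto simp: polygonal_lengths_def mono_def intro!: exI[of _ 0] exI[of _ "\<lambda>_. 0"])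
  have "jordan_length (frontier \<Omega>) = Sup (polygonal_lengths \<gamma>)"
    by (simp add: jordan_length_def path_len_def \<gamma>_def)
  then show "0 \<le> jordan_length (frontier \<Omega>)" "jordan_length (frontier \<Omega>) \<le> 4 * d"
    using cSup_upper[OF z bdd_aboveI[OF bound]] cSup_least[of "polygonal_lengths \<gamma>" "4 * d", OF _ bound] z by auto
qed

text \<open>With L \<le> 4 d and d h \<le> 4 a, where a is the area and K the thinness constant, the
  hypothesis gives (256 K + 1) a h^2 \<le> 16 d^2 h^2 \<le> 256 a^2, so 256 = 16 * 16 is what
  thinness of the strip requires.\<close>

lemma convex_uniqueness:
  assumes lbar: "0 < lbar" and Ebar: "0 \<le> Ebar" and \<Omega>: "open \<Omega>" "bounded \<Omega>" "convex \<Omega>" "\<Omega> \<noteq> {}"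
    and N: "256 * thin_const lbar Ebar + 1 \<le> isoperimetric_ratio \<Omega>" and l: "l \<le> lbar"
    and u: "mf_solution l \<Omega> u" "energy \<Omega> (mf_density \<Omega> u) \<le> Ebar"
    and v: "mf_solution l \<Omega> v" "energy \<Omega> (mf_density \<Omega> v) \<le> Ebar"
  shows "same_solution \<Omega> u v"
proof -
  define S where "S = closure \<Omega>"
  define a where "a = measure lebesgue \<Omega>"
  define K where "K = thin_const lbar Ebar"
  have K: "0 < K" by (simp add: K_def thin_const_pos lbar)
  have S: "compact S" "convex S" "S \<noteq> {}" using \<Omega> by (auto simp: S_def compact_closure convex_closure)
  obtain p q where pq: "p \<in> S" "q \<in> S" "dist p q = diameter S"
    using diameter_compact_attained[OF S(1,3)] by blast
  define d where "d = dist p q"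
  have d: "dist x y \<le> d" if "x \<in> S" "y \<in> S" for x y
    unfolding d_def pq(3) by (rule diameter_bounded_bound[OF compact_imp_bounded[OF S(1)] that])
  note L = jordan_length_convex_le[OF \<Omega> d[unfolded S_def]]
  \<comment> \<open>Were the area 0, division by 0 would make the isoperimetric ratio 0, below the
    required bound.\<close>
  have a: "0 < a"
  proof (rule ccontr)
    assume "\<not> 0 < a"
    then have "isoperimetric_ratio \<Omega> = 0" by (simp add: a_def isoperimetric_ratio_def not_less antisym)
    then show False using N K by (simp add: K_def)
  qed
  have La: "(256 * K + 1) * a \<le> 16 * d\<^sup>2"
  proof -
    have "(256 * K + 1) * a \<le> (jordan_length (frontier \<Omega>))\<^sup>2"
      using N a by (simp add: isoperimetric_ratio_def a_def K_def pos_le_divide_eq)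
    also have "\<dots> \<le> (4 * d)\<^sup>2" using L by (intro power_mono) (auto simp: S_def)
    finally show ?thesis by (simp add: power_mult_distrib)
  qed
  have "0 < (256 * K + 1) * a" using K a by (intro mult_pos_pos) auto
  then have dpos: "0 < d" using La by (cases "d = 0") (auto simp: d_def)
  \<comment> \<open>The unit normal to the diameter from p to q. The width h of the strip is then
    the largest distance of a point r of the closure from the line through p and q.\<close>
  define e where "e = \<i> * (q - p) / of_real d"
  have e: "norm e = 1" using dpos by (simp add: e_def norm_mult norm_divide d_def dist_norm norm_minus_commute)
  have "continuous_on S (\<lambda>x. \<bar>(x - p) \<bullet> e\<bar>)" by (intro continuous_intros)
  then obtain r where r: "r \<in> S" "\<And>x. x \<in> S \<Longrightarrow> \<bar>(x - p) \<bullet> e\<bar> \<le> \<bar>(r - p) \<bullet> e\<bar>"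
    using continuous_attains_sup[OF S(1,3), of "\<lambda>x. \<bar>(x - p) \<bullet> e\<bar>"] by blast
  define h where "h = \<bar>(r - p) \<bullet> e\<bar>"
  have "\<bar>Re (q - p) * Im (r - p) - Im (q - p) * Re (r - p)\<bar> / 4 \<le> measure lebesgue S"
  proof (rule parallelogram_measure[OF S(1), of p])
    \<comment> \<open>The point is the midpoint of one on the segment from p to q and one on the
      segment from p to r; taking midpoints is what limits s and t to 1/2 and costs the factor 4 in
      the area.\<close>
    fix s t :: real assume st: "0 \<le> s" "s \<le> 1 / 2" "0 \<le> t" "t \<le> 1 / 2"
    have "(1 - 2 * s) *\<^sub>R p + (2 * s) *\<^sub>R q \<in> S" "(1 - 2 * t) *\<^sub>R p + (2 * t) *\<^sub>R r \<in> S"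
      using st by (intro convexD_alt[OF S(2)] pq r(1); simp)+
    from convexD_alt[OF S(2) this, of "1 / 2"]
    have "(1 / 2) *\<^sub>R ((1 - 2 * s) *\<^sub>R p + (2 * s) *\<^sub>R q) + (1 / 2) *\<^sub>R ((1 - 2 * t) *\<^sub>R p + (2 * t) *\<^sub>R r) \<in> S" by simp
    moreover have "(1 / 2) *\<^sub>R ((1 - 2 * s) *\<^sub>R p + (2 * s) *\<^sub>R q) + (1 / 2) *\<^sub>R ((1 - 2 * t) *\<^sub>R p + (2 * t) *\<^sub>R r)
        = p + s *\<^sub>R (q - p) + t *\<^sub>R (r - p)" by (simp add: complex_eq_iff algebra_simps)
    ultimately show "p + s *\<^sub>R (q - p) + t *\<^sub>R (r - p) \<in> S" by simp
  qed
  moreover have "measure lebesgue S = a"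
    unfolding S_def a_def using \<Omega> by (intro measure_closure) (auto simp: negligible_convex_frontier)
  moreover have "\<bar>Re (q - p) * Im (r - p) - Im (q - p) * Re (r - p)\<bar> = d * h"
  proof -
    have "d * ((r - p) \<bullet> e) = Re (q - p) * Im (r - p) - Im (q - p) * Re (r - p)"
      using dpos by (simp add: e_def inner_complex_def Re_divide_of_real Im_divide_of_real field_simps)
    then show ?thesis using dpos unfolding h_def by (metis abs_mult abs_of_pos)
  qed
  ultimately have dh: "d * h \<le> 4 * a" by simp
  have h0: "0 \<le> h" by (simp add: h_def)
  have "K * h\<^sup>2 < a"
  proof -
    have "(d * h)\<^sup>2 \<le> (4 * a)\<^sup>2" using dh dpos h0 by (intro power_mono) auto
    then have "d\<^sup>2 * h\<^sup>2 \<le> 16 * (a * a)" by (simp add: power2_eq_square mult_ac)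
    moreover have "((256 * K + 1) * a) * h\<^sup>2 \<le> (16 * d\<^sup>2) * h\<^sup>2" by (rule mult_right_mono[OF La]) simp
    ultimately have "a * ((256 * K + 1) * h\<^sup>2) \<le> a * (256 * a)" by (simp add: mult_ac)
    then have le: "(256 * K + 1) * h\<^sup>2 \<le> 256 * a" using a by simp
    show ?thesis
    \<comment> \<open>The summand 1 beside 256 K makes the inequality strict for h > 0; for h = 0 it
      is the positivity of the area.\<close>
    proof (cases "h = 0")
      case False
      then have "0 < h\<^sup>2" by simp
      moreover have "256 * (K * h\<^sup>2) + h\<^sup>2 \<le> 256 * a" using le by (simp add: algebra_simps)
      ultimately show ?thesis by linarith
    qed (use a in simp)
  qed
  then have thin: "thin_const lbar Ebar * h\<^sup>2 < measure lebesgue \<Omega>" by (simp add: K_def a_def)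
  have strip: "\<bar>x \<bullet> e - p \<bullet> e\<bar> \<le> h" if "x \<in> \<Omega>" for x
    using r(2)[of x] closure_subset that by (auto simp: h_def S_def inner_diff_left)
  show ?thesis
    by (rule thin_uniqueness[OF \<Omega>(1,2) convex_imp_simply_connected[OF \<Omega>(3)] \<Omega>(4) e strip h0 lbar Ebar thin l u v])
qed

theorem theorem1p19:
  fixes lbar Ebar :: real
  assumes "8 * pi \<le> lbar" and "1 \<le> Ebar"
  shows "(\<forall>c::real. 0 < c \<and> c \<le> 1 \<longrightarrow>
      (\<exists>\<rho>1>0. \<forall>(\<rho>::real) (\<Omega>::complex set) (\<beta>m::real) (\<beta>p::real).
         0 < \<rho> \<and> \<rho> \<le> \<rho>1 \<and> simple_domain \<Omega> \<and> 0 < \<beta>m \<and> 0 < \<beta>p \<and>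
         ellipse \<rho> \<beta>m \<subseteq> \<Omega> \<and> \<Omega> \<subseteq> ellipse \<rho> \<beta>p \<and> c = \<beta>m\<^sup>2 / \<beta>p\<^sup>2 \<longrightarrow>
         (\<forall>l\<le>lbar. \<forall>u v.
            mf_solution l \<Omega> u \<and> energy \<Omega> (mf_density \<Omega> u) \<le> Ebar \<and>
            mf_solution l \<Omega> v \<and> energy \<Omega> (mf_density \<Omega> v) \<le> Ebar \<longrightarrow>
            same_solution \<Omega> u v))) \<and>
    (\<exists>N\<ge>4 * pi. \<forall>\<Omega>::complex set.
         open \<Omega> \<and> bounded \<Omega> \<and> convex \<Omega> \<and> \<Omega> \<noteq> {} \<and> isoperimetric_ratio \<Omega> \<ge> N \<longrightarrow>
         (\<forall>l\<le>lbar. \<forall>u v.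
            mf_solution l \<Omega> u \<and> energy \<Omega> (mf_density \<Omega> u) \<le> Ebar \<and>
            mf_solution l \<Omega> v \<and> energy \<Omega> (mf_density \<Omega> v) \<le> Ebar \<longrightarrow>
            same_solution \<Omega> u v))"
proof -
  have lbar: "0 < lbar" and Ebar: "0 \<le> Ebar" using assms pi_gt_zero by linarith+
  show ?thesis
  proof (intro conjI allI impI)
    fix c :: real assume c: "0 < c \<and> c \<le> 1"
    then have pos: "0 < c / (2 * thin_const lbar Ebar)" using thin_const_pos[OF lbar, of Ebar] by simp
    show "\<exists>\<rho>1>0. \<forall>(\<rho>::real) (\<Omega>::complex set) (\<beta>m::real) (\<beta>p::real).
         0 < \<rho> \<and> \<rho> \<le> \<rho>1 \<and> simple_domain \<Omega> \<and> 0 < \<beta>m \<and> 0 < \<beta>p \<and>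
         ellipse \<rho> \<beta>m \<subseteq> \<Omega> \<and> \<Omega> \<subseteq> ellipse \<rho> \<beta>p \<and> c = \<beta>m\<^sup>2 / \<beta>p\<^sup>2 \<longrightarrow>
         (\<forall>l\<le>lbar. \<forall>u v.
            mf_solution l \<Omega> u \<and> energy \<Omega> (mf_density \<Omega> u) \<le> Ebar \<and>
            mf_solution l \<Omega> v \<and> energy \<Omega> (mf_density \<Omega> v) \<le> Ebar \<longrightarrow>
            same_solution \<Omega> u v)"
      using ellipse_uniqueness[OF lbar Ebar] c pos by (intro exI[of _ "c / (2 * thin_const lbar Ebar)"]) blast
  next
    show "\<exists>N\<ge>4 * pi. \<forall>\<Omega>::complex set.
         open \<Omega> \<and> bounded \<Omega> \<and> convex \<Omega> \<and> \<Omega> \<noteq> {} \<and> isoperimetric_ratio \<Omega> \<ge> N \<longrightarrow>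
         (\<forall>l\<le>lbar. \<forall>u v.
            mf_solution l \<Omega> u \<and> energy \<Omega> (mf_density \<Omega> u) \<le> Ebar \<and>
            mf_solution l \<Omega> v \<and> energy \<Omega> (mf_density \<Omega> v) \<le> Ebar \<longrightarrow>
            same_solution \<Omega> u v)"
      using convex_uniqueness[OF lbar Ebar]
      by (intro exI[of _ "max (4 * pi) (256 * thin_const lbar Ebar + 1)"]) (auto simp: max.bounded_iff)
  qed
qed

end
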